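(* Let $b\in\mathcal{PB}_3$ be a pure $3$-braid and let $w$ be the reduced word in the free generators $a_1,a_2$ representing the image of $b$ in $\mathcal{PB}_3/\langle\Delta_3^2\rangle$. Then $$\frac{1}{2\pi}\mathcal{L}(w)\le \Lambda_{tr}(b)=\frac{1}{\mathcal{M}_{tr}(b)}\le 300\cdot\mathcal{L}(w),$$ except in the cases $w=a_1^n$ or $w=a_2^n$ for an integer $n$, in which $\Lambda_{tr}(b)=0$, i.e. $\mathcal{M}_{tr}(b)=\infty$. Moreover $$\frac{1}{2\pi}\mathcal{L}(w)\le \Lambda_{pb}(b)=\frac{1}{\mathcal{M}_{pb}(b)}\le 300\cdot\mathcal{L}(w),$$ except in the case that every term of the reduced word $w$ has the same exponent, this exponent being either $+1$ or $-1$; in that case $\Lambda_{pb}(b)=0$, i.e. $\mathcal{M}_{pb}(b)=\infty$.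
   Context: Configuration space: $C_3(\mathbb{C})=\{(z_1,z_2,z_3)\in\mathbb{C}^3: z_i\ne z_j \text{ for } i\ne j\}$, with the symmetric group $\mathcal{S}_3$ acting by permuting coordinates; $C_3(\mathbb{C})/\mathcal{S}_3$ is the symmetrized configuration space and $\mathcal{B}_3$ is identified with its fundamental group. The totally real set $\mathcal{E}^{tr}=C_3(\mathbb{R})/\mathcal{S}_3$ (unordered triples of distinct real numbers) and the set $\mathcal{E}_{pb}$ of unordered triples consisting of one real point and a pair of complex conjugate non-real points are connected and simply connected, so $\mathcal{B}_3$ is canonically isomorphic to the relative fundamental groups $\pi_1(C_3(\mathbb{C})/\mathcal{S}_3,\mathcal{E}^{tr})$ and $\pi_1(C_3(\mathbb{C})/\mathcal{S}_3,\mathcal{E}_{pb})$ (homotopy classes of arcs with endpoints in the respective set); $b_{tr}$, $b_{pb}$ denote the images of $b$. Rectangles have sides parallel to the axes; if the horizontal sides have length $\mathsf b$ and vertical sides length $\mathsf a$, the extremal length is $\lambda(R)=\mathsf a/\mathsf b$ and the conformal module $m(R)=\mathsf b/\mathsf a$. A map $f$ from an open rectangle $R$ to a space $X$, continuous on $\bar R$, represents a homotopy class $\mathsf h$ of arcs with endpoints in a set $E$ if it maps the open horizontal sides into $E$ and its restriction to the closure of every maximal vertical segment in $R$ represents $\mathsf h$. $\Lambda_{tr}(b)$ is the infimum of $\lambda(R)$ over rectangles $R$ admitting a holomorphic map to $C_3(\mathbb{C})/\mathcal{S}_3$ representing $b_{tr}$, and $\mathcal{M}_{tr}(b)$ the supremum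 of $m(R)$ over the same rectangles; $\Lambda_{pb}(b)$, $\mathcal{M}_{pb}(b)$ are defined in the same way with $b_{pb}$. $\Delta_3=\sigma_1\sigma_2\sigma_1$ is the Garside element; $\langle\Delta_3^2\rangle$ is the center. $\mathcal{PB}_3/\langle\Delta_3^2\rangle$ is free on $a_1,a_2$, the classes of $\sigma_1^2,\sigma_2^2$. Syllables of a nontrivial reduced word $w=w_1^{n_1}w_2^{n_2}\cdots$ ($n_j\ne0$, $w_j$ alternately $a_1,a_2$; the $w_j^{n_j}$ are the terms): (1) every term with $|n_j|\ge2$ is a syllable; (2) every maximal sequence of at least two consecutive terms all having the same exponent, equal to $+1$ or to $-1$, is a syllable; (3) every remaining term (exponent $\pm1$, neighbouring terms having different exponent) is a syllable, called a singleton. The degree $d_j$ of a syllable is the sum of the absolute values of the exponents of its terms. $\mathcal{L}(w)=\sum_j\log(4d_j-1)$, summed over all syllables; $\mathcal{L}(\text{identity})=0$. *)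

theory Defs
  imports "HOL-Analysis.Analysis"
begin

type_synonym cplx3 = "complex \<times> complex \<times> complex"

text \<open>The symmetrized configuration space C_3(C)/S_3 is realised (biholomorphically)
  via Vieta's map as the space of coefficient triples of monic cubics with distinct roots:
  an unordered triple {z1,z2,z3} corresponds to the coefficients of (z-z1)(z-z2)(z-z3).\<close>

definition vieta :: "cplx3 \<Rightarrow> cplx3" where
  "vieta p = (case p of (z1, z2, z3) \<Rightarrow>
     (-(z1 + z2 + z3), z1*z2 + z1*z3 + z2*z3, -(z1*z2*z3)))"

definition Conf3 :: "cplx3 set" where
  "Conf3 = {(z1, z2, z3). z1 \<noteq> z2 \<and> z1 \<noteq> z3 \<and> z2 \<noteq> z3}"

definition SymConf3 :: "cplx3 set" where
  "SymConf3 = vieta ` Conf3"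

definition E_tr :: "cplx3 set" where
  "E_tr = vieta ` {(z1, z2, z3). (z1, z2, z3) \<in> Conf3 \<and> Im z1 = 0 \<and> Im z2 = 0 \<and> Im z3 = 0}"

definition E_pb :: "cplx3 set" where
  "E_pb = vieta ` {(x, y, cnj y) | x y. Im x = 0 \<and> Im y \<noteq> 0}"

definition holo3 :: "(complex \<Rightarrow> cplx3) \<Rightarrow> complex set \<Rightarrow> bool" where
  "holo3 f S \<longleftrightarrow> (\<lambda>z. fst (f z)) holomorphic_on S \<and> (\<lambda>z. fst (snd (f z))) holomorphic_on S
                 \<and> (\<lambda>z. snd (snd (f z))) holomorphic_on S"

definition relhomotopic :: "'a::topological_space set \<Rightarrow> 'a set \<Rightarrow> (real \<Rightarrow> 'a) \<Rightarrow> (real \<Rightarrow> 'a) \<Rightarrow> bool" where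
  "relhomotopic X E g h \<longleftrightarrow>
     (\<exists>H :: real \<times> real \<Rightarrow> 'a.
        continuous_on ({0..1} \<times> {0..1}) H \<and> H ` ({0..1} \<times> {0..1}) \<subseteq> X \<and>
        (\<forall>t\<in>{0..1}. H (0, t) = g t \<and> H (1, t) = h t) \<and>
        (\<forall>s\<in>{0..1}. H (s, 0) \<in> E \<and> H (s, 1) \<in> E))"

text \<open>Pure braid loops in the ordered configuration space, base point (-1,0,1).
  gen_loop 1 = sigma_1^2 (points -1,0 make a full counterclockwise turn around -1/2),
  gen_loop 2 = sigma_2^2, delta2 = Delta_3^2 (full rotation).\<close>

definition base3 :: cplx3 where "base3 = (-1, 0, 1)"

definition gen_loop :: "nat \<Rightarrow> real \<Rightarrow> cplx3" where
  "gen_loop g t = (if g = 1 then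
      (-1/2 - (1/2) * exp (2 * pi * \<i> * t), -1/2 + (1/2) * exp (2 * pi * \<i> * t), 1)
    else
      (-1, 1/2 - (1/2) * exp (2 * pi * \<i> * t), 1/2 + (1/2) * exp (2 * pi * \<i> * t)))"

definition delta2 :: "real \<Rightarrow> cplx3" where
  "delta2 t = (- exp (2 * pi * \<i> * t), 0, exp (2 * pi * \<i> * t))"

fun npow :: "(real \<Rightarrow> 'a::real_normed_vector) \<Rightarrow> nat \<Rightarrow> real \<Rightarrow> 'a" where
  "npow p 0 = (\<lambda>t. p 0)"
| "npow p (Suc n) = p +++ npow p n"

definition ipow :: "(real \<Rightarrow> 'a::real_normed_vector) \<Rightarrow> int \<Rightarrow> real \<Rightarrow> 'a" where
  "ipow p n = (if n \<ge> 0 then npow p (nat n) else npow (reversepath p) (nat (- n)))"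

fun word_loop :: "(nat \<times> int) list \<Rightarrow> real \<Rightarrow> cplx3" where
  "word_loop [] = (\<lambda>t. base3)"
| "word_loop ((g, n) # ws) = ipow (gen_loop g) n +++ word_loop ws"

definition reduced_word :: "(nat \<times> int) list \<Rightarrow> bool" where
  "reduced_word w \<longleftrightarrow> (\<forall>(g, n) \<in> set w. g \<in> {1, 2} \<and> n \<noteq> 0) \<and>
     (\<forall>i. Suc i < length w \<longrightarrow> fst (w ! i) \<noteq> fst (w ! Suc i))"

text \<open>The pure braid b = a_{g_1}^{n_1} ... a_{g_r}^{n_r} Delta^{2k}; every pure braid has
  exactly one such representation with w reduced.  Its image arc in X with endpoints in E_tr:\<close>
definition braid_arc_tr :: "(nat \<times> int) list \<Rightarrow> int \<Rightarrow> real \<Rightarrow> cplx3" where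
  "braid_arc_tr w k = vieta \<circ> (word_loop w +++ ipow delta2 k)"

text \<open>Transport to E_pb along the quarter rotation from {-1,0,1} to {-i,0,i}.\<close>
definition rho :: "real \<Rightarrow> cplx3" where
  "rho t = vieta (- exp (pi * \<i> * t / 2), 0, exp (pi * \<i> * t / 2))"

definition braid_arc_pb :: "(nat \<times> int) list \<Rightarrow> int \<Rightarrow> real \<Rightarrow> cplx3" where
  "braid_arc_pb w k = reversepath rho +++ (braid_arc_tr w k +++ rho)"

definition admissible :: "cplx3 set \<Rightarrow> (real \<Rightarrow> cplx3) \<Rightarrow> real \<Rightarrow> real \<Rightarrow> real \<Rightarrow> real
    \<Rightarrow> (complex \<Rightarrow> cplx3) \<Rightarrow> bool" where
  "admissible E \<beta> a b c d f \<longleftrightarrow> a < b \<and> c < d \<and>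
     holo3 f (box (Complex a c) (Complex b d)) \<and>
     continuous_on (cbox (Complex a c) (Complex b d)) f \<and>
     f ` cbox (Complex a c) (Complex b d) \<subseteq> SymConf3 \<and>
     (\<forall>x\<in>{a<..<b}. f (Complex x c) \<in> E \<and> f (Complex x d) \<in> E) \<and>
     (\<forall>x\<in>{a<..<b}. relhomotopic SymConf3 E (\<lambda>t. f (Complex x (c + t * (d - c)))) \<beta>)"

definition ExtLen :: "cplx3 set \<Rightarrow> (real \<Rightarrow> cplx3) \<Rightarrow> ereal" where
  "ExtLen E \<beta> = Inf {ereal ((d - c) / (b - a)) | a b c d f. admissible E \<beta> a b c d f}"

definition ConfMod :: "cplx3 set \<Rightarrow> (real \<Rightarrow> cplx3) \<Rightarrow> ereal" where
  "ConfMod E \<beta> = Sup {ereal ((b - a) / (d - c)) | a b c d f. admissible E \<beta> a b c d f}"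

definition Lambda_tr where "Lambda_tr w k = ExtLen E_tr (braid_arc_tr w k)"
definition M_tr where "M_tr w k = ConfMod E_tr (braid_arc_tr w k)"
definition Lambda_pb where "Lambda_pb w k = ExtLen E_pb (braid_arc_pb w k)"
definition M_pb where "M_pb w k = ConfMod E_pb (braid_arc_pb w k)"

fun syl_degs :: "int list \<Rightarrow> nat list" where
  "syl_degs [] = []"
| "syl_degs [n] = [nat \<bar>n\<bar>]"
| "syl_degs (n # m # ns) =
     (if \<bar>n\<bar> = 1 \<and> m = n then (case syl_degs (m # ns) of d # ds \<Rightarrow> Suc d # ds | [] \<Rightarrow> [])
      else nat \<bar>n\<bar> # syl_degs (m # ns))"

definition Lw :: "(nat \<times> int) list \<Rightarrow> real" where
  "Lw w = (\<Sum>d\<leftarrow>syl_degs (map snd w). ln (4 * real d - 1))"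

end

theory Submission
  imports Defs "HOL-Complex_Analysis.Complex_Analysis" "HOL-Real_Asymp.Real_Asymp"
begin

text \<open>
  The modular function \<open>\<lambda>\<close> is the universal covering of the plane without 0 and 1 by the upper half plane, with deck group
  the image of \<open>\<Gamma>(2)\<close>. Applied to the ratio \<open>(z2 - z1) / (z3 - z1)\<close> it turns a map to the symmetrized configuration space into a
  map to the half plane. Suitably ordered, the triples in the two end sets correspond to the translates of the geodesics \<open>Re \<tau> = 0\<close>
  (three real points) and \<open>|\<tau>| = 1\<close> (a conjugate pair), and \<open>a_1\<close>, \<open>a_2\<close> act as \<open>\<tau> + 2\<close> and \<open>\<tau> / (1 - 2 \<tau>)\<close>. So a rectangle is admissible
  for the braid with matrix \<open>(a, b, c, d)\<close> iff it maps to the half plane with horizontal sides on a geodesic and on its image under the matrix.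
  The half plane is a strip of width \<open>\<pi>\<close> on which both geodesics are vertical segments at distance \<open>arcosh p\<close>, where \<open>p\<close> is
  \<open>|a d + b c|\<close> or \<open>|a^2 + d^2 - b^2 - c^2| / 2\<close>; hence the extremal length is exactly \<open>arcosh p / \<pi>\<close>. It remains to compare \<open>p\<close>
  with the product of the numbers \<open>4 d_j - 1\<close> over the syllables.
\<close>

section \<open>The Weierstrass function\<close>

text \<open>The hard analytic point is that the fibres of \<open>lam\<close> are exactly the orbits
  of Gamma(2). It is therefore built as the cross ratio (e3 - e2) / (e1 - e2) of half-period values:
  a rescaled Weierstrass function then solves a differential equation in which only this ratio
  occurs, and its poles recover the lattice. The centre costs nothing, because the universal
  covering of the ordered configuration space has log (z3 - z1) as a further coordinate, free to run
  through C; a linear function of z supplies the shift 2 pi i k. Endpoints may slide inside E during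
  a homotopy, so their lifts must be trapped on one geodesic; this works because \<open>lam\<close>
  is injective on \<open>gtr\<close> and on \<open>gpb\<close>. The exceptional words are those with
  p = 1: the two geodesics coincide or share an ideal endpoint, and arbitrarily wide rectangles fit.
  Otherwise let X be the matrix entry of largest absolute value and N the product of the 4 d - 1.
  Then N \<le> X^2 and |X| \<le> N, so arcosh p lies between (log N) / 2 and log 4 + 2 log N; the
  first explains the constant 1 / (2 pi), the second stays far below 300 pi log N.\<close>

definition csq :: "complex \<Rightarrow> complex" where "csq z = 1 / (sin (of_real pi * z))\<^sup>2"

definition Lat :: "complex \<Rightarrow> complex set" where
  "Lat \<tau> = {of_int m * \<tau> + of_int n | m n. True}"

definition wpt :: "complex \<Rightarrow> nat \<Rightarrow> complex \<Rightarrow> complex" where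
  "wpt \<tau> n z = csq (z + of_nat (Suc n) * \<tau>) + csq (z - of_nat (Suc n) * \<tau>)"

definition wpA :: "complex \<Rightarrow> complex \<Rightarrow> complex" where "wpA \<tau> z = (\<Sum>n. wpt \<tau> n z)"

text \<open>By the expansion of 1 / sin^2 into double poles at the integers, this is the classical
  Weierstrass function divided by pi^2, up to an additive constant that cancels in all differences
  of values. \<open>wpt\<close> joins the lattice rows n + 1 and -(n + 1).\<close>

definition wp :: "complex \<Rightarrow> complex \<Rightarrow> complex" where "wp \<tau> z = csq z + wpA \<tau> z"

section \<open>Convergence of the series and its periods\<close>

text \<open>The left side is the square of 2 sinh (a / 2), and |2 sinh h| \<ge> 2 |h|.\<close>

lemma exp_cosh_quadratic: "exp (a::real) + inverse (exp a) - 2 \<ge> a\<^sup>2"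
proof -
  have pos: "exp h - exp (-h) \<ge> 2 * h" if "h \<ge> 0" for h :: real
  proof -
    define u where "u = 1 + h + h\<^sup>2/2"
    have 1: "exp h \<ge> u" using exp_lower_Taylor_quadratic[OF that] by (simp add: u_def)
    have 2: "u > 0" using that by (simp add: u_def add_pos_nonneg)
    have "exp (-h) \<le> inverse u" using 1 2 by (simp add: exp_minus le_imp_inverse_le)
    \<comment> \<open>The product u (u - 2 h) is 1 + h^4 / 4, hence at least 1.\<close>
    moreover have "inverse u \<le> u - 2*h"
    proof -
      have "u * (u - 2*h) = 1 + (h\<^sup>2/2)\<^sup>2"
        by (simp add: u_def power2_eq_square field_simps)
      hence "u * inverse u \<le> u * (u - 2*h)" using 2 by simp
      thus ?thesis using 2 by (rule mult_left_le_imp_le)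
    qed
    ultimately show ?thesis using 1 by linarith
  qed
  have sq: "exp a + inverse (exp a) - 2 = (exp (a/2) - exp (-(a/2)))\<^sup>2"
  proof -
    have "(exp (a/2))\<^sup>2 = exp a" "(exp (-(a/2)))\<^sup>2 = exp (-a)" "exp (a/2) * exp (-(a/2)) = 1"
      by (simp_all add: power2_eq_square flip: exp_add)
    thus ?thesis by (simp add: power2_diff exp_minus)
  qed
  have "\<bar>exp (a/2) - exp (-(a/2))\<bar> \<ge> \<bar>a\<bar>"
  proof (cases "a \<ge> 0")
    case True thus ?thesis using pos[of "a/2"] by simp
  next
    case False thus ?thesis using pos[of "-(a/2)"] by simp
  qed
  hence "a\<^sup>2 \<le> (exp (a/2) - exp (-(a/2)))\<^sup>2" by (simp add: abs_le_square_iff)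
  thus ?thesis using sq by simp
qed

lemma norm_sin_pi_ge: "\<bar>Im z\<bar> \<le> norm (sin (of_real pi * z))"
proof -
  have "(2 * pi * Im z)\<^sup>2 \<le> exp (2 * pi * Im z) + inverse (exp (2 * pi * Im z)) - 2"
    by (rule exp_cosh_quadratic)
  also have "\<dots> \<le> 4 * (norm (sin (of_real pi * z)))\<^sup>2"
    using cos_le_one[of "2 * (pi * Re z)"] by (simp add: norm_sin_squared mult.assoc)
  finally have "(pi * Im z)\<^sup>2 \<le> (norm (sin (of_real pi * z)))\<^sup>2" by (simp add: power_mult_distrib)
  hence "\<bar>pi * Im z\<bar> \<le> norm (sin (of_real pi * z))"
    using abs_le_square_iff[of "pi * Im z" "norm (sin (of_real pi * z))"] by simp
  moreover have "\<bar>pi * Im z\<bar> \<ge> 1 * \<bar>Im z\<bar>"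
    unfolding abs_mult using pi_gt3 by (intro mult_right_mono) auto
  ultimately show ?thesis by simp
qed

lemma csq_bound: "Im z \<noteq> 0 \<Longrightarrow> norm (csq z) \<le> 1 / (Im z)\<^sup>2"
proof -
  assume h: "Im z \<noteq> 0"
  have "(Im z)\<^sup>2 \<le> (norm (sin (of_real pi * z)))\<^sup>2"
    using norm_sin_pi_ge[of z] abs_le_square_iff[of "Im z" "norm (sin (of_real pi * z))"] by simp
  thus ?thesis using h by (simp add: csq_def norm_divide norm_power frac_le)
qed

lemma sin_pi_eq_0: "sin (of_real pi * z) = (0::complex) \<longleftrightarrow> z \<in> \<int>"
proof -
  have "sin (of_real pi * z) = 0 \<longleftrightarrow> (\<exists>n. of_real pi * z = of_real (real_of_int n * pi))"
    by (simp add: sin_eq_0)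
  also have "\<dots> \<longleftrightarrow> (\<exists>n. of_real pi * z = of_real pi * of_int n)"
    by (simp add: mult.commute)
  also have "\<dots> \<longleftrightarrow> (\<exists>n. z = of_int n)"
    by (subst mult_cancel_left) simp
  finally show ?thesis by (auto simp: Ints_def)
qed

lemma csq_holo [holomorphic_intros]: "csq holomorphic_on (- \<int>)"
  unfolding csq_def by (intro holomorphic_intros) (auto simp: sin_pi_eq_0)

lemma csq_minus [simp]: "csq (-z) = csq z" by (simp add: csq_def)

lemma csq_period1: "csq (z + 1) = csq z"
  by (simp add: csq_def distrib_left sin_plus_pi)

lemma wpt_minus: "wpt \<tau> n (-z) = wpt \<tau> n z"
  using csq_minus[of "z - of_nat (Suc n) * \<tau>"] csq_minus[of "z + of_nat (Suc n) * \<tau>"]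
  by (simp add: wpt_def add.commute)

lemma wpA_minus: "wpA \<tau> (-z) = wpA \<tau> z" by (simp add: wpA_def wpt_minus)

lemma wp_minus: "wp \<tau> (-z) = wp \<tau> z" by (simp add: wp_def wpA_minus)

lemma wp_period1: "wp \<tau> (z + 1) = wp \<tau> z"
proof -
  have "wpt \<tau> n (z+1) = wpt \<tau> n z" for n
    using csq_period1[of "z + of_nat (Suc n) * \<tau>"] csq_period1[of "z - of_nat (Suc n) * \<tau>"]
    by (simp add: wpt_def algebra_simps)
  thus ?thesis by (simp add: wp_def wpA_def csq_period1)
qed

lemma summable_inverse_Suc_sq: "summable (\<lambda>n. c / (real (Suc n))\<^sup>2)"
  using summable_mult[OF inverse_power_summable[of 2, where 'a=real], of c]
  by (subst summable_Suc_iff) (simp add: divide_inverse)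

text \<open>On the strip |Im z| \<le> r a shift by (n + 1) \<tau> in either direction leaves an
  imaginary part of size at least (n + 1) (Im \<tau> - r), which makes the bound uniform in z and
  summable in n.\<close>

lemma wpt_bound:
  assumes "\<bar>Im z\<bar> \<le> r" "r < Im \<tau>"
  shows "norm (wpt \<tau> n z) \<le> (2 / (Im \<tau> - r)\<^sup>2) / (real (Suc n))\<^sup>2"
proof -
  define s where "s = real (Suc n) * (Im \<tau> - r)"
  have r0: "r \<ge> 0" using assms by linarith
  have s0: "s > 0" using assms unfolding s_def by simp
  have sr: "s \<le> real (Suc n) * Im \<tau> - r"
    using r0 mult_right_mono[of 1 "real (Suc n)" r] by (simp add: s_def algebra_simps)
  have b: "norm (csq w) \<le> 1 / s\<^sup>2" if "\<bar>Im w\<bar> \<ge> s" for w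
  proof -
    have "norm (csq w) \<le> 1 / (Im w)\<^sup>2" using that s0 by (intro csq_bound) auto
    also have "\<dots> \<le> 1 / s\<^sup>2" using that s0
      by (intro divide_left_mono) (auto simp: abs_le_square_iff[symmetric])
    finally show ?thesis .
  qed
  have "\<bar>Im (z + of_nat (Suc n) * \<tau>)\<bar> \<ge> s" "\<bar>Im (z - of_nat (Suc n) * \<tau>)\<bar> \<ge> s"
    using assms sr by (auto simp: algebra_simps)
  from b[OF this(1)] b[OF this(2)] have "norm (wpt \<tau> n z) \<le> 1/s\<^sup>2 + 1/s\<^sup>2"
    unfolding wpt_def by (intro norm_triangle_mono)
  thus ?thesis by (simp add: s_def power_mult_distrib mult.commute)
qed

lemma wpt_summable_strip: "\<bar>Im z\<bar> < Im \<tau> \<Longrightarrow> summable (\<lambda>n. wpt \<tau> n z)"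
  by (rule summable_comparison_test'[OF summable_inverse_Suc_sq, of 0])
     (rule wpt_bound[of z "\<bar>Im z\<bar>"], auto)

lemma csq_tau_tendsto:
  assumes "Im \<tau> > 0" "\<epsilon> = 1 \<or> \<epsilon> = -1"
  shows "(\<lambda>n. csq (z + of_int \<epsilon> * of_nat n * \<tau>)) \<longlonglongrightarrow> 0"
proof (rule Lim_null_comparison)
  have 1: "filterlim (\<lambda>n. real n * Im \<tau> - \<bar>Im z\<bar>) at_top sequentially"
    using assms(1) by real_asymp
  show "((\<lambda>n. 1 / (real n * Im \<tau> - \<bar>Im z\<bar>)\<^sup>2) \<longlongrightarrow> 0) sequentially"
    using assms(1) by real_asymp
  have "eventually (\<lambda>n. real n * Im \<tau> - \<bar>Im z\<bar> > 0) sequentially"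
    using spec[OF 1[unfolded filterlim_at_top_dense], of 0] by simp
  thus "eventually (\<lambda>n. norm (csq (z + of_int \<epsilon> * of_nat n * \<tau>)) \<le> 1 / (real n * Im \<tau> - \<bar>Im z\<bar>)\<^sup>2) sequentially"
  proof eventually_elim
    case (elim n)
    define w where "w = z + of_int \<epsilon> * of_nat n * \<tau>"
    have w: "\<bar>Im w\<bar> \<ge> real n * Im \<tau> - \<bar>Im z\<bar>" using assms(2) by (auto simp: w_def)
    have "norm (csq w) \<le> 1 / (Im w)\<^sup>2" using w elim by (intro csq_bound) auto
    also have "\<dots> \<le> 1 / (real n * Im \<tau> - \<bar>Im z\<bar>)\<^sup>2" using w elim
      by (intro divide_left_mono) (auto simp: abs_le_square_iff[symmetric] zero_less_mult_iff)
    finally show ?case by (simp add: w_def)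
  qed
qed

text \<open>Translation by \<tau> moves the window of summation by one row, so the symmetric partial
  sums differ by one boundary term at each end; both terms tend to 0.\<close>

lemma wp_partial:
  "csq (z+\<tau>) + (\<Sum>n<N. wpt \<tau> n (z+\<tau>)) =
   csq z + (\<Sum>n<N. wpt \<tau> n z) + csq (z + of_nat (Suc N) * \<tau>) - csq (z - of_nat N * \<tau>)"
proof (induction N)
  case (Suc N)
  have a: "z + \<tau> + of_nat (Suc N) * \<tau> = z + of_nat (Suc (Suc N)) * \<tau>" "z + \<tau> - of_nat (Suc N) * \<tau> = z - of_nat N * \<tau>"
    by (simp_all add: algebra_simps)
  show ?case using Suc.IH unfolding sum.lessThan_Suc wpt_def[of \<tau> N] a by (simp add: eq_diff_eq ac_simps del: of_nat_Suc)
qed simp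

text \<open>As an equivalence it carries convergence from the strip |Im z| < Im \<tau> to the whole
  plane in both directions; the value of the sum yields the period \<tau> at the same time.\<close>

lemma wp_sums_shift:
  assumes t: "Im \<tau> > 0"
  shows "(\<lambda>n. wpt \<tau> n z) sums L \<longleftrightarrow> (\<lambda>n. wpt \<tau> n (z+\<tau>)) sums (csq z + L - csq (z+\<tau>))"
proof -
  have d: "(\<lambda>N. csq (z + of_nat (Suc N) * \<tau>) - csq (z - of_nat N * \<tau>)) \<longlonglongrightarrow> 0 - 0"
    using csq_tau_tendsto[OF t, of 1 z] csq_tau_tendsto[OF t, of "-1" z]
    by (intro tendsto_diff) (auto dest: LIMSEQ_Suc simp del: of_nat_Suc)
  have e: "(\<Sum>n<N. wpt \<tau> n (z+\<tau>)) = (\<Sum>n<N. wpt \<tau> n z) + (csq z - csq (z+\<tau>)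
       + (csq (z + of_nat (Suc N) * \<tau>) - csq (z - of_nat N * \<tau>)))" for N
  proof -
    have gen: "a+b=c+d+e-f \<Longrightarrow> b = d+(c-a+(e-f))" for a b c d e f :: complex by (simp add: algebra_simps)
    show ?thesis by (rule gen[OF wp_partial])
  qed
  have c: "(\<lambda>N. csq z - csq (z+\<tau>) + (csq (z + of_nat (Suc N) * \<tau>) - csq (z - of_nat N * \<tau>)))
        \<longlonglongrightarrow> csq z - csq (z+\<tau>)"
    using tendsto_add[OF tendsto_const d] by simp
  show ?thesis
  proof
    assume "(\<lambda>n. wpt \<tau> n z) sums L"
    from tendsto_add[OF this[unfolded sums_def] c]
    show "(\<lambda>n. wpt \<tau> n (z+\<tau>)) sums (csq z + L - csq (z+\<tau>))"
      unfolding sums_def e by (simp add: algebra_simps)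
  next
    assume "(\<lambda>n. wpt \<tau> n (z+\<tau>)) sums (csq z + L - csq (z+\<tau>))"
    from tendsto_diff[OF this[unfolded sums_def] c]
    show "(\<lambda>n. wpt \<tau> n z) sums L"
      unfolding sums_def e by (simp add: algebra_simps)
  qed
qed

lemma summable_shift: assumes t: "Im \<tau> > 0"
  shows "summable (\<lambda>n. wpt \<tau> n (z+\<tau>)) \<longleftrightarrow> summable (\<lambda>n. wpt \<tau> n z)"
proof
  assume "summable (\<lambda>n. wpt \<tau> n (z+\<tau>))"
  then obtain M where M: "(\<lambda>n. wpt \<tau> n (z+\<tau>)) sums M" by (auto simp: summable_def)
  have "M = csq z + (M - csq z + csq (z+\<tau>)) - csq (z+\<tau>)" by simp
  hence "(\<lambda>n. wpt \<tau> n z) sums (M - csq z + csq (z+\<tau>))"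
    using M wp_sums_shift[OF t] by metis
  thus "summable (\<lambda>n. wpt \<tau> n z)" by (auto simp: summable_def)
qed (use wp_sums_shift[OF t] summable_def in blast)

lemma shift_int_induct:
  assumes "\<And>z. P (z+\<tau>) \<longleftrightarrow> P z"
  shows "P (z + of_int k * \<tau>) \<longleftrightarrow> P (z::complex)"
proof (induction k rule: int_induct[where k=0])
  case (step1 i)
  thus ?case using assms[of "z + of_int i * \<tau>"] by (simp add: algebra_simps)
next
  case (step2 i)
  thus ?case using assms[of "z + of_int (i-1) * \<tau>"] by (simp add: algebra_simps)
qed auto

lemma strip_rep:
  assumes t: "Im \<tau> > 0"
  obtains k :: int where "0 \<le> Im (z + of_int k * \<tau>)" "Im (z + of_int k * \<tau>) < Im \<tau>"
proof
  define f where "f = floor (Im z / Im \<tau>)"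
  have "of_int f \<le> Im z / Im \<tau>" "Im z / Im \<tau> < of_int f + 1" by (auto simp: f_def)
  hence "of_int f * Im \<tau> \<le> Im z" "Im z < (of_int f + 1) * Im \<tau>" using t by (auto simp: field_simps)
  thus "0 \<le> Im (z + of_int (-f) * \<tau>)" "Im (z + of_int (-f) * \<tau>) < Im \<tau>" by (auto simp: algebra_simps)
qed

lemma wpt_summable: assumes t: "Im \<tau> > 0" shows "summable (\<lambda>n. wpt \<tau> n z)"
proof -
  obtain k where k: "0 \<le> Im (z + of_int k * \<tau>)" "Im (z + of_int k * \<tau>) < Im \<tau>" using strip_rep[OF t] .
  have "summable (\<lambda>n. wpt \<tau> n (z + of_int k * \<tau>))" using k by (intro wpt_summable_strip) auto
  thus ?thesis using shift_int_induct[of "\<lambda>z. summable (\<lambda>n. wpt \<tau> n z)", OF summable_shift[OF t]] by blast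
qed

lemma wp_period_tau: assumes t: "Im \<tau> > 0" shows "wp \<tau> (z + \<tau>) = wp \<tau> z"
proof -
  have "(\<lambda>n. wpt \<tau> n z) sums wpA \<tau> z" unfolding wpA_def using wpt_summable[OF t] by (rule summable_sums)
  hence "(\<lambda>n. wpt \<tau> n (z+\<tau>)) sums (csq z + wpA \<tau> z - csq (z+\<tau>))" using wp_sums_shift[OF t] by blast
  hence "wpA \<tau> (z+\<tau>) = csq z + wpA \<tau> z - csq (z+\<tau>)" unfolding wpA_def by (rule sums_unique[symmetric])
  thus ?thesis by (simp add: wp_def)
qed

lemma period_lattice:
  assumes "\<And>z. f (z + 1) = f z" "\<And>z. f (z + \<tau>) = f (z::complex)" "l \<in> Lat \<tau>"
  shows "f (z + l) = f z"
proof -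
  from assms obtain m n where l: "l = of_int m * \<tau> + of_int n" by (auto simp: Lat_def)
  have "f (z + of_int m * \<tau>) = f z" using shift_int_induct[of "\<lambda>w. f w = f z" \<tau> z m] assms by auto
  moreover have "f (z + of_int m * \<tau> + of_int n * 1) = f (z + of_int m * \<tau>)"
    using shift_int_induct[of "\<lambda>w. f w = f (z + of_int m * \<tau>)" 1 "z + of_int m * \<tau>" n] assms by auto
  ultimately show ?thesis by (simp add: l add.assoc)
qed

lemma wp_lattice: "Im \<tau> > 0 \<Longrightarrow> l \<in> Lat \<tau> \<Longrightarrow> wp \<tau> (z + l) = wp \<tau> z"
  by (rule period_lattice) (auto simp: wp_period1 wp_period_tau)

section \<open>The period lattice and holomorphy off it\<close>

lemma Lat_simps [simp]: "0 \<in> Lat \<tau>" "1 \<in> Lat \<tau>" "\<tau> \<in> Lat \<tau>"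
proof -
  have "0 = of_int 0 * \<tau> + of_int 0" "1 = of_int 0 * \<tau> + of_int 1" "\<tau> = of_int 1 * \<tau> + of_int 0" by simp_all
  thus "0 \<in> Lat \<tau>" "1 \<in> Lat \<tau>" "\<tau> \<in> Lat \<tau>" unfolding Lat_def by blast+
qed

lemma Lat_add: "a \<in> Lat \<tau> \<Longrightarrow> b \<in> Lat \<tau> \<Longrightarrow> a + b \<in> Lat \<tau>"
proof -
  assume "a \<in> Lat \<tau>" "b \<in> Lat \<tau>"
  then obtain m n k l where "a = of_int m * \<tau> + of_int n" "b = of_int k * \<tau> + of_int l" by (auto simp: Lat_def)
  hence "a + b = of_int (m+k) * \<tau> + of_int (n+l)" by (simp add: algebra_simps)
  thus ?thesis unfolding Lat_def by blast
qed

lemma Lat_minus: "a \<in> Lat \<tau> \<Longrightarrow> - a \<in> Lat \<tau>"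
proof -
  assume "a \<in> Lat \<tau>"
  then obtain m n where "a = of_int m * \<tau> + of_int n" by (auto simp: Lat_def)
  hence "- a = of_int (-m) * \<tau> + of_int (-n)" by (simp add: algebra_simps)
  thus ?thesis unfolding Lat_def by blast
qed

lemma Lat_diff: "a \<in> Lat \<tau> \<Longrightarrow> b \<in> Lat \<tau> \<Longrightarrow> a - b \<in> Lat \<tau>"
  using Lat_add[of a \<tau> "-b"] Lat_minus[of b \<tau>] by simp

lemma Lat_cancel [simp]: "l \<in> Lat \<tau> \<Longrightarrow> z + l \<in> Lat \<tau> \<longleftrightarrow> z \<in> Lat \<tau>"
  using Lat_add[of z \<tau> l] Lat_diff[of "z+l" \<tau> l] by auto

lemma Lat_I [intro]: "of_int m * \<tau> + of_int n \<in> Lat \<tau>" unfolding Lat_def by blast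

text \<open>The rows other than the real one have no poles in this strip, and
  \<open>wpt_bound\<close> is uniform on small discs.\<close>

lemma wpA_holo: assumes t: "Im \<tau> > 0" shows "wpA \<tau> holomorphic_on {z. \<bar>Im z\<bar> < Im \<tau>}"
proof (rule holomorphic_uniform_sequence)
  let ?S = "{z. \<bar>Im z\<bar> < Im \<tau>}"
  have S: "?S = {z. Im z < Im \<tau>} \<inter> {z. Im z > - Im \<tau>}" by auto
  show op: "open ?S" unfolding S by (intro open_Int open_halfspace_Im_lt open_halfspace_Im_gt)
  have nz: "z + of_nat (Suc n) * \<tau> \<notin> \<int>" "z - of_nat (Suc n) * \<tau> \<notin> \<int>" if "z \<in> ?S" for z n
  proof -
    have "real (Suc n) * Im \<tau> \<ge> 1 * Im \<tau>" using t by (intro mult_right_mono) auto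
    hence "Im (z + of_nat (Suc n) * \<tau>) \<noteq> 0" "Im (z - of_nat (Suc n) * \<tau>) \<noteq> 0" using that by auto
    thus "z + of_nat (Suc n) * \<tau> \<notin> \<int>" "z - of_nat (Suc n) * \<tau> \<notin> \<int>"
      by (metis Ints_cases complex_Im_of_int)+
  qed
  have "wpt \<tau> n holomorphic_on ?S" for n
    unfolding wpt_def
    by (intro holomorphic_intros holomorphic_on_compose_gen[OF _ csq_holo, unfolded o_def])
       (use nz in auto)
  thus "(\<lambda>z. \<Sum>n<N. wpt \<tau> n z) holomorphic_on ?S" for N by (intro holomorphic_intros)
  fix x assume "x \<in> ?S"
  then obtain d where d: "d > 0" "cball x d \<subseteq> ?S" using op open_contains_cball by blast
  define r where "r = \<bar>Im x\<bar> + d"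
  have rt: "r < Im \<tau>"
  proof -
    have "x + \<i> * of_real d \<in> cball x d" "x - \<i> * of_real d \<in> cball x d" using d by (auto simp: dist_norm norm_mult)
    hence "x + \<i> * of_real d \<in> ?S" "x - \<i> * of_real d \<in> ?S" using d by blast+
    thus ?thesis using d by (auto simp: r_def)
  qed
  have "uniform_limit (cball x d) (\<lambda>N z. \<Sum>n<N. wpt \<tau> n z) (\<lambda>z. \<Sum>n. wpt \<tau> n z) sequentially"
  proof (rule Weierstrass_m_test[OF _ summable_inverse_Suc_sq[of "2 / (Im \<tau> - r)\<^sup>2"]])
    fix n z assume "z \<in> cball x d"
    hence "\<bar>Im x - Im z\<bar> \<le> d" using abs_Im_le_cmod[of "x - z"] by (auto simp: dist_norm)
    hence "\<bar>Im z\<bar> \<le> r" by (auto simp: r_def)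
    thus "norm (wpt \<tau> n z) \<le> 2 / (Im \<tau> - r)\<^sup>2 / (real (Suc n))\<^sup>2" using rt by (intro wpt_bound) auto
  qed
  thus "\<exists>d>0. cball x d \<subseteq> ?S \<and> uniform_limit (cball x d) (\<lambda>N z. \<Sum>n<N. wpt \<tau> n z) (wpA \<tau>) sequentially"
    using d unfolding wpA_def[abs_def] by blast
qed

lemma open_strip: "open {z. \<bar>Im z\<bar> < t}"
proof -
  have S: "{z. \<bar>Im z\<bar> < t} = {z. Im z < t} \<inter> {z. Im z > - t}" by auto
  show ?thesis unfolding S by (intro open_Int open_halfspace_Im_lt open_halfspace_Im_gt)
qed

lemma Lat_strip: assumes "Im \<tau> > 0" "z \<in> Lat \<tau>" "\<bar>Im z\<bar> < Im \<tau>" shows "z \<in> \<int>"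
proof -
  from assms obtain m n where z: "z = of_int m * \<tau> + of_int n" by (auto simp: Lat_def)
  have "\<bar>of_int m * Im \<tau>\<bar> < Im \<tau>" using assms z by simp
  hence "\<bar>real_of_int m\<bar> * Im \<tau> < 1 * Im \<tau>" using assms by (simp add: abs_mult)
  hence "\<bar>real_of_int m\<bar> < 1" using assms(1) mult_less_cancel_right_pos by blast
  hence "m = 0" by auto
  thus ?thesis by (simp add: z)
qed

lemma wp_field_diff:
  assumes t: "Im \<tau> > 0" and z: "z \<notin> Lat \<tau>" shows "wp \<tau> field_differentiable (at z)"
proof -
  obtain k where k: "0 \<le> Im (z + of_int k * \<tau>)" "Im (z + of_int k * \<tau>) < Im \<tau>" using strip_rep[OF t] .
  have kl: "of_int k * \<tau> \<in> Lat \<tau>" using Lat_I[of k \<tau> 0] by simp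
  define w where "w = z + of_int k * \<tau>"
  have wL: "w \<notin> \<int>"
  proof
    assume "w \<in> \<int>"
    hence "w \<in> Lat \<tau>" using Lat_I[of 0 \<tau>] by (auto elim!: Ints_cases)
    thus False using z kl by (simp add: w_def)
  qed
  let ?S = "{z. \<bar>Im z\<bar> < Im \<tau>} - \<int>"
  have "open ?S" by (intro open_Diff open_strip closed_Ints)
  moreover have "wp \<tau> holomorphic_on ?S"
    unfolding wp_def[abs_def]
    by (intro holomorphic_intros holomorphic_on_subset[OF csq_holo] holomorphic_on_subset[OF wpA_holo[OF t]]) auto
  moreover have "w \<in> ?S" using k wL by (auto simp: w_def)
  ultimately have "wp \<tau> field_differentiable (at w)" by (simp add: holomorphic_on_imp_differentiable_at)
  hence "(wp \<tau> \<circ> (\<lambda>z. z + of_int k * \<tau>)) field_differentiable (at z)"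
    unfolding w_def by (intro field_differentiable_compose) (auto intro!: derivative_intros)
  moreover have "wp \<tau> \<circ> (\<lambda>z. z + of_int k * \<tau>) = wp \<tau>" using wp_lattice[OF t kl] by auto
  ultimately show ?thesis by simp
qed

lemma wp_holo: "Im \<tau> > 0 \<Longrightarrow> wp \<tau> holomorphic_on (- Lat \<tau>)"
  unfolding holomorphic_on_def using wp_field_diff field_differentiable_at_within by blast

lemma Lat_small: "Im \<tau> > 0 \<Longrightarrow> z \<in> Lat \<tau> \<Longrightarrow> norm z < min 1 (Im \<tau>) \<Longrightarrow> z = 0"
proof -
  assume t: "Im \<tau> > 0" and z: "z \<in> Lat \<tau>" "norm z < min 1 (Im \<tau>)"
  have "\<bar>Im z\<bar> < Im \<tau>" using abs_Im_le_cmod[of z] z(2) by linarith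
  hence "z \<in> \<int>" using Lat_strip[OF t z(1)] by blast
  then obtain n where n: "z = of_int n" by (auto elim: Ints_cases)
  have "\<bar>real_of_int n\<bar> < 1" using z(2) unfolding n norm_of_int by linarith
  hence "n = 0" by linarith
  thus ?thesis using n by simp
qed

text \<open>Distinct points have distance at least |s| times the minimal lattice distance. The form
  covers the lattice itself and the poles of the rescaled function \<open>vsc\<close>, which are a
  scaled translate of it.\<close>

lemma Lat_discrete:
  assumes t: "Im \<tau> > 0" and s: "s \<noteq> 0"
  shows "closed ((\<lambda>l. s * (c + l)) ` Lat \<tau>)"
proof (rule discrete_imp_closed)
  show "0 < norm s * min 1 (Im \<tau>)" using t s by simp
  show "\<forall>x\<in>(\<lambda>l. s * (c + l)) ` Lat \<tau>. \<forall>y\<in>(\<lambda>l. s * (c + l)) ` Lat \<tau>. dist y x < norm s * min 1 (Im \<tau>) \<longrightarrow> y = x"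
  proof (intro ballI impI)
    fix x y assume "x \<in> (\<lambda>l. s * (c + l)) ` Lat \<tau>" "y \<in> (\<lambda>l. s * (c + l)) ` Lat \<tau>"
      and d: "dist y x < norm s * min 1 (Im \<tau>)"
    then obtain k l where kl: "k \<in> Lat \<tau>" "l \<in> Lat \<tau>" "x = s * (c + k)" "y = s * (c + l)" by blast
    have "y - x = s * (l - k)" by (simp add: kl algebra_simps)
    hence "norm s * norm (l - k) < norm s * min 1 (Im \<tau>)" using d by (simp add: dist_norm norm_mult)
    hence "norm (l - k) < min 1 (Im \<tau>)" using s by (simp del: min_less_iff_conj)
    hence "l - k = 0" using Lat_small[OF t Lat_diff[OF kl(2,1)]] by blast
    thus "y = x" by (simp add: kl)
  qed
qed

lemma Lat_closed: "Im \<tau> > 0 \<Longrightarrow> closed (Lat \<tau>)"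
  using Lat_discrete[of \<tau> 1 0] by simp

lemma Lat_countable: "countable (Lat \<tau>)"
proof -
  have "Lat \<tau> = (\<lambda>(m::int,n::int). of_int m * \<tau> + of_int n) ` UNIV" by (auto simp: Lat_def)
  thus ?thesis by simp
qed

lemma Lat_compl_open: "Im \<tau> > 0 \<Longrightarrow> open (- Lat \<tau>)" by (simp add: Lat_closed open_Compl)

lemma Lat_compl_connected: "connected (- Lat \<tau>)"
  using connected_open_diff_countable[OF _ open_UNIV connected_UNIV Lat_countable[of \<tau>]] by (simp add: Compl_eq_Diff_UNIV)

lemma eventually_at0_notin_Lat: "Im \<tau> > 0 \<Longrightarrow> eventually (\<lambda>z. z \<notin> Lat \<tau>) (at 0)"
proof -
  assume t: "Im \<tau> > 0"
  have "eventually (\<lambda>z. z \<noteq> 0 \<and> z \<in> ball 0 (min 1 (Im \<tau>))) (at (0::complex))"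
    using t by (intro eventually_conj eventually_at_in_open' eventually_neq_at_within) auto
  thus ?thesis by eventually_elim (use Lat_small[OF t] in auto)
qed

section \<open>A Liouville theorem for doubly periodic functions\<close>

lemma parallelogram_rep:
  assumes t: "Im \<tau> > 0"
  obtains l a b where "l \<in> Lat \<tau>" "z = of_real a * \<tau> + of_real b + l" "a \<in> {0..1}" "b \<in> {0..1}"
proof -
  define a0 where "a0 = Im z / Im \<tau>"
  define b0 where "b0 = Re (z - of_real a0 * \<tau>)"
  have z: "z = of_real a0 * \<tau> + of_real b0" using t by (simp add: complex_eq_iff b0_def a0_def)
  show ?thesis
  proof (rule that)
    show "of_int (floor a0) * \<tau> + of_int (floor b0) \<in> Lat \<tau>" by blast
    show "z = of_real (frac a0) * \<tau> + of_real (frac b0) + (of_int (floor a0) * \<tau> + of_int (floor b0))"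
      by (subst z) (simp add: frac_def algebra_simps)
  qed (auto simp: frac_lt_1 less_imp_le)
qed

text \<open>The limit at 0 removes the singularity there, the periods remove it at every lattice
  point, and the resulting entire function takes all its values on one compact
  parallelogram.\<close>

lemma lattice_liouville:
  assumes t: "Im \<tau> > 0" and g: "g holomorphic_on (- Lat \<tau>)"
    and p1: "\<And>z. g (z + 1) = g z" and pt: "\<And>z. g (z + \<tau>) = g z" and lim: "(g \<longlongrightarrow> l) (at 0)"
    and z: "z \<notin> Lat \<tau>"
  shows "g z = l"
proof -
  define G where "G = (\<lambda>z. if z \<in> Lat \<tau> then l else g z)"
  have Gp: "G (w + k) = G w" if "k \<in> Lat \<tau>" for w k
    using that period_lattice[OF p1 pt that] by (simp add: G_def)
  let ?B = "ball 0 (min 1 (Im \<tau>))"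
  have "(\<lambda>y. if y = 0 then l else g y) holomorphic_on ?B"
    using Lat_small[OF t] by (intro removable_singularity[OF _ _ lim] holomorphic_on_subset[OF g]) auto
  hence "G holomorphic_on ?B"
    by (rule holomorphic_transform) (use Lat_small[OF t] in \<open>auto simp: G_def\<close>)
  hence G0: "G field_differentiable (at 0)" using t by (intro holomorphic_on_imp_differentiable_at) auto
  have Gd: "G field_differentiable (at w)" for w
  proof (cases "w \<in> Lat \<tau>")
    case True
    have "(G \<circ> (\<lambda>v. v - w)) field_differentiable (at w)"
      using G0 by (intro field_differentiable_compose) (auto intro!: derivative_intros)
    moreover have "G \<circ> (\<lambda>v. v - w) = G" using Gp[OF Lat_minus[OF True]] by auto
    ultimately show ?thesis by simp
  next
    case False
    have "G holomorphic_on (- Lat \<tau>)" by (rule holomorphic_transform[OF g]) (auto simp: G_def)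
    thus ?thesis using False by (intro holomorphic_on_imp_differentiable_at) (auto simp: Lat_compl_open t)
  qed
  hence Gh: "G holomorphic_on UNIV" by (auto simp: holomorphic_on_def intro: field_differentiable_at_within)
  define K where "K = (\<lambda>(a,b). of_real a * \<tau> + of_real b) ` ({0..1::real} \<times> {0..1::real})"
  have "compact K" unfolding K_def
    by (intro compact_continuous_image compact_Times compact_Icc) (auto simp: case_prod_unfold intro!: continuous_intros)
  hence "compact (G ` K)"
    by (intro compact_continuous_image holomorphic_on_imp_continuous_on holomorphic_on_subset[OF Gh]) auto
  moreover have "range G \<subseteq> G ` K"
  proof clarify
    fix w
    obtain k a b where kab: "k \<in> Lat \<tau>" "w = of_real a * \<tau> + of_real b + k" "a \<in> {0..1}" "b \<in> {0..1}"
      using parallelogram_rep[OF t] .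
    have "of_real a * \<tau> + of_real b \<in> K" unfolding K_def using kab(3,4) by force
    moreover have "G w = G (of_real a * \<tau> + of_real b)" using Gp[OF kab(1)] kab(2) by metis
    ultimately show "G w \<in> G ` K" by blast
  qed
  ultimately have "bounded (range G)" using bounded_subset compact_imp_bounded by blast
  then obtain c where c: "\<And>w. G w = c" using Liouville_theorem[OF Gh] unfolding constant_on_def by auto
  have "G 0 = l" by (simp add: G_def)
  hence "c = l" using c by simp
  thus ?thesis using c[of z] z by (simp add: G_def)
qed

section \<open>The double pole at the origin\<close>

lemma sin_pi_over_id: "((\<lambda>z. sin (of_real pi * z) / z) \<longlongrightarrow> of_real pi) (at (0::complex))"
proof -
  have "((\<lambda>z::complex. sin (of_real pi * z)) has_field_derivative of_real pi) (at 0)"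
    by (auto intro!: derivative_eq_intros)
  thus ?thesis by (simp add: DERIV_def)
qed

lemma sq_csq_lim: "((\<lambda>z. z\<^sup>2 * csq z) \<longlongrightarrow> 1 / (of_real pi)\<^sup>2) (at 0)"
proof -
  have "((\<lambda>z. 1 / (sin (of_real pi * z) / z)\<^sup>2) \<longlongrightarrow> 1 / (of_real pi)\<^sup>2) (at (0::complex))"
    by (intro tendsto_intros sin_pi_over_id) auto
  thus ?thesis by (rule Lim_transform_eventually) (auto simp: csq_def power_divide)
qed

lemma csq_pole: "filterlim csq at_infinity (at 0)"
proof -
  have "((\<lambda>z::complex. (sin (of_real pi * z))\<^sup>2) \<longlongrightarrow> (sin (of_real pi * 0))\<^sup>2) (at 0)"
    by (intro tendsto_intros)
  moreover have "eventually (\<lambda>z::complex. (sin (of_real pi * z))\<^sup>2 \<noteq> 0) (at 0)"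
  proof -
    have "eventually (\<lambda>z. z \<noteq> 0 \<and> z \<in> ball 0 1) (at (0::complex))"
      by (intro eventually_conj eventually_at_in_open' eventually_neq_at_within) auto
    thus ?thesis
    proof eventually_elim
      case (elim z)
      have "z \<notin> \<int>"
      proof
        assume "z \<in> \<int>"
        then obtain n where n: "z = of_int n" by (auto elim: Ints_cases)
        show False using elim unfolding n by auto
      qed
      thus ?case by (simp add: sin_pi_eq_0)
    qed
  qed
  ultimately have "filterlim (\<lambda>z::complex. (sin (of_real pi * z))\<^sup>2) (at 0) (at 0)"
    by (simp add: filterlim_at)
  thus ?thesis unfolding csq_def by (intro filterlim_divide_at_infinity[OF tendsto_const]) auto
qed

lemma even_deriv_0:
  assumes ev: "\<And>z. A (-z) = A z" and d: "A field_differentiable (at (0::complex))"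
  shows "deriv A 0 = 0"
proof -
  have d: "(A has_field_derivative deriv A 0) (at 0)" using d by (simp add: DERIV_deriv_iff_field_differentiable)
  have "((\<lambda>z. A (-z)) has_field_derivative deriv A 0 * (-1)) (at 0)"
    by (rule DERIV_chain2[where f=A]) (use d in \<open>auto intro!: derivative_eq_intros\<close>)
  hence "(A has_field_derivative - deriv A 0) (at 0)" by (simp add: ev)
  from DERIV_unique[OF d this] have "2 * deriv A 0 = 0" by (metis add.right_inverse mult_2)
  thus ?thesis by simp
qed

text \<open>Evenness kills the linear term, so A - A(0) has a zero of order two, which cancels the
  double pole of \<open>csq\<close>.\<close>

lemma even_csq_limit:
  assumes A: "A holomorphic_on S" and S: "open S" "0 \<in> S"
    and ev: "\<And>z. A (-z) = A z"
  obtains c where "((\<lambda>z. csq z * (A z - A 0)) \<longlongrightarrow> c) (at 0)"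
proof -
  have d0: "deriv A 0 = 0"
    using A S by (intro even_deriv_0 ev holomorphic_on_imp_differentiable_at)
  define q where "q = (\<lambda>z. if z = 0 then deriv A 0 else (A z - A 0) / (z - 0))"
  have q: "q holomorphic_on S" unfolding q_def by (rule pole_lemma_open[OF A S(1)])
  define r where "r = (\<lambda>z. if z = 0 then deriv q 0 else (q z - q 0) / (z - 0))"
  have r: "r holomorphic_on S" unfolding r_def by (rule pole_lemma_open[OF q S(1)])
  have Ar: "A z - A 0 = z\<^sup>2 * r z" for z
  proof (cases "z = 0")
    case False
    hence "r z = q z / z" "q z = (A z - A 0) / z" by (simp_all add: r_def q_def d0)
    thus ?thesis using False by (simp add: power2_eq_square)
  qed simp
  have "isCont r 0" using holomorphic_on_imp_continuous_on[OF r] S by (simp add: continuous_on_eq_continuous_at)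
  hence "((\<lambda>z. z\<^sup>2 * csq z * r z) \<longlongrightarrow> 1 / (of_real pi)\<^sup>2 * r 0) (at 0)"
    by (intro tendsto_mult sq_csq_lim) (simp add: isCont_def)
  moreover have "(\<lambda>z. z\<^sup>2 * csq z * r z) = (\<lambda>z. csq z * (A z - A 0))" by (simp add: Ar mult_ac)
  ultimately have "((\<lambda>z. csq z * (A z - A 0)) \<longlongrightarrow> 1 / (of_real pi)\<^sup>2 * r 0) (at 0)" by (simp only:)
  thus thesis by (rule that)
qed

section \<open>The differential equation of the Weierstrass function\<close>

definition csq1 :: "complex \<Rightarrow> complex" where
  "csq1 z = - 2 * of_real pi * cos (of_real pi * z) / (sin (of_real pi * z))^3"

lemma csq_deriv: assumes "z \<notin> \<int>" shows "(csq has_field_derivative csq1 z) (at z)"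
proof -
  define s where "s = sin (of_real pi * z)"
  define c where "c = cos (of_real pi * z)"
  have s0: "s \<noteq> 0" using assms by (simp add: s_def sin_pi_eq_0)
  have "((\<lambda>z::complex. (sin (of_real pi * z))\<^sup>2) has_field_derivative 2 * s * (c * of_real pi)) (at z)"
    unfolding s_def c_def by (auto intro!: derivative_eq_intros)
  from DERIV_inverse_fun[OF this] s0
  have "(csq has_field_derivative - (inverse (s\<^sup>2) * (2 * s * (c * of_real pi)) * inverse (s\<^sup>2))) (at z)"
    by (simp add: csq_def[abs_def] s_def inverse_eq_divide)
  moreover have "- (inverse (s\<^sup>2) * (2 * s * (c * of_real pi)) * inverse (s\<^sup>2)) = csq1 z"
    unfolding csq1_def s_def[symmetric] c_def[symmetric] using s0 by (simp add: field_simps eval_nat_numeral)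
  ultimately show ?thesis by simp
qed

lemma csq1_deriv:
  assumes "z \<notin> \<int>"
  shows "(csq1 has_field_derivative (of_real pi)\<^sup>2 * (6 * (csq z)\<^sup>2 - 4 * csq z)) (at z)"
proof -
  define s where "s = sin (of_real pi * z)"
  define c where "c = cos (of_real pi * z)"
  have s0: "s \<noteq> 0" using assms by (simp add: s_def sin_pi_eq_0)
  have c2: "c\<^sup>2 = 1 - s\<^sup>2" by (simp add: s_def c_def cos_squared_eq)
  have "(csq1 has_field_derivative
      (2 * of_real pi * (s * of_real pi) * s^3 + 2 * of_real pi * c * (3 * s\<^sup>2 * (c * of_real pi))) / (s^3 * s^3)) (at z)"
    unfolding csq1_def[abs_def] s_def c_def
    by (rule derivative_eq_intros refl | use s0 in \<open>simp add: s_def\<close>)+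
  moreover have "(2 * of_real pi * (s * of_real pi) * s^3 + 2 * of_real pi * c * (3 * s\<^sup>2 * (c * of_real pi))) / (s^3 * s^3)
     = (of_real pi)\<^sup>2 * (6 * (csq z)\<^sup>2 - 4 * csq z)"
  proof -
    have "2 * of_real pi * c * (3 * s\<^sup>2 * (c * of_real pi)) = (of_real pi)\<^sup>2 * 6 * s\<^sup>2 * c\<^sup>2"
      by (simp add: power2_eq_square)
    hence n: "2 * of_real pi * (s * of_real pi) * s^3 + 2 * of_real pi * c * (3 * s\<^sup>2 * (c * of_real pi))
       = (of_real pi)\<^sup>2 * (6 * s\<^sup>2 - 4 * s^4)"
      unfolding c2 by (simp add: algebra_simps power2_eq_square power3_eq_cube power4_eq_xxxx)
    have k: "csq z = 1 / s\<^sup>2" by (simp add: csq_def s_def)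
    show ?thesis unfolding n k using s0 by (simp add: field_simps eval_nat_numeral)
  qed
  ultimately show ?thesis by simp
qed

lemma deriv_shift: "deriv f (z + c) = deriv (\<lambda>w. f (w + c)) z"
  by (simp add: deriv_def DERIV_shift)

lemma deriv_period: "(\<And>z. f (z + c) = f z) \<Longrightarrow> deriv f (z + c) = deriv f z"
  by (simp add: deriv_shift)

lemma wpA_holo_ball: "Im \<tau> > 0 \<Longrightarrow> wpA \<tau> holomorphic_on ball 0 (min 1 (Im \<tau>))"
  by (rule holomorphic_on_subset[OF wpA_holo]) (auto intro: le_less_trans[OF abs_Im_le_cmod])

lemma ball_notin_Ints: "z \<in> ball 0 (min 1 t) \<Longrightarrow> z \<noteq> (0::complex) \<Longrightarrow> z \<notin> \<int>"
proof
  assume z: "z \<in> ball 0 (min 1 t)" "z \<noteq> 0" and "z \<in> \<int>"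
  then obtain n where n: "z = of_int n" by (auto elim: Ints_cases)
  show False using z unfolding n by auto
qed

lemma wp_pole: "Im \<tau> > 0 \<Longrightarrow> filterlim (wp \<tau>) at_infinity (at 0)"
proof -
  assume t: "Im \<tau> > 0"
  have "isCont (wpA \<tau>) 0"
    using wpA_holo_ball[OF t] t by (intro holomorphic_on_imp_continuous_on[THEN continuous_on_interior]) auto
  hence "(wpA \<tau> \<longlongrightarrow> wpA \<tau> 0) (at 0)" by (simp add: isCont_def)
  from tendsto_add_filterlim_at_infinity[OF this csq_pole]
  show ?thesis by (simp add: wp_def[abs_def] add.commute)
qed

text \<open>With the right K all poles cancel in P'' - 6 pi^2 P^2 + K P, and a doubly periodic
  function without poles is constant.\<close>

lemma wp_ODE:
  assumes t: "Im \<tau> > 0"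
  obtains \<alpha> \<beta> where
    "\<And>z. z \<notin> Lat \<tau> \<Longrightarrow> deriv (deriv (wp \<tau>)) z = 6 * (of_real pi)\<^sup>2 * (wp \<tau> z)\<^sup>2 + \<alpha> * wp \<tau> z + \<beta>"
proof -
  let ?P = "wp \<tau>" and ?A = "wpA \<tau>"
  define p2 where "p2 = (of_real pi :: complex)\<^sup>2"
  \<comment> \<open>Near 0 one has P = csq + A and csq'' = pi^2 (6 csq^2 - 4 csq). This K reduces
    the polar part to -12 pi^2 csq (A - A(0)), which has a limit.\<close>
  define K where "K = 4 * p2 + 12 * p2 * ?A 0"
  define g where "g = (\<lambda>z. deriv (deriv ?P) z - 6 * p2 * (?P z)\<^sup>2 + K * ?P z)"
  let ?B = "ball 0 (min 1 (Im \<tau>))"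
  note op = Lat_compl_open[OF t]
  have Ah: "?A holomorphic_on ?B" by (rule wpA_holo_ball[OF t])
  have A2h: "deriv (deriv ?A) holomorphic_on ?B" by (intro holomorphic_deriv Ah open_ball)
  have g: "g holomorphic_on (- Lat \<tau>)" unfolding g_def
    by (intro holomorphic_intros holomorphic_deriv wp_holo t op)
  have P1: "?P (z + 1) = ?P z" "?P (z + \<tau>) = ?P z" for z by (simp_all add: wp_period1 wp_period_tau t)
  have D1: "deriv ?P (z + 1) = deriv ?P z" "deriv ?P (z + \<tau>) = deriv ?P z" for z
    by (rule deriv_period, rule P1)+
  have D2: "deriv (deriv ?P) (z + 1) = deriv (deriv ?P) z" "deriv (deriv ?P) (z + \<tau>) = deriv (deriv ?P) z" for z
    by (rule deriv_period, rule D1)+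
  obtain c where c: "((\<lambda>z. csq z * (?A z - ?A 0)) \<longlongrightarrow> c) (at 0)"
    using even_csq_limit[OF Ah open_ball] t wpA_minus by auto
  have lA: "(?A \<longlongrightarrow> ?A 0) (at 0)" "(deriv (deriv ?A) \<longlongrightarrow> deriv (deriv ?A) 0) (at 0)"
    using t holomorphic_on_imp_continuous_on[OF Ah] holomorphic_on_imp_continuous_on[OF A2h]
    by (auto simp: continuous_on_eq_continuous_at isCont_def)
  define l where "l = - 12 * p2 * c + deriv (deriv ?A) 0 - 6 * p2 * (?A 0)\<^sup>2 + K * ?A 0"
  have "((\<lambda>z. - 12 * p2 * (csq z * (?A z - ?A 0)) + deriv (deriv ?A) z - 6 * p2 * (?A z)\<^sup>2 + K * ?A z) \<longlongrightarrow> l) (at 0)"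
    unfolding l_def by (intro tendsto_intros c lA)
  moreover have "eventually (\<lambda>z. - 12 * p2 * (csq z * (?A z - ?A 0)) + deriv (deriv ?A) z - 6 * p2 * (?A z)\<^sup>2 + K * ?A z = g z) (at 0)"
  proof -
    have "eventually (\<lambda>z. z \<noteq> 0 \<and> z \<in> ?B) (at (0::complex))"
      using t by (intro eventually_conj eventually_at_in_open' eventually_neq_at_within) auto
    thus ?thesis
    proof eventually_elim
      case (elim z)
      let ?C = "?B - {0}"
      have oC: "open ?C" by auto
      have dP: "(?P has_field_derivative csq1 w + deriv ?A w) (at w)" if "w \<in> ?C" for w
        unfolding wp_def[abs_def]
        by (intro derivative_intros csq_deriv holomorphic_derivI[OF Ah]) (use that ball_notin_Ints in auto)
      have "((\<lambda>w. csq1 w + deriv ?A w) has_field_derivative p2 * (6 * (csq z)\<^sup>2 - 4 * csq z) + deriv (deriv ?A) z) (at z)"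
        unfolding p2_def
        by (intro derivative_intros csq1_deriv holomorphic_derivI[OF holomorphic_deriv[OF Ah]]) (use elim ball_notin_Ints in auto)
      hence "(deriv ?P has_field_derivative p2 * (6 * (csq z)\<^sup>2 - 4 * csq z) + deriv (deriv ?A) z) (at z)"
        by (rule has_field_derivative_transform_within_open[OF _ oC]) (use elim dP DERIV_imp_deriv in force)+
      hence "deriv (deriv ?P) z = p2 * (6 * (csq z)\<^sup>2 - 4 * csq z) + deriv (deriv ?A) z" by (rule DERIV_imp_deriv)
      thus ?case by (simp add: g_def wp_def K_def power2_eq_square algebra_simps)
    qed
  qed
  ultimately have lim: "(g \<longlongrightarrow> l) (at 0)" by (rule Lim_transform_eventually)
  have "g z = l" if "z \<notin> Lat \<tau>" for z
    by (rule lattice_liouville[OF t g _ _ lim that]) (simp_all add: g_def P1 D2)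
  hence "deriv (deriv ?P) z = 6 * (of_real pi)\<^sup>2 * (?P z)\<^sup>2 + (-K) * ?P z + l" if "z \<notin> Lat \<tau>" for z
    using that by (simp add: g_def p2_def algebra_simps)
  thus thesis using that by blast
qed

section \<open>Half periods and their values\<close>

lemma Lat_coord:
  assumes t: "Im \<tau> > 0"
  shows "of_real a * \<tau> + of_real b \<in> Lat \<tau> \<longleftrightarrow> a \<in> \<int> \<and> b \<in> \<int>"
proof
  assume "of_real a * \<tau> + of_real b \<in> Lat \<tau>"
  then obtain m n where e: "of_real a * \<tau> + of_real b = of_int m * \<tau> + of_int n" by (auto simp: Lat_def)
  have a: "a = of_int m" using arg_cong[OF e, of Im] t by simp
  have "b = of_int n" using arg_cong[OF e, of Re] a by simp
  thus "a \<in> \<int> \<and> b \<in> \<int>" using a by simp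
next
  assume "a \<in> \<int> \<and> b \<in> \<int>"
  then obtain m n where "a = of_int m" "b = of_int n" by (auto elim!: Ints_cases)
  thus "of_real a * \<tau> + of_real b \<in> Lat \<tau>" using Lat_I[of m \<tau> n] by simp
qed

lemma Lat_coord_unique:
  assumes t: "Im \<tau> > 0"
  shows "of_int a * \<tau> + of_int b = of_int c * \<tau> + of_int d \<longleftrightarrow> a = c \<and> b = d"
proof
  assume e: "of_int a * \<tau> + of_int b = of_int c * \<tau> + of_int d"
  have a: "a = c" using arg_cong[OF e, of Im] t by simp
  thus "a = c \<and> b = d" using arg_cong[OF e, of Re] a by simp
qed simp

lemma half_not_Int: "(1/2::real) \<notin> \<int>"
proof
  assume "(1/2::real) \<in> \<int>"
  then obtain n where "1/2 = real_of_int n" by (auto elim: Ints_cases)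
  hence "real_of_int 1 = real_of_int (2 * n)" by simp
  hence "1 = 2 * n" by (simp only: of_int_eq_iff)
  thus False by presburger
qed

definition we1 where "we1 \<tau> = wp \<tau> (1/2)"
definition we2 where "we2 \<tau> = wp \<tau> (\<tau>/2)"
definition we3 where "we3 \<tau> = wp \<tau> ((1+\<tau>)/2)"

lemma halves_notin_Lat:
  assumes t: "Im \<tau> > 0" shows "1/2 \<notin> Lat \<tau>" "\<tau>/2 \<notin> Lat \<tau>" "(1+\<tau>)/2 \<notin> Lat \<tau>"
proof -
  have e: "1/2 = of_real 0 * \<tau> + of_real (1/2)" "\<tau>/2 = of_real (1/2) * \<tau> + of_real 0"
    "(1+\<tau>)/2 = of_real (1/2) * \<tau> + of_real (1/2)" by (simp_all add: field_simps)
  show "1/2 \<notin> Lat \<tau>" "\<tau>/2 \<notin> Lat \<tau>" "(1+\<tau>)/2 \<notin> Lat \<tau>"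
    unfolding e Lat_coord[OF t] using half_not_Int by auto
qed

lemma two_halves_Lat: "2 * (1/2) \<in> Lat \<tau>" "2 * (\<tau>/2) \<in> Lat \<tau>" "2 * ((1+\<tau>)/2) \<in> Lat \<tau>"
proof -
  have e: "2 * ((1+\<tau>)/2) = 1 + \<tau>" by simp
  show "2 * ((1+\<tau>)/2) \<in> Lat \<tau>" unfolding e by (rule Lat_add) simp_all
qed simp_all

lemma wp_half_even: "Im \<tau> > 0 \<Longrightarrow> 2 * h \<in> Lat \<tau> \<Longrightarrow> wp \<tau> (- z + h) = wp \<tau> (z + h)"
  using wp_lattice[of \<tau> "2*h" "-(z + - h + 2 * h) + 0"] wp_minus[of \<tau> "z + h"] by (simp add: algebra_simps)

lemma wp_half_deriv:
  assumes t: "Im \<tau> > 0" and h: "h \<notin> Lat \<tau>" "2 * h \<in> Lat \<tau>" shows "deriv (wp \<tau>) h = 0"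
proof -
  have "(wp \<tau> \<circ> (\<lambda>z. z + h)) field_differentiable (at 0)"
    by (intro field_differentiable_compose) (use wp_field_diff[OF t h(1)] in \<open>auto intro!: derivative_intros\<close>)
  hence "deriv (\<lambda>z. wp \<tau> (z + h)) 0 = 0"
    by (intro even_deriv_0 wp_half_even t h) (simp add: o_def)
  thus ?thesis using deriv_shift[of "wp \<tau>" 0 h] by simp
qed

lemma tendsto_not_at_infinity: "(f \<longlongrightarrow> c) F \<Longrightarrow> F \<noteq> bot \<Longrightarrow> filterlim f at_infinity F \<Longrightarrow> False"
  using not_tendsto_and_filterlim_at_infinity by blast

lemma eventually_pole_neq: "filterlim f at_infinity F \<Longrightarrow> eventually (\<lambda>z. f z \<noteq> (c::complex)) F"
proof -
  assume "filterlim f at_infinity F"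
  hence "eventually (\<lambda>z. norm (f z) \<ge> norm c + 1) F"
    by (subst (asm) filterlim_at_infinity[OF order_refl[of 0]]) (auto simp: add_nonneg_pos)
  thus ?thesis by eventually_elim auto
qed

text \<open>Since 2 h is a period of P, the product (P(z) - P(h)) (P(z + h) - P(h)) has the periods
  1 and h, and its second factor, even with a double zero at 0, cancels the pole of the first. So
  the product is constant; a solution p of P(p) = P(h) outside \<open>Lat h\<close> would make it 0,
  and P would be constant.\<close>

lemma half_distinct:
  assumes t: "Im \<tau> > 0" and h: "h \<notin> Lat \<tau>" "2 * h \<in> Lat \<tau>" "Im h > 0"
    and sub: "Lat \<tau> \<subseteq> Lat h" and p: "p \<notin> Lat h"
  shows "wp \<tau> p \<noteq> wp \<tau> h"
proof
  assume ph: "wp \<tau> p = wp \<tau> h"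
  define B where "B = (\<lambda>z. wp \<tau> (z + h))"
  define g where "g = (\<lambda>z. (wp \<tau> z - wp \<tau> h) * (B z - B 0))"
  have B0: "B 0 = wp \<tau> h" by (simp add: B_def)
  have nL: "z \<notin> Lat \<tau>" "z + h \<notin> Lat \<tau>" if "z \<notin> Lat h" for z
    using that sub Lat_cancel[of h h z] by auto
  have Bev: "B (-z) = B z" for z unfolding B_def by (rule wp_half_even[OF t h(2)])
  define S where "S = (\<lambda>z. z + h) -` (- Lat \<tau>)"
  have S: "open S" "0 \<in> S"
  proof -
    show "open S" unfolding S_def by (rule open_vimage[OF Lat_compl_open[OF t]]) (intro continuous_intros)
    show "0 \<in> S" unfolding S_def using h by simp
  qed
  have BS: "B holomorphic_on S" unfolding B_def
    by (rule holomorphic_on_compose_gen[OF _ wp_holo[OF t], unfolded o_def])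
       (auto simp: S_def intro!: holomorphic_intros)
  have gh: "g holomorphic_on (- Lat h)" unfolding g_def
    by (intro holomorphic_intros holomorphic_on_subset[OF wp_holo[OF t]] holomorphic_on_subset[OF BS])
       (use nL in \<open>auto simp: S_def\<close>)
  have Bh: "B (z + h) = wp \<tau> z" for z
    using wp_lattice[OF t h(2), of z] by (simp add: B_def add.assoc)
  have g1: "g (z + 1) = g z" for z
  proof -
    have "wp \<tau> (z + 1 + h) = wp \<tau> (z + h)" using wp_period1[of \<tau> "z + h"] by (simp add: ac_simps)
    thus ?thesis by (simp add: g_def B_def wp_period1)
  qed
  have gt: "g (z + h) = g z" for z
    by (simp add: g_def Bh B0) (simp add: B_def)
  obtain c where c: "((\<lambda>z. csq z * (B z - B 0)) \<longlongrightarrow> c) (at 0)"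
    using even_csq_limit[OF BS S Bev] .
  have lA: "(wpA \<tau> \<longlongrightarrow> wpA \<tau> 0) (at 0)"
    using t holomorphic_on_imp_continuous_on[OF wpA_holo_ball[OF t]]
    by (auto simp: continuous_on_eq_continuous_at isCont_def)
  have lB: "(B \<longlongrightarrow> B 0) (at 0)"
    using S holomorphic_on_imp_continuous_on[OF BS] by (auto simp: continuous_on_eq_continuous_at isCont_def)
  have "((\<lambda>z. csq z * (B z - B 0) + (wpA \<tau> z - wp \<tau> h) * (B z - B 0)) \<longlongrightarrow> c + (wpA \<tau> 0 - wp \<tau> h) * (B 0 - B 0)) (at 0)"
    by (intro tendsto_intros c lA lB)
  hence lim: "(g \<longlongrightarrow> c) (at 0)" by (simp add: g_def[abs_def] wp_def algebra_simps)
  have gc: "g z = c" if "z \<notin> Lat h" for z by (rule lattice_liouville[OF h(3) gh g1 gt lim that])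
  have c0: "c = 0" using gc[OF p] ph by (simp add: g_def)
  have "eventually (\<lambda>z. B z = B 0) (at 0)"
    using eventually_pole_neq[OF wp_pole[OF t], of "wp \<tau> h"] eventually_at0_notin_Lat[OF h(3)]
  proof eventually_elim
    case (elim z)
    thus ?case using gc[OF elim(2)] c0 by (simp add: g_def)
  qed
  then obtain d where d: "d > 0" "\<And>z. z \<noteq> 0 \<Longrightarrow> dist z 0 < d \<Longrightarrow> B z = B 0"
    by (auto simp: eventually_at)
  obtain e where e: "e > 0" "ball h e \<subseteq> - Lat \<tau>"
    using Lat_compl_open[OF t] h(1) open_contains_ball by blast
  have const: "wp \<tau> z = wp \<tau> h" if z: "z \<notin> Lat \<tau>" for z
  proof (rule analytic_continuation_open[where s="ball h (min d e)" and s'="- Lat \<tau>" and f="wp \<tau>" and g="\<lambda>_. wp \<tau> h"])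
    fix w assume "w \<in> ball h (min d e)"
    hence "dist (w - h) 0 < d" by (simp add: dist_norm norm_minus_commute)
    thus "wp \<tau> w = wp \<tau> h" using d(2)[of "w - h"] by (cases "w = h") (auto simp: B_def)
  qed (use d e z t in \<open>auto simp: Lat_compl_open Lat_compl_connected wp_holo\<close>)
  have "eventually (\<lambda>z. False) (at (0::complex))"
    using eventually_pole_neq[OF wp_pole[OF t], of "wp \<tau> h"] eventually_at0_notin_Lat[OF t]
    by eventually_elim (use const in auto)
  thus False by simp
qed

lemma we_distinct:
  assumes t: "Im \<tau> > 0"
  shows "we1 \<tau> \<noteq> we2 \<tau>" "we3 \<tau> \<noteq> we2 \<tau>" "we1 \<tau> \<noteq> we3 \<tau>"
proof -
  have sub1: "Lat \<tau> \<subseteq> Lat (\<tau>/2)"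
  proof
    fix x assume "x \<in> Lat \<tau>"
    then obtain m n where "x = of_int m * \<tau> + of_int n" by (auto simp: Lat_def)
    hence "x = of_int (2*m) * (\<tau>/2) + of_int n" by simp
    thus "x \<in> Lat (\<tau>/2)" by (metis Lat_I)
  qed
  have sub2: "Lat \<tau> \<subseteq> Lat ((1+\<tau>)/2)"
  proof
    fix x assume "x \<in> Lat \<tau>"
    then obtain m n where "x = of_int m * \<tau> + of_int n" by (auto simp: Lat_def)
    hence "x = of_int (2*m) * ((1+\<tau>)/2) + of_int (n-m)" by (simp add: field_simps)
    thus "x \<in> Lat ((1+\<tau>)/2)" by (metis Lat_I)
  qed
  have t2: "Im (\<tau>/2) > 0" "Im ((1+\<tau>)/2) > 0" using t by auto
  note l = two_halves_Lat(2,3)[of \<tau>]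
  have e: "1/2 = of_real 0 * (\<tau>/2) + of_real (1/2)" "(1+\<tau>)/2 = of_real 1 * (\<tau>/2) + of_real (1/2)"
    "1/2 = of_real 0 * ((1+\<tau>)/2) + of_real (1/2)" by (simp_all add: field_simps)
  have n: "1/2 \<notin> Lat (\<tau>/2)" "(1+\<tau>)/2 \<notin> Lat (\<tau>/2)" "1/2 \<notin> Lat ((1+\<tau>)/2)"
    using Lat_coord[OF t2(1), of 0 "1/2", folded e(1)] Lat_coord[OF t2(1), of 1 "1/2", folded e(2)]
      Lat_coord[OF t2(2), of 0 "1/2", folded e(3)] half_not_Int
    by blast+
  note hl = halves_notin_Lat[OF t]
  show "we1 \<tau> \<noteq> we2 \<tau>" "we3 \<tau> \<noteq> we2 \<tau>" "we1 \<tau> \<noteq> we3 \<tau>"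
    unfolding we1_def we2_def we3_def
    using half_distinct[OF t hl(2) l(1) t2(1) sub1] half_distinct[OF t hl(3) l(2) t2(2) sub2] n by blast+
qed

text \<open>The first integral, P'^2 minus a cubic in P, is constant, and P' vanishes at the half
  periods by evenness. So e1, e2, e3 are the roots of that cubic, and as they are distinct, divided
  differences give its coefficients.\<close>

lemma wp_ODE_we:
  assumes t: "Im \<tau> > 0" and z: "z \<notin> Lat \<tau>"
  shows "deriv (deriv (wp \<tau>)) z = (of_real pi)\<^sup>2 * (6 * (wp \<tau> z)\<^sup>2 - 4 * (we1 \<tau> + we2 \<tau> + we3 \<tau>) * wp \<tau> z
     + 2 * (we1 \<tau> * we2 \<tau> + we1 \<tau> * we3 \<tau> + we2 \<tau> * we3 \<tau>))"
proof -
  define p2 where "p2 = (of_real pi :: complex)\<^sup>2"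
  obtain \<alpha> \<beta> where ab: "\<And>z. z \<notin> Lat \<tau> \<Longrightarrow> deriv (deriv (wp \<tau>)) z = 6 * p2 * (wp \<tau> z)\<^sup>2 + \<alpha> * wp \<tau> z + \<beta>"
    using wp_ODE[OF t] unfolding p2_def by blast
  let ?P = "wp \<tau>" and ?P' = "deriv (wp \<tau>)"
  define F where "F = (\<lambda>z. (?P' z)\<^sup>2 - (4 * p2 * (?P z)^3 + \<alpha> * (?P z)\<^sup>2 + 2 * \<beta> * ?P z))"
  note op = Lat_compl_open[OF t]
  have dP: "(?P has_field_derivative ?P' w) (at w)" "(?P' has_field_derivative deriv ?P' w) (at w)" if "w \<notin> Lat \<tau>" for w
    using that wp_holo[OF t] holomorphic_deriv[OF wp_holo[OF t] op] op by (auto intro: holomorphic_derivI)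
  have "(F has_field_derivative 0) (at w)" if w: "w \<notin> Lat \<tau>" for w
  proof -
    have "(F has_field_derivative (2 * ?P' w * deriv ?P' w) - (4 * p2 * (3 * (?P w)\<^sup>2 * ?P' w) + \<alpha> * (2 * ?P w * ?P' w) + 2 * \<beta> * ?P' w)) (at w)"
      unfolding F_def
      by (rule derivative_eq_intros dP[OF w] refl)+ (simp add: power2_eq_square algebra_simps)
    moreover have "(2 * ?P' w * deriv ?P' w) - (4 * p2 * (3 * (?P w)\<^sup>2 * ?P' w) + \<alpha> * (2 * ?P w * ?P' w) + 2 * \<beta> * ?P' w) = 0"
      unfolding ab[OF w] by (simp add: algebra_simps)
    ultimately show ?thesis by simp
  qed
  hence "\<forall>w\<in>- Lat \<tau> - {}. (F has_field_derivative 0) (at w)" by auto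
  moreover from this have "continuous_on (- Lat \<tau>) F"
    by (intro DERIV_continuous_on) (auto intro: has_field_derivative_at_within)
  ultimately obtain c where c: "\<And>w. w \<in> - Lat \<tau> \<Longrightarrow> F w = c"
    using DERIV_zero_connected_constant[OF Lat_compl_connected op finite.emptyI] by metis
  have cub: "4 * p2 * (?P h)^3 + \<alpha> * (?P h)\<^sup>2 + 2 * \<beta> * ?P h + c = 0" if "h \<notin> Lat \<tau>" "2 * h \<in> Lat \<tau>" for h
  proof -
    have e: "c = - (4 * p2 * (?P h)^3 + \<alpha> * (?P h)\<^sup>2 + 2 * \<beta> * ?P h)"
      using c[of h] that wp_half_deriv[OF t that] by (simp add: F_def)
    show ?thesis unfolding e by (rule add.right_inverse)
  qed
  note hl = halves_notin_Lat[OF t]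
  note l = two_halves_Lat[of \<tau>]
  define x y w where "x = we1 \<tau>" and "y = we2 \<tau>" and "w = we3 \<tau>"
  have q: "4 * p2 * x^3 + \<alpha> * x\<^sup>2 + 2 * \<beta> * x + c = 0" "4 * p2 * y^3 + \<alpha> * y\<^sup>2 + 2 * \<beta> * y + c = 0"
     "4 * p2 * w^3 + \<alpha> * w\<^sup>2 + 2 * \<beta> * w + c = 0"
    using cub[OF hl(1) l(1)] cub[OF hl(2) l(2)] cub[OF hl(3) l(3)] by (simp_all add: x_def y_def w_def we1_def we2_def we3_def)
  have ne: "x \<noteq> y" "w \<noteq> y" "x \<noteq> w" using we_distinct[OF t] by (simp_all add: x_def y_def w_def)
  have cd: "(r - s) * (4 * p2 * (r\<^sup>2 + r * s + s\<^sup>2) + \<alpha> * (r + s) + 2 * \<beta>) =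
      (4 * p2 * r^3 + \<alpha> * r\<^sup>2 + 2 * \<beta> * r + c) - (4 * p2 * s^3 + \<alpha> * s\<^sup>2 + 2 * \<beta> * s + c)" for r s
    by (simp add: algebra_simps power2_eq_square power3_eq_cube)
  have 1: "4 * p2 * (x\<^sup>2 + x*y + y\<^sup>2) + \<alpha> * (x + y) + 2 * \<beta> = 0" using cd[of x y] ne unfolding q by simp
  have 2: "4 * p2 * (w\<^sup>2 + w*y + y\<^sup>2) + \<alpha> * (w + y) + 2 * \<beta> = 0" using cd[of w y] ne unfolding q by simp
  have "(x - w) * (4 * p2 * (x + y + w) + \<alpha>) = (4 * p2 * (x\<^sup>2 + x*y + y\<^sup>2) + \<alpha> * (x + y) + 2 * \<beta>)
     - (4 * p2 * (w\<^sup>2 + w*y + y\<^sup>2) + \<alpha> * (w + y) + 2 * \<beta>)"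
    by (simp add: algebra_simps power2_eq_square)
  also have "\<dots> = 0" unfolding 1 2 by simp
  finally have "4 * p2 * (x + y + w) + \<alpha> = 0" using ne by simp
  hence a: "\<alpha> = - 4 * p2 * (x + y + w)" by (simp add: add_eq_0_iff)
  have "2 * (\<beta> - 2 * p2 * (x*y + x*w + y*w)) = 0" using 1 unfolding a by (simp add: algebra_simps power2_eq_square)
  hence b: "\<beta> = 2 * p2 * (x*y + x*w + y*w)" by simp
  show ?thesis unfolding ab[OF z] a b p2_def[symmetric] x_def[symmetric] y_def[symmetric] w_def[symmetric]
    by (simp add: algebra_simps)
qed

section \<open>Uniqueness for the initial value problem\<close>

text \<open>The difference d satisfies the linear equation d'' = d G with G holomorphic, so by the
  Leibniz rule all derivatives of d at 0 vanish; connectedness of U does the rest.\<close>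

lemma ODE_unique:
  assumes U: "open U" "connected U" "0 \<in> U" and f: "f holomorphic_on U" and g: "g holomorphic_on U"
    and f2: "\<And>u. u \<in> U \<Longrightarrow> deriv (deriv f) u = a * (f u)\<^sup>2 + b * f u + c"
    and g2: "\<And>u. u \<in> U \<Longrightarrow> deriv (deriv g) u = a * (g u)\<^sup>2 + b * g u + (c::complex)"
    and e0: "f 0 = g 0" "deriv f 0 = deriv g 0" and u: "u \<in> U"
  shows "f u = g u"
proof -
  define d where "d = (\<lambda>u. f u - g u)"
  define G where "G = (\<lambda>u. a * (f u + g u) + b)"
  have dh: "d holomorphic_on U" and Gh: "G holomorphic_on U"
    unfolding d_def G_def by (intro holomorphic_intros f g)+
  have d1: "deriv d w = deriv f w - deriv g w" if "w \<in> U" for w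
    unfolding d_def by (intro deriv_diff) (use f g U that in \<open>auto simp: holomorphic_on_imp_differentiable_at\<close>)
  have f'h: "deriv f holomorphic_on U" "deriv g holomorphic_on U" using f g U by (auto intro: holomorphic_deriv)
  have d2: "deriv (deriv d) w = d w * G w" if w: "w \<in> U" for w
  proof -
    have "deriv (deriv d) w = deriv (\<lambda>w. deriv f w - deriv g w) w"
      by (rule complex_derivative_transform_within_open[OF holomorphic_deriv[OF dh U(1)] _ U(1) w d1])
         (intro holomorphic_intros f'h)
    also have "\<dots> = deriv (deriv f) w - deriv (deriv g) w"
      by (intro deriv_diff) (use f'h U that in \<open>auto simp: holomorphic_on_imp_differentiable_at\<close>)
    also have "\<dots> = d w * G w" unfolding f2[OF w] g2[OF w] d_def G_def by (simp add: algebra_simps power2_eq_square)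
    finally show ?thesis .
  qed
  have d2h: "deriv (deriv d) holomorphic_on U" by (intro holomorphic_deriv dh U)
  have z: "(deriv ^^ n) d 0 = 0" for n
  proof (induction n rule: less_induct)
    case (less n)
    consider "n = 0" | "n = 1" | m where "n = Suc (Suc m)" by (metis One_nat_def not0_implies_Suc)
    thus ?case
    proof cases
      case (3 m)
      have "(deriv ^^ n) d 0 = (deriv ^^ m) (deriv (deriv d)) 0"
        by (simp only: 3 funpow_Suc_right o_def)
      also have "\<dots> = (deriv ^^ m) (\<lambda>w. d w * G w) 0"
        by (rule higher_deriv_transform_within_open[OF d2h _ U(1,3) d2]) (intro holomorphic_intros dh Gh)
      also have "\<dots> = (\<Sum>i = 0..m. of_nat (m choose i) * (deriv ^^ i) d 0 * (deriv ^^ (m-i)) G 0)"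
        by (rule higher_deriv_mult[OF dh Gh U(1,3)])
      also have "\<dots> = 0" by (intro sum.neutral) (use less 3 in auto)
      finally show ?thesis .
    qed (use e0 d1[OF U(3)] in \<open>auto simp: d_def\<close>)
  qed
  have "d u = 0" by (rule holomorphic_fun_eq_0_on_connected[OF dh U(1,2) z U(3) u])
  thus ?thesis by (simp add: d_def)
qed

section \<open>The modular function lambda\<close>

definition lamr where "lamr \<tau> = (we3 \<tau> - we2 \<tau>) / (we1 \<tau> - we2 \<tau>)"

text \<open>Centred at the half period \<tau>/2, where P - e2 has a double zero, so that value and
  derivative at 0 both vanish. With s^2 = e1 - e2 the values e2, e1, e3 become 0, 1 and
  lambda.\<close>

definition vsc :: "complex \<Rightarrow> complex \<Rightarrow> complex \<Rightarrow> complex" where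
  "vsc \<tau> s u = (wp \<tau> (u / s + \<tau> / 2) - we2 \<tau>) / s\<^sup>2"

definition vpoles :: "complex \<Rightarrow> complex \<Rightarrow> complex set" where
  "vpoles \<tau> s = (\<lambda>l. s * (\<tau>/2 + l)) ` Lat \<tau>"

lemma vpoles_iff: "s \<noteq> 0 \<Longrightarrow> u \<in> vpoles \<tau> s \<longleftrightarrow> u / s + \<tau>/2 \<in> Lat \<tau>"
proof
  assume s: "s \<noteq> 0" and "u \<in> vpoles \<tau> s"
  then obtain l where l: "l \<in> Lat \<tau>" "u = s * (\<tau>/2 + l)" by (auto simp: vpoles_def)
  hence "u / s + \<tau>/2 = l + \<tau>" using s by (simp add: field_simps)
  thus "u / s + \<tau>/2 \<in> Lat \<tau>" using l by simp
next
  assume s: "s \<noteq> 0" and l: "u / s + \<tau>/2 \<in> Lat \<tau>"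
  have "\<tau>/2 + (q + \<tau>/2 - \<tau>) = q" for q by (simp add: field_simps)
  hence "u = s * (\<tau>/2 + (u / s + \<tau>/2 - \<tau>))" by (simp only: nonzero_mult_div_cancel_left times_divide_eq_right s not_False_eq_True)
  thus "u \<in> vpoles \<tau> s" unfolding vpoles_def
    by (rule image_eqI[OF _ Lat_diff[OF l Lat_simps(3)]])
qed

lemma vpoles_closed: "Im \<tau> > 0 \<Longrightarrow> s \<noteq> 0 \<Longrightarrow> closed (vpoles \<tau> s)"
  unfolding vpoles_def by (rule Lat_discrete)

lemma vpoles_countable: "countable (vpoles \<tau> s)"
  unfolding vpoles_def by (intro countable_image Lat_countable)

lemma vsc_0: "Im \<tau> > 0 \<Longrightarrow> s \<noteq> 0 \<Longrightarrow> vsc \<tau> s 0 = 0" by (simp add: vsc_def we2_def)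

lemma vsc_deriv:
  assumes t: "Im \<tau> > 0" and s: "s \<noteq> 0" and u: "u \<notin> vpoles \<tau> s"
  shows "(vsc \<tau> s has_field_derivative deriv (wp \<tau>) (u/s + \<tau>/2) / s^3) (at u)"
    "((\<lambda>u. deriv (wp \<tau>) (u/s + \<tau>/2) / s^3) has_field_derivative deriv (deriv (wp \<tau>)) (u/s + \<tau>/2) / s^4) (at u)"
proof -
  have n: "u/s + \<tau>/2 \<in> - Lat \<tau>" using u vpoles_iff[OF s] by auto
  note op = Lat_compl_open[OF t]
  have d: "((\<lambda>u. u/s + \<tau>/2) has_field_derivative 1/s) (at u)" by (auto intro!: derivative_eq_intros simp: s)
  have 1: "((\<lambda>u. wp \<tau> (u/s + \<tau>/2)) has_field_derivative deriv (wp \<tau>) (u/s + \<tau>/2) * (1/s)) (at u)"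
    by (rule DERIV_chain2[OF holomorphic_derivI[OF wp_holo[OF t] op n] d])
  show "(vsc \<tau> s has_field_derivative deriv (wp \<tau>) (u/s + \<tau>/2) / s^3) (at u)"
    unfolding vsc_def[abs_def]
    by (rule DERIV_cong[OF DERIV_cdivide[OF DERIV_diff[OF 1 DERIV_const]]]) (use s in \<open>simp add: power3_eq_cube power2_eq_square\<close>)
  have 2: "((\<lambda>u. deriv (wp \<tau>) (u/s + \<tau>/2)) has_field_derivative deriv (deriv (wp \<tau>)) (u/s + \<tau>/2) * (1/s)) (at u)"
    by (rule DERIV_chain2[OF holomorphic_derivI[OF holomorphic_deriv[OF wp_holo[OF t] op] op n] d])
  show "((\<lambda>u. deriv (wp \<tau>) (u/s + \<tau>/2) / s^3) has_field_derivative deriv (deriv (wp \<tau>)) (u/s + \<tau>/2) / s^4) (at u)"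
    by (rule DERIV_cong[OF DERIV_cdivide[OF 2]]) (use s in \<open>simp add: power3_eq_cube power4_eq_xxxx\<close>)
qed

lemma vsc_holo: "Im \<tau> > 0 \<Longrightarrow> s \<noteq> 0 \<Longrightarrow> vsc \<tau> s holomorphic_on (- vpoles \<tau> s)"
  using vsc_deriv(1) vpoles_closed by (auto simp: holomorphic_on_open open_Compl)

lemma vsc_deriv0:
  assumes t: "Im \<tau> > 0" and s: "s \<noteq> 0" shows "0 \<notin> vpoles \<tau> s" "deriv (vsc \<tau> s) 0 = 0"
proof -
  show 0: "0 \<notin> vpoles \<tau> s" using vpoles_iff[OF s, of 0] halves_notin_Lat[OF t] by simp
  show "deriv (vsc \<tau> s) 0 = 0"
    using DERIV_imp_deriv[OF vsc_deriv(1)[OF t s 0]] wp_half_deriv[OF t halves_notin_Lat(2)[OF t]] by simp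
qed

lemma vsc_ODE:
  assumes t: "Im \<tau> > 0" and s: "s\<^sup>2 = we1 \<tau> - we2 \<tau>" and u: "u \<notin> vpoles \<tau> s"
  shows "deriv (deriv (vsc \<tau> s)) u = 6 * (of_real pi)\<^sup>2 * (vsc \<tau> s u)\<^sup>2
     + (- 4 * (of_real pi)\<^sup>2 * (1 + lamr \<tau>)) * vsc \<tau> s u + 2 * (of_real pi)\<^sup>2 * lamr \<tau>"
proof -
  define p2 where "p2 = (of_real pi :: complex)\<^sup>2"
  have s0: "s \<noteq> 0" using s we_distinct[OF t] by auto
  have n: "u/s + \<tau>/2 \<notin> Lat \<tau>" using u vpoles_iff[OF s0] by auto
  have "deriv (deriv (vsc \<tau> s)) u = deriv (\<lambda>u. deriv (wp \<tau>) (u/s + \<tau>/2) / s^3) u"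
  proof (rule complex_derivative_transform_within_open[where s = "- vpoles \<tau> s"])
    show op: "open (- vpoles \<tau> s)" using vpoles_closed[OF t s0] by auto
    show "deriv (vsc \<tau> s) holomorphic_on - vpoles \<tau> s" by (intro holomorphic_deriv vsc_holo t s0 op)
    show "(\<lambda>u. deriv (wp \<tau>) (u/s + \<tau>/2) / s^3) holomorphic_on - vpoles \<tau> s"
      using vsc_deriv(2)[OF t s0] op by (auto simp: holomorphic_on_open)
  qed (use u DERIV_imp_deriv[OF vsc_deriv(1)[OF t s0]] in auto)
  also have "\<dots> = deriv (deriv (wp \<tau>)) (u/s + \<tau>/2) / s^4" by (rule DERIV_imp_deriv[OF vsc_deriv(2)[OF t s0 u]])
  finally have d: "deriv (deriv (vsc \<tau> s)) u = deriv (deriv (wp \<tau>)) (u/s + \<tau>/2) / s^4" .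
  define v where "v = vsc \<tau> s u"
  define L where "L = lamr \<tau>"
  define y where "y = we2 \<tau>"
  have w: "wp \<tau> (u/s + \<tau>/2) = s\<^sup>2 * v + y" using s0 by (simp add: v_def vsc_def y_def)
  have e1: "we1 \<tau> = s\<^sup>2 + y" using s by (simp add: y_def algebra_simps)
  have e3: "we3 \<tau> = L * s\<^sup>2 + y" using s0 by (simp add: L_def lamr_def y_def s[symmetric])
  show ?thesis
    unfolding d wp_ODE_we[OF t n] v_def[symmetric] L_def[symmetric] w e1 e3 y_def[symmetric] p2_def[symmetric]
    using s0 by (simp add: field_simps power2_eq_square power4_eq_xxxx)
qed

lemma vsc_pole:
  assumes t: "Im \<tau> > 0" and s: "s \<noteq> 0" and p: "p \<in> vpoles \<tau> s"
  shows "filterlim (vsc \<tau> s) at_infinity (at p)" "eventually (\<lambda>u. u \<notin> vpoles \<tau> s) (at p)"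
proof -
  define k where "k = p/s + \<tau>/2"
  have k: "k \<in> Lat \<tau>" using p vpoles_iff[OF s] by (simp add: k_def)
  have "((\<lambda>u. u/s + \<tau>/2 - k) \<longlongrightarrow> p/s + \<tau>/2 - k) (at p)" by (intro tendsto_intros s)
  hence f: "filterlim (\<lambda>u. u/s + \<tau>/2 - k) (at 0) (at p)"
    unfolding filterlim_at using s by (auto simp: k_def eventually_at_filter)
  have "filterlim (\<lambda>u. wp \<tau> (u/s + \<tau>/2 - k)) at_infinity (at p)"
    by (rule filterlim_compose[OF wp_pole[OF t] f])
  moreover have "wp \<tau> (u/s + \<tau>/2 - k) = wp \<tau> (u/s + \<tau>/2)" for u
    using wp_lattice[OF t Lat_minus[OF k], of "u/s + \<tau>/2"] by simp
  ultimately have "filterlim (\<lambda>u. wp \<tau> (u/s + \<tau>/2)) at_infinity (at p)" by simp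
  from tendsto_mult_filterlim_at_infinity[OF tendsto_const[of "1/s\<^sup>2"] _
      tendsto_add_filterlim_at_infinity'[OF this tendsto_const[of "- we2 \<tau>"]]]
  show "filterlim (vsc \<tau> s) at_infinity (at p)" using s by (simp add: vsc_def[abs_def])
  have "eventually (\<lambda>u. u/s + \<tau>/2 - k \<notin> Lat \<tau>) (at p)"
    by (rule eventually_compose_filterlim[OF eventually_at0_notin_Lat[OF t] f])
  thus "eventually (\<lambda>u. u \<notin> vpoles \<tau> s) (at p)"
    by eventually_elim (use k Lat_diff vpoles_iff[OF s] in blast)
qed

lemma csqrt_ex: "\<exists>s. s\<^sup>2 = (z::complex)" using power2_csqrt by blast

text \<open>The rescaled function \<^const>\<open>vsc\<close> solves an initial value problem that depends on the value of
  \<^const>\<open>lamr\<close> only, so equal values force equal lattices of poles up to scaling.\<close>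

lemma lamr_inj_lattice:
  assumes t: "Im \<tau> > 0" and t': "Im \<tau>' > 0" and eq: "lamr \<tau> = lamr \<tau>'"
  obtains s s' where "s\<^sup>2 = we1 \<tau> - we2 \<tau>" "s'\<^sup>2 = we1 \<tau>' - we2 \<tau>'" "vpoles \<tau> s = vpoles \<tau>' s'"
    "\<And>u. u \<notin> vpoles \<tau> s \<Longrightarrow> vsc \<tau> s u = vsc \<tau>' s' u"
proof -
  obtain s s' where s: "s\<^sup>2 = we1 \<tau> - we2 \<tau>" and s': "s'\<^sup>2 = we1 \<tau>' - we2 \<tau>'" using csqrt_ex by metis
  have s0: "s \<noteq> 0" "s' \<noteq> 0" using s s' we_distinct[OF t] we_distinct[OF t'] by auto
  define P P' where "P = vpoles \<tau> s" and "P' = vpoles \<tau>' s'"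
  define U where "U = - (P \<union> P')"
  have cl: "closed P" "closed P'" unfolding P_def P'_def using vpoles_closed t t' s0 by auto
  have U: "open U" "connected U" "0 \<in> U"
    using cl connected_open_diff_countable[OF _ open_UNIV connected_UNIV, of "P \<union> P'"] vpoles_countable vsc_deriv0(1) t t' s0
    by (auto simp: U_def P_def P'_def Compl_eq_Diff_UNIV open_Diff)
  have hol: "vsc \<tau> s holomorphic_on U" "vsc \<tau>' s' holomorphic_on U"
    by (rule holomorphic_on_subset[OF vsc_holo]; use t t' s0 in \<open>auto simp: U_def P_def P'_def\<close>)+
  have agree: "vsc \<tau> s u = vsc \<tau>' s' u" if "u \<in> U" for u
    by (rule ODE_unique[OF U hol vsc_ODE[OF t s] vsc_ODE[OF t' s', folded eq] _ _ that])
       (use t t' s0 in \<open>auto simp: U_def P_def P'_def vsc_0 vsc_deriv0\<close>)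
  \<comment> \<open>A pole of one function at which the other is continuous would contradict their
    agreement nearby; hence the pole sets coincide.\<close>
  have sub: "p \<in> vpoles b sb"
    if p: "p \<in> vpoles a sa" and ab: "Im a > 0" "Im b > 0" "sa \<noteq> 0" "sb \<noteq> 0"
      and ag: "\<And>u. u \<notin> vpoles a sa \<Longrightarrow> u \<notin> vpoles b sb \<Longrightarrow> vsc a sa u = vsc b sb u" for a b sa sb p
  proof (rule ccontr)
    assume np: "p \<notin> vpoles b sb"
    have "open (- vpoles b sb)" using vpoles_closed ab by auto
    hence c: "isCont (vsc b sb) p" and e: "eventually (\<lambda>u. u \<notin> vpoles b sb) (at p)"
      using np holomorphic_on_imp_continuous_on[OF vsc_holo, of b sb] ab
      by (auto simp: continuous_on_eq_continuous_at dest: eventually_at_in_open')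
    have "eventually (\<lambda>u. vsc a sa u = vsc b sb u) (at p)"
      using e vsc_pole(2)[OF ab(1,3) p] by eventually_elim (rule ag)
    hence "filterlim (vsc b sb) at_infinity (at p)"
      using vsc_pole(1)[OF ab(1,3) p] by (rule filterlim_cong[OF refl refl, THEN iffD1])
    thus False using tendsto_not_at_infinity[OF c[unfolded isCont_def] at_neq_bot] by blast
  qed
  have PP: "P = P'" unfolding P_def P'_def
    using sub[of _ \<tau> s \<tau>' s'] sub[of _ \<tau>' s' \<tau> s] t t' s0 agree by (auto simp: U_def P_def P'_def)
  show thesis using that[OF s s'] PP agree by (auto simp: U_def P_def P'_def)
qed

lemma wp_half_values:
  assumes t: "Im \<tau> > 0"
  shows "even m \<Longrightarrow> odd n \<Longrightarrow> wp \<tau> (of_int m * (\<tau>/2) + of_int n / 2) = we1 \<tau>"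
    "odd m \<Longrightarrow> even n \<Longrightarrow> wp \<tau> (of_int m * (\<tau>/2) + of_int n / 2) = we2 \<tau>"
    "odd m \<Longrightarrow> odd n \<Longrightarrow> wp \<tau> (of_int m * (\<tau>/2) + of_int n / 2) = we3 \<tau>"
proof -
  have *: "wp \<tau> (z + (of_int a * \<tau> + of_int b)) = wp \<tau> z" for a b z using wp_lattice[OF t Lat_I] .
  show "wp \<tau> (of_int m * (\<tau>/2) + of_int n / 2) = we1 \<tau>" if e: "even m" "odd n"
  proof -
    obtain a where a: "m = 2 * a" using e(1) by (rule evenE)
    obtain b where b: "n = 2 * b + 1" using e(2) by (rule oddE)
    from a b have "of_int m * (\<tau>/2) + of_int n / 2 = 1/2 + (of_int a * \<tau> + of_int b)" by (simp add: field_simps)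
    thus ?thesis by (simp only: * we1_def)
  qed
  show "wp \<tau> (of_int m * (\<tau>/2) + of_int n / 2) = we2 \<tau>" if e: "odd m" "even n"
  proof -
    obtain a where a: "m = 2 * a + 1" using e(1) by (rule oddE)
    obtain b where b: "n = 2 * b" using e(2) by (rule evenE)
    from a b have "of_int m * (\<tau>/2) + of_int n / 2 = \<tau>/2 + (of_int a * \<tau> + of_int b)" by (simp add: field_simps)
    thus ?thesis by (simp only: * we2_def)
  qed
  show "wp \<tau> (of_int m * (\<tau>/2) + of_int n / 2) = we3 \<tau>" if e: "odd m" "odd n"
  proof -
    obtain a where a: "m = 2 * a + 1" using e(1) by (rule oddE)
    obtain b where b: "n = 2 * b + 1" using e(2) by (rule oddE)
    from a b have "of_int m * (\<tau>/2) + of_int n / 2 = (1+\<tau>)/2 + (of_int a * \<tau> + of_int b)" by (simp add: field_simps)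
    thus ?thesis by (simp only: * we3_def)
  qed
qed

text \<open>For \<mu> = s' / s the pole sets give \<tau>/2 + Lat \<tau> = \<mu> (\<tau>'/2 + Lat
  \<tau>'), and differences show that \<mu> carries one lattice onto the other. The parities of b
  and c express that e2 and e1 correspond to e2 and e1, beyond the equality of the lattices.\<close>

lemma lamr_inj:
  assumes t: "Im \<tau> > 0" and t': "Im \<tau>' > 0" and eq: "lamr \<tau> = lamr \<tau>'"
  obtains a b c d :: int where "even b" "even c" "a * d - b * c = 1"
    "of_int c * \<tau> + of_int d \<noteq> 0" "\<tau>' * (of_int c * \<tau> + of_int d) = of_int a * \<tau> + of_int b"
proof -
  obtain s s' where s: "s\<^sup>2 = we1 \<tau> - we2 \<tau>" and s': "s'\<^sup>2 = we1 \<tau>' - we2 \<tau>'" and PP: "vpoles \<tau> s = vpoles \<tau>' s'"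
    and ag: "\<And>u. u \<notin> vpoles \<tau> s \<Longrightarrow> vsc \<tau> s u = vsc \<tau>' s' u" using lamr_inj_lattice[OF t t' eq] by blast
  have s0: "s \<noteq> 0" "s' \<noteq> 0" using s s' we_distinct[OF t] we_distinct[OF t'] by auto
  define \<mu> where "\<mu> = s' / s"
  have m0: "\<mu> \<noteq> 0" and s'm: "s' = s * \<mu>" using s0 by (simp_all add: \<mu>_def)
  have P1: "\<exists>k\<in>Lat \<tau>'. \<tau>/2 + l = \<mu> * (\<tau>'/2 + k)" if "l \<in> Lat \<tau>" for l
  proof -
    have "s * (\<tau>/2 + l) \<in> vpoles \<tau> s" unfolding vpoles_def using that by blast
    hence "s * (\<tau>/2 + l) \<in> vpoles \<tau>' s'" unfolding PP .
    then obtain k where "k \<in> Lat \<tau>'" "s * (\<tau>/2 + l) = s * (\<mu> * (\<tau>'/2 + k))" by (auto simp: vpoles_def s'm mult.assoc)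
    thus ?thesis using s0 by auto
  qed
  have P2: "\<exists>l\<in>Lat \<tau>. \<tau>/2 + l = \<mu> * (\<tau>'/2 + k)" if "k \<in> Lat \<tau>'" for k
  proof -
    have "s' * (\<tau>'/2 + k) \<in> vpoles \<tau>' s'" unfolding vpoles_def using that by blast
    hence "s' * (\<tau>'/2 + k) \<in> vpoles \<tau> s" unfolding PP .
    then obtain l where "l \<in> Lat \<tau>" "s * (\<mu> * (\<tau>'/2 + k)) = s * (\<tau>/2 + l)" by (auto simp: vpoles_def s'm mult.assoc)
    thus ?thesis using s0 by auto
  qed
  obtain l0 where l0: "l0 \<in> Lat \<tau>" "\<tau>/2 + l0 = \<mu> * (\<tau>'/2)" using P2[of 0] by auto
  have L2: "\<mu> * k \<in> Lat \<tau>" if k: "k \<in> Lat \<tau>'" for k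
  proof -
    obtain l where l: "l \<in> Lat \<tau>" "\<tau>/2 + l = \<mu> * (\<tau>'/2 + k)" using P2[OF k] by auto
    have "\<mu> * k = \<mu> * (\<tau>'/2 + k) - \<mu> * (\<tau>'/2)" by (simp add: algebra_simps)
    also have "\<dots> = l - l0" unfolding l0(2)[symmetric] l(2)[symmetric] by simp
    finally show ?thesis using l l0 Lat_diff by simp
  qed
  have L1: "\<exists>k\<in>Lat \<tau>'. l = \<mu> * k" if l: "l \<in> Lat \<tau>" for l
  proof -
    obtain k where k: "k \<in> Lat \<tau>'" "\<tau>/2 + (l + l0) = \<mu> * (\<tau>'/2 + k)" using P1[OF Lat_add[OF l l0(1)]] by auto
    have "l = (\<tau>/2 + (l + l0)) - (\<tau>/2 + l0)" by simp
    also have "\<dots> = \<mu> * k" unfolding k(2) l0(2) by (simp add: algebra_simps)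
    finally show ?thesis using k by blast
  qed
  obtain c d where cd: "\<mu> = of_int c * \<tau> + of_int d" using L2[OF Lat_simps(2)] by (auto simp: Lat_def)
  obtain a b where ab: "\<mu> * \<tau>' = of_int a * \<tau> + of_int b" using L2[OF Lat_simps(3)] by (auto simp: Lat_def)
  obtain k l where kl: "1 = \<mu> * (of_int k * \<tau>' + of_int l)" using L1[OF Lat_simps(2)] by (auto simp: Lat_def)
  obtain m n where mn: "\<tau> = \<mu> * (of_int m * \<tau>' + of_int n)" using L1[OF Lat_simps(3)] by (auto simp: Lat_def)
  obtain e f where ef: "l0 = of_int e * \<tau> + of_int f" using l0 by (auto simp: Lat_def)
  \<comment> \<open>Doubling the equation for \<open>l0\<close> gives \<mu> \<tau>' = \<tau> + 2 l0,
    whence a is odd and b even.\<close>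
  have "of_int a * \<tau> + of_int b = of_int (2 * e + 1) * \<tau> + of_int (2 * f)"
  proof -
    have "of_int a * \<tau> + of_int b = 2 * (\<mu> * (\<tau>'/2))" unfolding ab[symmetric] by simp
    also have "\<dots> = of_int (2 * e + 1) * \<tau> + of_int (2 * f)" unfolding l0(2)[symmetric] ef by (simp add: algebra_simps)
    finally show ?thesis .
  qed
  hence ab2: "a = 2 * e + 1" "b = 2 * f" unfolding Lat_coord_unique[OF t] by simp_all
  have "of_int (k * a + l * c) * \<tau> + of_int (k * b + l * d) = of_int 0 * \<tau> + of_int 1"
  proof -
    have "of_int 0 * \<tau> + of_int 1 = of_int k * (\<mu> * \<tau>') + of_int l * \<mu>"
      using kl by (simp add: algebra_simps)
    thus ?thesis unfolding ab unfolding cd by (simp add: algebra_simps)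
  qed
  hence d1: "k * a + l * c = 0" "k * b + l * d = 1" unfolding Lat_coord_unique[OF t] by simp_all
  have "of_int (m * a + n * c) * \<tau> + of_int (m * b + n * d) = of_int 1 * \<tau> + of_int 0"
  proof -
    have "of_int 1 * \<tau> + of_int 0 = of_int m * (\<mu> * \<tau>') + of_int n * \<mu>"
      using mn by (simp add: algebra_simps)
    thus ?thesis unfolding ab unfolding cd by (simp add: algebra_simps)
  qed
  hence d2: "m * a + n * c = 1" "m * b + n * d = 0" unfolding Lat_coord_unique[OF t] by simp_all
  have det: "(m * l - n * k) * (a * d - b * c) = 1"
  proof -
    have "(m * l - n * k) * (a * d - b * c) = (m * a + n * c) * (k * b + l * d) - (m * b + n * d) * (k * a + l * c)"
      by (simp add: algebra_simps)
    thus ?thesis by (simp add: d1 d2)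
  qed
  \<comment> \<open>The integral matrix is invertible, and the signs of the imaginary parts select
    the determinant 1 instead of -1.\<close>
  have im: "Im (\<mu> * \<tau>' * cnj \<mu>) = of_int (a * d - b * c) * Im \<tau>"
    unfolding ab unfolding cd by (simp add: algebra_simps)
  have "of_int (a * d - b * c) * Im \<tau> = (norm \<mu>)\<^sup>2 * Im \<tau>'"
    unfolding im[symmetric] cmod_power2 by (simp add: power2_eq_square algebra_simps)
  hence "real_of_int (a * d - b * c) * Im \<tau> > 0" using m0 t' by simp
  hence "a * d - b * c > 0" using t by (simp add: zero_less_mult_iff del: of_int_diff of_int_mult)
  hence det1: "a * d - b * c = 1" using det by (metis pos_zmult_eq_1_iff mult.commute)
  \<comment> \<open>Here the first function is 1, that is, P takes the value e1. So the second takes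
    its e1 at the corresponding half-lattice point of \<tau>', which determines the parities p and q
    and forces c to be even.\<close>
  define u where "u = s * ((1 + \<tau>)/2)"
  have us: "u / s + \<tau>/2 = 1/2 + \<tau>" using s0 by (simp add: u_def field_simps)
  have uP: "u \<notin> vpoles \<tau> s" using vpoles_iff[OF s0(1), of u \<tau>] halves_notin_Lat(1)[OF t] unfolding us by simp
  have v1: "vsc \<tau> s u = 1"
    using wp_lattice[OF t Lat_simps(3), of "1/2"] s0(1) by (simp add: vsc_def us s[symmetric] we1_def[symmetric])
  hence v2: "wp \<tau>' (u / s' + \<tau>'/2) = we1 \<tau>'" using ag[OF uP] s0 s' by (simp add: vsc_def field_simps)
  define x where "x = u / s' + \<tau>'/2"
  have xm: "2 * (\<mu> * x) = 1 + \<tau> + \<mu> * \<tau>'" using s0 by (simp add: x_def u_def \<mu>_def field_simps)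
  obtain p q where pq: "1 + \<tau> + \<mu> * \<tau>' = \<mu> * (of_int p * \<tau>' + of_int q)"
  proof -
    have "1 + \<tau> + \<mu> * \<tau>' \<in> Lat \<tau>" using L2[OF Lat_simps(3)] by (intro Lat_add) auto
    thus thesis using L1 that by (auto simp: Lat_def)
  qed
  have xpq: "x = of_int p * (\<tau>'/2) + of_int q / 2"
  proof -
    have "\<mu> * (2 * x) = \<mu> * (of_int p * \<tau>' + of_int q)" using xm pq by (simp add: mult_ac)
    hence "2 * x = of_int p * \<tau>' + of_int q" using m0 by simp
    thus ?thesis by (simp add: field_simps)
  qed
  have xnL: "x \<notin> Lat \<tau>'" using vpoles_iff[OF s0(2), of u \<tau>'] uP unfolding PP x_def by simp
  have "\<not> (even p \<and> even q)"
  proof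
    assume "even p \<and> even q"
    then obtain p' q' where "p = 2 * p'" "q = 2 * q'" by (meson evenE)
    hence "x = of_int p' * \<tau>' + of_int q'" by (simp add: xpq)
    thus False using xnL by blast
  qed
  moreover have "\<not> (odd p \<and> even q)"
    using wp_half_values(2)[OF t', of p q] v2[folded x_def] we_distinct[OF t'] by (auto simp: xpq)
  moreover have "\<not> (odd p \<and> odd q)"
    using wp_half_values(3)[OF t', of p q] v2[folded x_def] we_distinct[OF t'] by (auto simp: xpq)
  ultimately have p: "even p" "odd q" by auto
  have "of_int (1 + a) * \<tau> + of_int (1 + b) = of_int (p * a + q * c) * \<tau> + of_int (p * b + q * d)"
  proof -
    have "of_int (1 + a) * \<tau> + of_int (1 + b) = 1 + \<tau> + \<mu> * \<tau>'" unfolding ab by (simp add: algebra_simps)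
    also have "\<dots> = of_int p * (\<mu> * \<tau>') + of_int q * \<mu>" unfolding pq by (simp add: algebra_simps)
    also have "\<dots> = of_int (p * a + q * c) * \<tau> + of_int (p * b + q * d)" unfolding ab unfolding cd by (simp add: algebra_simps)
    finally show ?thesis .
  qed
  hence "1 + a = p * a + q * c" unfolding Lat_coord_unique[OF t] by simp
  hence "even (p * a + q * c)" using ab2 by (metis even_add even_mult_iff odd_one even_numeral)
  hence "even c" using p by simp
  thus thesis using that[of b c a d] ab2 det1 m0 ab cd by (simp add: mult.commute)
qed

section \<open>Expansion in the nome\<close>

definition nome :: "complex \<Rightarrow> complex" where "nome \<tau> = exp (\<i> * of_real pi * \<tau>)"

text \<open>Chosen so that e3 - e2 = q lnum(q) and e1 - e2 = lden(q). With the factor q split off,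
  both series are nonzero on the whole disc, including q = 0.\<close>

definition lnumt :: "nat \<Rightarrow> complex \<Rightarrow> complex" where
  "lnumt n q = 8 * q^(2*n) * (1/(1+q^(2*n+1))\<^sup>2 + 1/(1-q^(2*n+1))\<^sup>2)"
definition ldent :: "nat \<Rightarrow> complex \<Rightarrow> complex" where
  "ldent n q = 8 * q^(2*n+2)/(1+q^(2*n+2))\<^sup>2 + 8 * q^(2*n+1)/(1-q^(2*n+1))\<^sup>2"
definition lnum :: "complex \<Rightarrow> complex" where "lnum q = (\<Sum>n. lnumt n q)"
definition lden :: "complex \<Rightarrow> complex" where "lden q = 1 + (\<Sum>n. ldent n q)"

text \<open>Agrees with \<open>lamr\<close> on the upper half plane; this form shows the behaviour
  at the cusp q = 0.\<close>

definition lam :: "complex \<Rightarrow> complex" where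
  "lam \<tau> = nome \<tau> * lnum (nome \<tau>) / lden (nome \<tau>)"

lemma norm_nome: "norm (nome \<tau>) = exp (- (pi * Im \<tau>))"
  by (simp add: nome_def norm_exp_eq_Re)

lemma nome_lt_1: "Im \<tau> > 0 \<Longrightarrow> norm (nome \<tau>) < 1"
  by (simp add: norm_nome)

lemma nome_ex: assumes "q \<noteq> 0" "norm q < 1" obtains \<tau> where "Im \<tau> > 0" "nome \<tau> = q"
proof
  show 1: "nome (Ln q / (\<i> * of_real pi)) = q" using assms by (simp add: nome_def)
  have "exp (- (pi * Im (Ln q / (\<i> * of_real pi)))) < 1" using assms(2) norm_nome 1 by metis
  thus "Im (Ln q / (\<i> * of_real pi)) > 0" by (simp add: zero_less_mult_iff)
qed

lemma csq_exp: "csq z = - 4 * exp (2 * of_real pi * \<i> * z) / (1 - exp (2 * of_real pi * \<i> * z))\<^sup>2"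
proof -
  define w where "w = exp (\<i> * of_real pi * z)"
  have w0: "w \<noteq> 0" by (simp add: w_def)
  have E: "exp (2 * of_real pi * \<i> * z) = w\<^sup>2"
    by (simp add: w_def power2_eq_square mult_ac flip: exp_add)
  have s: "sin (of_real pi * z) = (w - 1/w) / (2 * \<i>)"
    by (simp add: sin_exp_eq w_def exp_minus field_simps)
  have s2: "(sin (of_real pi * z))\<^sup>2 = - (1 - w\<^sup>2)\<^sup>2 / (4 * w\<^sup>2)"
    unfolding s using w0 by (simp add: field_simps power2_eq_square)
  show ?thesis unfolding csq_def E s2 using w0 by simp
qed

lemma exp_nome: "exp (2 * of_real pi * \<i> * (of_nat k * \<tau> / 2)) = nome \<tau> ^ k"
proof -
  have "nome \<tau> ^ k = exp (of_nat k * (\<i> * of_real pi * \<tau>))" unfolding nome_def by (rule exp_of_nat_mult[symmetric])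
  thus ?thesis by (simp add: mult_ac)
qed

lemma csq_nome: "csq (of_nat k * \<tau> / 2) = - 4 * nome \<tau> ^ k / (1 - nome \<tau> ^ k)\<^sup>2"
  unfolding csq_exp exp_nome ..

lemma csq_nome_half: "csq (1/2 + of_nat k * \<tau> / 2) = 4 * nome \<tau> ^ k / (1 + nome \<tau> ^ k)\<^sup>2"
proof -
  have "exp (2 * of_real pi * \<i> * (1/2 + of_nat k * \<tau> / 2)) = exp (of_real pi * \<i>) * nome \<tau> ^ k"
    unfolding exp_nome[symmetric] exp_add[symmetric] by (simp add: algebra_simps)
  also have "\<dots> = - (nome \<tau> ^ k)" by simp
  finally show ?thesis unfolding csq_exp by simp
qed

lemma norm_one_pm_pow:
  assumes "norm (q::complex) \<le> r" "r < 1" "k \<ge> 1"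
  shows "norm (1 / (1 + q^k)\<^sup>2) \<le> 1 / (1-r)\<^sup>2" "norm (1 / (1 - q^k)\<^sup>2) \<le> 1 / (1-r)\<^sup>2"
proof -
  have r0: "r \<ge> 0" using assms(1) norm_ge_zero[of q] by linarith
  have "norm (q^k) \<le> r^k" using assms(1) by (simp add: norm_power power_mono)
  also have "\<dots> \<le> r^1" using r0 assms by (intro power_decreasing) auto
  finally have b: "norm (q^k) \<le> r" by simp
  have "norm (1 + q^k) \<ge> 1 - r" "norm (1 - q^k) \<ge> 1 - r"
    using norm_triangle_ineq2[of 1 "- (q^k)"] norm_triangle_ineq2[of 1 "q^k"] b by auto
  hence "(1-r)\<^sup>2 \<le> (norm (1+q^k))\<^sup>2" "(1-r)\<^sup>2 \<le> (norm (1-q^k))\<^sup>2" using assms by (auto intro: power_mono)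
  thus "norm (1 / (1 + q^k)\<^sup>2) \<le> 1 / (1-r)\<^sup>2" "norm (1 / (1 - q^k)\<^sup>2) \<le> 1 / (1-r)\<^sup>2"
    using assms by (auto simp: norm_divide norm_power intro!: divide_left_mono mult_pos_pos zero_less_power)
qed

lemma lterm_bounds:
  assumes q: "norm (q::complex) \<le> r" "r < 1"
  shows "norm (lnumt n q) \<le> 16 / (1-r)\<^sup>2 * r^n" "norm (ldent n q) \<le> 16 / (1-r)\<^sup>2 * r^n"
proof -
  have r0: "r \<ge> 0" using q(1) norm_ge_zero[of q] by linarith
  have p: "norm (q^k) \<le> r^n" if "k \<ge> n" for k
  proof -
    have "norm (q^k) \<le> r^k" using q by (simp add: norm_power power_mono)
    also have "\<dots> \<le> r^n" using r0 q that by (intro power_decreasing) auto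
    finally show ?thesis .
  qed
  define C where "C = 1 / (1-r)\<^sup>2"
  have b: "norm (1 / (1 + q^k)\<^sup>2) \<le> C" "norm (1 / (1 - q^k)\<^sup>2) \<le> C" if "k \<ge> 1" for k
    using norm_one_pm_pow[OF q that] by (simp_all add: C_def)
  have m: "norm (8 * q^k * x) \<le> 8 * r^n * c" if "k \<ge> n" "norm x \<le> c" for k x c
  proof -
    have "norm (8 * q^k * x) = 8 * (norm (q^k) * norm x)" by (simp add: norm_mult)
    also have "\<dots> \<le> 8 * (r^n * c)" by (intro mult_left_mono mult_mono p that) (use r0 in auto)
    finally show ?thesis by (simp add: mult.assoc)
  qed
  have "norm (1/(1+q^(2*n+1))\<^sup>2 + 1/(1-q^(2*n+1))\<^sup>2) \<le> C + C" by (rule norm_triangle_mono; rule b) auto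
  from m[OF _ this, of "2*n"] show "norm (lnumt n q) \<le> 16 / (1-r)\<^sup>2 * r^n"
    by (simp add: lnumt_def C_def)
  have "norm (8 * q^(2*n+2) * (1/(1+q^(2*n+2))\<^sup>2) + 8 * q^(2*n+1) * (1/(1-q^(2*n+1))\<^sup>2)) \<le> 8 * r^n * C + 8 * r^n * C"
    by (rule norm_triangle_mono; rule m; (rule b)?; simp)
  thus "norm (ldent n q) \<le> 16 / (1-r)\<^sup>2 * r^n"
    by (simp add: ldent_def C_def)
qed

lemma pow_neq_1: "norm (q::complex) < 1 \<Longrightarrow> q ^ Suc k \<noteq> 1" "norm q < 1 \<Longrightarrow> q ^ Suc k \<noteq> -1"
proof -
  assume q: "norm q < 1"
  have "norm (q ^ Suc k) < 1" using q by (simp only: norm_power power_less_one_iff norm_ge_zero zero_less_Suc)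
  thus "q ^ Suc k \<noteq> 1" "q ^ Suc k \<noteq> -1" by fastforce+
qed

lemma series_holo:
  assumes hol: "\<And>n. f n holomorphic_on ball 0 1"
    and bd: "\<And>n q r. norm (q::complex) \<le> r \<Longrightarrow> r < 1 \<Longrightarrow> norm (f n q) \<le> 16 / (1-r)\<^sup>2 * r^n"
  shows "(\<lambda>q. \<Sum>n. f n q) holomorphic_on ball 0 1"
proof (rule holomorphic_uniform_sequence[OF open_ball])
  show "(\<lambda>q. \<Sum>n<N. f n q) holomorphic_on ball 0 1" for N by (intro holomorphic_intros hol)
  fix x :: complex assume x: "x \<in> ball 0 1"
  define r where "r = (1 + norm x) / 2"
  have r: "r < 1" "norm x < r" "0 \<le> r" using x by (auto simp: r_def intro: add_nonneg_nonneg)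
  have sub: "norm q \<le> r" if "q \<in> cball x (r - norm x)" for q
    using that norm_triangle_ineq2[of q x] by (auto simp: dist_norm norm_minus_commute)
  have "uniform_limit (cball x (r - norm x)) (\<lambda>N q. \<Sum>n<N. f n q) (\<lambda>q. \<Sum>n. f n q) sequentially"
    by (rule Weierstrass_m_test[where M="\<lambda>n. 16 / (1-r)\<^sup>2 * r^n"]) (use bd[OF sub r(1)] r in \<open>auto intro!: summable_mult summable_geometric\<close>)
  thus "\<exists>d>0. cball x d \<subseteq> ball 0 1 \<and> uniform_limit (cball x d) (\<lambda>N q. \<Sum>n<N. f n q) (\<lambda>q. \<Sum>n. f n q) sequentially"
    using r sub by (intro exI[of _ "r - norm x"]) force
qed

lemma lnumt_holo: "lnumt n holomorphic_on ball 0 1"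
  using pow_neq_1[where k="2*n"] unfolding lnumt_def[abs_def]
  by (intro holomorphic_intros) (auto simp: add_eq_0_iff)

lemma ldent_holo: "ldent n holomorphic_on ball 0 1"
  using pow_neq_1[where k="2*n"] pow_neq_1[where k="2*n+1"] unfolding ldent_def[abs_def]
  by (intro holomorphic_intros) (auto simp: add_eq_0_iff)

lemma lnum_holo: "lnum holomorphic_on ball 0 1"
  unfolding lnum_def[abs_def] by (rule series_holo[OF lnumt_holo lterm_bounds(1)])

lemma lden_holo: "lden holomorphic_on ball 0 1"
  unfolding lden_def[abs_def] by (intro holomorphic_intros series_holo[OF ldent_holo lterm_bounds(2)])

lemma lterm_summable:
  assumes "norm (q::complex) < 1" shows "summable (\<lambda>n. lnumt n q)" "summable (\<lambda>n. ldent n q)"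
proof -
  have s: "summable (\<lambda>n. 16 / (1 - norm q)\<^sup>2 * norm q ^ n)" using assms by (intro summable_mult summable_geometric) auto
  show "summable (\<lambda>n. lnumt n q)" "summable (\<lambda>n. ldent n q)"
    by (rule summable_comparison_test'[OF s, of 0]; use lterm_bounds[OF order_refl assms] in simp)+
qed

text \<open>At \<tau>/2 the rows n + 1 and -(n + 1) contribute c(n + 1) and c(n), and the real row
  contributes c(0); so every c(n) occurs twice.\<close>

lemma telescoping_pair:
  fixes c :: "nat \<Rightarrow> complex"
  assumes "(\<lambda>n. c (Suc n) + c n) sums L" "c \<longlonglongrightarrow> 0"
  shows "(\<lambda>n. 2 * c n) sums (c 0 + L)"
proof -
  have e: "(\<Sum>n<N. 2 * c n) = c 0 + (\<Sum>n<N. c (Suc n) + c n) - c N" for N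
    by (induction N) (simp_all add: algebra_simps)
  have "(\<lambda>N. c 0 + (\<Sum>n<N. c (Suc n) + c n) - c N) \<longlonglongrightarrow> c 0 + L - 0"
    using assms unfolding sums_def by (intro tendsto_intros)
  thus ?thesis unfolding sums_def e by simp
qed

lemma we_nome:
  assumes t: "Im \<tau> > 0"
  shows "we1 \<tau> - we2 \<tau> = lden (nome \<tau>)" "we3 \<tau> - we2 \<tau> = nome \<tau> * lnum (nome \<tau>)"
proof -
  define q where "q = nome \<tau>"
  have q1: "norm q < 1" using nome_lt_1[OF t] by (simp add: q_def)
  have sums: "(\<lambda>n. wpt \<tau> n z) sums wpA \<tau> z" for z unfolding wpA_def using wpt_summable[OF t] by (rule summable_sums)
  have csq_tau: "(\<lambda>n. csq (z + of_nat n * \<tau>)) \<longlonglongrightarrow> 0" for z using csq_tau_tendsto[OF t, of 1 z] by simp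
  have s1: "(\<lambda>n. 8 * q^(2*n+2)/(1+q^(2*n+2))\<^sup>2) sums (we1 \<tau> - 1)"
  proof -
    have "wpt \<tau> n (1/2) = 8 * q^(2*n+2)/(1+q^(2*n+2))\<^sup>2" for n
    proof -
      \<comment> \<open>Up to sign and the period 1, the points 1/2 - (n + 1) \<tau> and 1/2 + (n +
        1) \<tau> are the same argument of \<open>csq\<close>.\<close>
      have "csq (1/2 - of_nat (Suc n) * \<tau>) = csq (- (1/2 - of_nat (Suc n) * \<tau>) + 1)"
        unfolding csq_period1 csq_minus ..
      also have "- (1/2 - of_nat (Suc n) * \<tau>) + 1 = 1/2 + of_nat (2*n+2) * \<tau> / 2" by (simp add: field_simps)
      finally have a: "csq (1/2 - of_nat (Suc n) * \<tau>) = csq (1/2 + of_nat (2*n+2) * \<tau> / 2)" .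
      have b: "1/2 + of_nat (Suc n) * \<tau> = 1/2 + of_nat (2*n+2) * \<tau> / 2" by (simp add: field_simps)
      show ?thesis unfolding wpt_def a unfolding b csq_nome_half q_def[symmetric] by simp
    qed
    moreover have "csq (1/2) = 1" using csq_nome_half[of 0 \<tau>] by simp
    ultimately show ?thesis using sums[of "1/2"] by (simp add: we1_def wp_def)
  qed
  have s2: "(\<lambda>n. - 8 * q^(2*n+1)/(1-q^(2*n+1))\<^sup>2) sums we2 \<tau>"
  proof -
    define c where "c = (\<lambda>n. csq (of_nat (2*n+1) * \<tau> / 2))"
    have "wpt \<tau> n (\<tau>/2) = c (Suc n) + c n" for n
    proof -
      have a: "\<tau>/2 + of_nat (Suc n) * \<tau> = of_nat (2*Suc n+1) * \<tau> / 2" "\<tau>/2 - of_nat (Suc n) * \<tau> = - (of_nat (2*n+1) * \<tau> / 2)"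
        by (simp_all add: field_simps)
      show ?thesis unfolding wpt_def a c_def csq_minus ..
    qed
    hence "(\<lambda>n. c (Suc n) + c n) sums wpA \<tau> (\<tau>/2)" using sums[of "\<tau>/2"] by simp
    moreover have "c = (\<lambda>n. csq (\<tau>/2 + of_nat n * \<tau>))" by (simp add: c_def field_simps)
    hence "c \<longlonglongrightarrow> 0" using csq_tau[of "\<tau>/2"] by simp
    ultimately have "(\<lambda>n. 2 * c n) sums (c 0 + wpA \<tau> (\<tau>/2))" by (rule telescoping_pair)
    moreover have "c 0 = csq (\<tau>/2)" by (simp add: c_def)
    moreover have "2 * c n = - 8 * q^(2*n+1)/(1-q^(2*n+1))\<^sup>2" for n unfolding c_def csq_nome q_def by simp
    ultimately show ?thesis by (simp add: we2_def wp_def)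
  qed
  have s3: "(\<lambda>n. 8 * q^(2*n+1)/(1+q^(2*n+1))\<^sup>2) sums we3 \<tau>"
  proof -
    define c where "c = (\<lambda>n. csq (1/2 + of_nat (2*n+1) * \<tau> / 2))"
    have "wpt \<tau> n ((1+\<tau>)/2) = c (Suc n) + c n" for n
    proof -
      have a: "(1+\<tau>)/2 + of_nat (Suc n) * \<tau> = 1/2 + of_nat (2*Suc n+1) * \<tau> / 2" "(1+\<tau>)/2 - of_nat (Suc n) * \<tau> = - (1/2 + of_nat (2*n+1) * \<tau> / 2) + 1"
        by (simp_all add: field_simps)
      show ?thesis unfolding wpt_def a c_def csq_period1 csq_minus ..
    qed
    hence "(\<lambda>n. c (Suc n) + c n) sums wpA \<tau> ((1+\<tau>)/2)" using sums[of "(1+\<tau>)/2"] by simp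
    moreover have "c = (\<lambda>n. csq ((1+\<tau>)/2 + of_nat n * \<tau>))" by (simp add: c_def field_simps)
    hence "c \<longlonglongrightarrow> 0" using csq_tau[of "(1+\<tau>)/2"] by simp
    ultimately have "(\<lambda>n. 2 * c n) sums (c 0 + wpA \<tau> ((1+\<tau>)/2))" by (rule telescoping_pair)
    moreover have "c 0 = csq ((1+\<tau>)/2)" by (simp add: c_def add_divide_distrib)
    moreover have "2 * c n = 8 * q^(2*n+1)/(1+q^(2*n+1))\<^sup>2" for n unfolding c_def csq_nome_half q_def by simp
    ultimately show ?thesis by (simp add: we3_def wp_def)
  qed
  have "(\<lambda>n. ldent n q) sums (we1 \<tau> - 1 - we2 \<tau>)"
    using sums_diff[OF s1 s2] by (simp add: ldent_def[abs_def])
  hence "(\<Sum>n. ldent n q) = we1 \<tau> - 1 - we2 \<tau>" by (rule sums_unique[symmetric])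
  thus "we1 \<tau> - we2 \<tau> = lden (nome \<tau>)" by (simp add: lden_def q_def)
  have "(\<lambda>n. q * lnumt n q) sums (we3 \<tau> - we2 \<tau>)"
  proof -
    have "8 * q^(2*n+1)/(1+q^(2*n+1))\<^sup>2 - - 8 * q^(2*n+1)/(1-q^(2*n+1))\<^sup>2 = q * lnumt n q" for n
      by (simp add: lnumt_def algebra_simps)
    thus ?thesis using sums_diff[OF s3 s2] by simp
  qed
  moreover have "(\<lambda>n. q * lnumt n q) sums (q * lnum q)"
    unfolding lnum_def by (intro sums_mult summable_sums lterm_summable q1)
  ultimately show "we3 \<tau> - we2 \<tau> = nome \<tau> * lnum (nome \<tau>)" using sums_unique2 q_def by blast
qed

lemma lam_eq_lamr: "Im \<tau> > 0 \<Longrightarrow> lam \<tau> = lamr \<tau>"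
  by (simp add: lam_def lamr_def we_nome)

lemma lnum_0: "lnum 0 = 16"
proof -
  have "(\<lambda>n. lnumt n 0) sums (\<Sum>n\<in>{0}. lnumt n 0)" by (rule sums_finite) (auto simp: lnumt_def)
  thus ?thesis unfolding lnum_def by (simp add: sums_unique[symmetric] lnumt_def)
qed

lemma lden_0: "lden 0 = 1" by (simp add: lden_def ldent_def)

text \<open>For q \<noteq> 0 this is the distinctness of the half-period values at some \<tau> with
  nome q.\<close>

lemma lnum_lden_neq_0:
  assumes "norm q < 1" shows "lnum q \<noteq> 0" "lden q \<noteq> 0"
proof -
  have "lnum q \<noteq> 0 \<and> lden q \<noteq> 0"
  proof (cases "q = 0")
    case False
    then obtain \<tau> where t: "Im \<tau> > 0" "nome \<tau> = q" using nome_ex assms by blast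
    show ?thesis using we_nome[OF t(1)] we_distinct[OF t(1)] t(2) by auto
  qed (simp add: lnum_0 lden_0)
  thus "lnum q \<noteq> 0" "lden q \<noteq> 0" by auto
qed

section \<open>Values, symmetry and logarithm of lambda\<close>

lemma lam_neq: "Im \<tau> > 0 \<Longrightarrow> lam \<tau> \<noteq> 0" "Im \<tau> > 0 \<Longrightarrow> lam \<tau> \<noteq> 1"
  using we_distinct[of \<tau>] by (auto simp: lam_eq_lamr lamr_def divide_eq_1_iff)

lemma nome_holo [holomorphic_intros]: "nome holomorphic_on A"
  unfolding nome_def[abs_def] by (intro holomorphic_intros)

abbreviation "UH \<equiv> {\<tau>. Im \<tau> > 0}"

lemma lam_holo: "lam holomorphic_on UH"
  unfolding lam_def[abs_def]
  by (intro holomorphic_intros holomorphic_on_compose_gen[OF nome_holo lnum_holo, unfolded o_def]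
      holomorphic_on_compose_gen[OF nome_holo lden_holo, unfolded o_def])
     (auto simp: nome_lt_1 lnum_lden_neq_0)

lemma lam_tendsto_0:
  assumes "\<epsilon> > 0" obtains Y where "\<And>\<tau>. Im \<tau> \<ge> Y \<Longrightarrow> norm (lam \<tau>) < \<epsilon>"
proof -
  have "(\<lambda>q. q * lnum q / lden q) holomorphic_on ball 0 1"
    by (intro holomorphic_intros lnum_holo lden_holo) (use lnum_lden_neq_0 in auto)
  hence "isCont (\<lambda>q. q * lnum q / lden q) 0"
    using holomorphic_on_imp_continuous_on by (fastforce simp: continuous_on_eq_continuous_at)
  then obtain d where d: "d > 0" "\<And>q. norm q < d \<Longrightarrow> norm (q * lnum q / lden q) < \<epsilon>"
    using assms by (auto simp: continuous_at_eps_delta dist_norm)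
  define Y where "Y = (1 - ln d) / pi"
  show thesis
  proof (rule that)
    fix \<tau> assume "Im \<tau> \<ge> Y"
    hence "pi * Im \<tau> \<ge> 1 - ln d" by (simp add: Y_def field_simps)
    hence "norm (nome \<tau>) < exp (ln d)" unfolding norm_nome by simp
    thus "norm (lam \<tau>) < \<epsilon>" using d by (simp add: lam_def)
  qed
qed

lemma nome_cnj: "nome (- cnj \<tau>) = cnj (nome \<tau>)" by (simp add: nome_def exp_cnj)

lemma lam_cnj: assumes t: "Im \<tau> > 0" shows "lam (- cnj \<tau>) = cnj (lam \<tau>)"
proof -
  define q where "q = nome \<tau>"
  have q1: "norm q < 1" using nome_lt_1[OF t] by (simp add: q_def)
  have "lnum (cnj q) = cnj (lnum q)"
    unfolding lnum_def using bounded_linear.suminf[OF bounded_linear_cnj lterm_summable(1)[OF q1]]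
    by (simp add: lnumt_def)
  moreover have "lden (cnj q) = cnj (lden q)"
    unfolding lden_def using bounded_linear.suminf[OF bounded_linear_cnj lterm_summable(2)[OF q1]]
    by (simp add: ldent_def)
  ultimately show ?thesis by (simp add: lam_def nome_cnj q_def[symmetric])
qed

text \<open>On the imaginary axis the nome lies in (0, 1), where every term of both series is real
  and positive.\<close>

lemma lam_imag_pos:
  assumes y: "y > 0" shows "Im (lam (\<i> * of_real y)) = 0" "Re (lam (\<i> * of_real y)) > 0"
proof -
  define x where "x = exp (- (pi * y))"
  have x: "0 < x" "x < 1" using y by (auto simp: x_def)
  have "\<i> * of_real pi * (\<i> * of_real y) = of_real (- (pi * y))" by (simp add: complex_eq_iff)
  hence q: "nome (\<i> * of_real y) = of_real x" unfolding nome_def x_def by (simp only: exp_of_real)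
  have n1: "norm (of_real x :: complex) < 1" using x by simp
  define a where "a = (\<lambda>n. 8 * x^(2*n) * (1/(1+x^(2*n+1))\<^sup>2 + 1/(1-x^(2*n+1))\<^sup>2))"
  define b where "b = (\<lambda>n. 8 * x^(2*n+2)/(1+x^(2*n+2))\<^sup>2 + 8 * x^(2*n+1)/(1-x^(2*n+1))\<^sup>2)"
  have ca: "lnumt n (of_real x) = of_real (a n)" "ldent n (of_real x) = of_real (b n)" for n
    by (simp_all add: lnumt_def ldent_def a_def b_def)
  have xk: "x ^ k < 1" if "k > 0" for k using x that by (simp add: power_less_one_iff)
  have s: "summable a" "summable b"
    using lterm_summable[OF n1] unfolding ca by (simp_all add: summable_of_real_iff)
  have pos: "suminf a > 0" "suminf b > 0"
  proof -
    have "1 + x ^ k > 0" for k using x by (simp add: add_pos_pos)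
    moreover have "1 - x ^ (2*n+1) > 0" for n using xk[of "2*n+1"] by simp
    ultimately have "a n > 0" "b n > 0" for n
      unfolding a_def b_def
      by (intro mult_pos_pos add_pos_pos divide_pos_pos zero_less_power; (use x in simp)?)+
    thus "suminf a > 0" "suminf b > 0" using s by (auto intro: suminf_pos)
  qed
  have "lam (\<i> * of_real y) = of_real (x * suminf a / (1 + suminf b))"
    unfolding lam_def q lnum_def lden_def ca using s by (simp add: suminf_of_real)
  thus "Im (lam (\<i> * of_real y)) = 0" "Re (lam (\<i> * of_real y)) > 0" using x pos by (simp_all add: add_pos_pos)
qed

text \<open>The quotient lambda / q is a nonvanishing function of q on the disc and has a logarithm
  there; the factor q contributes i pi \<tau>, which grows by 2 pi i under \<tau> + 2.\<close>

lemma lam_log: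
  obtains Lg where "continuous_on UH Lg" "\<And>\<tau>. Im \<tau> > 0 \<Longrightarrow> lam \<tau> = exp (Lg \<tau>)"
    "\<And>\<tau>. Im \<tau> > 0 \<Longrightarrow> Lg (\<tau> + 2) = Lg \<tau> + 2 * of_real pi * \<i>"
proof -
  have "(\<lambda>q. lnum q / lden q) holomorphic_on ball 0 1"
    by (intro holomorphic_intros lnum_holo lden_holo) (use lnum_lden_neq_0 in auto)
  then obtain r where r: "r holomorphic_on ball 0 1" "\<And>q. q \<in> ball 0 1 \<Longrightarrow> lnum q / lden q = exp (r q)"
    using contractible_imp_holomorphic_log[of "\<lambda>q. lnum q / lden q" "ball 0 1"] lnum_lden_neq_0
    by (auto simp: convex_imp_contractible)
  define Lg where "Lg = (\<lambda>\<tau>. \<i> * of_real pi * \<tau> + r (nome \<tau>))"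
  show thesis
  proof (rule that)
    show "continuous_on UH Lg" unfolding Lg_def
      by (intro continuous_intros holomorphic_on_imp_continuous_on holomorphic_on_compose_gen[OF nome_holo r(1), unfolded o_def])
         (auto simp: nome_lt_1)
    show "lam \<tau> = exp (Lg \<tau>)" if "Im \<tau> > 0" for \<tau>
    proof -
      have "lam \<tau> = nome \<tau> * (lnum (nome \<tau>) / lden (nome \<tau>))" by (simp add: lam_def)
      also have "\<dots> = nome \<tau> * exp (r (nome \<tau>))" using r(2)[of "nome \<tau>"] nome_lt_1[OF that] by simp
      also have "\<dots> = exp (Lg \<tau>)" by (simp add: Lg_def exp_add nome_def)
      finally show ?thesis .
    qed
    have "nome (\<tau> + 2) = nome \<tau>" for \<tau>
    proof -
      have "nome (\<tau> + 2) = nome \<tau> * exp (2 * of_real pi * \<i>)" by (simp add: nome_def algebra_simps exp_add)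
      thus ?thesis by simp
    qed
    thus "Lg (\<tau> + 2) = Lg \<tau> + 2 * of_real pi * \<i>" for \<tau> by (simp add: Lg_def algebra_simps)
  qed
qed

section \<open>Modular transformations\<close>

text \<open>Real coefficients, because the quarter turn about i used later is not integral.\<close>

definition mob :: "real \<Rightarrow> real \<Rightarrow> real \<Rightarrow> real \<Rightarrow> complex \<Rightarrow> complex" where
  "mob a b c d \<tau> = (of_real a * \<tau> + of_real b) / (of_real c * \<tau> + of_real d)"

lemma mob_denom_neq_0: "Im \<tau> > 0 \<Longrightarrow> a * d - b * c = 1 \<Longrightarrow> of_real c * \<tau> + of_real d \<noteq> 0"
  by (auto simp: complex_eq_iff)

lemma mob_Im:
  assumes t: "Im \<tau> > 0" and det: "a * d - b * c = 1"
  shows "Im (mob a b c d \<tau>) * (norm (of_real c * \<tau> + of_real d))\<^sup>2 = Im \<tau>" "Im (mob a b c d \<tau>) > 0"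
proof -
  define m where "m = of_real c * \<tau> + of_real d"
  have m0: "m \<noteq> 0" using mob_denom_neq_0[OF t det] by (simp add: m_def)
  have nm: "(norm m)\<^sup>2 > 0" using m0 by simp
  have "mob a b c d \<tau> = (of_real a * \<tau> + of_real b) * cnj m / of_real ((norm m)\<^sup>2)"
    unfolding mob_def m_def[symmetric] using m0 complex_norm_square[of m] by (simp add: field_simps)
  hence "Im (mob a b c d \<tau>) = Im ((of_real a * \<tau> + of_real b) * cnj m) / (norm m)\<^sup>2"
    by (simp add: Im_divide_of_real)
  also have "Im ((of_real a * \<tau> + of_real b) * cnj m) = (a * d - b * c) * Im \<tau>"
    by (simp add: m_def algebra_simps)
  finally have e: "Im (mob a b c d \<tau>) = Im \<tau> / (norm m)\<^sup>2" by (simp add: det)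
  show "Im (mob a b c d \<tau>) * (norm (of_real c * \<tau> + of_real d))\<^sup>2 = Im \<tau>"
    unfolding e m_def[symmetric] using nm by simp
  show "Im (mob a b c d \<tau>) > 0" unfolding e using nm t by simp
qed

lemma mob_mob:
  assumes t: "Im \<tau> > 0" and det: "a' * d' - b' * c' = 1"
  shows "mob a b c d (mob a' b' c' d' \<tau>) = mob (a*a'+b*c') (a*b'+b*d') (c*a'+d*c') (c*b'+d*d') \<tau>"
proof -
  define m where "m = of_real c' * \<tau> + of_real d'"
  have m0: "m \<noteq> 0" using mob_denom_neq_0[OF t det] by (simp add: m_def)
  define N where "N = (\<lambda>x y::real. of_real x * (of_real a' * \<tau> + of_real b') + of_real y * m)"
  have h: "of_real x * mob a' b' c' d' \<tau> + of_real y = N x y / m" for x y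
    unfolding mob_def m_def[symmetric] N_def using m0 by (simp add: field_simps)
  have "mob a b c d (mob a' b' c' d' \<tau>) = (N a b / m) / (N c d / m)" unfolding mob_def[of a b c d] h ..
  also have "\<dots> = N a b / N c d" using m0 by simp
  also have "\<dots> = mob (a*a'+b*c') (a*b'+b*d') (c*a'+d*c') (c*b'+d*d') \<tau>"
    by (simp add: mob_def N_def m_def algebra_simps)
  finally show ?thesis .
qed

lemma mob_id [simp]: "mob 1 0 0 1 \<tau> = \<tau>" "mob (-1) 0 0 (-1) \<tau> = \<tau>" by (simp_all add: mob_def)

lemma mob_inv:
  assumes "Im \<tau> > 0" "a * d - b * c = 1"
  shows "mob d (-b) (-c) a (mob a b c d \<tau>) = \<tau>" "mob a b c d (mob d (-b) (-c) a \<tau>) = \<tau>"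
  using mob_mob[OF assms, of d "-b" "-c" a] mob_mob[OF assms(1), of d a "-b" "-c" a b c d] assms(2)
  by (simp_all add: algebra_simps)

lemma mob_cont: assumes "a * d - b * c = 1" shows "continuous_on UH (mob a b c d)"
  unfolding mob_def[abs_def] using mob_denom_neq_0 assms by (intro continuous_intros) auto

section \<open>Transformation of lambda under SL(2, Z)\<close>

lemma csq_laurent:
  obtains r where "r holomorphic_on ball 0 1" "\<And>z. z \<in> ball 0 1 \<Longrightarrow> z \<noteq> 0 \<Longrightarrow> csq z = 1 / (of_real pi * z)\<^sup>2 + r z"
proof -
  define \<phi> where "\<phi> = (\<lambda>z. if z = 0 then 1 / (of_real pi)\<^sup>2 else z\<^sup>2 * csq z)"
  have B: "z \<in> ball 0 1 \<Longrightarrow> z \<noteq> 0 \<Longrightarrow> z \<notin> \<int>" for z :: complex using ball_notin_Ints[of z 1] by simp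
  have ph: "\<phi> holomorphic_on ball 0 1" unfolding \<phi>_def
    by (intro removable_singularity[OF _ open_ball sq_csq_lim] holomorphic_intros holomorphic_on_subset[OF csq_holo])
       (use B in auto)
  have d0: "deriv \<phi> 0 = 0"
    using ph by (intro even_deriv_0 holomorphic_on_imp_differentiable_at) (auto simp: \<phi>_def)
  define q where "q = (\<lambda>z. if z = 0 then deriv \<phi> 0 else (\<phi> z - \<phi> 0) / (z - 0))"
  have q: "q holomorphic_on ball 0 1" unfolding q_def by (rule pole_lemma_open[OF ph open_ball])
  define r where "r = (\<lambda>z. if z = 0 then deriv q 0 else (q z - q 0) / (z - 0))"
  have r: "r holomorphic_on ball 0 1" unfolding r_def by (rule pole_lemma_open[OF q open_ball])
  show thesis
  proof (rule that[OF r])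
    fix z :: complex assume z: "z \<noteq> 0"
    have "q 0 = 0" by (simp add: q_def d0)
    hence "r z = q z / z" using z by (simp add: r_def)
    also have "q z = (z\<^sup>2 * csq z - 1 / (of_real pi)\<^sup>2) / z" using z by (simp add: q_def) (simp add: \<phi>_def)
    finally have "r z = (z\<^sup>2 * csq z - 1 / (of_real pi)\<^sup>2) / z\<^sup>2" by (simp add: power2_eq_square)
    thus "csq z = 1 / (of_real pi * z)\<^sup>2 + r z" using z by (simp add: field_simps power_mult_distrib)
  qed
qed

text \<open>Both functions have the principal part \<mu>^2 / (pi z)^2 at 0 and the same periods, so
  their difference is constant. The constant can stay unnamed because cross ratios do not see
  it.\<close>

lemma wp_scale:
  assumes t: "Im \<tau> > 0" and t': "Im \<tau>' > 0" and m: "\<mu> \<noteq> 0"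
    and lat: "\<And>z. z / \<mu> \<in> Lat \<tau>' \<longleftrightarrow> z \<in> Lat \<tau>"
  obtains C where "\<And>z. z \<notin> Lat \<tau> \<Longrightarrow> wp \<tau>' (z / \<mu>) = \<mu>\<^sup>2 * wp \<tau> z + C"
proof -
  define g where "g = (\<lambda>z. wp \<tau>' (z / \<mu>) - \<mu>\<^sup>2 * wp \<tau> z)"
  have per: "g (z + l) = g z" if l: "l \<in> Lat \<tau>" for z l
    using wp_lattice[OF t l, of z] wp_lattice[OF t', of "l/\<mu>" "z/\<mu>"] lat l by (simp add: g_def add_divide_distrib)
  have gh: "g holomorphic_on (- Lat \<tau>)" unfolding g_def
    by (intro holomorphic_intros wp_holo t holomorphic_on_compose_gen[OF _ wp_holo[OF t'], unfolded o_def]) (use m lat in auto)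
  obtain r where r: "r holomorphic_on ball 0 1" "\<And>z. z \<in> ball 0 1 \<Longrightarrow> z \<noteq> 0 \<Longrightarrow> csq z = 1 / (of_real pi * z)\<^sup>2 + r z"
    using csq_laurent by blast
  have c0: "isCont f 0 \<Longrightarrow> ((\<lambda>z. f (z / \<mu>)) \<longlongrightarrow> f 0) (at 0)" for f :: "complex \<Rightarrow> complex"
  proof -
    assume f: "isCont f 0"
    have z: "((\<lambda>z. z / \<mu>) \<longlongrightarrow> 0) (at 0)" using m by (auto intro!: tendsto_eq_intros)
    show ?thesis by (rule isCont_tendsto_compose[OF f z])
  qed
  have hc: "isCont f 0" if "f holomorphic_on ball 0 e" "e > 0" for f :: "complex \<Rightarrow> complex" and e
    using holomorphic_on_imp_continuous_on[OF that(1)] that(2) by (auto simp: continuous_on_eq_continuous_at)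
  have ic: "isCont r 0" "isCont (wpA \<tau>) 0" "isCont (wpA \<tau>') 0"
    using hc[OF r(1)] hc[OF wpA_holo_ball[OF t]] hc[OF wpA_holo_ball[OF t']] t t' by auto
  define l where "l = r 0 - \<mu>\<^sup>2 * r 0 + (wpA \<tau>' 0 - \<mu>\<^sup>2 * wpA \<tau> 0)"
  have "((\<lambda>z. r (z/\<mu>) - \<mu>\<^sup>2 * r z + (wpA \<tau>' (z/\<mu>) - \<mu>\<^sup>2 * wpA \<tau> z)) \<longlongrightarrow> l) (at 0)"
    unfolding l_def using ic by (intro tendsto_intros c0) (auto simp: isCont_def)
  moreover have "eventually (\<lambda>z. r (z/\<mu>) - \<mu>\<^sup>2 * r z + (wpA \<tau>' (z/\<mu>) - \<mu>\<^sup>2 * wpA \<tau> z) = g z) (at 0)"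
  proof -
    have "eventually (\<lambda>z. z \<noteq> 0 \<and> z \<in> ball 0 (min 1 (norm \<mu>))) (at (0::complex))"
      using m by (intro eventually_conj eventually_at_in_open' eventually_neq_at_within) auto
    thus ?thesis
    proof eventually_elim
      case (elim z)
      have 1: "csq z = 1 / (of_real pi * z)\<^sup>2 + r z" using elim r(2) by auto
      have 2: "csq (z/\<mu>) = 1 / (of_real pi * (z/\<mu>))\<^sup>2 + r (z/\<mu>)" using elim r(2)[of "z/\<mu>"] m by (auto simp: norm_divide)
      have "1 / (of_real pi * (z/\<mu>))\<^sup>2 = \<mu>\<^sup>2 * (1 / (of_real pi * z)\<^sup>2)" using elim m by (simp add: field_simps)
      thus ?case unfolding g_def wp_def 1 2 by (simp add: algebra_simps)
    qed
  qed
  ultimately have lim: "(g \<longlongrightarrow> l) (at 0)" by (rule Lim_transform_eventually)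
  have "g z = l" if "z \<notin> Lat \<tau>" for z
    by (rule lattice_liouville[OF t gh per per lim that]) simp_all
  thus thesis using that[of l] by (simp add: g_def algebra_simps)
qed

text \<open>Multiplication by \<mu> = c \<tau> + d takes the half periods 1/2 and \<tau>'/2 of the
  new lattice to (c \<tau> + d) / 2 and (a \<tau> + b) / 2; the factor \<mu>^2 and the additive
  constant of \<open>wp_scale\<close> cancel in the quotient.\<close>

lemma lam_mob:
  fixes a b c d :: int
  assumes t: "Im \<tau> > 0" and det: "a * d - b * c = 1"
  defines "E \<equiv> \<lambda>m n. wp \<tau> (of_int m * (\<tau>/2) + of_int n / 2)"
  shows "lam (mob a b c d \<tau>) = (E (a+c) (b+d) - E a b) / (E c d - E a b)"
proof -
  define \<mu> where "\<mu> = of_int c * \<tau> + of_int d"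
  define \<tau>' where "\<tau>' = mob a b c d \<tau>"
  have detr: "real_of_int a * real_of_int d - real_of_int b * real_of_int c = 1"
    using arg_cong[OF det, of real_of_int] by simp
  have t': "Im \<tau>' > 0" unfolding \<tau>'_def by (rule mob_Im(2)[OF t detr])
  have m0: "\<mu> \<noteq> 0" using mob_denom_neq_0[OF t detr] by (simp add: \<mu>_def)
  have mt: "\<mu> * \<tau>' = of_int a * \<tau> + of_int b" using m0 by (simp add: \<tau>'_def mob_def \<mu>_def)
  have lat: "z / \<mu> \<in> Lat \<tau>' \<longleftrightarrow> z \<in> Lat \<tau>" for z
  proof
    assume "z / \<mu> \<in> Lat \<tau>'"
    then obtain m n where "z / \<mu> = of_int m * \<tau>' + of_int n" by (auto simp: Lat_def)
    hence "z = of_int m * (\<mu> * \<tau>') + of_int n * \<mu>" using m0 by (simp add: field_simps)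
    also have "\<dots> = of_int (m * a + n * c) * \<tau> + of_int (m * b + n * d)" unfolding mt unfolding \<mu>_def by (simp add: algebra_simps)
    finally show "z \<in> Lat \<tau>" by blast
  next
    assume "z \<in> Lat \<tau>"
    then obtain p q where z: "z = of_int p * \<tau> + of_int q" by (auto simp: Lat_def)
    define m n where "m = p * d - q * c" and "n = q * a - p * b"
    have e: "m * a + n * c = p" "m * b + n * d = q"
    proof -
      have "m * a + n * c = p * (a * d - b * c)" "m * b + n * d = q * (a * d - b * c)" by (simp_all add: m_def n_def algebra_simps)
      thus "m * a + n * c = p" "m * b + n * d = q" by (simp_all add: det)
    qed
    have "\<mu> * (of_int m * \<tau>' + of_int n) = of_int m * (\<mu> * \<tau>') + of_int n * \<mu>" by (simp add: algebra_simps)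
    also have "\<dots> = of_int (m * a + n * c) * \<tau> + of_int (m * b + n * d)" unfolding mt unfolding \<mu>_def by (simp add: algebra_simps)
    finally have "\<mu> * (of_int m * \<tau>' + of_int n) = z" unfolding e z .
    hence "z / \<mu> = of_int m * \<tau>' + of_int n" using m0 by (simp add: field_simps)
    thus "z / \<mu> \<in> Lat \<tau>'" by auto
  qed
  obtain C where C: "\<And>z. z \<notin> Lat \<tau> \<Longrightarrow> wp \<tau>' (z / \<mu>) = \<mu>\<^sup>2 * wp \<tau> z + C"
    using wp_scale[OF t t' m0 lat] by blast
  have C': "wp \<tau>' h = \<mu>\<^sup>2 * wp \<tau> (\<mu> * h) + C" if "h \<notin> Lat \<tau>'" for h
    using C[of "\<mu> * h"] lat[of "\<mu> * h"] that m0 by simp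
  note hl = halves_notin_Lat[OF t']
  have h1: "\<mu> * (1/2) = of_int c * (\<tau>/2) + of_int d / 2" by (simp add: \<mu>_def field_simps)
  have h2: "\<mu> * (\<tau>'/2) = of_int a * (\<tau>/2) + of_int b / 2" using mt by (simp add: field_simps)
  have "\<mu> * ((1+\<tau>')/2) = \<mu> * (1/2) + \<mu> * (\<tau>'/2)" by (simp add: field_simps)
  also have "\<dots> = of_int (a + c) * (\<tau>/2) + of_int (b + d) / 2" unfolding h1 h2 by (simp add: field_simps)
  finally have h3: "\<mu> * ((1+\<tau>')/2) = of_int (a + c) * (\<tau>/2) + of_int (b + d) / 2" .
  have "we1 \<tau>' = \<mu>\<^sup>2 * E c d + C" "we2 \<tau>' = \<mu>\<^sup>2 * E a b + C" "we3 \<tau>' = \<mu>\<^sup>2 * E (a+c) (b+d) + C"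
    unfolding we1_def we2_def we3_def C'[OF hl(1)] C'[OF hl(2)] C'[OF hl(3)] h1 h2 h3 E_def by simp_all
  hence "lam \<tau>' = (\<mu>\<^sup>2 * (E (a+c) (b+d) - E a b)) / (\<mu>\<^sup>2 * (E c d - E a b))"
    unfolding lam_eq_lamr[OF t'] lamr_def by (simp add: algebra_simps)
  thus ?thesis using m0 by (simp add: \<tau>'_def)
qed

text \<open>The orbit of x under the anharmonic group, which permutes 0, 1 and infinity.\<close>

definition six :: "complex \<Rightarrow> complex set" where
  "six x = {x, 1 - x, 1 / x, x / (x - 1), (x - 1) / x, 1 / (1 - x)}"

text \<open>The classes of half periods modulo the lattice depend only on the matrix modulo 2, and
  SL(2, Z/2) has six elements, one for each permutation of e1, e2, e3.\<close>

lemma lam_mob_six: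
  fixes a b c d :: int
  assumes t: "Im \<tau> > 0" and det: "a * d - b * c = 1"
  shows "even b \<Longrightarrow> even c \<Longrightarrow> lam (mob a b c d \<tau>) = lam \<tau>"
    "even a \<Longrightarrow> even d \<Longrightarrow> lam (mob a b c d \<tau>) = 1 - lam \<tau>"
    "odd b \<Longrightarrow> even c \<Longrightarrow> lam (mob a b c d \<tau>) = lam \<tau> / (lam \<tau> - 1)"
    "lam (mob a b c d \<tau>) \<in> six (lam \<tau>)"
proof -
  define x where "x = lam \<tau>"
  define D where "D = we1 \<tau> - we2 \<tau>"
  have D0: "D \<noteq> 0" using we_distinct[OF t] by (simp add: D_def)
  have e1: "we1 \<tau> = we2 \<tau> + D" by (simp add: D_def)
  have e3: "we3 \<tau> = we2 \<tau> + x * D" using D0 by (simp add: x_def lam_eq_lamr[OF t] lamr_def D_def)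
  have x: "x \<noteq> 0" "x - 1 \<noteq> 0" "1 - x \<noteq> 0" using lam_neq[OF t] by (auto simp: x_def)
  have quot: "(x * D - D) / (- D) = 1 - x" "D / (x * D) = 1 / x" "- (x * D) / (D - x * D) = x / (x - 1)"
     "(D - x * D) / (- (x * D)) = (x - 1) / x" "- D / (x * D - D) = 1 / (1 - x)"
    using D0 x by (simp_all add: divide_simps) (simp_all add: algebra_simps)
  have od: "odd (a * d - b * c)" using det by simp
  note L = lam_mob[OF t det]
  note W = wp_half_values[OF t]
  consider (1) "odd a" "even b" "even c" "odd d" | (2) "even a" "odd b" "odd c" "even d"
    | (3) "odd a" "odd b" "even c" "odd d" | (4) "odd a" "even b" "odd c" "odd d"
    | (5) "even a" "odd b" "odd c" "odd d" | (6) "odd a" "odd b" "odd c" "even d"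
    using od by auto
  note cs = this
  have A: "lam (mob a b c d \<tau>) = x" if "odd a" "even b" "even c" "odd d"
    using that L W(1)[of c d] W(2)[of a b] W(3)[of "a+c" "b+d"] D0 by (simp add: e1 e3)
  have B: "lam (mob a b c d \<tau>) = 1 - x" if "even a" "odd b" "odd c" "even d"
    using that L W(2)[of c d] W(1)[of a b] W(3)[of "a+c" "b+d"] quot by (simp add: e1 e3)
  have C: "lam (mob a b c d \<tau>) = x / (x - 1)" if "odd a" "odd b" "even c" "odd d"
    using that L W(1)[of c d] W(3)[of a b] W(2)[of "a+c" "b+d"] quot by (simp add: e1 e3)
  have E: "lam (mob a b c d \<tau>) = 1 / x" if "odd a" "even b" "odd c" "odd d"
    using that L W(3)[of c d] W(2)[of a b] W(1)[of "a+c" "b+d"] quot by (simp add: e1 e3)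
  have F: "lam (mob a b c d \<tau>) = 1 / (1 - x)" if "even a" "odd b" "odd c" "odd d"
    using that L W(3)[of c d] W(1)[of a b] W(2)[of "a+c" "b+d"] quot by (simp add: e1 e3)
  have G: "lam (mob a b c d \<tau>) = (x - 1) / x" if "odd a" "odd b" "odd c" "even d"
    using that L W(2)[of c d] W(3)[of a b] W(1)[of "a+c" "b+d"] quot by (simp add: e1 e3)
  show "even b \<Longrightarrow> even c \<Longrightarrow> lam (mob a b c d \<tau>) = lam \<tau>" using A od by (auto simp: x_def)
  show "even a \<Longrightarrow> even d \<Longrightarrow> lam (mob a b c d \<tau>) = 1 - lam \<tau>" using B od by (auto simp: x_def)
  show "odd b \<Longrightarrow> even c \<Longrightarrow> lam (mob a b c d \<tau>) = lam \<tau> / (lam \<tau> - 1)" using C od by (auto simp: x_def)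
  show "lam (mob a b c d \<tau>) \<in> six (lam \<tau>)"
    using cs by cases (simp_all add: A B C E F G six_def x_def)
qed

lemma lam_S: "Im \<tau> > 0 \<Longrightarrow> lam (- 1 / \<tau>) = 1 - lam \<tau>"
  using lam_mob_six(2)[of \<tau> 0 0 "-1" 1] by (simp add: mob_def)

lemma lam_T: "Im \<tau> > 0 \<Longrightarrow> lam (\<tau> + 1) = lam \<tau> / (lam \<tau> - 1)"
  using lam_mob_six(3)[of \<tau> 1 1 1 0] by (simp add: mob_def)

text \<open>Up to the factor 256 this is the modular invariant j in terms of lambda.\<close>

definition Jf :: "complex \<Rightarrow> complex" where "Jf x = (x\<^sup>2 - x + 1)^3 / (x\<^sup>2 * (x - 1)\<^sup>2)"

lemma Jf_six: "x \<noteq> 0 \<Longrightarrow> x \<noteq> 1 \<Longrightarrow> y \<in> six x \<Longrightarrow> Jf y = Jf x"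
proof -
  assume x: "x \<noteq> 0" "x \<noteq> 1" and y: "y \<in> six x"
  have S: "Jf (1 - z) = Jf z" for z
  proof -
    have h: "(1-z)\<^sup>2 - (1-z) + 1 = z\<^sup>2 - z + 1" "(1-z)\<^sup>2 * (1-z-1)\<^sup>2 = z\<^sup>2 * (z-1)\<^sup>2"
      by (simp_all add: power2_eq_square algebra_simps)
    show ?thesis unfolding Jf_def h ..
  qed
  have I: "Jf (1 / z) = Jf z" if z: "z \<noteq> 0" for z
  proof -
    have 1: "(1/z)\<^sup>2 - 1/z + 1 = (z\<^sup>2 - z + 1) / z\<^sup>2" using z by (simp add: field_simps power2_eq_square)
    have 2: "(1/z)\<^sup>2 * (1/z - 1)\<^sup>2 = z\<^sup>2 * (z - 1)\<^sup>2 / (z\<^sup>2)^3" using z by (simp add: field_simps power2_eq_square eval_nat_numeral)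
    have "Jf (1 / z) = ((z\<^sup>2 - z + 1) / z\<^sup>2)^3 / (z\<^sup>2 * (z - 1)\<^sup>2 / (z\<^sup>2)^3)" unfolding Jf_def 1 2 ..
    thus ?thesis using z by (simp add: Jf_def power_divide)
  qed
  have n: "1 - x \<noteq> 0" "x - 1 \<noteq> 0" using x by auto
  have T: "x / (x - 1) = 1 - 1 / (1 - x)" using n by (simp add: field_simps)
  have U: "(x - 1) / x = 1 - 1 / x" using x by (simp add: field_simps)
  show "Jf y = Jf x" using y unfolding six_def T U by (auto simp: S I x n)
qed

text \<open>After cross-multiplication the difference of the two sides splits into six factors, one
  for each element of \<open>six y\<close>.\<close>

lemma Jf_eq_six:
  assumes x: "x \<noteq> 0" "x \<noteq> 1" and y: "y \<noteq> 0" "y \<noteq> 1" and eq: "Jf x = Jf y"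
  shows "x \<in> six y"
proof -
  have "(x\<^sup>2 - x + 1)^3 * (y\<^sup>2 * (y - 1)\<^sup>2) = (y\<^sup>2 - y + 1)^3 * (x\<^sup>2 * (x - 1)\<^sup>2)"
    using eq x y unfolding Jf_def by (simp add: frac_eq_eq)
  moreover have "(x\<^sup>2 - x + 1)^3 * (y\<^sup>2 * (y - 1)\<^sup>2) - (y\<^sup>2 - y + 1)^3 * (x\<^sup>2 * (x - 1)\<^sup>2)
     = - ((x - y) * (x + y - 1) * (x * y - 1) * (x * (1 - y) - 1) * (x * y - y + 1) * (x * (y - 1) - y))"
    by algebra
  ultimately have "(x - y) * (x + y - 1) * (x * y - 1) * (x * (1 - y) - 1) * (x * y - y + 1) * (x * (y - 1) - y) = 0"
    by simp
  hence "x - y = 0 \<or> x + y - 1 = 0 \<or> x * y - 1 = 0 \<or> x * (1 - y) - 1 = 0 \<or> x * y - y + 1 = 0 \<or> x * (y - 1) - y = 0" by simp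
  moreover have "1 - y \<noteq> 0" "y - 1 \<noteq> 0" using y by auto
  ultimately have "x = y \<or> x = 1 - y \<or> x = 1 / y \<or> x = 1 / (1 - y) \<or> x = (y - 1) / y \<or> x = y / (y - 1)"
    using y by (simp add: eq_divide_eq) (auto simp: algebra_simps)
  thus ?thesis by (auto simp: six_def)
qed

section \<open>The covering of the twice punctured plane\<close>

lemma lattice_ball_finite:
  assumes t: "Im \<tau> > 0"
  shows "finite {(c::int, d::int). norm (of_int c * \<tau> + of_int d) \<le> R}"
proof (rule finite_subset)
  define k where "k = \<lceil>R / Im \<tau>\<rceil>"
  define l where "l = \<lceil>R + R / Im \<tau> * norm \<tau>\<rceil>"
  show "finite ({-k..k} \<times> {-l..l})" by simp
  show "{(c::int, d::int). norm (of_int c * \<tau> + of_int d) \<le> R} \<subseteq> {-k..k} \<times> {-l..l}"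
  proof clarify
    fix c d :: int assume n: "norm (of_int c * \<tau> + of_int d) \<le> R"
    have "\<bar>of_int c * Im \<tau>\<bar> \<le> R" using abs_Im_le_cmod[of "of_int c * \<tau> + of_int d"] n by simp
    hence c: "\<bar>real_of_int c\<bar> \<le> R / Im \<tau>" using t by (simp add: abs_mult field_simps)
    have "\<bar>real_of_int d\<bar> = norm ((of_int c * \<tau> + of_int d) - of_int c * \<tau>)" by simp
    also have "\<dots> \<le> R + \<bar>real_of_int c\<bar> * norm \<tau>"
      using norm_triangle_ineq4[of "of_int c * \<tau> + of_int d" "of_int c * \<tau>"] n by (simp add: norm_mult)
    also have "\<dots> \<le> R + R / Im \<tau> * norm \<tau>" using c by (intro add_left_mono mult_right_mono) auto
    finally have d: "\<bar>real_of_int d\<bar> \<le> R + R / Im \<tau> * norm \<tau>" .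
    have ck: "\<bar>real_of_int c\<bar> \<le> of_int k" "\<bar>real_of_int d\<bar> \<le> of_int l"
      using c d unfolding k_def l_def by linarith+
    hence "\<bar>c\<bar> \<le> k" "\<bar>d\<bar> \<le> l" by linarith+
    thus "c \<in> {-k..k} \<and> d \<in> {-l..l}" by auto
  qed
qed

text \<open>A row (c, d) that minimizes |c \<tau> + d| is coprime, so it completes to a matrix, and
  a translation adjusts the real part. Comparison with the row (a, b) shows that the new point has
  modulus at least 1; the resulting bound 1/2 on the imaginary part is all that compactness
  requires.\<close>

lemma reduction:
  assumes t: "Im \<tau> > 0"
  obtains a b c d :: int where "a * d - b * c = 1" "\<bar>Re (mob a b c d \<tau>)\<bar> \<le> 1/2" "Im (mob a b c d \<tau>) \<ge> 1/2"
proof -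
  define f where "f = (\<lambda>(c::int, d::int). norm (of_int c * \<tau> + of_int d))"
  \<comment> \<open>Finitely many rows have norm at most 1, and (0, 1) is one of them, so a minimum
    over A is a minimum over all nonzero rows.\<close>
  define A where "A = {p. f p \<le> 1} - {(0,0)}"
  have "finite {p. f p \<le> 1}" using lattice_ball_finite[OF t, of 1] unfolding f_def by (simp add: case_prod_unfold)
  hence fA: "finite A" by (simp add: A_def)
  have A1: "(0,1) \<in> A" by (simp add: A_def f_def)
  define p where "p = arg_min_on f A"
  have pA: "p \<in> A" and pm: "\<not> (\<exists>x\<in>A. f x < f p)" using arg_min_if_finite[OF fA, of f] A1 unfolding p_def by blast+
  have min: "f p \<le> f x" if "x \<noteq> (0,0)" for x
  proof (cases "f x \<le> 1")
    case True thus ?thesis using that pm by (force simp: A_def)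
  next
    case False thus ?thesis using pA by (simp add: A_def)
  qed
  obtain c d where cd: "p = (c, d)" by (cases p)
  have nz: "(c, d) \<noteq> (0,0)" using pA cd by (simp add: A_def)
  have cop: "gcd c d = 1"
  proof -
    define g where "g = gcd c d"
    have g0: "g > 0" using nz by (auto simp: g_def)
    obtain c' d' where c': "c = g * c'" "d = g * d'" unfolding g_def by (meson dvdE gcd_dvd1 gcd_dvd2)
    have "(c', d') \<noteq> (0,0)" using nz c' by auto
    hence le: "f (c, d) \<le> f (c', d')" using min cd by metis
    have "f (c, d) = of_int g * f (c', d')"
    proof -
      have "of_int c * \<tau> + of_int d = of_int g * (of_int c' * \<tau> + of_int d')" by (simp add: c' algebra_simps)
      thus ?thesis using g0 by (simp add: f_def norm_mult)
    qed
    moreover have "f (c', d') > 0"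
    proof -
      have "of_int c' * \<tau> + of_int d' \<noteq> of_int 0 * \<tau> + of_int 0" using \<open>(c', d') \<noteq> (0,0)\<close> Lat_coord_unique[OF t] by blast
      thus ?thesis by (simp add: f_def)
    qed
    ultimately have "real_of_int g \<le> 1" using le by simp
    thus ?thesis using g0 unfolding g_def by linarith
  qed
  obtain u v where uv: "u * c + v * d = 1" using bezout_int[of c d] cop by metis
  define n where "n = round (Re (mob v (-u) c d \<tau>))"
  define a b where "a = v - n * c" and "b = - u - n * d"
  have det: "a * d - b * c = 1" using uv by (simp add: a_def b_def algebra_simps)
  have detr: "real_of_int a * real_of_int d - real_of_int b * real_of_int c = 1"
    using arg_cong[OF det, of real_of_int] by simp
  define m where "m = of_int c * \<tau> + of_int d"
  have m0: "m \<noteq> 0" using mob_denom_neq_0[OF t detr] by (simp add: m_def)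
  have sh: "mob a b c d \<tau> = mob v (-u) c d \<tau> - of_int n"
  proof -
    have "mob a b c d \<tau> = ((of_int v * \<tau> + of_int (-u)) - of_int n * m) / m" by (simp add: mob_def m_def a_def b_def algebra_simps)
    also have "\<dots> = (of_int v * \<tau> + of_int (-u)) / m - of_int n" using m0 by (simp add: diff_divide_distrib)
    finally show ?thesis by (simp add: mob_def m_def)
  qed
  have re: "\<bar>Re (mob a b c d \<tau>)\<bar> \<le> 1/2"
    unfolding sh n_def using of_int_round_abs_le[of "Re (mob v (-u) c d \<tau>)"] by (simp add: abs_minus_commute)
  have "(a, b) \<noteq> (0,0)" using det by auto
  hence "f (c, d) \<le> f (a, b)" using min cd by metis
  hence "norm (mob a b c d \<tau>) \<ge> 1" using m0 by (simp add: f_def mob_def norm_divide m_def)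
  hence "1 \<le> (Re (mob a b c d \<tau>))\<^sup>2 + (Im (mob a b c d \<tau>))\<^sup>2" by (simp add: cmod_power2[symmetric] one_le_power)
  moreover have "(Re (mob a b c d \<tau>))\<^sup>2 \<le> (1/2)\<^sup>2" using re by (simp only: abs_le_square_iff[symmetric])
  ultimately have "(1/2)\<^sup>2 \<le> (Im (mob a b c d \<tau>))\<^sup>2" by (simp add: power2_eq_square)
  hence "1/2 \<le> Im (mob a b c d \<tau>)"
    using mob_Im(2)[OF t detr] by (simp only: abs_le_square_iff[symmetric])
  thus thesis using that det re by blast
qed

lemma UH_open: "open UH" by (rule open_halfspace_Im_gt)
lemma UH_convex: "convex UH" by (rule convex_halfspace_Im_gt)

section \<open>Surjectivity of lambda\<close>

lemma Jf_large:
  assumes K: "K > 0" obtains e where "e > 0" "\<And>x. x \<noteq> 0 \<Longrightarrow> norm x < e \<Longrightarrow> norm (Jf x) > K"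
proof
  \<comment> \<open>For |x| < e \<le> 1/8 the numerator is at least (1/2)^3 and the denominator at
    most 4 e^2; the quotient of these bounds is 2 (K + 1)^2.\<close>
  define e where "e = 1 / (8 * (K + 1))"
  show e0: "e > 0" using K by (simp add: e_def)
  have e8: "e \<le> 1/8" using K by (simp add: e_def field_simps)
  fix x :: complex assume x: "x \<noteq> 0" "norm x < e"
  have nx: "norm x < 1/8" using x e8 by simp
  have "norm (x\<^sup>2 - x) \<le> norm x * norm x + norm x" using norm_triangle_ineq4[of "x\<^sup>2" x] by (simp add: norm_power power2_eq_square norm_mult)
  also have "\<dots> \<le> 1 * (1/8) + 1/8" using nx by (intro add_mono mult_mono) auto
  finally have "norm (x\<^sup>2 - x + 1) \<ge> 1/2" using norm_diff_ineq[of 1 "x\<^sup>2 - x"] by (simp add: add.commute)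
  hence num: "norm ((x\<^sup>2 - x + 1)^3) \<ge> (1/2)^3" unfolding norm_power by (intro power_mono) auto
  have "norm (x - 1) \<le> 2" using norm_triangle_ineq4[of x 1] nx by simp
  hence "norm ((x - 1)\<^sup>2) \<le> 2\<^sup>2" unfolding norm_power by (intro power_mono) auto
  hence "norm (x\<^sup>2 * (x - 1)\<^sup>2) \<le> (norm x)\<^sup>2 * 2\<^sup>2" unfolding norm_mult norm_power[of x] by (intro mult_left_mono) auto
  also have "\<dots> \<le> e\<^sup>2 * 2\<^sup>2" using x by (intro mult_right_mono power_mono) auto
  finally have den: "norm (x\<^sup>2 * (x - 1)\<^sup>2) \<le> 4 * e\<^sup>2" by simp
  have dpos: "norm (x\<^sup>2 * (x - 1)\<^sup>2) > 0" using x nx by auto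
  have "K < (1/2)^3 / (4 * e\<^sup>2)"
  proof -
    have "(1/2)^3 / (4 * e\<^sup>2) = 2 * (K + 1)\<^sup>2" using K by (simp add: e_def power2_eq_square power3_eq_cube field_simps)
    moreover have "K < 2 * (K + 1)\<^sup>2" using K by (simp add: power2_eq_square algebra_simps add_pos_pos)
    ultimately show ?thesis by simp
  qed
  also have "\<dots> \<le> norm ((x\<^sup>2 - x + 1)^3) / norm (x\<^sup>2 * (x - 1)\<^sup>2)"
    by (rule frac_le[OF _ num dpos den]) simp
  finally show "norm (Jf x) > K" by (simp add: Jf_def norm_divide)
qed

text \<open>The image is open because J(lambda) is holomorphic and not constant. It is closed
  because, near a limit value, preimages can be reduced into a compact rectangle: high up towards
  the cusp J is too large. The invariance of J under all of SL(2, Z) is what makes this reduction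
  possible.\<close>

lemma Jf_lam_surj: obtains \<tau> where "Im \<tau> > 0" "Jf (lam \<tau>) = y"
proof -
  define F where "F = (\<lambda>\<tau>. Jf (lam \<tau>))"
  have Fh: "F holomorphic_on UH" unfolding F_def Jf_def[abs_def]
    by (intro holomorphic_intros lam_holo) (use lam_neq in auto)
  have large: "\<exists>Y>1. \<forall>\<tau>. Im \<tau> \<ge> Y \<longrightarrow> norm (F \<tau>) > K" if K: "K > 0" for K
  proof -
    obtain e where e: "e > 0" "\<And>x. x \<noteq> 0 \<Longrightarrow> norm x < e \<Longrightarrow> norm (Jf x) > K" using Jf_large[OF K] by blast
    obtain Y where Y: "\<And>\<tau>. Im \<tau> \<ge> Y \<Longrightarrow> norm (lam \<tau>) < e" using lam_tendsto_0[OF e(1)] by blast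
    have "norm (F \<tau>) > K" if "Im \<tau> \<ge> max Y 2" for \<tau>
      unfolding F_def using that by (intro e Y lam_neq) auto
    thus ?thesis by (intro exI[of _ "max Y 2"]) auto
  qed
  have ii: "\<i> \<in> UH" by simp
  have nc: "\<not> F constant_on UH"
  proof
    assume "F constant_on UH"
    then obtain k where k: "\<And>\<tau>. \<tau> \<in> UH \<Longrightarrow> F \<tau> = k" unfolding constant_on_def by auto
    obtain Y where Y: "Y > 1" "\<forall>\<tau>. Im \<tau> \<ge> Y \<longrightarrow> norm (F \<tau>) > norm k + 1" using large[of "norm k + 1"] by (auto simp: add_nonneg_pos)
    have "norm (F (\<i> * of_real Y)) > norm k + 1" using Y(2)[rule_format, of "\<i> * of_real Y"] by simp
    moreover have "F (\<i> * of_real Y) = k" using Y(1) by (intro k) simp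
    ultimately show False by simp
  qed
  have op: "open (F ` UH)"
    by (rule open_mapping_thm[OF Fh UH_open convex_connected[OF UH_convex] UH_open order_refl nc])
  have red: "\<exists>\<tau>'. F \<tau>' = F \<tau> \<and> \<bar>Re \<tau>'\<bar> \<le> 1/2 \<and> Im \<tau>' \<ge> 1/2" if t: "Im \<tau> > 0" for \<tau>
  proof -
    obtain a b c d :: int where m: "a * d - b * c = 1" "\<bar>Re (mob a b c d \<tau>)\<bar> \<le> 1/2" "Im (mob a b c d \<tau>) \<ge> 1/2"
      using reduction[OF t] by metis
    have "F (mob a b c d \<tau>) = F \<tau>" unfolding F_def
      using Jf_six[OF lam_neq[OF t] lam_mob_six(4)[OF t m(1)]] .
    thus ?thesis using m by blast
  qed
  have cl: "closed (F ` UH)"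
  proof (subst closure_subset_eq[symmetric])
    show "closure (F ` UH) \<subseteq> F ` UH"
    proof
      fix z assume z: "z \<in> closure (F ` UH)"
      obtain Y where Y: "Y > 1" "\<forall>\<tau>. Im \<tau> \<ge> Y \<longrightarrow> norm (F \<tau>) > norm z + 1" using large[of "norm z + 1"] by (auto simp: add_nonneg_pos)
      define K where "K = cbox (Complex (-1/2) (1/2)) (Complex (1/2) Y)"
      have KU: "K \<subseteq> UH" by (auto simp: K_def in_cbox_complex_iff)
      have "compact (F ` K)"
        by (intro compact_continuous_image holomorphic_on_imp_continuous_on holomorphic_on_subset[OF Fh KU]) (simp add: K_def)
      hence cK: "closed (F ` K)" by (rule compact_imp_closed)
      have sub: "ball z 1 \<inter> F ` UH \<subseteq> F ` K"
      proof
        fix w assume w: "w \<in> ball z 1 \<inter> F ` UH"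
        then obtain \<tau> where "Im \<tau> > 0" "w = F \<tau>" by auto
        then obtain \<tau>' where \<tau>': "F \<tau>' = w" "\<bar>Re \<tau>'\<bar> \<le> 1/2" "Im \<tau>' \<ge> 1/2" using red by metis
        have "norm w \<le> norm z + 1" using w norm_triangle_ineq2[of w z] by (auto simp: dist_norm norm_minus_commute)
        hence "Im \<tau>' < Y" using Y(2) \<tau>'(1) by (meson not_le)
        hence "\<tau>' \<in> K" using \<tau>' by (auto simp: K_def in_cbox_complex_iff)
        thus "w \<in> F ` K" using \<tau>'(1) by blast
      qed
      have "z \<in> ball z 1 \<inter> closure (F ` UH)" using z by simp
      hence "z \<in> closure (ball z 1 \<inter> F ` UH)" using open_Int_closure_subset[OF open_ball] by blast
      hence "z \<in> F ` K" using closure_minimal[OF sub cK] by blast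
      thus "z \<in> F ` UH" using KU by blast
    qed
  qed
  have "F ` UH = UNIV" using op cl ii clopen by (metis empty_iff image_is_empty)
  thus thesis using that unfolding F_def by (metis (mono_tags, lifting) UNIV_I imageE mem_Collect_eq)
qed

lemma lam_surj: assumes x: "x \<noteq> 0" "x \<noteq> 1" obtains \<tau> where "Im \<tau> > 0" "lam \<tau> = x"
proof -
  obtain \<tau> where t: "Im \<tau> > 0" "Jf (lam \<tau>) = Jf x" using Jf_lam_surj .
  define y where "y = lam \<tau>"
  have y: "y \<noteq> 0" "y \<noteq> 1" "1 - y \<noteq> 0" "y - 1 \<noteq> 0" using lam_neq[OF t(1)] by (auto simp: y_def)
  have S: "\<exists>\<tau>. Im \<tau> > 0 \<and> lam \<tau> = 1 - z" if ex: "\<exists>\<tau>. Im \<tau> > 0 \<and> lam \<tau> = z" for z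
  proof -
    obtain s where s: "Im s > 0" "lam s = z" using ex by blast
    have "Im (- 1 / s) > 0" using s(1) by (simp add: Im_divide zero_less_divide_iff sum_power2_gt_zero_iff)
    thus ?thesis using lam_S[OF s(1)] s(2) by blast
  qed
  have T: "\<exists>\<tau>. Im \<tau> > 0 \<and> lam \<tau> = z / (z - 1)" if ex: "\<exists>\<tau>. Im \<tau> > 0 \<and> lam \<tau> = z" for z
  proof -
    obtain s where s: "Im s > 0" "lam s = z" using ex by blast
    show ?thesis using lam_T[OF s(1)] s by (intro exI[of _ "s + 1"]) auto
  qed
  have 0: "\<exists>\<tau>. Im \<tau> > 0 \<and> lam \<tau> = y" using t y_def by blast
  have e: "1 - y / (y - 1) = 1 / (1 - y)" "(1 - y) / (1 - y - 1) = (y - 1) / y" "1 - (y - 1) / y = 1 / y"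
    using y by (simp_all add: field_simps)
  have "\<exists>\<tau>. Im \<tau> > 0 \<and> lam \<tau> = x"
    using Jf_eq_six[OF x y(1,2)] t(2) 0 S[OF 0] T[OF 0] S[OF T[OF 0]] T[OF S[OF 0]] S[OF T[OF S[OF 0]]]
    unfolding six_def e by (auto simp: y_def)
  thus thesis using that by blast
qed

section \<open>Proper discontinuity of Gamma(2)\<close>

text \<open>At a fixed point |c \<tau> + d| = 1, and c \<tau> + d has real part (a + d) / 2, an
  integer since a and d are odd. If c \<noteq> 0, this integer is 0, and then -a^2 - b c = 1 with a
  odd and b, c even fails modulo 4.\<close>

lemma Gamma2_free:
  fixes a b c d :: int
  assumes t: "Im \<tau> > 0" and ev: "even b" "even c" and det: "a * d - b * c = 1" and fx: "mob a b c d \<tau> = \<tau>"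
  shows "b = 0 \<and> c = 0 \<and> (a = 1 \<and> d = 1 \<or> a = -1 \<and> d = -1)"
proof -
  have detr: "real_of_int a * real_of_int d - real_of_int b * real_of_int c = 1"
    using arg_cong[OF det, of real_of_int] by simp
  have "(norm (of_real c * \<tau> + of_real d))\<^sup>2 = 1" using mob_Im(1)[OF t detr] t unfolding fx by simp
  hence n: "(of_int c * Re \<tau> + of_int d)\<^sup>2 + (of_int c * Im \<tau>)\<^sup>2 = 1" by (simp add: cmod_power2)
  have "\<tau> * (of_int c * \<tau> + of_int d) = of_int a * \<tau> + of_int b"
    using fx mob_denom_neq_0[OF t detr] by (simp add: mob_def field_simps)
  from arg_cong[OF this, of Im] arg_cong[OF this, of Re]
  have im: "(2 * of_int c * Re \<tau>) * Im \<tau> = (of_int a - of_int d) * Im \<tau>"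
    and re: "of_int c * ((Re \<tau>)\<^sup>2 - (Im \<tau>)\<^sup>2) + of_int d * Re \<tau> = of_int a * Re \<tau> + of_int b"
    by (simp_all add: algebra_simps power2_eq_square)
  have im: "2 * of_int c * Re \<tau> = of_int a - of_int d" using im t by simp
  have "a * d = 1 + b * c" using det by simp
  hence "odd (a * d)" using ev by simp
  hence od: "odd a" "odd d" by simp_all
  have c0: "c = 0"
  proof (rule ccontr)
    assume c: "c \<noteq> 0"
    obtain k where k: "a + d = 2 * k" using od by (metis even_add evenE)
    have "of_int c * Re \<tau> + of_int d = real_of_int k" using im arg_cong[OF k, of real_of_int] by simp
    hence "(real_of_int k)\<^sup>2 < 1" using n c t by (metis add_less_same_cancel1 less_add_same_cancel1 mult_eq_0_iff of_int_eq_0_iff less_irrefl zero_less_power2)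
    hence "k = 0" by (simp add: power2_less_imp_less abs_square_less_1)
    hence d: "d = - a" using k by simp
    obtain e f g where efg: "a = 2 * e + 1" "b = 2 * f" "c = 2 * g" using od ev by (meson evenE oddE)
    have "4 * (e * e + e + f * g) = - 2" using det unfolding d efg by (simp add: algebra_simps)
    thus False by presburger
  qed
  have ad: "a = d" using im c0 by simp
  have "b = 0" using re c0 ad by simp
  moreover have "a * a = 1" using det c0 ad by simp
  hence "a = 1 \<or> a = -1" by (simp add: square_eq_1_iff)
  ultimately show ?thesis using c0 ad by auto
qed

lemma det_real: "a * d - b * c = (1::int) \<Longrightarrow> real_of_int a * real_of_int d - real_of_int b * real_of_int c = 1"
  by (metis of_int_1 of_int_diff of_int_mult)

lemma lam_eqD:
  assumes t: "Im \<tau> > 0" and t': "Im \<tau>' > 0" and eq: "lam \<tau> = lam \<tau>'"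
  obtains a b c d :: int where "even b" "even c" "a * d - b * c = 1" "\<tau>' = mob a b c d \<tau>"
proof -
  obtain a b c d :: int where "even b" "even c" "a * d - b * c = 1"
    "of_int c * \<tau> + of_int d \<noteq> 0" "\<tau>' * (of_int c * \<tau> + of_int d) = of_int a * \<tau> + of_int b"
    using lamr_inj[OF t t'] eq lam_eq_lamr[OF t] lam_eq_lamr[OF t'] by metis
  thus thesis using that[of b c a d] by (simp add: mob_def nonzero_eq_divide_eq)
qed

lemma entries_bound:
  assumes h: "h > 0" "Im \<tau> \<ge> h" "norm \<tau> \<le> R" and n: "norm (of_int c * \<tau> + of_int d) \<le> B"
  shows "\<bar>real_of_int c\<bar> \<le> B / h" "\<bar>real_of_int d\<bar> \<le> B + B / h * R"
proof -
  have B0: "B \<ge> 0" using n norm_ge_zero order_trans by blast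
  have "\<bar>of_int c * Im \<tau>\<bar> \<le> B" using abs_Im_le_cmod[of "of_int c * \<tau> + of_int d"] n by simp
  moreover have "\<bar>real_of_int c\<bar> * h \<le> \<bar>of_int c * Im \<tau>\<bar>" using h by (simp add: abs_mult mult_left_mono)
  ultimately show c: "\<bar>real_of_int c\<bar> \<le> B / h" using h by (simp add: field_simps)
  have "\<bar>real_of_int d\<bar> = norm ((of_int c * \<tau> + of_int d) - of_int c * \<tau>)" by simp
  also have "\<dots> \<le> B + \<bar>real_of_int c\<bar> * norm \<tau>"
    using norm_triangle_ineq4[of "of_int c * \<tau> + of_int d" "of_int c * \<tau>"] n by (simp add: norm_mult)
  also have "\<dots> \<le> B + B / h * R" using c h B0 by (intro add_left_mono mult_mono) auto
  finally show "\<bar>real_of_int d\<bar> \<le> B + B / h * R" .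
qed

text \<open>Only finitely many integral matrices of determinant 1 bring a point of a small disc back
  into it. Those in Gamma(2) other than plus or minus the identity move the centre by
  \<open>Gamma2_free\<close>, so a smaller disc is disjoint from its images under them.\<close>

lemma Gamma2_separation:
  assumes t0: "Im \<tau>0 > 0"
  obtains e where "e > 0" "ball \<tau>0 e \<subseteq> UH"
    "\<And>(a::int) b c d \<tau>. even b \<Longrightarrow> even c \<Longrightarrow> a * d - b * c = 1 \<Longrightarrow> \<tau> \<in> ball \<tau>0 e \<Longrightarrow> mob a b c d \<tau> \<in> ball \<tau>0 e
       \<Longrightarrow> b = 0 \<and> c = 0 \<and> (a = 1 \<and> d = 1 \<or> a = -1 \<and> d = -1)"
proof -
  define h where "h = Im \<tau>0 / 2"
  define R where "R = norm \<tau>0 + h"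
  have h0: "h > 0" using t0 by (simp add: h_def)
  have near: "Im \<tau> \<ge> h" "Im \<tau> \<le> 3 * h" "norm \<tau> \<le> R" if "\<tau> \<in> ball \<tau>0 h" for \<tau>
  proof -
    have d: "norm (\<tau> - \<tau>0) < h" using that by (simp add: dist_norm norm_minus_commute)
    thus "Im \<tau> \<ge> h" "Im \<tau> \<le> 3 * h" using abs_Im_le_cmod[of "\<tau> - \<tau>0"] by (auto simp: h_def)
    show "norm \<tau> \<le> R" using norm_triangle_ineq2[of \<tau> \<tau>0] d by (simp add: R_def)
  qed
  have R0: "R \<ge> 0" using h0 by (simp add: R_def)
  \<comment> \<open>Collects the bounds of \<open>entries_bound\<close> for rows (c, d) of norm at
    most 2 and rows (a, b) of norm at most 2 R.\<close>
  define N where "N = max (\<lceil>2 + 2 / h * R\<rceil>) (max \<lceil>2 / h\<rceil> (max \<lceil>2 * R / h\<rceil> \<lceil>2 * R + 2 * R / h * R\<rceil>))"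
  define F where "F = ({-N..N} \<times> {-N..N} \<times> {-N..N} \<times> {-N..N})"
  define F' where "F' = {(a,b,c,d) \<in> F. even b \<and> even c \<and> a * d - b * c = 1 \<and> \<not> (b = 0 \<and> c = 0 \<and> (a = 1 \<and> d = 1 \<or> a = -1 \<and> d = -1))}"
  have fin: "finite F'" by (rule finite_subset[of _ F]) (auto simp: F'_def F_def)
  have inF: "(a,b,c,d) \<in> F" if det: "a * d - b * c = 1" and b1: "\<tau> \<in> ball \<tau>0 h" and b2: "mob a b c d \<tau> \<in> ball \<tau>0 h" for a b c d :: int and \<tau>
  proof -
    have t: "Im \<tau> > 0" using near(1)[OF b1] h0 by linarith
    note dr = det_real[OF det]
    define m where "m = of_int c * \<tau> + of_int d"
    have "h * (norm m)\<^sup>2 \<le> Im (mob a b c d \<tau>) * (norm m)\<^sup>2" using near(1)[OF b2] by (intro mult_right_mono) auto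
    also have "\<dots> \<le> 3 * h" using mob_Im(1)[OF t dr] near(2)[OF b1] by (simp add: m_def)
    finally have "(norm m)\<^sup>2 \<le> 3" using h0 by simp
    also have "\<dots> \<le> 2\<^sup>2" by simp
    finally have m2: "norm m \<le> 2" by (rule power2_le_imp_le) simp
    have "mob a b c d \<tau> * m = of_int a * \<tau> + of_int b"
      using mob_denom_neq_0[OF t dr] by (simp add: mob_def m_def)
    hence "norm (of_int a * \<tau> + of_int b) = norm (mob a b c d \<tau>) * norm m" by (metis norm_mult)
    also have "\<dots> \<le> R * 2" using near(3)[OF b2] m2 R0 by (intro mult_mono) auto
    finally have ab: "norm (of_int a * \<tau> + of_int b) \<le> 2 * R" by simp
    have "\<bar>real_of_int c\<bar> \<le> of_int N" "\<bar>real_of_int d\<bar> \<le> of_int N" "\<bar>real_of_int a\<bar> \<le> of_int N" "\<bar>real_of_int b\<bar> \<le> of_int N"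
      using entries_bound[OF h0 near(1,3)[OF b1] m2[unfolded m_def]] entries_bound[OF h0 near(1,3)[OF b1] ab]
      unfolding N_def of_int_max by linarith+
    thus ?thesis unfolding F_def by (simp only: of_int_abs[symmetric] of_int_le_iff) auto
  qed
  have ev: "\<forall>M\<in>F'. eventually (\<lambda>e. \<forall>\<tau>\<in>ball \<tau>0 e. (case M of (a,b,c,d) \<Rightarrow> mob (of_int a) (of_int b) (of_int c) (of_int d) \<tau>) \<notin> ball \<tau>0 e) (at_right 0)"
  proof
    fix M assume M: "M \<in> F'"
    obtain a b c d where Me: "M = (a,b,c,d)" by (metis prod_cases4)
    have p: "even b" "even c" "a * d - b * c = 1" and n: "\<not> (b = 0 \<and> c = 0 \<and> (a = 1 \<and> d = 1 \<or> a = -1 \<and> d = -1))"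
      using M unfolding Me F'_def by auto
    define g where "g = mob a b c d"
    have ne: "g \<tau>0 \<noteq> \<tau>0" using Gamma2_free[OF t0 p] n unfolding g_def by blast
    define \<delta> where "\<delta> = dist (g \<tau>0) \<tau>0 / 2"
    have d0: "\<delta> > 0" using ne by (simp add: \<delta>_def)
    have "isCont g \<tau>0" using mob_cont[OF det_real[OF p(3)]] t0 UH_open
      unfolding g_def by (simp add: continuous_on_eq_continuous_at)
    then obtain e1 where e1: "e1 > 0" "\<And>\<tau>. dist \<tau> \<tau>0 < e1 \<Longrightarrow> dist (g \<tau>) (g \<tau>0) < \<delta>"
      using d0 unfolding continuous_at_eps_delta by blast
    have "eventually (\<lambda>e. e < min e1 \<delta>) (at_right 0)" using e1 d0 by (intro eventually_at_right_less[THEN eventually_mono] order_tendstoD(2)[OF tendsto_ident_at]) auto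
    thus "eventually (\<lambda>e. \<forall>\<tau>\<in>ball \<tau>0 e. (case M of (a,b,c,d) \<Rightarrow> mob (of_int a) (of_int b) (of_int c) (of_int d) \<tau>) \<notin> ball \<tau>0 e) (at_right 0)"
    proof eventually_elim
      case (elim e)
      show ?case
      proof (clarsimp simp: Me)
        fix \<tau> assume "dist \<tau>0 \<tau> < e" "dist \<tau>0 (mob a b c d \<tau>) < e"
        hence "dist (g \<tau>) (g \<tau>0) < \<delta>" "dist (g \<tau>) \<tau>0 < \<delta>" using elim e1(2)[of \<tau>] by (auto simp: dist_commute g_def)
        thus False using dist_triangle2[of "g \<tau>0" \<tau>0 "g \<tau>"] by (simp add: \<delta>_def dist_commute)
      qed
    qed
  qed
  have "eventually (\<lambda>e::real. 0 < e \<and> e < h) (at_right 0)"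
    using h0 by (intro eventually_conj eventually_at_right_less order_tendstoD(2)[OF tendsto_ident_at]) auto
  with eventually_ball_finite[OF fin ev]
  have "eventually (\<lambda>e. 0 < e \<and> e < h \<and> (\<forall>M\<in>F'. \<forall>\<tau>\<in>ball \<tau>0 e. (case M of (a,b,c,d) \<Rightarrow> mob (of_int a) (of_int b) (of_int c) (of_int d) \<tau>) \<notin> ball \<tau>0 e)) (at_right 0)"
    by eventually_elim auto
  then obtain e where e: "0 < e" "e < h" and
    sep: "\<forall>M\<in>F'. \<forall>\<tau>\<in>ball \<tau>0 e. (case M of (a,b,c,d) \<Rightarrow> mob (of_int a) (of_int b) (of_int c) (of_int d) \<tau>) \<notin> ball \<tau>0 e"
    using eventually_happens'[OF trivial_limit_at_right_real] by blast
  show thesis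
  proof (rule that[OF e(1)])
    show "ball \<tau>0 e \<subseteq> UH"
    proof
      fix \<tau> assume "\<tau> \<in> ball \<tau>0 e"
      hence "Im \<tau> \<ge> h" using e by (intro near(1)) auto
      thus "\<tau> \<in> UH" using h0 by simp
    qed
    fix a b c d :: int and \<tau> assume p: "even b" "even c" "a * d - b * c = 1" "\<tau> \<in> ball \<tau>0 e" "mob a b c d \<tau> \<in> ball \<tau>0 e"
    have "(a,b,c,d) \<in> F" using p e by (intro inF[of a d b c \<tau>]) auto
    moreover have "(a,b,c,d) \<notin> F'" using sep p by fastforce
    ultimately show "b = 0 \<and> c = 0 \<and> (a = 1 \<and> d = 1 \<or> a = -1 \<and> d = -1)" using p by (simp add: F'_def)
  qed
qed

lemma mob_inj_on: "a * d - b * c = 1 \<Longrightarrow> inj_on (mob a b c d) UH"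
  by (rule inj_on_inverseI[of _ "mob d (-b) (-c) a"]) (simp add: mob_inv)

text \<open>The image of a small disc is evenly covered, its sheets being the translates of the disc
  under Gamma(2). They exhaust the preimage by \<open>lam_eqD\<close>, and invariance of domain
  supplies openness and the inverse homeomorphisms.\<close>

lemma lam_covering: "covering_space UH lam (- {0, 1})"
proof (rule covering_spaceI)
  show c: "continuous_on UH lam" by (rule holomorphic_on_imp_continuous_on[OF lam_holo])
  show "lam ` UH = - {0, 1}"
  proof (intro equalityI subsetI)
    fix x assume "x \<in> lam ` UH" thus "x \<in> - {0,1}" using lam_neq by auto
  next
    fix x :: complex assume "x \<in> - {0,1}"
    then obtain \<tau> where "Im \<tau> > 0" "lam \<tau> = x" using lam_surj[of x] by auto
    thus "x \<in> lam ` UH" by blast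
  qed
  fix x :: complex assume "x \<in> - {0,1}"
  then obtain \<tau>0 where t0: "Im \<tau>0 > 0" "lam \<tau>0 = x" using lam_surj[of x] by auto
  obtain e where e: "e > 0" "ball \<tau>0 e \<subseteq> UH"
    and sep: "\<And>(a::int) b c d \<tau>. even b \<Longrightarrow> even c \<Longrightarrow> a * d - b * c = 1 \<Longrightarrow> \<tau> \<in> ball \<tau>0 e \<Longrightarrow> mob a b c d \<tau> \<in> ball \<tau>0 e
       \<Longrightarrow> b = 0 \<and> c = 0 \<and> (a = 1 \<and> d = 1 \<or> a = -1 \<and> d = -1)"
    using Gamma2_separation[OF t0(1)] by blast
  define B where "B = ball \<tau>0 e"
  have BU: "B \<subseteq> UH" using e by (simp add: B_def)
  have inj: "inj_on lam B"
  proof (rule inj_onI)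
    fix s t assume st: "s \<in> B" "t \<in> B" "lam s = lam t"
    have i: "Im s > 0" "Im t > 0" using st BU by auto
    obtain a b c d :: int where m: "even b" "even c" "a * d - b * c = 1" "t = mob a b c d s"
      by (rule lam_eqD[OF i st(3)])
    have "b = 0 \<and> c = 0 \<and> (a = 1 \<and> d = 1 \<or> a = -1 \<and> d = -1)" using sep[OF m(1-3)] st m(4) unfolding B_def by blast
    thus "s = t" using m(4) by auto
  qed
  define T where "T = lam ` B"
  have oT: "open T" unfolding T_def
    by (rule invariance_of_domain[OF continuous_on_subset[OF c BU] _ inj]) (simp add: B_def)
  define v where "v = {mob (of_int a) (of_int b) (of_int c) (of_int d) ` B | a b c d :: int. even b \<and> even c \<and> a * d - b * c = 1}"
  have v_mem: "\<And>a b c d :: int. even b \<Longrightarrow> even c \<Longrightarrow> a * d - b * c = 1 \<Longrightarrow> mob a b c d ` B \<in> v" unfolding v_def by blast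
  show "\<exists>T. x \<in> T \<and> openin (top_of_set (- {0, 1})) T \<and> (\<exists>v. \<Union> v = UH \<inter> lam -` T \<and>
         (\<forall>u\<in>v. openin (top_of_set UH) u) \<and> pairwise disjnt v \<and> (\<forall>u\<in>v. \<exists>q. homeomorphism u T lam q))"
  proof (intro exI[of _ T] exI[of _ v] conjI ballI)
    show "x \<in> T" using t0 e by (auto simp: T_def B_def)
    show "openin (top_of_set (- {0, 1})) T"
      by (rule open_subset[OF _ oT]) (use BU lam_neq in \<open>auto simp: T_def\<close>)
    show "\<Union> v = UH \<inter> lam -` T"
    proof (intro equalityI subsetI)
      fix s assume "s \<in> \<Union> v"
      then obtain a b c d :: int and t where m: "even b" "even c" "a * d - b * c = 1" "s = mob a b c d t" "t \<in> B"
        unfolding v_def by blast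
      have t: "Im t > 0" using BU m(5) by auto
      show "s \<in> UH \<inter> lam -` T" using mob_Im(2)[OF t det_real[OF m(3)]] lam_mob_six(1)[OF t m(3,1,2)] m(4,5)
        by (auto simp: T_def)
    next
      fix s assume s: "s \<in> UH \<inter> lam -` T"
      then obtain t where t: "t \<in> B" "lam t = lam s" by (auto simp: T_def)
      have i: "Im t > 0" "Im s > 0" using t s BU by auto
      obtain a b c d :: int where m: "even b" "even c" "a * d - b * c = 1" "s = mob a b c d t"
        by (rule lam_eqD[OF i t(2)])
      thus "s \<in> \<Union> v" using v_mem[OF m(1-3)] t(1) by blast
    qed
    fix u assume "u \<in> v"
    then obtain a b c d :: int where m: "even b" "even c" "a * d - b * c = 1" and u: "u = mob a b c d ` B"
      unfolding v_def by blast
    note dr = det_real[OF m(3)]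
    have uU: "u \<subseteq> UH" using mob_Im(2)[OF _ dr] BU by (auto simp: u)
    have lu: "lam (mob a b c d t) = lam t" if "t \<in> B" for t using lam_mob_six(1)[OF _ m(3,1,2)] BU that by blast
    have ou: "open u" unfolding u
      by (rule invariance_of_domain[OF continuous_on_subset[OF mob_cont[OF dr] BU] _ inj_on_subset[OF mob_inj_on[OF dr] BU]]) (simp add: B_def)
    show "openin (top_of_set UH) u" by (rule open_subset[OF uU ou])
    have "inj_on lam u" unfolding u using inj lu by (auto simp: inj_on_def)
    moreover have "lam ` u = T" unfolding u T_def using lu by (auto simp: image_iff)
    ultimately show "\<exists>q. homeomorphism u T lam q"
      using invariance_of_domain_homeomorphism[OF ou continuous_on_subset[OF c uU]] by (metis order_refl)
  next
    show "pairwise disjnt v"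
    proof (rule pairwiseI)
      fix u1 u2 assume "u1 \<in> v" "u2 \<in> v" and ne: "u1 \<noteq> u2"
      then obtain a b c d a' b' c' d' :: int where m: "even b" "even c" "a * d - b * c = 1" "u1 = mob a b c d ` B"
        and m': "even b'" "even c'" "a' * d' - b' * c' = 1" "u2 = mob a' b' c' d' ` B" unfolding v_def by blast
      note dr = det_real[OF m(3)] and dr' = det_real[OF m'(3)]
      \<comment> \<open>Translates that meet agree as maps: the meeting points coincide because
        \<open>lam\<close> is injective on B, so the quotient matrix has a fixed point and is plus
        or minus the identity.\<close>
      have eqB: "mob a b c d s = mob a' b' c' d' s" if "s0 \<in> B" "t0 \<in> B" "mob a b c d s0 = mob a' b' c' d' t0" "s \<in> B" for s s0 t0
      proof -
        have im: "Im s0 > 0" "Im t0 > 0" "Im s > 0" using that BU by auto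
        have "lam s0 = lam t0" using lam_mob_six(1)[OF im(1) m(3,1,2)] lam_mob_six(1)[OF im(2) m'(3,1,2)] that(3) by simp
        hence st: "s0 = t0" using inj that by (auto simp: inj_on_def)
        define p q r w where "p = d' * a - b' * c" and "q = d' * b - b' * d" and "r = - c' * a + a' * c" and "w = - c' * b + a' * d"
        have comp: "mob d' (-b') (-c') a' (mob a b c d z) = mob p q r w z" if "Im z > 0" for z
          using mob_mob[OF that dr, of d' "-b'" "-c'" a'] by (simp add: p_def q_def r_def w_def)
        have "p * w - q * r = (a' * d' - b' * c') * (a * d - b * c)" by (simp add: p_def q_def r_def w_def algebra_simps)
        hence "p * w - q * r = 1" using m(3) m'(3) by simp
        moreover have "even q" "even r" using m(1,2) m'(1,2) by (simp_all add: q_def r_def)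
        moreover have "mob p q r w s0 = s0"
          using comp[OF im(1)] that(3) st mob_inv(1)[OF im(2) dr'] by simp
        ultimately have "q = 0 \<and> r = 0 \<and> (p = 1 \<and> w = 1 \<or> p = -1 \<and> w = -1)" using Gamma2_free[OF im(1)] by blast
        hence "mob p q r w s = s" by auto
        hence "mob d' (-b') (-c') a' (mob a b c d s) = s" using comp[OF im(3)] by simp
        hence "mob a' b' c' d' (mob d' (-b') (-c') a' (mob a b c d s)) = mob a' b' c' d' s" by simp
        thus ?thesis using mob_inv(2)[OF mob_Im(2)[OF im(3) dr] dr'] by simp
      qed
      show "disjnt u1 u2"
      proof (rule ccontr)
        assume "\<not> disjnt u1 u2"
        then obtain s0 t0 where "s0 \<in> B" "t0 \<in> B" "mob a b c d s0 = mob a' b' c' d' t0" unfolding disjnt_def m(4) m'(4) by blast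
        hence "u1 = u2" unfolding m(4) m'(4) using eqB by (intro image_cong refl) blast
        thus False using ne by blast
      qed
    qed
  qed
qed

section \<open>A lift for the first generator\<close>

lemma lam_imag: assumes "y > 0" shows "Im (lam (\<i> * of_real y)) = 0" "0 < Re (lam (\<i> * of_real y))" "Re (lam (\<i> * of_real y)) < 1"
proof -
  show "Im (lam (\<i> * of_real y)) = 0" "0 < Re (lam (\<i> * of_real y))" using lam_imag_pos[OF assms] by auto
  have "- 1 / (\<i> * of_real y) = \<i> * of_real (1/y)" using assms by (simp add: field_simps)
  hence "lam (\<i> * of_real (1/y)) = 1 - lam (\<i> * of_real y)" using lam_S[of "\<i> * of_real y"] assms by simp
  thus "Re (lam (\<i> * of_real y)) < 1" using lam_imag_pos(2)[of "1/y"] assms by simp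
qed

lemma lam_i: "lam \<i> = 1/2"
proof -
  have "lam \<i> = 1 - lam \<i>" using lam_S[of \<i>] by simp
  hence "2 * lam \<i> = 1" by (simp add: algebra_simps)
  thus ?thesis by (simp add: field_simps)
qed

text \<open>The quotient (z2 - z1) / (z3 - z1) along \<open>gen_loop 1\<close>: there z2 - z1 = e
  and z3 - z1 = (3 + e) / 2 with e = exp (2 pi i t).\<close>

definition loop0 :: "real \<Rightarrow> complex" where
  "loop0 t = 2 * exp (2 * pi * \<i> * t) / (3 + exp (2 * pi * \<i> * t))"

text \<open>Both \<^const>\<open>loop0\<close> and the image under \<^const>\<open>lam\<close> of a path from \<open>\<i>\<close> to \<open>\<i> + 2\<close> through a neighbourhood of the
  cusp have logarithms in the convex set \<open>W\<close> (a half-plane with an open segment of its boundary),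
  whose image under \<open>exp\<close> avoids \<open>0\<close> and \<open>1\<close>.\<close>

lemma loop0_lift:
  obtains P where "path P" "path_image P \<subseteq> UH" "pathstart P = \<i>" "pathfinish P = \<i> + 2"
    "\<And>t. t \<in> {0..1} \<Longrightarrow> lam (P t) = loop0 t"
proof -
  obtain Lg where Lg: "continuous_on UH Lg" "\<And>\<tau>. Im \<tau> > 0 \<Longrightarrow> lam \<tau> = exp (Lg \<tau>)"
    "\<And>\<tau>. Im \<tau> > 0 \<Longrightarrow> Lg (\<tau> + 2) = Lg \<tau> + 2 * of_real pi * \<i>" using lam_log by blast
  obtain Y0 where Y0: "\<And>\<tau>. Im \<tau> \<ge> Y0 \<Longrightarrow> norm (lam \<tau>) < 1" using lam_tendsto_0[of 1] by auto
  define Y where "Y = max Y0 1"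
  have Y: "Y \<ge> 1" "\<And>\<tau>. Im \<tau> \<ge> Y \<Longrightarrow> norm (lam \<tau>) < 1" using Y0 by (auto simp: Y_def)
  \<comment> \<open>On the vertical legs lambda lies in (0, 1) and on the horizontal leg it is small
    by the choice of Y. So |lambda| < 1 on the whole path, and its logarithm has negative real
    part.\<close>
  define l where "l = linepath \<i> (\<i> * of_real Y) +++ (linepath (\<i> * of_real Y) (\<i> * of_real Y + 2) +++ linepath (\<i> * of_real Y + 2) (\<i> + 2))"
  have lp: "path l" "pathstart l = \<i>" "pathfinish l = \<i> + 2" by (simp_all add: l_def)
  have small: "norm (lam \<tau>) < 1 \<and> Im \<tau> > 0" if "\<tau> \<in> path_image l" for \<tau>
  proof -
    have "\<tau> \<in> closed_segment \<i> (\<i> * of_real Y) \<union> closed_segment (\<i> * of_real Y) (\<i> * of_real Y + 2) \<union> closed_segment (\<i> * of_real Y + 2) (\<i> + 2)"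
      using that by (auto simp: l_def path_image_join)
    moreover have V: "norm (lam (\<i> * of_real y)) < 1" if "y > 0" for y
      using lam_imag[OF that] by (simp add: cmod_eq_Re)
    have seg: "\<exists>y\<ge>1. \<tau> = \<i> * of_real y" if s: "\<tau> \<in> closed_segment \<i> (\<i> * of_real Y)" for \<tau>
    proof -
      obtain u where u: "0 \<le> u" "u \<le> 1" "\<tau> = (1-u) *\<^sub>R \<i> + u *\<^sub>R (\<i> * of_real Y)" using s by (auto simp: closed_segment_def)
      have "u * 1 \<le> u * Y" using u Y(1) by (intro mult_left_mono) auto
      thus ?thesis using u by (intro exI[of _ "(1-u) + u * Y"]) (auto simp: complex_eq_iff)
    qed
    ultimately consider "\<tau> \<in> closed_segment \<i> (\<i> * of_real Y)" | "\<tau> \<in> closed_segment (\<i> * of_real Y) (\<i> * of_real Y + 2)"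
      | "\<tau> \<in> closed_segment (\<i> * of_real Y + 2) (\<i> + 2)" by blast
    thus ?thesis
    proof cases
      case 1 thus ?thesis using seg[OF 1] V by auto
    next
      case 2
      then obtain u where "\<tau> = (1-u) *\<^sub>R (\<i> * of_real Y) + u *\<^sub>R (\<i> * of_real Y + 2)" by (auto simp: closed_segment_def)
      hence "Im \<tau> = Y" by (simp add: algebra_simps)
      thus ?thesis using Y by auto
    next
      case 3
      have "\<tau> - 2 \<in> closed_segment \<i> (\<i> * of_real Y)"
      proof -
        obtain u where u: "0 \<le> u" "u \<le> 1" "\<tau> = (1-u) *\<^sub>R (\<i> * of_real Y + 2) + u *\<^sub>R (\<i> + 2)" using 3 by (auto simp: closed_segment_def)
        have "\<tau> - 2 = (1-u) *\<^sub>R (\<i> * of_real Y) + u *\<^sub>R \<i>" by (simp add: u complex_eq_iff algebra_simps)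
        hence "\<tau> - 2 \<in> closed_segment (\<i> * of_real Y) \<i>" using u by (auto simp: closed_segment_def)
        thus ?thesis by (simp add: closed_segment_commute)
      qed
      then obtain y where y: "y \<ge> 1" "\<tau> = \<i> * of_real y + 2" using seg by (metis diff_eq_eq)
      have "lam \<tau> = lam (\<i> * of_real y)"
        using y Lg(2)[of \<tau>] Lg(2)[of "\<i> * of_real y"] Lg(3)[of "\<i> * of_real y"] by (simp add: exp_add)
      thus ?thesis using V[of y] y by auto
    qed
  qed
  \<comment> \<open>A multiple of 2 pi i, chosen such that both logarithms start at - ln 2.\<close>
  define c where "c = - Lg \<i> - of_real (ln 2)"
  have eLi: "exp (Lg \<i>) = 1/2" using Lg(2)[of \<i>] lam_i by simp
  have ec: "exp c = 1" unfolding c_def exp_diff exp_minus eLi by (simp add: exp_of_real)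
  define u0 where "u0 = (\<lambda>t. Lg (l t) + c)"
  define u1 where "u1 = (\<lambda>t::real. 2 * pi * \<i> * t + of_real (ln 2) - Ln (3 + exp (2 * pi * \<i> * t)))"
  define W where "W = {u. Re u < 0 \<or> (Re u = 0 \<and> 0 < Im u \<and> Im u < 2 * pi)}"
  have li: "Im (l t) > 0" "norm (lam (l t)) < 1" if "t \<in> {0..1}" for t
    using small[of "l t"] that by (auto simp: path_image_def)
  have eu0: "exp (u0 t) = lam (l t)" if "t \<in> {0..1}" for t
    using Lg(2)[OF li(1)[OF that]] by (simp add: u0_def exp_add ec)
  have p0: "path u0" unfolding path_def u0_def
    by (intro continuous_intros continuous_on_compose2[OF Lg(1)] lp(1)[unfolded path_def]) (use li in auto)
  have re0: "Re (u0 t) < 0" if "t \<in> {0..1}" for t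
  proof -
    have "exp (Re (u0 t)) < 1" using li(2)[OF that] eu0[OF that] by (metis norm_exp_eq_Re)
    thus ?thesis by simp
  qed
  define E where "E = (\<lambda>t::real. exp (2 * pi * \<i> * t))"
  have nE: "norm (E t) = 1" for t by (simp add: E_def norm_exp_eq_Re)
  have Re3: "Re (3 + E t) \<ge> 2" for t using abs_Re_le_cmod[of "E t"] nE[of t] by auto
  have Ecos: "Re (E t) = cos (2 * pi * t)" for t by (simp add: E_def Re_exp)
  have nz: "3 + E t \<notin> \<real>\<^sub>\<le>\<^sub>0" "3 + E t \<noteq> 0" for t using Re3[of t] by (auto simp: complex_nonpos_Reals_iff complex_eq_iff)
  have eu1: "exp (u1 t) = loop0 t" for t
    using nz[of t] by (simp add: u1_def loop0_def exp_diff exp_add exp_of_real E_def)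
  have p1: "path u1" unfolding path_def u1_def
    by (intro continuous_intros) (use nz in \<open>auto simp: E_def\<close>)
  have E01: "E 0 = 1" "E 1 = 1" by (simp_all add: E_def)
  have L4: "Ln 4 = 2 * of_real (ln 2)"
  proof -
    have "Ln 4 = of_real (ln 4)" using Ln_of_real[of 4] by simp
    also have "ln 4 = 2 * ln (2::real)" using ln_realpow[of 2 2] by simp
    finally show ?thesis by simp
  qed
  have u1e: "u1 0 = - of_real (ln 2)" "u1 1 = 2 * of_real pi * \<i> - of_real (ln 2)"
    using E01 L4 by (simp_all add: u1_def E_def)
  have u0e: "u0 0 = - of_real (ln 2)" "u0 1 = 2 * of_real pi * \<i> - of_real (ln 2)"
    using lp(2,3) Lg(3)[of \<i>] by (simp_all add: u0_def c_def pathstart_def pathfinish_def)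
  have W1: "u1 t \<in> W" if t: "t \<in> {0..1}" for t
  \<comment> \<open>The modulus of \<open>loop0\<close> reaches 1 only at t = 1/2, where the
    logarithm is pi i; for this point W contains a piece of its boundary.\<close>
  proof (cases "E t = -1")
    case True
    have "u1 t = 2 * pi * \<i> * t" using True Ln_of_real[of 2] by (simp add: u1_def E_def)
    moreover have "t \<noteq> 0" "t \<noteq> 1" using True E01 by auto
    ultimately show ?thesis using t by (auto simp: W_def)
  next
    case False
    have "norm (3 + E t) > 2"
    proof (rule ccontr)
      assume "\<not> ?thesis"
      hence "Re (3 + E t) = 2" "norm (3 + E t) \<le> Re (3 + E t)" using Re3[of t] complex_Re_le_cmod[of "3 + E t"] by linarith+
      moreover from this have "Im (3 + E t) = 0" using cmod_power2[of "3 + E t"] complex_Re_le_cmod[of "3 + E t"] by (metis add_cancel_right_right antisym power2_eq_iff_nonneg zero_eq_power2 Re3 order_trans zero_le_numeral norm_ge_zero)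
      ultimately have "E t = -1" by (simp add: complex_eq_iff)
      thus False using False by simp
    qed
    hence "ln 2 < ln (norm (3 + E t))" by (subst ln_less_cancel_iff) linarith+
    moreover have "Re (u1 t) = ln 2 - ln (norm (3 + E t))" using nz[of t] by (simp add: u1_def E_def)
    ultimately show ?thesis by (simp add: W_def)
  qed
  have hom: "homotopic_paths W u0 u1"
  proof (rule homotopic_paths_linear[OF p0 p1])
    fix t :: real assume t: "t \<in> {0..1}"
    show "closed_segment (u0 t) (u1 t) \<subseteq> W"
    proof
      fix z assume "z \<in> closed_segment (u0 t) (u1 t)"
      then obtain s where s: "0 \<le> s" "s \<le> 1" "z = (1-s) *\<^sub>R u0 t + s *\<^sub>R u1 t" by (auto simp: closed_segment_def)
      show "z \<in> W"
      proof (cases "s = 1")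
        case True thus ?thesis using s W1[OF t] by simp
      next
        case False
        have "(1-s) * Re (u0 t) < 0" using False s re0[OF t] by (simp add: mult_pos_neg)
        moreover have "s * Re (u1 t) \<le> 0" using s W1[OF t] by (auto simp: W_def mult_nonneg_nonpos)
        ultimately have "Re z < 0" using s(3) by simp
        thus ?thesis by (simp add: W_def)
      qed
    qed
  qed (simp_all add: pathstart_def pathfinish_def u0e u1e)
  have eW: "exp \<in> W \<rightarrow> - {0,1}"
  proof
    fix u assume u: "u \<in> W"
    have "exp u \<noteq> 1"
    proof
      assume "exp u = 1"
      then obtain n where n: "Re u = 0" "Im u = of_int (2 * n) * pi" by (auto simp: exp_eq_1)
      hence "0 < of_int (2 * n) * pi" "of_int (2 * n) * pi < 2 * pi" using u by (auto simp: W_def)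
      hence "0 < real_of_int n" "real_of_int n < 1" by (auto simp: zero_less_mult_iff)
      hence "0 < n" "n < 1" by simp_all
      thus False by linarith
    qed
    thus "exp u \<in> - {0,1}" by simp
  qed
  have h2: "homotopic_paths (- {0,1}) (exp \<circ> u0) (exp \<circ> u1)"
    by (rule homotopic_paths_continuous_image[OF hom _ eW]) (intro continuous_intros)
  have pil: "path_image l \<subseteq> UH" using small by auto
  obtain P where "path P" "path_image P \<subseteq> UH" "pathstart P = \<i>" "pathfinish P = \<i> + 2" "\<And>t. t \<in> {0..1} \<Longrightarrow> lam (P t) = (exp \<circ> u1) t"
    using covering_space_lift_homotopic_path[OF lam_covering h2 lp(1) pil lp(2,3)] eu0 by auto
  thus thesis using that[of P] eu1 by simp
qed

section \<open>Geodesics over the end sets\<close>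

text \<open>Real and imaginary parts give d s' = a s and b = - c s s', so a d \<ge> 0 and b c \<le>
  0; with determinant 1 this leaves a d = 0 or a d = 1.\<close>

lemma imag_fix:
  fixes a b c d :: int
  assumes s: "s > 0" "s' > 0" and det: "a * d - b * c = 1"
    and eq: "\<i> * of_real s' * (of_int c * (\<i> * of_real s) + of_int d) = of_int a * (\<i> * of_real s) + of_int b"
  shows "s = s' \<or> a = 0 \<and> d = 0"
proof -
  have 1: "of_int d * s' = of_int a * s" using arg_cong[OF eq, of Im] by (simp add: mult.commute)
  have 2: "- (of_int c * (s' * s)) = of_int b" using arg_cong[OF eq, of Re] by (simp add: mult_ac)
  have ad: "real_of_int a * real_of_int d - real_of_int b * real_of_int c = 1" by (rule det_real[OF det])
  have "real_of_int b * real_of_int c = - ((of_int c)\<^sup>2 * (s' * s))" by (simp add: 2[symmetric] power2_eq_square)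
  hence "real_of_int (b * c) \<le> 0" using s by simp
  hence bc: "b * c \<le> 0" by linarith
  have "real_of_int a * real_of_int d * s = of_int d * (of_int a * s)" by simp
  also have "\<dots> = (of_int d)\<^sup>2 * s'" unfolding 1[symmetric] by (simp add: power2_eq_square)
  finally have "real_of_int a * real_of_int d * s = (of_int d)\<^sup>2 * s'" .
  hence "real_of_int a * real_of_int d * s \<ge> 0" using s by simp
  hence "real_of_int (a * d) \<ge> 0" using s by (simp add: zero_le_mult_iff)
  hence ad0: "a * d \<ge> 0" by linarith
  consider "a * d = 0" | "a * d = 1" using bc ad0 det by linarith
  thus ?thesis
  proof cases
    case 1
    hence "a = 0 \<or> d = 0" by simp
    thus ?thesis using \<open>of_int d * s' = of_int a * s\<close> s by auto
  next
    case 2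
    hence "a = d" by (metis zmult_eq_1_iff)
    moreover have "d \<noteq> 0" using 2 by auto
    ultimately show ?thesis using \<open>of_int d * s' = of_int a * s\<close> by auto
  qed
qed

definition gtr :: "complex set" where "gtr = {\<tau>. Re \<tau> = 0 \<and> Im \<tau> > 0}"
definition gpb :: "complex set" where "gpb = {\<tau>. norm \<tau> = 1 \<and> Im \<tau> > 0}"

lemma gtr_eq: "gtr = (\<lambda>y. \<i> * of_real y) ` {0<..}"
  by (auto simp: gtr_def image_iff complex_eq_iff)

text \<open>The Cayley transform (w - 1) / (w + 1) at w = i s, which takes the positive imaginary
  axis to the upper unit semicircle.\<close>

definition cay :: "real \<Rightarrow> complex" where "cay s = (\<i> * of_real s - 1) / (\<i> * of_real s + 1)"

lemma cay_denom: "\<i> * of_real s + 1 \<noteq> 0" by (simp add: complex_eq_iff)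

lemma gpb_eq: "gpb = cay ` {0<..}"
proof (intro equalityI subsetI)
  fix \<tau> assume t: "\<tau> \<in> gpb"
  define w where "w = (1 + \<tau>) / (1 - \<tau>)"
  have n1: "1 - \<tau> \<noteq> 0" using t by (auto simp: gpb_def)
  have "(1 + \<tau>) * cnj (1 - \<tau>) = 2 * \<i> * of_real (Im \<tau>)"
  proof -
    have "(Re \<tau>)\<^sup>2 + (Im \<tau>)\<^sup>2 = 1" using t by (simp add: gpb_def cmod_power2[symmetric])
    thus ?thesis by (simp add: complex_eq_iff algebra_simps power2_eq_square)
  qed
  moreover have "w = (1 + \<tau>) * cnj (1 - \<tau>) / of_real ((norm (1 - \<tau>))\<^sup>2)"
    unfolding complex_norm_square using n1 by (simp add: w_def del: complex_cnj_diff)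
  ultimately have w: "w = \<i> * of_real (2 * Im \<tau> / (norm (1 - \<tau>))\<^sup>2)" by simp
  define s where "s = 2 * Im \<tau> / (norm (1 - \<tau>))\<^sup>2"
  have s: "s > 0" using t n1 by (simp add: s_def gpb_def)
  have "\<tau> = (w - 1) / (w + 1)"
  proof -
    have "w - 1 = 2 * \<tau> / (1 - \<tau>)" "w + 1 = 2 / (1 - \<tau>)" using n1 by (simp_all add: w_def field_simps)
    thus ?thesis using n1 by simp
  qed
  hence "\<tau> = cay s" by (simp add: cay_def w s_def)
  thus "\<tau> \<in> cay ` {0<..}" using s by auto
next
  fix \<tau> assume "\<tau> \<in> cay ` {0<..}"
  then obtain s where s: "s > 0" "\<tau> = cay s" by auto
  have "norm (\<i> * of_real s - 1) = norm (\<i> * of_real s + 1)" by (simp add: cmod_def)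
  hence n: "norm \<tau> = 1" using cay_denom[of s] by (simp add: s cay_def norm_divide)
  have "\<tau> = (\<i> * of_real s - 1) * cnj (\<i> * of_real s + 1) / of_real ((norm (\<i> * of_real s + 1))\<^sup>2)"
    unfolding s cay_def by (subst complex_div_cnj) simp
  hence "Im \<tau> = 2 * s / (norm (\<i> * of_real s + 1))\<^sup>2" by (simp add: Im_divide_of_real)
  moreover have "(norm (\<i> * of_real s + 1))\<^sup>2 > 0" using cay_denom[of s] by simp
  ultimately have "Im \<tau> > 0" using s by simp
  thus "\<tau> \<in> gpb" using n by (simp add: gpb_def)
qed

lemma cay_cont: "continuous_on A cay"
  unfolding cay_def by (intro continuous_intros) (use cay_denom in auto)

lemma gpb_path_connected: "path_connected gpb"
  unfolding gpb_eq by (intro path_connected_continuous_image cay_cont convex_imp_path_connected convex_real_interval)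

lemma gtr_convex: "convex gtr"
proof -
  have e: "gtr = {\<tau>. inner 1 \<tau> = 0} \<inter> UH" by (auto simp: gtr_def inner_complex_def)
  show ?thesis unfolding e by (intro convex_Int convex_hyperplane convex_halfspace_Im_gt)
qed

lemma lam_gtr: "\<tau> \<in> gtr \<Longrightarrow> Im (lam \<tau>) = 0 \<and> 0 < Re (lam \<tau>) \<and> Re (lam \<tau>) < 1"
  using lam_imag by (auto simp: gtr_eq)

text \<open>On the unit circle -1 / \<tau> = - cnj \<tau>, so reflection symmetry and lambda(-1 /
  \<tau>) = 1 - lambda(\<tau>) combine to cnj lambda = 1 - lambda.\<close>

lemma lam_gpb: assumes "\<tau> \<in> gpb" shows "Re (lam \<tau>) = 1/2"
proof -
  have t: "Im \<tau> > 0" "norm \<tau> = 1" using assms by (auto simp: gpb_def)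
  have "\<tau> * cnj \<tau> = 1" using t complex_norm_square[of \<tau>] by simp
  moreover have "\<tau> \<noteq> 0" using t by auto
  ultimately have "1 / \<tau> = cnj \<tau>" by (simp add: divide_eq_eq mult.commute)
  hence "- 1 / \<tau> = - cnj \<tau>" by simp
  hence "cnj (lam \<tau>) = 1 - lam \<tau>" using lam_S[OF t(1)] lam_cnj[OF t(1)] by simp
  from arg_cong[OF this, of Re] show ?thesis by simp
qed

lemma lam_inj_gtr: "inj_on lam gtr"
proof (rule inj_onI)
  fix \<tau> \<tau>' assume "\<tau> \<in> gtr" "\<tau>' \<in> gtr" and eq: "lam \<tau> = lam \<tau>'"
  then obtain s s' where s: "s > 0" "s' > 0" "\<tau> = \<i> * of_real s" "\<tau>' = \<i> * of_real s'" by (auto simp: gtr_eq)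
  have im: "Im \<tau> > 0" "Im \<tau>' > 0" using s by auto
  obtain a b c d :: int where m: "even b" "even c" "a * d - b * c = 1" "\<tau>' = mob a b c d \<tau>"
    by (rule lam_eqD[OF im eq])
  have "\<i> * of_real s' * (of_int c * (\<i> * of_real s) + of_int d) = of_int a * (\<i> * of_real s) + of_int b"
    using m(4) mob_denom_neq_0[OF im(1) det_real[OF m(3)]] by (simp add: s mob_def field_simps)
  from imag_fix[OF s(1,2) m(3) this] show "\<tau> = \<tau>'"
  proof
    assume "a = 0 \<and> d = 0"
    hence "b * c = -1" using m(3) by simp
    moreover have "even (b * c)" using m(1) by simp
    ultimately show ?thesis by simp
  qed (simp add: s)
qed

text \<open>Conjugation by the Cayley transform makes the points imaginary and the matrix (a', b',
  c', d'), which is still integral because a, d are odd and b, c even; so \<open>imag_fix\<close>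
  applies. Its exceptional case would give b^2 - a^2 = 1 with b even and a odd, impossible modulo
  4.\<close>

lemma lam_inj_gpb: "inj_on lam gpb"
proof (rule inj_onI)
  fix \<tau> \<tau>' assume "\<tau> \<in> gpb" "\<tau>' \<in> gpb" and eq: "lam \<tau> = lam \<tau>'"
  then obtain s s' where s: "s > 0" "s' > 0" "\<tau> = cay s" "\<tau>' = cay s'" by (auto simp: gpb_eq)
  have im: "Im \<tau> > 0" "Im \<tau>' > 0" using \<open>\<tau> \<in> gpb\<close> \<open>\<tau>' \<in> gpb\<close> by (auto simp: gpb_def)
  obtain a b c d :: int where m: "even b" "even c" "a * d - b * c = 1" "\<tau>' = mob a b c d \<tau>"
    by (rule lam_eqD[OF im eq])
  have "a * d = 1 + b * c" using m(3) by simp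
  hence "odd (a * d)" using m(1) by simp
  hence od: "odd a" "odd d" by simp_all
  then obtain k l where ad: "a = 2 * k + 1" "d = 2 * l + 1" by (meson oddE)
  obtain p q where bc: "b = 2 * p" "c = 2 * q" using m by (meson evenE)
  define a' b' c' d' where "a' = k + l + 1 + p + q" and "b' = l - k + p - q" and "c' = l - k + q - p" and "d' = k + l + 1 - p - q"
  have e2: "2 * a' = a + b + c + d" "2 * b' = - a - c + b + d" "2 * c' = c - a + d - b" "2 * d' = a - c - b + d"
    by (simp_all add: a'_def b'_def c'_def d'_def ad bc)
  have "4 * (a' * d' - b' * c') = (2 * a') * (2 * d') - (2 * b') * (2 * c')" by simp
  also have "\<dots> = 4 * (a * d - b * c)" unfolding e2 by (simp add: algebra_simps)
  finally have det': "a' * d' - b' * c' = 1" using m(3) by simp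
  define x where "x = \<i> * of_real s"
  define y where "y = \<i> * of_real s'"
  have x1: "x + 1 \<noteq> 0" "y + 1 \<noteq> 0" using cay_denom by (simp_all add: x_def y_def)
  have t: "\<tau> * (x + 1) = x - 1" "\<tau>' * (y + 1) = y - 1" using x1 by (simp_all add: s cay_def x_def y_def)
  have "\<tau>' * (of_int c * \<tau> + of_int d) = of_int a * \<tau> + of_int b"
    using m(4) mob_denom_neq_0[OF im(1) det_real[OF m(3)]] by (simp add: mob_def)
  hence "(\<tau>' * (y + 1)) * (of_int c * (\<tau> * (x + 1)) + of_int d * (x + 1)) = (y + 1) * (of_int a * (\<tau> * (x + 1)) + of_int b * (x + 1))"
    by (metis (no_types, opaque_lifting) distrib_right mult.assoc mult.commute mult.left_commute)
  hence F: "(y - 1) * (of_int c * (x - 1) + of_int d * (x + 1)) = (y + 1) * (of_int a * (x - 1) + of_int b * (x + 1))"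
    unfolding t .
  have "2 * (y * (of_int c' * x + of_int d')) = y * (of_int (2 * c') * x + of_int (2 * d'))" by (simp add: algebra_simps)
  also have "\<dots> = of_int (2 * a') * x + of_int (2 * b')" unfolding e2 using F by (simp add: algebra_simps)
  also have "\<dots> = 2 * (of_int a' * x + of_int b')" by (simp add: algebra_simps)
  finally have "y * (of_int c' * x + of_int d') = of_int a' * x + of_int b'" by (simp only: mult_cancel_left) simp
  from imag_fix[OF s(1,2) det' this[unfolded x_def y_def]]
  show "\<tau> = \<tau>'"
  proof
    assume "a' = 0 \<and> d' = 0"
    hence "a + b + c + d = 0" "a - c - b + d = 0" using e2 by simp_all
    hence "d = - a" "c = - b" by simp_all
    hence "b * b - a * a = 1" using m(3) by simp
    hence "4 * (p * p - k * k - k) = 2" by (simp add: ad bc algebra_simps)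
    thus ?thesis by presburger
  qed (simp add: s)
qed

text \<open>A sheet over \<open>J\<close>: a set mapped homeomorphically onto \<open>J\<close> by the covering \<^const>\<open>lam\<close>.\<close>

definition lam_sheet :: "complex set \<Rightarrow> complex set \<Rightarrow> bool" where
  "lam_sheet C J \<longleftrightarrow> C \<subseteq> UH \<and> lam ` C \<subseteq> J \<and> (\<exists>h. continuous_on J h \<and> h ` J \<subseteq> C \<and> (\<forall>x\<in>J. lam (h x) = x) \<and> (\<forall>\<tau>\<in>C. h (lam \<tau>) = \<tau>))"

text \<open>Re lambda is injective on the half line, hence a homeomorphism onto its image. It tends
  to 0 at the cusp, and by lambda(-1 / \<tau>) = 1 - lambda(\<tau>) it comes as close to 1.\<close>

lemma lam_sheet_gtr: "lam_sheet gtr {x. Im x = 0 \<and> 0 < Re x \<and> Re x < 1}"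
proof -
  define f where "f = (\<lambda>\<tau>. Re (lam \<tau>))"
  have sub: "gtr \<subseteq> UH" by (auto simp: gtr_def)
  have fc: "continuous_on gtr f" unfolding f_def
    by (intro continuous_intros continuous_on_subset[OF holomorphic_on_imp_continuous_on[OF lam_holo] sub])
  have "inj_on f gtr"
    using lam_inj_gtr lam_gtr unfolding inj_on_def f_def by (metis complex_eq_iff)
  then obtain g where g: "homeomorphism gtr (f ` gtr) f g"
    using injective_into_1d_eq_homeomorphism[OF fc convex_imp_path_connected[OF gtr_convex]] by blast
  have img: "x \<in> f ` gtr" if x: "0 < x" "x < 1" for x
  proof -
    obtain Y where Y: "\<And>\<tau>. Im \<tau> \<ge> Y \<Longrightarrow> norm (lam \<tau>) < min x (1 - x)" using lam_tendsto_0[of "min x (1-x)"] x by auto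
    define y where "y = max Y 1"
    have y: "y > 0" "Im (\<i> * of_real y) \<ge> Y" by (auto simp: y_def)
    have 1: "f (\<i> * of_real y) < min x (1 - x)" using Y[OF y(2)] complex_Re_le_cmod[of "lam (\<i> * of_real y)"] by (simp add: f_def)
    have "- 1 / (\<i> * of_real y) = \<i> * of_real (1/y)" using y(1) by (simp add: field_simps)
    hence "lam (\<i> * of_real (1/y)) = 1 - lam (\<i> * of_real y)" using lam_S[of "\<i> * of_real y"] y(1) by simp
    hence 2: "f (\<i> * of_real (1/y)) > x" using 1 by (simp add: f_def)
    have m: "\<i> * of_real y \<in> gtr" "\<i> * of_real (1/y) \<in> gtr" using y(1) by (auto simp: gtr_def)
    have "connected (f ` gtr)" by (intro connected_continuous_image fc convex_connected gtr_convex)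
    thus ?thesis using 1 2 m connectedD_interval[of "f ` gtr" "f (\<i> * of_real y)" "f (\<i> * of_real (1/y))" x] by auto
  qed
  show ?thesis unfolding lam_sheet_def
  proof (intro conjI exI[of _ "\<lambda>x. g (Re x)"] ballI)
    show "gtr \<subseteq> UH" by (rule sub)
    show "lam ` gtr \<subseteq> {x. Im x = 0 \<and> 0 < Re x \<and> Re x < 1}" using lam_gtr by auto
    show "continuous_on {x. Im x = 0 \<and> 0 < Re x \<and> Re x < 1} (\<lambda>x. g (Re x))"
      by (rule continuous_on_compose2[OF homeomorphism_cont2[OF g]]) (auto intro!: continuous_intros img)
    show "(\<lambda>x. g (Re x)) ` {x. Im x = 0 \<and> 0 < Re x \<and> Re x < 1} \<subseteq> gtr"
      using homeomorphism_image2[OF g] img by auto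
    fix x assume x: "x \<in> {x. Im x = 0 \<and> 0 < Re x \<and> Re x < 1}"
    hence "g (Re x) \<in> gtr" "f (g (Re x)) = Re x" using homeomorphism_image2[OF g] homeomorphism_apply2[OF g] img by auto
    thus "lam (g (Re x)) = x" using lam_gtr x by (auto simp: f_def complex_eq_iff)
  next
    fix \<tau> assume "\<tau> \<in> gtr" thus "g (Re (lam \<tau>)) = \<tau>" using homeomorphism_apply1[OF g] by (simp add: f_def)
  qed
qed

text \<open>For Re \<tau>' = 1/2 the point 1 - 1 / \<tau>' lies on the unit circle, and lambda takes
  there the value 1 - 1 / lambda(\<tau>'), which is large when \<tau>' is near the cusp. Reflection
  corrects the sign of the imaginary part.\<close>

lemma lam_gpb_unbounded: "\<exists>\<tau>\<in>gpb. Im (lam \<tau>) > K"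
proof -
  define M where "M = \<bar>K\<bar> + 2"
  obtain Y where Y: "\<And>\<tau>. Im \<tau> \<ge> Y \<Longrightarrow> norm (lam \<tau>) < 1 / (M + 1)"
  proof -
    have "1 / (M + 1) > 0" by (simp add: M_def)
    thus thesis using lam_tendsto_0 that by blast
  qed
  define \<tau>' where "\<tau>' = Complex (1/2) (max Y 1)"
  have t': "Im \<tau>' > 0" by (simp add: \<tau>'_def)
  define \<tau> where "\<tau> = - 1 / \<tau>' + 1"
  have t0: "\<tau>' \<noteq> 0" using t' by auto
  have S: "Im (- 1 / \<tau>') > 0" using t' t0 by (simp add: Im_divide zero_less_divide_iff sum_power2_gt_zero_iff)
  have "\<tau> = (\<tau>' - 1) / \<tau>'" using t0 by (simp add: \<tau>_def field_simps)
  moreover have "norm (\<tau>' - 1) = norm \<tau>'" by (simp add: \<tau>'_def cmod_def)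
  ultimately have "norm \<tau> = 1" using t0 by (simp add: norm_divide)
  hence tp: "\<tau> \<in> gpb" using S by (simp add: gpb_def \<tau>_def)
  define z where "z = lam \<tau>'"
  have z0: "z \<noteq> 0" using lam_neq[OF t'] by (simp add: z_def)
  have "lam \<tau> = (1 - z) / (1 - z - 1)" unfolding \<tau>_def lam_T[OF S] lam_S[OF t'] z_def ..
  hence l: "lam \<tau> = 1 - 1 / z" using z0 by (simp add: field_simps)
  have "norm z < 1 / (M + 1)" unfolding z_def by (rule Y) (simp add: \<tau>'_def)
  hence "norm (1 / z) > M + 1" using z0 by (simp add: norm_divide field_simps M_def)
  hence "norm (lam \<tau>) > M" using norm_triangle_ineq2[of "1/z" 1] by (simp add: l norm_minus_commute)
  moreover have "norm (lam \<tau>) \<le> \<bar>Re (lam \<tau>)\<bar> + \<bar>Im (lam \<tau>)\<bar>" by (rule cmod_le)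
  ultimately have big: "\<bar>Im (lam \<tau>)\<bar> > K" using lam_gpb[OF tp] by (simp add: M_def)
  show ?thesis
  proof (cases "Im (lam \<tau>) \<ge> 0")
    case True thus ?thesis using big tp by auto
  next
    case False
    have "Im \<tau> > 0" using tp by (simp add: gpb_def)
    hence "lam (- cnj \<tau>) = cnj (lam \<tau>)" by (rule lam_cnj)
    moreover have "- cnj \<tau> \<in> gpb" using tp by (simp add: gpb_def)
    ultimately show ?thesis using big False by (intro bexI[of _ "- cnj \<tau>"]) auto
  qed
qed

lemma lam_sheet_gpb: "lam_sheet gpb {x. Re x = 1/2}"
proof -
  define f where "f = (\<lambda>\<tau>. Im (lam \<tau>))"
  have sub: "gpb \<subseteq> UH" by (auto simp: gpb_def)
  have fc: "continuous_on gpb f" unfolding f_def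
    by (intro continuous_intros continuous_on_subset[OF holomorphic_on_imp_continuous_on[OF lam_holo] sub])
  have "inj_on f gpb"
    using lam_inj_gpb lam_gpb unfolding inj_on_def f_def by (metis complex_eq_iff)
  then obtain g where g: "homeomorphism gpb (f ` gpb) f g"
    using injective_into_1d_eq_homeomorphism[OF fc gpb_path_connected] by blast
  have img: "x \<in> f ` gpb" for x
  proof -
    obtain \<tau> where 1: "\<tau> \<in> gpb" "f \<tau> > x" using lam_gpb_unbounded[of x] by (auto simp: f_def)
    obtain \<tau>' where 2: "\<tau>' \<in> gpb" "f \<tau>' > - x" using lam_gpb_unbounded[of "- x"] by (auto simp: f_def)
    have "Im \<tau>' > 0" using 2 by (simp add: gpb_def)
    hence "f (- cnj \<tau>') < x" using lam_cnj[of \<tau>'] 2 by (simp add: f_def)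
    moreover have "- cnj \<tau>' \<in> gpb" using 2 by (simp add: gpb_def)
    moreover have "connected (f ` gpb)" by (intro connected_continuous_image fc path_connected_imp_connected gpb_path_connected)
    ultimately show ?thesis using 1 connectedD_interval[of "f ` gpb" "f (- cnj \<tau>')" "f \<tau>" x] by auto
  qed
  show ?thesis unfolding lam_sheet_def
  proof (intro conjI exI[of _ "\<lambda>x. g (Im x)"] ballI)
    show "gpb \<subseteq> UH" by (rule sub)
    show "lam ` gpb \<subseteq> {x. Re x = 1/2}" using lam_gpb by auto
    show "continuous_on {x. Re x = 1/2} (\<lambda>x. g (Im x))"
      by (rule continuous_on_compose2[OF homeomorphism_cont2[OF g]]) (auto intro!: continuous_intros img)
    show "(\<lambda>x. g (Im x)) ` {x. Re x = 1/2} \<subseteq> gpb" using homeomorphism_image2[OF g] img by auto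
    fix x :: complex assume x: "x \<in> {x. Re x = 1/2}"
    have m: "g (Im x) \<in> gpb" "f (g (Im x)) = Im x" using homeomorphism_image2[OF g] homeomorphism_apply2[OF g] img by auto
    have xx: "Re x = 1/2" using x by blast
    show "lam (g (Im x)) = x"
      by (rule complex_eqI[OF trans[OF lam_gpb[OF m(1)] sym[OF xx]] m(2)[unfolded f_def]])
  next
    fix \<tau> assume "\<tau> \<in> gpb" thus "g (Im (lam \<tau>)) = \<tau>" using homeomorphism_apply1[OF g] by (simp add: f_def)
  qed
qed

text \<open>Uniqueness of lifts: the inverse of \<open>lam\<close> on the sheet, followed by the
  matrix, is a second lift of the same map with the same value at \<open>k0\<close>.\<close>

lemma lam_sheet_stay:
  fixes g :: "'a::topological_space \<Rightarrow> complex" and a b c d :: int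
  assumes sh: "lam_sheet C J" and m: "even b" "even c" "a * d - b * c = 1"
    and K: "connected K" "k0 \<in> K" "k \<in> K" and g: "continuous_on K g" "\<And>k. k \<in> K \<Longrightarrow> Im (g k) > 0"
    and J: "\<And>k. k \<in> K \<Longrightarrow> lam (g k) \<in> J" and k0: "g k0 \<in> mob a b c d ` C"
  shows "g k \<in> mob a b c d ` C"
proof -
  obtain h where h: "continuous_on J h" "h ` J \<subseteq> C" "\<And>x. x \<in> J \<Longrightarrow> lam (h x) = x" "\<And>\<tau>. \<tau> \<in> C \<Longrightarrow> h (lam \<tau>) = \<tau>" and CU: "C \<subseteq> UH"
    using sh unfolding lam_sheet_def by blast
  note dr = det_real[OF m(3)]
  have hU: "h x \<in> C" "Im (h x) > 0" if "x \<in> J" for x using h(2) CU that by auto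
  have cg: "continuous_on K (\<lambda>k. lam (g k))"
    by (rule continuous_on_compose2[OF holomorphic_on_imp_continuous_on[OF lam_holo] g(1)]) (use g(2) in auto)
  have ch: "continuous_on K (\<lambda>k. h (lam (g k)))" by (rule continuous_on_compose2[OF h(1) cg]) (use J in auto)
  have "g k = mob a b c d (h (lam (g k)))"
  proof (rule covering_space_lift_unique[OF lam_covering, of g k0 "\<lambda>k. mob a b c d (h (lam (g k)))" K "\<lambda>k. lam (g k)"])
    obtain t where t: "t \<in> C" "g k0 = mob a b c d t" using k0 by blast
    have "lam (g k0) = lam t" using lam_mob_six(1)[OF _ m(3,1,2)] t CU by auto
    thus "g k0 = mob a b c d (h (lam (g k0)))" using h(4)[OF t(1)] t(2) by simp
    show "continuous_on K (\<lambda>k. mob a b c d (h (lam (g k))))"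
      by (rule continuous_on_compose2[OF mob_cont[OF dr] ch]) (use hU J in auto)
    show "(\<lambda>k. mob a b c d (h (lam (g k)))) \<in> K \<rightarrow> UH" using mob_Im(2)[OF hU(2)[OF J] dr] by auto
    show "(\<lambda>k. lam (g k)) \<in> K \<rightarrow> - {0, 1}" using lam_neq g(2) by auto
    show "lam (g x) = lam (mob a b c d (h (lam (g x))))" if "x \<in> K" for x
      using lam_mob_six(1)[OF hU(2)[OF J[OF that]] m(3,1,2)] h(3)[OF J[OF that]] by simp
  qed (use K g cg in auto)
  thus ?thesis using hU(1)[OF J[OF K(3)]] by blast
qed

section \<open>Matrices of reduced words\<close>

fun mat :: "(nat \<times> int) list \<Rightarrow> int \<times> int \<times> int \<times> int" where
  "mat [] = (1, 0, 0, 1)"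
| "mat ((g, n) # w) = (case mat w of (a, b, c, d) \<Rightarrow>
     if g = 1 then (a + 2*n*c, b + 2*n*d, c, d) else (a, b, c - 2*n*a, d - 2*n*b))"

lemma mat_Gamma2:
  "mat w = (a, b, c, d) \<Longrightarrow> a * d - b * c = 1 \<and> even b \<and> even c \<and> odd a \<and> odd d"
proof (induction w arbitrary: a b c d)
  case (Cons x w)
  obtain g n where x: "x = (g, n)" by (cases x)
  obtain a' b' c' d' where m: "mat w = (a', b', c', d')" by (metis prod_cases4)
  show ?case using Cons.IH[OF m] Cons.prems
    by (auto simp: x m algebra_simps split: if_splits)
qed simp

text \<open>The matrix of the second generator contains -2. After the sign change both generators
  act as (x, y) \<mapsto> (2 m x + y, x), up to an exchange of coordinates, and equal neighbouring
  exponents become opposite.\<close>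

definition adj :: "(nat \<times> int) list \<Rightarrow> int list" where
  "adj w = map (\<lambda>(g, n). if g = 1 then n else - n) w"

fun kv :: "int list \<Rightarrow> int \<times> int \<Rightarrow> int \<times> int" where
  "kv [] v = v"
| "kv (m # ms) v = (case kv ms v of (x, y) \<Rightarrow> (2*m*x + y, x))"

text \<open>The syllable degrees after the sign change of \<open>adj\<close>, where a run of equal
  unit exponents appears as an alternating run.\<close>

fun alt_degs :: "int list \<Rightarrow> nat list" where
  "alt_degs [] = []"
| "alt_degs [n] = [nat \<bar>n\<bar>]"
| "alt_degs (n # m # ns) =
     (if \<bar>n\<bar> = 1 \<and> m = - n then (case alt_degs (m # ns) of d # ds \<Rightarrow> Suc d # ds | [] \<Rightarrow> [])
      else nat \<bar>n\<bar> # alt_degs (m # ns))"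

lemma reduced_Cons:
  "reduced_word ((g, n) # w) \<longleftrightarrow> g \<in> {1, 2} \<and> n \<noteq> 0 \<and> reduced_word w \<and> (w \<noteq> [] \<longrightarrow> fst (hd w) \<noteq> g)"
proof -
  have "(\<forall>i. Suc i < length ((g, n) # w) \<longrightarrow> fst (((g, n) # w) ! i) \<noteq> fst (((g, n) # w) ! Suc i))
    \<longleftrightarrow> (\<forall>i. Suc i < length w \<longrightarrow> fst (w ! i) \<noteq> fst (w ! Suc i)) \<and> (w \<noteq> [] \<longrightarrow> fst (hd w) \<noteq> g)" (is "?L \<longleftrightarrow> ?R")
  proof
    assume L: ?L
    show ?R
    proof (intro conjI allI impI)
      fix i assume "Suc i < length w"
      thus "fst (w ! i) \<noteq> fst (w ! Suc i)" using L[rule_format, of "Suc i"] by simp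
    next
      assume "w \<noteq> []" thus "fst (hd w) \<noteq> g" using L[rule_format, of 0] by (simp add: hd_conv_nth)
    qed
  next
    assume R: ?R
    show ?L
    proof (intro allI impI)
      fix i assume i: "Suc i < length ((g, n) # w)"
      show "fst (((g, n) # w) ! i) \<noteq> fst (((g, n) # w) ! Suc i)"
        using R i by (cases i) (auto simp: hd_conv_nth)
    qed
  qed
  thus ?thesis unfolding reduced_word_def by auto
qed

lemma syl_degs_adj: "reduced_word w \<Longrightarrow> syl_degs (map snd w) = alt_degs (adj w)"
proof (induction w rule: induct_list012)
  case (2 x) thus ?case by (cases x) (simp add: adj_def)
next
  case (3 x y w)
  obtain g n h m where xy: "x = (g, n)" "y = (h, m)" by (cases x; cases y)
  have r: "reduced_word (y # w)" "g \<in> {1,2}" "h \<in> {1,2}" "h \<noteq> g"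
    using 3(3) by (auto simp: xy reduced_Cons)
  have IH: "syl_degs (m # map snd w) = alt_degs ((if h = 1 then m else - m) # adj w)"
    using 3(2)[OF r(1)] by (simp add: xy adj_def)
  show ?case using r IH by (auto simp: xy adj_def)
qed (simp add: adj_def)

text \<open>The states of \<^const>\<open>kv\<close> are the columns of \<^const>\<open>mat\<close>, ordered so that the next letter acts on the first entry.\<close>

lemma mat_kv:
  assumes "reduced_word w" "w \<noteq> []" "mat w = (a, b, c, d)" "kv (adj w) (1, 0) = (X, y)" "kv (adj w) (0, 1) = (u, v)"
  shows "a * d + b * c = X * v + y * u" "\<bar>a\<^sup>2 + d\<^sup>2 - b\<^sup>2 - c\<^sup>2\<bar> = \<bar>X\<^sup>2 + v\<^sup>2 - y\<^sup>2 - u\<^sup>2\<bar>"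
proof -
  \<comment> \<open>The last and the first letter decide whether the columns and the rows come out
    exchanged. Either exchange preserves a d + b c and at most changes the sign of a^2 + d^2 - b^2 -
    c^2.\<close>
  have "(let (a, c, b, d) = (if fst (last w) = 1 then (b, d, a, c) else (a, c, b, d)) in
      if fst (hd w) = 1 then a = X \<and> c = y \<and> b = u \<and> d = v else c = X \<and> a = y \<and> d = u \<and> b = v)"
    using assms
  proof (induction w arbitrary: a b c d X y u v)
    case (Cons x w)
    obtain g n where x: "x = (g, n)" by (cases x)
    have r: "g \<in> {1,2}" "reduced_word w" "w \<noteq> [] \<Longrightarrow> fst (hd w) \<noteq> g" "w \<noteq> [] \<Longrightarrow> fst (hd w) \<in> {1,2}"
      using Cons.prems(1) by (auto simp: x reduced_Cons) (cases w; auto simp: reduced_Cons)+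
    show ?case
    proof (cases "w = []")
      case True
      thus ?thesis using Cons.prems r(1) by (auto simp: x adj_def)
    next
      case False
      obtain a' b' c' d' where m: "mat w = (a', b', c', d')" by (metis prod_cases4)
      obtain X' y' where k: "kv (adj w) (1, 0) = (X', y')" by fastforce
      obtain u' v' where l: "kv (adj w) (0, 1) = (u', v')" by fastforce
      have ad: "adj (x # w) = (if g = 1 then n else - n) # adj w" by (simp add: adj_def x)
      show ?thesis
        using Cons.IH[OF r(2) False m k l] Cons.prems(3-5) r(1,3,4) False unfolding ad
        by (auto simp: x m k l Let_def split: if_splits)
    qed
  qed simp
  thus "a * d + b * c = X * v + y * u" "\<bar>a\<^sup>2 + d\<^sup>2 - b\<^sup>2 - c\<^sup>2\<bar> = \<bar>X\<^sup>2 + v\<^sup>2 - y\<^sup>2 - u\<^sup>2\<bar>"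
    by (auto simp: Let_def algebra_simps split: if_splits)
qed

section \<open>Growth of the leading entry\<close>

definition lprod :: "nat list \<Rightarrow> int" where "lprod ds = (\<Prod>d\<leftarrow>ds. 4 * int d - 1)"

lemma lprod_Cons [simp]: "lprod (d # ds) = (4 * int d - 1) * lprod ds" "lprod [] = 1" by (simp_all add: lprod_def)

lemma alt_degs_pos: "\<forall>m\<in>set ms. m \<noteq> 0 \<Longrightarrow> \<forall>d\<in>set (alt_degs ms). d \<ge> 1"
proof (induction ms rule: alt_degs.induct)
  case (3 n m ns)
  have IH: "\<forall>d\<in>set (alt_degs (m # ns)). d \<ge> 1" using 3 by (cases "\<bar>n\<bar> = 1 \<and> m = - n") auto
  show ?case using IH 3(3) by (cases "alt_degs (m # ns)") auto
qed auto

lemma alt_degs_Cons: "\<exists>d ds. alt_degs (m # ms) = d # ds"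
proof (induction ms arbitrary: m)
  case (Cons a ms)
  obtain d ds where "alt_degs (a # ms) = d # ds" using Cons by blast
  thus ?case by auto
qed simp

lemma lprod_pos: "\<forall>d\<in>set ds. d \<ge> 1 \<Longrightarrow> lprod ds \<ge> 1"
proof (induction ds)
  case (Cons d ds)
  have "1 * 1 \<le> (4 * int d - 1) * lprod ds" using Cons by (intro mult_mono) auto
  thus ?case by simp
qed simp

lemma abs_twice_add:
  fixes t y :: int
  assumes "t \<noteq> 0" "\<bar>y\<bar> \<le> \<bar>t\<bar>"
  shows "\<bar>2*t + y\<bar> = 2 * \<bar>t\<bar> + (if t * y \<ge> 0 then \<bar>y\<bar> else - \<bar>y\<bar>)" "t * (2*t + y) > 0"
proof -
  have "\<bar>2*t + y\<bar> = 2 * \<bar>t\<bar> + (if t * y \<ge> 0 then \<bar>y\<bar> else - \<bar>y\<bar>) \<and> t * (2*t + y) > 0"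
  proof (cases "t > 0")
    case True
    have "2*t + y > 0" using True assms by linarith
    moreover have i: "t * y \<ge> 0 \<longleftrightarrow> y \<ge> 0" using True by (simp add: zero_le_mult_iff)
    ultimately show ?thesis unfolding i using True by auto
  next
    case False
    hence t: "t < 0" using assms by simp
    have "2*t + y < 0" using t assms by linarith
    moreover have i: "t * y \<ge> 0 \<longleftrightarrow> y \<le> 0" using t by (simp add: zero_le_mult_iff)
    ultimately show ?thesis unfolding i using t by (auto simp: mult_neg_neg)
  qed
  thus "\<bar>2*t + y\<bar> = 2 * \<bar>t\<bar> + (if t * y \<ge> 0 then \<bar>y\<bar> else - \<bar>y\<bar>)" "t * (2*t + y) > 0" by blast+
qed

lemma abs_weak_dominant:
  fixes m x y :: int
  assumes "m \<noteq> 0" "\<bar>y\<bar> \<le> \<bar>x\<bar>" "x \<noteq> 0"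
  shows "\<bar>2*m*x + y\<bar> = 2 * \<bar>m\<bar> * \<bar>x\<bar> + (if m * x * y \<ge> 0 then \<bar>y\<bar> else - \<bar>y\<bar>)"
    "m * (2*m*x + y) * x > 0" "\<bar>x\<bar> \<le> \<bar>2*m*x+y\<bar>" "2*m*x+y \<noteq> 0"
proof -
  have "1 * \<bar>x\<bar> \<le> \<bar>m\<bar> * \<bar>x\<bar>" using assms(1) by (intro mult_right_mono) auto
  hence mx: "\<bar>m * x\<bar> \<ge> \<bar>x\<bar>" by (simp add: abs_mult)
  note T = abs_twice_add[of "m * x" y]
  have T0: "m * x \<noteq> 0" "\<bar>y\<bar> \<le> \<bar>m * x\<bar>" using assms mx by auto
  show "\<bar>2*m*x + y\<bar> = 2 * \<bar>m\<bar> * \<bar>x\<bar> + (if m * x * y \<ge> 0 then \<bar>y\<bar> else - \<bar>y\<bar>)"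
    using T(1)[OF T0] by (simp only: mult.assoc abs_mult)
  show "m * (2*m*x + y) * x > 0" using T(2)[OF T0] by (simp add: algebra_simps)
  show "\<bar>x\<bar> \<le> \<bar>2*m*x+y\<bar>" using mx assms(2) unfolding mult.assoc by linarith
  thus "2*m*x+y \<noteq> 0" using assms(3) by auto
qed

lemma abs_dominant:
  fixes m x y :: int
  assumes "m \<noteq> 0" "\<bar>y\<bar> < \<bar>x\<bar>"
  shows "\<bar>x\<bar> < \<bar>2*m*x+y\<bar>"
proof -
  have "1 * \<bar>x\<bar> \<le> \<bar>m\<bar> * \<bar>x\<bar>" using assms(1) by (intro mult_right_mono) auto
  hence mx: "\<bar>m * x\<bar> \<ge> \<bar>x\<bar>" by (simp add: abs_mult)
  thus ?thesis using assms(2) unfolding mult.assoc by linarith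
qed

text \<open>Along an alternating run of unit letters |X| grows only arithmetically: |X| = x0 + d D
  with D = |X| - |y| and x0 the size at the start of the run, so a square has to outgrow 4 d - 1. If
  the run starts without cancellation, D \<ge> x0. If it starts with cancellation, the letter
  applied before has size at least 2; then only D \<ge> 2 x0 / 3 holds, but that letter leaves a
  surplus factor 9/7 in x0^2. The two implications at the end transport this information.\<close>

lemma kv_growth:
  assumes "\<forall>m\<in>set (m # ms). m \<noteq> 0" "kv (m # ms) (1, 0) = (X, y)" "alt_degs (m # ms) = d # ds"
  shows "\<bar>y\<bar> < \<bar>X\<bar> \<and> y \<noteq> 0 \<and> m * X * y > 0 \<and> X\<^sup>2 \<ge> lprod (d # ds) \<and> \<bar>X\<bar> \<le> (2 * int d + 1) * lprod ds
    \<and> (\<bar>m\<bar> = 1 \<longrightarrow> \<bar>X\<bar> - \<bar>y\<bar> \<le> 2 * lprod ds \<and> (\<exists>x0 \<ge> 0. \<bar>X\<bar> = x0 + int d * (\<bar>X\<bar> - \<bar>y\<bar>) \<and>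
         (\<bar>X\<bar> - \<bar>y\<bar> \<ge> x0 \<and> x0\<^sup>2 \<ge> lprod ds \<or> 3 * (\<bar>X\<bar> - \<bar>y\<bar>) \<ge> 2 * x0 \<and> 7 * x0\<^sup>2 \<ge> 9 * lprod ds)))
    \<and> (\<bar>m\<bar> \<ge> 2 \<longrightarrow> 7 * X\<^sup>2 \<ge> 9 * lprod (d # ds) \<and> \<bar>X\<bar> \<ge> 3 * \<bar>y\<bar>)"
  using assms
proof (induction ms arbitrary: m X y d ds)
  case Nil
  hence e: "X = 2 * m" "y = 1" "int d = \<bar>m\<bar>" "ds = []" "m \<noteq> 0" by auto
  have m2: "m\<^sup>2 = \<bar>m\<bar> * \<bar>m\<bar>" by (simp add: power2_eq_square)
  have a: "0 \<le> (\<bar>m\<bar> - 1) * \<bar>m\<bar>" using e by (intro mult_nonneg_nonneg) auto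
  have b: "\<bar>m\<bar> \<ge> 2 \<Longrightarrow> 0 \<le> (\<bar>m\<bar> - 2) * \<bar>m\<bar>" by (simp add: zero_le_mult_iff)
  have c: "0 < m * (2 * m)" using e by (simp add: zero_less_mult_iff) auto
  have d: "\<bar>m\<bar> \<ge> 1" using e by auto
  show ?case
    using a b c d by (auto simp: e power_mult_distrib m2 abs_mult algebra_simps intro!: exI[of _ 1])
next
  case (Cons m' ms)
  obtain X' y' where k: "kv (m' # ms) (1, 0) = (X', y')" by fastforce
  obtain d' ds' where ad: "alt_degs (m' # ms) = d' # ds'" using alt_degs_Cons by blast
  have nz: "\<forall>m\<in>set (m' # ms). m \<noteq> 0" "m \<noteq> 0" "m' \<noteq> 0" using Cons.prems(1) by auto
  note IH = Cons.IH[OF nz(1) k ad]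
  have Xy: "X = 2*m*X' + y'" "y = X'" using Cons.prems(2) k by auto
  define x z where "x = \<bar>X'\<bar>" and "z = \<bar>y'\<bar>"
  have y'0: "y' \<noteq> 0" "\<bar>y'\<bar> < \<bar>X'\<bar>" using IH by blast+
  hence zx: "z < x" "z \<ge> 1" unfolding x_def z_def by linarith+
  have X'0: "X' \<noteq> 0" using y'0 by auto
  have dom: "\<bar>X\<bar> = 2 * \<bar>m\<bar> * x + (if m * X' * y' \<ge> 0 then z else - z)" "m * X * y > 0" "x < \<bar>X\<bar>"
    using abs_weak_dominant(1,2)[OF nz(2) less_imp_le[OF y'0(2)] X'0] abs_dominant[OF nz(2) y'0(2)] unfolding Xy x_def z_def by auto
  have dpos: "\<forall>d\<in>set (d' # ds'). d \<ge> 1" using alt_degs_pos[OF nz(1)] ad by metis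
  have L1: "lprod ds' \<ge> 1" "lprod (d' # ds') \<ge> 1" using dpos lprod_pos[OF dpos] by (auto intro: lprod_pos)
  have xW: "x\<^sup>2 \<ge> lprod (d' # ds')" "x \<le> (2 * int d' + 1) * lprod ds'" using IH by (auto simp: x_def)
  have "(2 * int d' + 1) * lprod ds' \<le> lprod (d' # ds')" using dpos L1 by (simp add: mult_right_mono)
  hence xN: "x \<le> lprod (d' # ds')" using xW(2) by linarith
  have yx: "\<bar>y\<bar> = x" by (simp add: Xy x_def)
  have sgn': "m' * X' * y' > 0" using IH by blast
  consider (run) "\<bar>m\<bar> = 1" "m' = - m" | (big) "\<bar>m\<bar> \<ge> 2" | (new) "\<bar>m\<bar> = 1" "m' \<noteq> - m" using nz(2) by fastforce
  thus ?case
  proof cases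
    case run
    have dd: "d = Suc d'" "ds = ds'" using Cons.prems(3) run ad by auto
    have neg: "m * X' * y' < 0" using sgn' run by (simp add: algebra_simps)
    have X: "\<bar>X\<bar> = 2 * x - z" using dom(1) neg run by simp
    have m1: "\<bar>m'\<bar> = 1" using run by simp
    obtain x0 where x0: "x0 \<ge> 0" "x = x0 + int d' * (x - z)" "x - z \<le> 2 * lprod ds"
      and alt: "x - z \<ge> x0 \<and> x0\<^sup>2 \<ge> lprod ds \<or> 3 * (x - z) \<ge> 2 * x0 \<and> 7 * x0\<^sup>2 \<ge> 9 * lprod ds"
      using IH m1 unfolding x_def z_def dd by blast
    define D where "D = x - z"
    have D1: "D \<ge> 1" using zx by (simp add: D_def)
    have XD: "\<bar>X\<bar> = x0 + int d * D" using X x0(2) by (simp add: D_def dd algebra_simps)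
    have alt: "D \<ge> x0 \<and> x0\<^sup>2 \<ge> lprod ds \<or> 3 * D \<ge> 2 * x0 \<and> 7 * x0\<^sup>2 \<ge> 9 * lprod ds" using alt by (simp add: D_def)
    have L0: "lprod ds \<ge> 0" using L1 dd by simp
    have sq: "X\<^sup>2 \<ge> lprod (d # ds)"
      using alt
    proof
      assume a: "D \<ge> x0 \<and> x0\<^sup>2 \<ge> lprod ds"
      have "int d * x0 \<le> int d * D" using a by (intro mult_left_mono) auto
      hence "(int d + 1) * x0 \<le> \<bar>X\<bar>" using XD by (simp add: algebra_simps)
      hence "((int d + 1) * x0)\<^sup>2 \<le> \<bar>X\<bar>\<^sup>2" using x0(1) by (intro power_mono) auto
      hence "(int d + 1)\<^sup>2 * x0\<^sup>2 \<le> X\<^sup>2" by (simp add: power_mult_distrib)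
      moreover have "(4 * int d - 1) * lprod ds \<le> (int d + 1)\<^sup>2 * x0\<^sup>2"
      proof (rule mult_mono)
        \<comment> \<open>(d + 1)^2 - 4 d = (d - 1)^2.\<close>
        have "0 \<le> (int d - 1)\<^sup>2" by simp
        thus "4 * int d - 1 \<le> (int d + 1)\<^sup>2" by (simp add: power2_eq_square algebra_simps)
      qed (use a L0 in auto)
      ultimately show ?thesis by simp
    next
      assume a: "3 * D \<ge> 2 * x0 \<and> 7 * x0\<^sup>2 \<ge> 9 * lprod ds"
      have "int d * (2 * x0) \<le> int d * (3 * D)" using a by (intro mult_left_mono) auto
      hence "(3 + 2 * int d) * x0 \<le> 3 * \<bar>X\<bar>" using XD by (simp add: algebra_simps)
      hence "((3 + 2 * int d) * x0)\<^sup>2 \<le> (3 * \<bar>X\<bar>)\<^sup>2" using x0(1) by (intro power_mono) auto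
      hence 1: "(3 + 2 * int d)\<^sup>2 * x0\<^sup>2 \<le> 9 * X\<^sup>2" by (simp add: power_mult_distrib)
      have "(3 + 2 * int d)\<^sup>2 * (9 * lprod ds) \<le> (3 + 2 * int d)\<^sup>2 * (7 * x0\<^sup>2)" using a by (intro mult_left_mono) auto
      also have "\<dots> \<le> 7 * (9 * X\<^sup>2)" using 1 by (simp add: mult_ac)
      finally have "(3 + 2 * int d)\<^sup>2 * lprod ds \<le> 7 * X\<^sup>2" by (simp add: mult_ac)
      moreover have "(7 * (4 * int d - 1)) * lprod ds \<le> (3 + 2 * int d)\<^sup>2 * lprod ds"
      proof (rule mult_right_mono[OF _ L0])
        \<comment> \<open>(3 + 2 d)^2 - 7 (4 d - 1) = 4 (d - 2)^2, with equality at d = 2: the slope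
          2/3 and the surplus 9/7 just suffice together.\<close>
        have "0 \<le> 4 * (int d - 2)\<^sup>2" by simp
        thus "7 * (4 * int d - 1) \<le> (3 + 2 * int d)\<^sup>2" by (simp add: power2_eq_square algebra_simps)
      qed
      ultimately have "(7 * (4 * int d - 1)) * lprod ds \<le> 7 * X\<^sup>2" by linarith
      hence "7 * lprod (d # ds) \<le> 7 * X\<^sup>2" by (simp only: lprod_Cons mult.assoc)
      thus ?thesis by linarith
    qed
    have "\<bar>X\<bar> \<le> (2 * int d + 1) * lprod ds" using X x0(3) xW(2) by (simp add: dd algebra_simps)
    moreover have "\<bar>X\<bar> - \<bar>y\<bar> = D" using X yx by (simp add: D_def)
    ultimately show ?thesis
      using dom(2,3) zx x0(1,3) sq alt XD run(1) yx by (auto simp: D_def intro!: exI[of _ x0])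
  next
    case big
    have dd: "d = nat \<bar>m\<bar>" "ds = d' # ds'" using Cons.prems(3) big ad by auto
    have di: "int d = \<bar>m\<bar>" by (simp add: dd)
    have "(2 * \<bar>m\<bar> - 1) * x \<le> \<bar>X\<bar>" using dom(1) zx by (auto simp: algebra_simps split: if_splits)
    hence X1: "(2 * int d - 1) * x \<le> \<bar>X\<bar>" by (simp add: di)
    have d2: "int d \<ge> 2" using big di by simp
    have "((2 * int d - 1) * x)\<^sup>2 \<le> \<bar>X\<bar>\<^sup>2" using X1 d2 zx by (intro power_mono mult_nonneg_nonneg) auto
    hence X2: "(2 * int d - 1)\<^sup>2 * x\<^sup>2 \<le> X\<^sup>2" by (simp add: power_mult_distrib)
    have A: "(9 * (4 * int d - 1)) * lprod ds \<le> (7 * (2 * int d - 1)\<^sup>2) * x\<^sup>2"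
    proof (rule mult_mono)
      \<comment> \<open>7 (2 d - 1)^2 - 9 (4 d - 1) = (d - 2) (28 d - 8). The surplus 9/7 is the
        value of (2 d - 1)^2 / (4 d - 1) at d = 2.\<close>
      have "0 \<le> (int d - 2) * (28 * int d - 8)" using d2 by (intro mult_nonneg_nonneg) auto
      thus "9 * (4 * int d - 1) \<le> 7 * (2 * int d - 1)\<^sup>2" by (simp add: power2_eq_square algebra_simps)
    qed (use xW L1 dd in auto)
    have "9 * lprod (d # ds) \<le> 7 * ((2 * int d - 1)\<^sup>2 * x\<^sup>2)" using A by (simp only: lprod_Cons mult.assoc)
    hence sq: "9 * lprod (d # ds) \<le> 7 * X\<^sup>2" using X2 by linarith
    have "3 * x \<le> (2 * int d - 1) * x" using d2 zx by (intro mult_right_mono) auto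
    hence x3: "3 * \<bar>y\<bar> \<le> \<bar>X\<bar>" using X1 yx by simp
    have "\<bar>X\<bar> \<le> (2 * int d + 1) * x" using dom(1) zx by (auto simp: di algebra_simps split: if_splits)
    also have "\<dots> \<le> (2 * int d + 1) * lprod ds" using xN dd by (intro mult_left_mono) auto
    finally have up: "\<bar>X\<bar> \<le> (2 * int d + 1) * lprod ds" .
    have "lprod (d # ds) \<ge> 0" using L1 dd d2 by simp
    thus ?thesis using sq x3 up dom(2,3) zx yx big by auto
  next
    case new
    have dd: "d = 1" "ds = d' # ds'" using Cons.prems(3) new ad by auto
    have X: "\<bar>X\<bar> = 2 * x + (if m * X' * y' \<ge> 0 then z else - z)" using dom(1) new by simp
    have up: "\<bar>X\<bar> \<le> 3 * lprod ds" "\<bar>X\<bar> - \<bar>y\<bar> \<le> 2 * lprod ds" using X xN zx dd yx by (auto split: if_splits)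
    show ?thesis
    proof (cases "m * X' * y' \<ge> 0")
      case True
      have "(2 * x)\<^sup>2 \<le> \<bar>X\<bar>\<^sup>2" using X True zx by (intro power_mono) auto
      hence "4 * x\<^sup>2 \<le> X\<^sup>2" by simp
      hence "lprod (d # ds) \<le> X\<^sup>2" using xW(1) L1 by (simp add: dd)
      thus ?thesis using X True up zx xW(1) dom(2,3) yx new(1) by (auto simp: dd intro!: exI[of _ x])
    next
      case False
      \<comment> \<open>A unit m' would equal m, as the run does not continue, and then m X' y'
        would be positive. Cancellation at the start of a run thus occurs only after a letter of
        size at least 2.\<close>
      have "\<bar>m'\<bar> \<noteq> 1"
      proof
        assume "\<bar>m'\<bar> = 1"
        hence "m' = m" using new by (auto simp: abs_if split: if_splits)
        thus False using sgn' False by simp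
      qed
      hence "\<bar>m'\<bar> \<ge> 2" using nz(3) by (auto simp: abs_if split: if_splits)
      hence b: "7 * x\<^sup>2 \<ge> 9 * lprod ds" "x \<ge> 3 * z" using IH by (auto simp: dd x_def z_def)
      \<comment> \<open>Here |X| = 2 x - z with z \<le> x / 3.\<close>
      have "(5 * x)\<^sup>2 \<le> (3 * \<bar>X\<bar>)\<^sup>2" using X False b zx by (intro power_mono) auto
      hence "25 * x\<^sup>2 \<le> 9 * X\<^sup>2" by (simp add: power_mult_distrib)
      moreover have "lprod ds \<ge> 1" using L1 dd by simp
      ultimately have "3 * lprod ds \<le> X\<^sup>2" using b(1) by linarith
      hence "lprod (d # ds) \<le> X\<^sup>2" by (simp add: dd(1))
      thus ?thesis using X False up zx b dom(2,3) yx new(1) by (auto simp: dd intro!: exI[of _ x])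
    qed
  qed
qed

lemma kv_det: "kv ms (1, 0) = (X, y) \<Longrightarrow> kv ms (0, 1) = (u, v) \<Longrightarrow> \<bar>X * v - y * u\<bar> = 1"
proof (induction ms arbitrary: X y u v)
  case (Cons m ms)
  obtain X' y' where k: "kv ms (1, 0) = (X', y')" by fastforce
  obtain u' v' where l: "kv ms (0, 1) = (u', v')" by fastforce
  have e: "X = 2*m*X' + y'" "y = X'" "u = 2*m*u' + v'" "v = u'" using Cons.prems k l by auto
  have "X * v - y * u = - (X' * v' - y' * u')" by (simp add: e algebra_simps)
  thus ?case using Cons.IH[OF k l] by simp
qed simp

section \<open>Alternating unit words and the quadratic form\<close>

fun slow :: "int list \<Rightarrow> bool" where
  "slow [] = True" | "slow [m] = (\<bar>m\<bar> = 1)" | "slow (m # m' # ms) = (\<bar>m\<bar> = 1 \<and> m' = - m \<and> slow (m' # ms))"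

text \<open>With \<open>\<sigma>\<close> the sign of the last exponent, the column difference \<open>(D, E)\<close> stays bounded exactly along the slow words.\<close>

lemma kv_difference:
  assumes "\<forall>m\<in>set (m # ms). m \<noteq> 0" "\<sigma> = sgn (last (m # ms))" "kv (m # ms) (1, - \<sigma>) = (D, E)" "kv (m # ms) (0, 1) = (u, v)"
  shows "odd D \<and> odd E \<and> \<bar>E\<bar> \<le> \<bar>D\<bar> \<and> \<bar>v\<bar> \<le> \<bar>u\<bar> \<and> \<sigma> * D * u > 0 \<and> \<sigma> * E * v \<ge> 0 \<and> m * D * E > 0 \<and> m * u * v \<ge> 0
    \<and> (if slow (m # ms) then \<bar>D\<bar> = 1 \<and> \<bar>E\<bar> = 1 else \<bar>E\<bar> < \<bar>D\<bar>) \<and> (ms \<noteq> [] \<longrightarrow> v \<noteq> 0)"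
  using assms
proof (induction ms arbitrary: m D E u v)
  case Nil
  hence e: "\<sigma> = sgn m" "D = 2 * m - \<sigma>" "E = 1" "u = 1" "v = 0" "m \<noteq> 0" by auto
  show ?case by (cases "m > 0") (use e in \<open>auto simp: sgn_if mult_pos_pos mult_neg_neg\<close>)
next
  case (Cons m' ms)
  obtain D' E' where k: "kv (m' # ms) (1, - \<sigma>) = (D', E')" by fastforce
  obtain u' v' where l: "kv (m' # ms) (0, 1) = (u', v')" by fastforce
  have nz: "\<forall>m\<in>set (m' # ms). m \<noteq> 0" "m \<noteq> 0" using Cons.prems(1) by auto
  have sg: "\<sigma> = sgn (last (m' # ms))" using Cons.prems(2) by simp
  note IH = Cons.IH[OF nz(1) sg k l]
  have e: "D = 2*m*D' + E'" "E = D'" "u = 2*m*u' + v'" "v = u'" using Cons.prems(3,4) k l by auto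
  have nz': "D' \<noteq> 0" "u' \<noteq> 0" using IH by auto
  have a: "m * D * E > 0" "\<bar>E\<bar> \<le> \<bar>D\<bar>" "D \<noteq> 0" using abs_weak_dominant(2-4)[OF nz(2) _ nz'(1), of E'] IH unfolding e by blast+
  have b: "m * u * v > 0" "\<bar>v\<bar> \<le> \<bar>u\<bar>" "u \<noteq> 0" using abs_weak_dominant(2-4)[OF nz(2) _ nz'(2), of v'] IH unfolding e by blast+
  have Ev: "\<sigma> * E * v > 0" using IH by (simp add: e)
  \<comment> \<open>The sign of \<sigma> D u is found by multiplying with a square and regrouping
    into three factors of known sign.\<close>
  have "(\<sigma> * D * u) * (m * m * (E * v) * (E * v)) = (\<sigma> * E * v) * ((m * D * E) * (m * u * v))" by (simp add: algebra_simps)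
  also have "\<dots> > 0" by (rule mult_pos_pos[OF Ev mult_pos_pos[OF a(1) b(1)]])
  finally have Du: "\<sigma> * D * u > 0" by (simp add: zero_less_mult_iff) (auto simp: zero_less_mult_iff mult_less_0_iff)
  have str: "if slow (m # m' # ms) then \<bar>D\<bar> = 1 \<and> \<bar>E\<bar> = 1 else \<bar>E\<bar> < \<bar>D\<bar>"
  proof (cases "slow (m' # ms)")
    case False
    hence "\<bar>E'\<bar> < \<bar>D'\<bar>" using IH by simp
    from abs_dominant[OF nz(2) this] show ?thesis using False by (simp add: e)
  next
    case True
    hence h: "\<bar>D'\<bar> = 1" "\<bar>E'\<bar> = 1" "m' * D' * E' > 0" using IH by auto
    have m': "\<bar>m'\<bar> = 1" using True by (cases ms) auto
    have "E' = m' * D'" using h m' by (auto simp: abs_if split: if_splits)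
    hence D: "D = (2 * m + m') * D'" by (simp add: e algebra_simps)
    hence Da: "\<bar>D\<bar> = \<bar>2 * m + m'\<bar>" using h by (simp add: abs_mult)
    show ?thesis
    proof (cases "\<bar>m\<bar> = 1 \<and> m' = - m")
      case True thus ?thesis using \<open>slow (m' # ms)\<close> Da h by (auto simp: e)
    next
      case False
      have "\<bar>2 * m + m'\<bar> > 1" using False m' nz(2) by (auto simp: abs_if split: if_splits)
      thus ?thesis using False Da h by (auto simp: e)
    qed
  qed
  have o: "odd D" "odd E" using IH by (simp_all add: e)
  have v0: "v \<noteq> 0" using nz' by (simp add: e)
  show ?case using o a b Ev Du str v0 less_imp_le by blast
qed

lemma kv_linear: "kv ms (1, 0) = (X, y) \<Longrightarrow> kv ms (0, 1) = (u, v) \<Longrightarrow> kv ms (1, s) = (X + s * u, y + s * v)"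
proof (induction ms arbitrary: X y u v)
  case (Cons m ms)
  obtain X' y' where k: "kv ms (1, 0) = (X', y')" by fastforce
  obtain u' v' where l: "kv ms (0, 1) = (u', v')" by fastforce
  show ?case using Cons.prems Cons.IH[OF k l] by (auto simp: k l algebra_simps)
qed simp

text \<open>The columns (X, y) and (u, v) have determinant plus or minus 1, so X v + y u differs
  from 2 X v by 1. For the quadratic form one writes X = D + \<sigma> u and y = E + \<sigma> v; the
  signs match, and it becomes |D|^2 - |E|^2 + 2 (|D| |u| - |E| |v|).\<close>

lemma kv_bounds:
  assumes nz: "\<forall>m\<in>set ms. m \<noteq> 0" and ne: "ms \<noteq> []" and k: "kv ms (1, 0) = (X, y)" and l: "kv ms (0, 1) = (u, v)"
  shows "lprod (alt_degs ms) \<le> X\<^sup>2" "\<bar>X\<bar> \<le> lprod (alt_degs ms)" "\<bar>u\<bar> \<le> \<bar>X\<bar>" "\<bar>y\<bar> \<le> \<bar>X\<bar>" "\<bar>v\<bar> \<le> \<bar>X\<bar>" "3 \<le> lprod (alt_degs ms)"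
    "length ms = 1 \<Longrightarrow> X * v + y * u = 1" "length ms > 1 \<Longrightarrow> \<bar>X * v + y * u\<bar> \<ge> 2 * \<bar>X\<bar> - 1"
    "slow ms \<Longrightarrow> \<bar>X\<^sup>2 + v\<^sup>2 - y\<^sup>2 - u\<^sup>2\<bar> = 2" "\<not> slow ms \<Longrightarrow> \<bar>X\<^sup>2 + v\<^sup>2 - y\<^sup>2 - u\<^sup>2\<bar> \<ge> 2 * \<bar>X\<bar> + 2"
proof -
  obtain m ms' where ms: "ms = m # ms'" using ne by (cases ms) auto
  obtain d ds where ad: "alt_degs ms = d # ds" using alt_degs_Cons unfolding ms by blast
  have G: "\<bar>y\<bar> < \<bar>X\<bar> \<and> y \<noteq> 0 \<and> X\<^sup>2 \<ge> lprod (d # ds) \<and> \<bar>X\<bar> \<le> (2 * int d + 1) * lprod ds"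
    using kv_growth[of m ms' X y d ds] nz k ad unfolding ms by blast
  have dpos: "\<forall>d\<in>set (d # ds). d \<ge> 1" using alt_degs_pos[OF nz] ad by metis
  have L1: "lprod ds \<ge> 1" using dpos by (auto intro: lprod_pos)
  show "lprod (alt_degs ms) \<le> X\<^sup>2" using G ad by simp
  have "(2 * int d + 1) * lprod ds \<le> lprod (d # ds)" using dpos L1 by (simp add: mult_right_mono)
  thus "\<bar>X\<bar> \<le> lprod (alt_degs ms)" using G ad by simp
  have "3 * 1 \<le> (4 * int d - 1) * lprod ds" using dpos L1 by (intro mult_mono) auto
  thus "3 \<le> lprod (alt_degs ms)" by (simp add: ad)
  show "\<bar>y\<bar> \<le> \<bar>X\<bar>" using G by simp
  define \<sigma> where "\<sigma> = sgn (last ms)"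
  have s1: "\<sigma> = 1 \<or> \<sigma> = -1" using nz ne last_in_set[OF ne] by (auto simp: \<sigma>_def sgn_if)
  define D E where "D = X - \<sigma> * u" and "E = y - \<sigma> * v"
  have "kv ms (1, - \<sigma>) = (D, E)" using kv_linear[OF k l, of "- \<sigma>"] by (simp add: D_def E_def)
  hence H: "odd D \<and> odd E \<and> \<bar>E\<bar> \<le> \<bar>D\<bar> \<and> \<bar>v\<bar> \<le> \<bar>u\<bar> \<and> \<sigma> * D * u > 0 \<and> \<sigma> * E * v \<ge> 0 \<and> m * D * E > 0 \<and> m * u * v \<ge> 0
    \<and> (if slow ms then \<bar>D\<bar> = 1 \<and> \<bar>E\<bar> = 1 else \<bar>E\<bar> < \<bar>D\<bar>) \<and> (ms' \<noteq> [] \<longrightarrow> v \<noteq> 0)"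
    using kv_difference[of m ms' \<sigma> D E u v] nz l unfolding ms \<sigma>_def by blast
  have Du: "\<sigma> * (D * u) = \<bar>D\<bar> * \<bar>u\<bar>" "\<sigma> * (E * v) = \<bar>E\<bar> * \<bar>v\<bar>"
  proof -
    have s1a: "\<bar>\<sigma>\<bar> = 1" using s1 by auto
    have p: "\<sigma> * (D * u) \<ge> 0" "\<sigma> * (E * v) \<ge> 0" using H by (simp_all add: mult.assoc[symmetric])
    show "\<sigma> * (D * u) = \<bar>D\<bar> * \<bar>u\<bar>" "\<sigma> * (E * v) = \<bar>E\<bar> * \<bar>v\<bar>"
      using abs_of_nonneg[OF p(1)] abs_of_nonneg[OF p(2)] by (simp_all add: abs_mult s1a)
  qed
  have ss: "\<sigma> * \<sigma> = 1" using s1 by auto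
  have XD: "X = D + \<sigma> * u" "y = E + \<sigma> * v" by (simp_all add: D_def E_def)
  have aX: "\<bar>X\<bar> = \<bar>D\<bar> + \<bar>u\<bar>"
  proof -
    have "(\<bar>D\<bar> + \<bar>u\<bar>)\<^sup>2 = X\<^sup>2"
    proof -
      have "X\<^sup>2 = D\<^sup>2 + 2 * (\<sigma> * (D * u)) + (\<sigma> * \<sigma>) * u\<^sup>2" unfolding XD by (simp add: power2_eq_square algebra_simps)
      thus ?thesis unfolding Du ss by (simp add: power2_sum)
    qed
    thus ?thesis by (metis abs_ge_zero add_nonneg_nonneg power2_abs power2_eq_imp_eq)
  qed
  have vu: "\<bar>v\<bar> \<le> \<bar>u\<bar>" using H by blast
  show "\<bar>u\<bar> \<le> \<bar>X\<bar>" "\<bar>v\<bar> \<le> \<bar>X\<bar>" using aX vu by linarith+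
  have det: "\<bar>X * v - y * u\<bar> = 1" by (rule kv_det[OF k l])
  show "X * v + y * u = 1" if "length ms = 1"
  proof -
    have "ms' = []" using that by (simp add: ms)
    thus ?thesis using k l by (simp add: ms)
  qed
  show "\<bar>X * v + y * u\<bar> \<ge> 2 * \<bar>X\<bar> - 1" if "length ms > 1"
  proof -
    have "v \<noteq> 0" using H that by (auto simp: ms)
    hence "\<bar>X\<bar> * 1 \<le> \<bar>X\<bar> * \<bar>v\<bar>" by (intro mult_left_mono) auto
    hence "\<bar>X\<bar> \<le> \<bar>X * v\<bar>" by (simp add: abs_mult)
    thus ?thesis using det by linarith
  qed
  have Q: "X\<^sup>2 + v\<^sup>2 - y\<^sup>2 - u\<^sup>2 = \<bar>D\<bar>\<^sup>2 - \<bar>E\<bar>\<^sup>2 + 2 * (\<bar>D\<bar> * \<bar>u\<bar> - \<bar>E\<bar> * \<bar>v\<bar>)"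
  proof -
    have "X\<^sup>2 + v\<^sup>2 - y\<^sup>2 - u\<^sup>2 = D\<^sup>2 - E\<^sup>2 + 2 * (\<sigma> * (D * u) - \<sigma> * (E * v)) + (\<sigma> * \<sigma> - 1) * (u\<^sup>2 - v\<^sup>2)"
      unfolding XD by (simp add: power2_eq_square algebra_simps)
    thus ?thesis unfolding Du ss by simp
  qed
  show "\<bar>X\<^sup>2 + v\<^sup>2 - y\<^sup>2 - u\<^sup>2\<bar> = 2" if "slow ms"
  proof -
    have h: "\<bar>D\<bar> = 1" "\<bar>E\<bar> = 1" using H that by auto
    have "D * v - E * u = X * v - y * u" by (simp add: D_def E_def algebra_simps)
    hence de: "\<bar>D * v - E * u\<bar> = 1" using det by simp
    \<comment> \<open>D v and E u have the same sign; since |D| = |E| = 1, the determinant then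
      gives |u| - |v| = 1.\<close>
    have "0 \<le> m * D * E" "0 \<le> m * u * v" using H by (blast intro: less_imp_le)+
    hence "0 \<le> (m * D * E) * (m * u * v)" by (rule mult_nonneg_nonneg)
    also have "\<dots> = (m * m) * ((D * v) * (E * u))" by (simp add: mult_ac)
    finally have "(m * m) * 0 \<le> (m * m) * ((D * v) * (E * u))" by simp
    moreover have "m \<noteq> 0" using nz by (simp add: ms)
    hence "0 < m * m" by (cases "m > 0") (auto intro: mult_pos_pos mult_neg_neg)
    ultimately have nn: "0 \<le> (D * v) * (E * u)" using mult_le_cancel_left_pos by blast
    have gen: "r * t \<ge> 0 \<Longrightarrow> \<bar>r - t\<bar> = \<bar>\<bar>r\<bar> - \<bar>t\<bar>\<bar>" for r t :: int by (simp only: zero_le_mult_iff) linarith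
    have "\<bar>\<bar>D * v\<bar> - \<bar>E * u\<bar>\<bar> = 1" using de unfolding gen[OF nn] .
    hence "\<bar>\<bar>v\<bar> - \<bar>u\<bar>\<bar> = 1" unfolding abs_mult h by simp
    hence "\<bar>u\<bar> - \<bar>v\<bar> = 1" using vu by linarith
    thus ?thesis unfolding Q h by simp
  qed
  show "\<bar>X\<^sup>2 + v\<^sup>2 - y\<^sup>2 - u\<^sup>2\<bar> \<ge> 2 * \<bar>X\<bar> + 2" if "\<not> slow ms"
  proof -
    have lt: "\<bar>E\<bar> < \<bar>D\<bar>" using H that by simp
    \<comment> \<open>D and E are odd, so |E| < |D| improves to a gap of at least 2.\<close>
    have "even (\<bar>D\<bar> - \<bar>E\<bar>)" using H by simp
    then obtain k where "\<bar>D\<bar> - \<bar>E\<bar> = 2 * k" by (rule evenE)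
    moreover from this have "k \<ge> 1" using lt by linarith
    ultimately have D2: "\<bar>D\<bar> - \<bar>E\<bar> \<ge> 2" by linarith
    have "u \<noteq> 0" "E \<noteq> 0" using H by auto
    hence u1: "\<bar>u\<bar> \<ge> 1" and E1: "\<bar>E\<bar> \<ge> 1" by linarith+
    have "\<bar>E\<bar> * \<bar>v\<bar> \<le> \<bar>E\<bar> * \<bar>u\<bar>" using H by (intro mult_left_mono) auto
    hence "X\<^sup>2 + v\<^sup>2 - y\<^sup>2 - u\<^sup>2 \<ge> (\<bar>D\<bar> - \<bar>E\<bar>) * (\<bar>D\<bar> + \<bar>E\<bar> + 2 * \<bar>u\<bar>)"
      unfolding Q by (simp add: power2_eq_square algebra_simps)
    moreover have "2 * (\<bar>D\<bar> + \<bar>E\<bar> + 2 * \<bar>u\<bar>) \<le> (\<bar>D\<bar> - \<bar>E\<bar>) * (\<bar>D\<bar> + \<bar>E\<bar> + 2 * \<bar>u\<bar>)" using D2 by (intro mult_right_mono) auto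
    ultimately have "2 * (\<bar>D\<bar> + \<bar>E\<bar> + 2 * \<bar>u\<bar>) \<le> X\<^sup>2 + v\<^sup>2 - y\<^sup>2 - u\<^sup>2" by (rule order_trans[rotated])
    also have "\<dots> \<le> \<bar>X\<^sup>2 + v\<^sup>2 - y\<^sup>2 - u\<^sup>2\<bar>" by (rule abs_ge_self)
    finally have le: "2 * (\<bar>D\<bar> + \<bar>E\<bar> + 2 * \<bar>u\<bar>) \<le> \<bar>X\<^sup>2 + v\<^sup>2 - y\<^sup>2 - u\<^sup>2\<bar>" .
    have arith: "x = d + t \<Longrightarrow> 1 \<le> t \<Longrightarrow> 1 \<le> e \<Longrightarrow> 2 * (d + e + 2 * t) \<le> q \<Longrightarrow> 2 * x + 2 \<le> q" for x d t e q :: int by presburger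
    show ?thesis by (rule arith[OF aX u1 E1 le])
  qed
qed

text \<open>Undoing the sign change turns alternating unit letters into equal unit exponents, the
  exceptional case for conjugate pairs.\<close>

lemma slow_adj:
  "reduced_word w \<Longrightarrow> slow (adj w) \<longleftrightarrow> (\<forall>(g, n) \<in> set w. n = 1) \<or> (\<forall>(g, n) \<in> set w. n = -1)"
proof (induction w rule: induct_list012)
  case (2 x) thus ?case by (cases x) (auto simp: adj_def reduced_Cons)
next
  case (3 x y w)
  obtain g n h m where xy: "x = (g, n)" "y = (h, m)" by (cases x; cases y)
  have r: "reduced_word (y # w)" "g \<in> {1,2}" "h \<in> {1,2}" "h \<noteq> g"
    using 3(3) by (auto simp: xy reduced_Cons)
  have IH: "slow ((if h = 1 then m else - m) # adj w) \<longleftrightarrow> (m = 1 \<and> (\<forall>(g, n) \<in> set w. n = 1)) \<or> (m = -1 \<and> (\<forall>(g, n) \<in> set w. n = -1))"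
    using 3(2)[OF r(1)] by (simp add: xy adj_def)
  have "slow (adj (x # y # w)) \<longleftrightarrow> \<bar>n\<bar> = 1 \<and> m = n \<and> slow ((if h = 1 then m else - m) # adj w)"
    using r by (auto simp: xy adj_def)
  thus ?case unfolding IH by (auto simp: xy)
qed (simp add: adj_def)

section \<open>Comparison with the product over the syllables\<close>

lemma Lw_lprod: assumes "reduced_word w" shows "exp (Lw w) = of_int (lprod (alt_degs (adj w)))"
proof -
  have nz: "\<forall>m\<in>set (adj w). m \<noteq> 0" using assms by (auto simp: adj_def reduced_word_def)
  have "\<forall>d\<in>set ds. d \<ge> 1 \<Longrightarrow> exp (\<Sum>d\<leftarrow>ds. ln (4 * real d - 1)) = of_int (lprod ds)" for ds
    by (induction ds) (auto simp: exp_add)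
  thus ?thesis using alt_degs_pos[OF nz] syl_degs_adj[OF assms] by (simp add: Lw_def)
qed

text \<open>Both exponentials of which cosh is the mean are at most x.\<close>

lemma cosh_half_le:
  assumes "exp L \<le> x\<^sup>2" "x \<ge> 1" "L \<ge> 0" shows "cosh (L/2) \<le> (x::real)"
proof -
  define s where "s = exp (L/2)"
  have "s\<^sup>2 = exp L" by (simp add: s_def power2_eq_square flip: exp_add)
  hence "s \<le> x" using assms by (metis abs_le_square_iff abs_of_nonneg abs_exp_cancel s_def order_trans zero_le_one)
  moreover have "exp (- (L/2)) \<le> x" using assms by (intro order_trans[OF _ assms(2)]) simp
  ultimately show ?thesis by (simp add: cosh_def s_def)
qed

text \<open>Here p belongs to real triples and q to conjugate pairs. The value 1 marks the
  exceptional words; on all others cosh (L / 2) is a lower bound because it does not exceed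
  |X|.\<close>

lemma word_matrix_bounds:
  assumes r: "reduced_word w" and m: "mat w = (a, b, c, d)"
  defines "p \<equiv> real_of_int \<bar>a * d + b * c\<bar>" and "q \<equiv> real_of_int \<bar>a\<^sup>2 + d\<^sup>2 - b\<^sup>2 - c\<^sup>2\<bar> / 2"
  shows "w \<noteq> [] \<Longrightarrow> Lw w \<ge> 1" "length w \<le> 1 \<Longrightarrow> p = 1"
    "length w > 1 \<Longrightarrow> cosh (Lw w / 2) \<le> p \<and> p \<le> 2 * exp (2 * Lw w)"
    "(\<forall>(g, n) \<in> set w. n = 1) \<or> (\<forall>(g, n) \<in> set w. n = -1) \<Longrightarrow> q = 1"
    "\<not> ((\<forall>(g, n) \<in> set w. n = 1) \<or> (\<forall>(g, n) \<in> set w. n = -1)) \<Longrightarrow> cosh (Lw w / 2) \<le> q \<and> q \<le> 2 * exp (2 * Lw w)"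
proof -
  obtain X y where k: "kv (adj w) (1, 0) = (X, y)" by fastforce
  obtain u v where l: "kv (adj w) (0, 1) = (u, v)" by fastforce
  have nz: "\<forall>m\<in>set (adj w). m \<noteq> 0" using r by (auto simp: adj_def reduced_word_def)
  have len: "length (adj w) = length w" by (simp add: adj_def)
  define N where "N = lprod (alt_degs (adj w))"
  have eN: "exp (Lw w) = of_int N" unfolding N_def by (rule Lw_lprod[OF r])
  have main: "Lw w \<ge> 1 \<and> (length w = 1 \<longrightarrow> p = 1) \<and> (length w > 1 \<longrightarrow> cosh (Lw w / 2) \<le> p \<and> p \<le> 2 * exp (2 * Lw w)) \<and>
     (slow (adj w) \<longrightarrow> q = 1) \<and> (\<not> slow (adj w) \<longrightarrow> cosh (Lw w / 2) \<le> q \<and> q \<le> 2 * exp (2 * Lw w))" if w: "w \<noteq> []"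
  proof -
    have ne: "adj w \<noteq> []" using w by (simp add: adj_def)
    note B = kv_bounds[OF nz ne k l, folded N_def]
    note K = mat_kv[OF r w m k l]
    have N3: "real_of_int N \<ge> 3" using B(6) by simp
    \<comment> \<open>A single syllable already contributes a factor 4 d - 1 \<ge> 3 > e.\<close>
    have L1: "Lw w \<ge> 1"
    proof -
      have "exp 1 \<le> exp (Lw w)" unfolding eN using exp_le N3 by linarith
      thus ?thesis by simp
    qed
    have X1: "\<bar>X\<bar> \<ge> 1" using B(1) N3 by (cases "X = 0") auto
    have EX: "exp (Lw w) \<le> (real_of_int \<bar>X\<bar>)\<^sup>2" unfolding eN using B(1) by (metis of_int_le_iff of_int_power power2_abs)
    have ch: "cosh (Lw w / 2) \<le> real_of_int \<bar>X\<bar>" using X1 L1 by (intro cosh_half_le[OF EX]) auto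
    have e2: "exp (2 * Lw w) = (of_int N)\<^sup>2" unfolding eN[symmetric] by (simp add: power2_eq_square flip: exp_add)
    have XN: "(real_of_int \<bar>X\<bar>)\<^sup>2 \<le> exp (2 * Lw w)" unfolding e2 using B(2) by (intro power_mono) auto
    have xx: "\<bar>X\<bar> * \<bar>X\<bar> = \<bar>X\<bar>\<^sup>2" by (simp add: power2_eq_square)
    have ple: "\<bar>X * v + y * u\<bar> \<le> 2 * \<bar>X\<bar>\<^sup>2"
    proof -
      have "\<bar>X\<bar> * \<bar>v\<bar> \<le> \<bar>X\<bar> * \<bar>X\<bar>" "\<bar>y\<bar> * \<bar>u\<bar> \<le> \<bar>X\<bar> * \<bar>X\<bar>" by (intro mult_mono B(3,4,5) abs_ge_zero order_refl)+
      thus ?thesis unfolding xx using abs_triangle_ineq[of "X * v" "y * u"] by (simp add: abs_mult)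
    qed
    have qle: "\<bar>X\<^sup>2 + v\<^sup>2 - y\<^sup>2 - u\<^sup>2\<bar> \<le> 2 * \<bar>X\<bar>\<^sup>2"
    proof -
      have "v\<^sup>2 \<le> X\<^sup>2" "y\<^sup>2 \<le> X\<^sup>2" "u\<^sup>2 \<le> X\<^sup>2" using B by (auto simp: abs_le_square_iff)
      moreover have "0 \<le> v\<^sup>2" "0 \<le> y\<^sup>2" "0 \<le> u\<^sup>2" by auto
      ultimately show ?thesis unfolding abs_le_iff power2_abs by linarith
    qed
    have p2: "p \<le> 2 * exp (2 * Lw w)"
    proof -
      have "p \<le> real_of_int (2 * \<bar>X\<bar>\<^sup>2)" unfolding p_def K(1) using ple by (simp only: of_int_le_iff)
      thus ?thesis using XN by simp
    qed
    have q2: "q \<le> 2 * exp (2 * Lw w)"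
    proof -
      have "real_of_int \<bar>a\<^sup>2 + d\<^sup>2 - b\<^sup>2 - c\<^sup>2\<bar> \<le> real_of_int (2 * \<bar>X\<bar>\<^sup>2)" unfolding K(2) using qle by (simp only: of_int_le_iff)
      hence "q \<le> (real_of_int \<bar>X\<bar>)\<^sup>2" by (simp add: q_def)
      also have "\<dots> \<le> 2 * exp (2 * Lw w)" using XN by (smt (verit) exp_gt_zero)
      finally show ?thesis .
    qed
    have "length w = 1 \<longrightarrow> p = 1" unfolding p_def K(1) using B(7) len by simp
    moreover have "cosh (Lw w / 2) \<le> p" if "length w > 1"
    proof -
      have "real_of_int (2 * \<bar>X\<bar> - 1) \<le> p" unfolding p_def K(1) using B(8) len that by (simp only: of_int_le_iff)
      thus ?thesis using ch X1 by simp
    qed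
    moreover have "q = 1" if "slow (adj w)" using B(9)[OF that] unfolding q_def K(2) by simp
    moreover have "cosh (Lw w / 2) \<le> q" if "\<not> slow (adj w)"
    proof -
      have "real_of_int (2 * \<bar>X\<bar> + 2) \<le> real_of_int \<bar>X\<^sup>2 + v\<^sup>2 - y\<^sup>2 - u\<^sup>2\<bar>" using B(10)[OF that] by (simp only: of_int_le_iff)
      hence "real_of_int (2 * \<bar>X\<bar> + 2) \<le> 2 * q" unfolding q_def K(2) by simp
      thus ?thesis using ch by simp
    qed
    ultimately show ?thesis using p2 q2 L1 by blast
  qed
  have nil: "p = 1 \<and> q = 1" if "w = []" using m that by (simp add: p_def q_def)
  show "w \<noteq> [] \<Longrightarrow> Lw w \<ge> 1" using main by blast
  show "length w \<le> 1 \<Longrightarrow> p = 1" using main nil by (cases w) auto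
  show "length w > 1 \<Longrightarrow> cosh (Lw w / 2) \<le> p \<and> p \<le> 2 * exp (2 * Lw w)" using main by (cases w) auto
  show "(\<forall>(g, n) \<in> set w. n = 1) \<or> (\<forall>(g, n) \<in> set w. n = -1) \<Longrightarrow> q = 1"
    using main nil unfolding slow_adj[OF r, symmetric] by (cases "w = []") auto
  show "\<not> ((\<forall>(g, n) \<in> set w. n = 1) \<or> (\<forall>(g, n) \<in> set w. n = -1)) \<Longrightarrow> cosh (Lw w / 2) \<le> q \<and> q \<le> 2 * exp (2 * Lw w)"
    using main unfolding slow_adj[OF r, symmetric] by (cases "w = []") (auto simp: adj_def)
qed

section \<open>Extremal length between two geodesics\<close>

text \<open>The mean value theorem for the real part of a primitive on horizontal and vertical
  segments. The vertical derivative is \<i> G, whose real part is - Im G.\<close>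

lemma vertical_derivs:
  assumes P: "\<And>z. z \<in> cbox (Complex a c) (Complex b d) \<Longrightarrow> (\<Psi> has_field_derivative G z) (at z within cbox (Complex a c) (Complex b d))"
  shows "c \<le> y \<Longrightarrow> y \<le> d \<Longrightarrow> a < b \<Longrightarrow> c < d \<Longrightarrow> \<exists>\<xi>\<in>{a<..<b}. Re (\<Psi> (Complex b y)) - Re (\<Psi> (Complex a y)) = (b - a) * Re (G (Complex \<xi> y))"
    "a \<le> x \<Longrightarrow> x \<le> b \<Longrightarrow> a < b \<Longrightarrow> c < d \<Longrightarrow> \<exists>\<xi>\<in>{c<..<d}. Re (\<Psi> (Complex x d)) - Re (\<Psi> (Complex x c)) = - ((d - c) * Im (G (Complex x \<xi>)))"
proof -
  let ?R = "cbox (Complex a c) (Complex b d)"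
  have gen: "((\<lambda>t. Re (\<Psi> (p t))) has_derivative (\<lambda>h. h * Re (v * G (p t)))) (at t within {l..u})"
    if p: "\<And>t. (p has_vector_derivative v) (at t)" and im: "p ` {l..u} \<subseteq> ?R" and t: "t \<in> {l..u}" for p v t l u
  proof -
    have "((\<Psi> \<circ> p) has_vector_derivative v * G (p t)) (at t within {l..u})"
      by (rule field_vector_diff_chain_within[OF has_vector_derivative_at_within[OF p] DERIV_subset[OF P im]]) (use im t in auto)
    hence "((\<lambda>t. Re ((\<Psi> \<circ> p) t)) has_vector_derivative Re (v * G (p t))) (at t within {l..u})"
      by (rule bounded_linear.has_vector_derivative[OF bounded_linear_Re])
    thus ?thesis by (simp add: has_vector_derivative_def)
  qed
  show "\<exists>\<xi>\<in>{a<..<b}. Re (\<Psi> (Complex b y)) - Re (\<Psi> (Complex a y)) = (b - a) * Re (G (Complex \<xi> y))"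
    if "c \<le> y" "y \<le> d" "a < b" "c < d"
  proof -
    have v: "((\<lambda>x. Complex x y) has_vector_derivative 1) (at t)" for t
      unfolding Complex_eq by (auto intro!: derivative_eq_intros)
    have "\<exists>\<xi>\<in>{a<..<b}. Re (\<Psi> (Complex b y)) - Re (\<Psi> (Complex a y)) = (\<lambda>h. h * Re (1 * G (Complex \<xi> y))) (b - a)"
      by (rule mvt_simple[OF that(3)], rule gen[OF v]) (use that in \<open>auto simp: in_cbox_complex_iff\<close>)
    thus ?thesis by simp
  qed
  show "\<exists>\<xi>\<in>{c<..<d}. Re (\<Psi> (Complex x d)) - Re (\<Psi> (Complex x c)) = - ((d - c) * Im (G (Complex x \<xi>)))"
    if "a \<le> x" "x \<le> b" "a < b" "c < d"
  proof -
    have v: "((\<lambda>y. Complex x y) has_vector_derivative \<i>) (at t)" for t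
      unfolding Complex_eq by (auto intro!: derivative_eq_intros)
    have "\<exists>\<xi>\<in>{c<..<d}. Re (\<Psi> (Complex x d)) - Re (\<Psi> (Complex x c)) = (\<lambda>h. h * Re (\<i> * G (Complex x \<xi>))) (d - c)"
      by (rule mvt_simple[OF that(4)], rule gen[OF v]) (use that in \<open>auto simp: in_cbox_complex_iff\<close>)
    thus ?thesis by simp
  qed
qed

text \<open>The real part of a primitive of \<open>G\<close> changes by \<open>D * (b - a)\<close> along the top side, by \<open>0\<close> along the bottom
  side, and by at most \<open>pi * (d - c)\<close> along the two vertical sides together.\<close>

lemma rectangle_to_strip:
  assumes ab: "a < b" "c < d" and G: "continuous_on (cbox (Complex a c) (Complex b d)) G" "G holomorphic_on box (Complex a c) (Complex b d)"
    and im: "\<And>z. z \<in> cbox (Complex a c) (Complex b d) \<Longrightarrow> 0 \<le> Im (G z) \<and> Im (G z) \<le> pi"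
    and bot: "\<And>x. a < x \<Longrightarrow> x < b \<Longrightarrow> Re (G (Complex x c)) = 0"
    and top: "\<And>x. a < x \<Longrightarrow> x < b \<Longrightarrow> Re (G (Complex x d)) = D"
  shows "D * (b - a) \<le> pi * (d - c)"
proof -
  let ?R = "cbox (Complex a c) (Complex b d)"
  obtain \<Psi> where P: "\<And>z. z \<in> ?R \<Longrightarrow> (\<Psi> has_field_derivative G z) (at z within ?R)"
    using holomorphic_convex_primitive[OF convex_box(1) finite.emptyI G(1)] G(2)
    by (metis Diff_empty holomorphic_on_imp_differentiable_at interior_cbox open_box)
  note V = vertical_derivs[OF P]
  \<comment> \<open>The intermediate points lie inside the open sides, where \<open>bot\<close> and
    \<open>top\<close> are available.\<close>
  obtain x0 where x0: "a < x0" "x0 < b" "Re (\<Psi> (Complex b c)) - Re (\<Psi> (Complex a c)) = (b - a) * Re (G (Complex x0 c))"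
    using V(1)[of c] ab by auto
  obtain x1 where x1: "a < x1" "x1 < b" "Re (\<Psi> (Complex b d)) - Re (\<Psi> (Complex a d)) = (b - a) * Re (G (Complex x1 d))"
    using V(1)[of d] ab by auto
  obtain y0 where y0: "c < y0" "y0 < d" "Re (\<Psi> (Complex a d)) - Re (\<Psi> (Complex a c)) = - ((d - c) * Im (G (Complex a y0)))"
    using V(2)[of a] ab by auto
  obtain y1 where y1: "c < y1" "y1 < d" "Re (\<Psi> (Complex b d)) - Re (\<Psi> (Complex b c)) = - ((d - c) * Im (G (Complex b y1)))"
    using V(2)[of b] ab by auto
  have i: "Im (G (Complex a y0)) \<le> pi" "0 \<le> Im (G (Complex b y1))"
    using im[of "Complex a y0"] im[of "Complex b y1"] y0 y1 ab by (auto simp: in_cbox_complex_iff)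
  have "D * (b - a) = (d - c) * (Im (G (Complex a y0)) - Im (G (Complex b y1)))"
    using x0(3) x1(3) y0(3) y1(3) bot[OF x0(1,2)] top[OF x1(1,2)] by (simp add: algebra_simps)
  also have "\<dots> \<le> (d - c) * pi" using ab i by (intro mult_left_mono) auto
  finally show ?thesis by (simp add: mult.commute)
qed

section \<open>A geodesic and its translate in strip coordinates\<close>

text \<open>On the real line the expression is (c x - a) (d x - b): the curve is the circle or line
  orthogonal to the real axis with endpoints a / c and b / d, the images of infinity and 0.\<close>

lemma geodesic_mem:
  assumes det: "a * d - b * c = 1" and t: "Im \<tau> > 0"
  shows "\<tau> \<in> mob a b c d ` gtr \<longleftrightarrow> c * d * (norm \<tau>)\<^sup>2 - (a * d + b * c) * Re \<tau> + a * b = 0"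
proof -
  define s where "s = mob d (-b) (-c) a \<tau>"
  have det': "d * a - (-b) * (-c) = 1" using det by (simp add: algebra_simps)
  have s: "Im s > 0" unfolding s_def by (rule mob_Im(2)[OF t det'])
  define m where "m = of_real (-c) * \<tau> + of_real a"
  have m0: "m \<noteq> 0" unfolding m_def using mob_denom_neq_0[OF t det'] .
  have "s = (of_real d * \<tau> + of_real (-b)) * cnj m / (of_real (norm m))\<^sup>2"
    unfolding s_def mob_def m_def[symmetric] by (subst complex_div_cnj) simp
  hence "Re s = Re ((of_real d * \<tau> + of_real (-b)) * cnj m) / (norm m)\<^sup>2"
    by (metis Re_divide_of_real of_real_power)
  also have "Re ((of_real d * \<tau> + of_real (-b)) * cnj m) = - (c * d * (norm \<tau>)\<^sup>2 - (a * d + b * c) * Re \<tau> + a * b)"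
    unfolding cmod_power2 by (simp add: m_def algebra_simps power2_eq_square)
  finally have Re: "Re s = 0 \<longleftrightarrow> c * d * (norm \<tau>)\<^sup>2 - (a * d + b * c) * Re \<tau> + a * b = 0"
    using m0 by (simp only: divide_eq_0_iff neg_equal_0_iff_equal power_eq_0_iff norm_eq_zero) simp
  have "\<tau> \<in> mob a b c d ` gtr \<longleftrightarrow> Re s = 0"
  proof
    assume "\<tau> \<in> mob a b c d ` gtr"
    then obtain u where u: "u \<in> gtr" "\<tau> = mob a b c d u" by blast
    hence "s = u" unfolding s_def using mob_inv(1)[OF _ det] by (auto simp: gtr_def)
    thus "Re s = 0" using u by (simp add: gtr_def)
  next
    assume "Re s = 0"
    hence "s \<in> gtr" using s by (simp add: gtr_def)
    moreover have "\<tau> = mob a b c d s" unfolding s_def using mob_inv(2)[OF t det] by simp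
    ultimately show "\<tau> \<in> mob a b c d ` gtr" by blast
  qed
  thus ?thesis using Re by simp
qed

text \<open>The circle |\<tau>| = r with r^2 = a b / (c d) is the common perpendicular, because
  inversion in it exchanges 0 with infinity and a / c with b / d. \<open>N\<close> sends -r to 0 and
  r to infinity, so both geodesics become arcs of circles about 0, which the logarithm turns into
  vertical segments.\<close>

lemma geodesic_strip:
  fixes a b c d :: real
  assumes det: "a * d - b * c = 1" and P1: "\<bar>a * d + b * c\<bar> > 1"
  obtains G Gi where "G holomorphic_on UH" "\<And>\<tau>. Im \<tau> > 0 \<Longrightarrow> 0 < Im (G \<tau>) \<and> Im (G \<tau>) < pi"
    "\<And>\<tau>. \<tau> \<in> gtr \<Longrightarrow> Re (G \<tau>) = 0" "\<And>\<tau>. \<tau> \<in> mob a b c d ` gtr \<Longrightarrow> Re (G \<tau>) = arcosh \<bar>a * d + b * c\<bar>"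
    "Gi holomorphic_on {\<zeta>. 0 < Im \<zeta> \<and> Im \<zeta> < pi}" "\<And>\<zeta>. 0 < Im \<zeta> \<Longrightarrow> Im \<zeta> < pi \<Longrightarrow> Im (Gi \<zeta>) > 0"
    "\<And>\<zeta>. 0 < Im \<zeta> \<Longrightarrow> Im \<zeta> < pi \<Longrightarrow> Re \<zeta> = 0 \<Longrightarrow> Gi \<zeta> \<in> gtr"
    "\<And>\<zeta>. 0 < Im \<zeta> \<Longrightarrow> Im \<zeta> < pi \<Longrightarrow> Re \<zeta> = arcosh \<bar>a * d + b * c\<bar> \<Longrightarrow> Gi \<zeta> \<in> mob a b c d ` gtr"
proof -
  define P where "P = a * d + b * c"
  have P2: "P\<^sup>2 > 1" using P1 unfolding P_def by (metis abs_1 abs_square_less_1 not_le one_less_power power2_abs pos2 zero_less_numeral)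
  have "P\<^sup>2 - 1 = P\<^sup>2 - (a * d - b * c)\<^sup>2" by (simp add: det)
  also have "\<dots> = 4 * ((a * b) * (c * d))" by (simp add: P_def power2_eq_square algebra_simps)
  finally have abcd: "4 * ((a * b) * (c * d)) = P\<^sup>2 - 1" by simp
  have pos: "(a * b) * (c * d) > 0" using abcd P2 by linarith
  have cd0: "c * d \<noteq> 0" using pos by auto
  define r where "r = sqrt (a * b / (c * d))"
  have q0: "a * b / (c * d) > 0" using pos by (simp add: zero_less_divide_iff zero_less_mult_iff)
  have r: "r > 0" "r\<^sup>2 * (c * d) = a * b" using q0 cd0 by (simp_all add: r_def)
  \<comment> \<open>Then Q^2 = P^2 - 1, so P + Q and P - Q are inverse to each other and ln |P + Q|
    is arcosh |P| up to sign.\<close>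
  define Q where "Q = 2 * r * (c * d)"
  have "Q\<^sup>2 = 4 * (r\<^sup>2 * (c * d)) * (c * d)" by (simp add: Q_def power2_eq_square)
  also have "\<dots> = P\<^sup>2 - 1" unfolding r(2) using abcd by simp
  finally have Q2: "Q\<^sup>2 = P\<^sup>2 - 1" .
  have PQ: "(P + Q) * (P - Q) = 1" using Q2 by (simp add: algebra_simps power2_eq_square)
  define N where "N = (\<lambda>\<tau>::complex. (\<tau> + of_real r) / (of_real r - \<tau>))"
  define Ni where "Ni = (\<lambda>w::complex. of_real r * (w - 1) / (w + 1))"
  have nz: "of_real r - \<tau> \<noteq> 0" "w + 1 \<noteq> 0" if "Im \<tau> > 0" "Im w > 0" for \<tau> w :: complex
    using that by (auto simp: complex_eq_iff)
  have NIm: "Im (N \<tau>) > 0" if t: "Im \<tau> > 0" for \<tau>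
  proof -
    have "N \<tau> = (\<tau> + of_real r) * cnj (of_real r - \<tau>) / of_real ((norm (of_real r - \<tau>))\<^sup>2)"
      unfolding N_def by (subst complex_div_cnj) simp
    hence "Im (N \<tau>) = Im ((\<tau> + of_real r) * cnj (of_real r - \<tau>)) / (norm (of_real r - \<tau>))\<^sup>2" by (metis Im_divide_of_real)
    also have "Im ((\<tau> + of_real r) * cnj (of_real r - \<tau>)) = 2 * r * Im \<tau>" by (simp add: algebra_simps)
    finally show ?thesis using t r nz[OF t t] by simp
  qed
  have NiIm: "Im (Ni w) > 0" if t: "Im w > 0" for w
  proof -
    have "Ni w = of_real r * (w - 1) * cnj (w + 1) / of_real ((norm (w + 1))\<^sup>2)"
      unfolding Ni_def by (subst complex_div_cnj) simp
    hence "Im (Ni w) = Im (of_real r * (w - 1) * cnj (w + 1)) / (norm (w + 1))\<^sup>2" by (metis Im_divide_of_real)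
    also have "Im (of_real r * (w - 1) * cnj (w + 1)) = 2 * r * Im w" by (simp add: algebra_simps)
    finally show ?thesis using t r nz[OF t t] by simp
  qed
  have NNi: "N (Ni w) = w" if w: "Im w > 0" for w
  proof -
    have "Ni w + of_real r = 2 * of_real r * w / (w + 1)" "of_real r - Ni w = 2 * of_real r / (w + 1)"
      using nz(2)[OF w w] by (simp_all add: Ni_def field_simps)
    thus ?thesis using nz(2)[OF w w] r(1) by (simp add: N_def)
  qed
  have n2: "(norm (\<tau> + of_real r))\<^sup>2 = (norm \<tau>)\<^sup>2 + r\<^sup>2 + 2 * r * Re \<tau>" "(norm (of_real r - \<tau>))\<^sup>2 = (norm \<tau>)\<^sup>2 + r\<^sup>2 - 2 * r * Re \<tau>" for \<tau> :: complex
    unfolding cmod_power2 by (simp_all add: power2_eq_square algebra_simps)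
  have on_geo: "norm (N \<tau>) = \<bar>P + Q\<bar> \<longleftrightarrow> \<tau> \<in> mob a b c d ` gtr" if t: "Im \<tau> > 0" for \<tau>
  proof -
    define x S where "x = Re \<tau>" and "S = (norm \<tau>)\<^sup>2 + r\<^sup>2"
    have "norm (N \<tau>) = \<bar>P + Q\<bar> \<longleftrightarrow> (norm (N \<tau>))\<^sup>2 = (P + Q)\<^sup>2"
      by (metis abs_ge_zero norm_ge_zero power2_abs power2_eq_iff_nonneg)
    also have "\<dots> \<longleftrightarrow> (norm (\<tau> + of_real r))\<^sup>2 = (P + Q)\<^sup>2 * (norm (of_real r - \<tau>))\<^sup>2"
      using nz(1)[OF t t] by (simp add: N_def norm_divide power_divide divide_eq_eq)
    also have "\<dots> \<longleftrightarrow> S + 2 * r * x = (P + Q) * (P + Q) * (S - 2 * r * x)" unfolding n2 by (simp add: S_def x_def power2_eq_square)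
    also have "\<dots> \<longleftrightarrow> (P - Q) * (S + 2 * r * x) = (P + Q) * (S - 2 * r * x)"
    proof
      assume e: "S + 2 * r * x = (P + Q) * (P + Q) * (S - 2 * r * x)"
      have "(P - Q) * (S + 2 * r * x) = ((P + Q) * (P - Q)) * ((P + Q) * (S - 2 * r * x))" unfolding e by (simp only: mult_ac)
      thus "(P - Q) * (S + 2 * r * x) = (P + Q) * (S - 2 * r * x)" unfolding PQ by simp
    next
      assume e: "(P - Q) * (S + 2 * r * x) = (P + Q) * (S - 2 * r * x)"
      have "S + 2 * r * x = ((P + Q) * (P - Q)) * (S + 2 * r * x)" unfolding PQ by simp
      also have "\<dots> = (P + Q) * ((P + Q) * (S - 2 * r * x))" unfolding e[symmetric] by (simp only: mult_ac)
      finally show "S + 2 * r * x = (P + Q) * (P + Q) * (S - 2 * r * x)" by (simp only: mult_ac)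
    qed
    also have "\<dots> \<longleftrightarrow> (4 * r) * (x * P - S * (c * d)) = 0" by (simp add: Q_def algebra_simps)
    also have "\<dots> \<longleftrightarrow> c * d * (norm \<tau>)\<^sup>2 - P * Re \<tau> + a * b = 0"
    proof -
      have e: "c * d * (norm \<tau>)\<^sup>2 - P * Re \<tau> + a * b = - (x * P - S * (c * d))"
        unfolding S_def x_def r(2)[symmetric] by (simp add: algebra_simps)
      show ?thesis unfolding e using r(1) by (simp only: mult_eq_0_iff neg_equal_0_iff_equal) simp
    qed
    finally show ?thesis using geodesic_mem[OF det t] by (simp add: P_def)
  qed
  define G0 where "G0 = (\<lambda>\<tau>. Ln (N \<tau>))"
  define G1 where "G1 = (\<lambda>\<zeta>. Ni (exp \<zeta>))"
  have N0: "N \<tau> \<noteq> 0" if "Im \<tau> > 0" for \<tau> using NIm[OF that] by auto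
  have G0h: "G0 holomorphic_on UH" unfolding G0_def N_def
  proof (intro holomorphic_intros)
    fix \<tau> assume t: "\<tau> \<in> UH"
    show "of_real r - \<tau> \<noteq> 0" using nz(1)[of \<tau> \<tau>] t by auto
    have "Im (N \<tau>) > 0" using NIm t by auto
    thus "(\<tau> + of_real r) / (of_real r - \<tau>) \<notin> \<real>\<^sub>\<le>\<^sub>0" by (auto simp: N_def complex_nonpos_Reals_iff)
  qed
  have G0i: "0 < Im (G0 \<tau>) \<and> Im (G0 \<tau>) < pi" if "Im \<tau> > 0" for \<tau>
    unfolding G0_def using NIm[OF that] N0[OF that] Im_Ln_pos_lt by blast
  have G0r: "Re (G0 \<tau>) = ln (norm (N \<tau>))" if "Im \<tau> > 0" for \<tau> using N0[OF that] by (simp add: G0_def)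
  have G0g: "Re (G0 \<tau>) = 0" if "\<tau> \<in> gtr" for \<tau>
  proof -
    have t: "Im \<tau> > 0" "Re \<tau> = 0" using that by (auto simp: gtr_def)
    have "(norm (\<tau> + of_real r))\<^sup>2 = (norm (of_real r - \<tau>))\<^sup>2" unfolding n2 using t by simp
    hence "norm (\<tau> + of_real r) = norm (of_real r - \<tau>)" by simp
    thus ?thesis using G0r[OF t(1)] nz(1)[OF t(1) t(1)] by (simp add: N_def norm_divide)
  qed
  define D where "D = ln \<bar>P + Q\<bar>"
  have PQ0: "\<bar>P + Q\<bar> > 0" using PQ by auto
  have G0m: "Re (G0 \<tau>) = D" if "\<tau> \<in> mob a b c d ` gtr" for \<tau>
  proof -
    have t: "Im \<tau> > 0" using that mob_Im(2)[OF _ det] by (auto simp: gtr_def)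
    show ?thesis using G0r[OF t] on_geo[OF t] that by (simp add: D_def)
  qed
  have eI: "Im (exp \<zeta>) > 0" if "0 < Im \<zeta>" "Im \<zeta> < pi" for \<zeta> using that by (simp add: Im_exp sin_gt_zero)
  have G1h: "G1 holomorphic_on {\<zeta>. 0 < Im \<zeta> \<and> Im \<zeta> < pi}" unfolding G1_def Ni_def
    by (intro holomorphic_intros) (use nz(2) eI in blast)
  have G1i: "Im (G1 \<zeta>) > 0" if "0 < Im \<zeta>" "Im \<zeta> < pi" for \<zeta> unfolding G1_def by (intro NiIm eI that)
  have NG1: "norm (N (G1 \<zeta>)) = exp (Re \<zeta>)" if "0 < Im \<zeta>" "Im \<zeta> < pi" for \<zeta>
    unfolding G1_def NNi[OF eI[OF that]] by (rule norm_exp_eq_Re)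
  have G1g: "G1 \<zeta> \<in> gtr" if "0 < Im \<zeta>" "Im \<zeta> < pi" "Re \<zeta> = 0" for \<zeta>
  proof -
    define \<tau> where "\<tau> = G1 \<zeta>"
    have t: "Im \<tau> > 0" using G1i that by (simp add: \<tau>_def)
    have "norm (N \<tau>) = 1" using NG1[OF that(1,2)] that(3) by (simp add: \<tau>_def)
    hence "norm (\<tau> + of_real r) = norm (of_real r - \<tau>)" using nz(1)[OF t t] by (simp add: N_def norm_divide)
    hence "(norm (\<tau> + of_real r))\<^sup>2 = (norm (of_real r - \<tau>))\<^sup>2" by simp
    hence "Re \<tau> = 0" unfolding n2 using r by simp
    thus ?thesis using t by (simp add: gtr_def \<tau>_def)
  qed
  have G1m: "G1 \<zeta> \<in> mob a b c d ` gtr" if "0 < Im \<zeta>" "Im \<zeta> < pi" "Re \<zeta> = D" for \<zeta>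
  proof -
    have "norm (N (G1 \<zeta>)) = \<bar>P + Q\<bar>" unfolding NG1[OF that(1,2)] that(3) D_def using PQ0 by simp
    thus ?thesis using on_geo[OF G1i[OF that(1,2)]] by blast
  qed
  have ac: "arcosh \<bar>P\<bar> = ln (\<bar>P\<bar> + \<bar>Q\<bar>)"
  proof -
    have "\<bar>Q\<bar> = sqrt (\<bar>P\<bar>\<^sup>2 - 1)" by (metis Q2 power2_abs real_sqrt_abs)
    thus ?thesis using P1 by (simp add: arcosh_real_def P_def)
  qed
  have dich: "D = arcosh \<bar>P\<bar> \<or> D = - arcosh \<bar>P\<bar>"
  proof (cases "P * Q \<ge> 0")
    case True
    hence "\<bar>P + Q\<bar> = \<bar>P\<bar> + \<bar>Q\<bar>" by (auto simp: zero_le_mult_iff)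
    thus ?thesis by (simp add: ac D_def)
  next
    case False
    hence "\<bar>P - Q\<bar> = \<bar>P\<bar> + \<bar>Q\<bar>" by (auto simp: zero_le_mult_iff abs_if split: if_splits)
    moreover have "\<bar>P + Q\<bar> * \<bar>P - Q\<bar> = 1" using PQ by (simp flip: abs_mult)
    ultimately have "\<bar>P + Q\<bar> = 1 / (\<bar>P\<bar> + \<bar>Q\<bar>)" using PQ0 by (metis nonzero_eq_divide_eq mult_zero_right zero_neq_one)
    moreover have "\<bar>P\<bar> + \<bar>Q\<bar> > 0" using P1 by (simp add: P_def)
    ultimately show ?thesis by (simp add: ac D_def ln_div)
  qed
  show thesis
  proof (cases "D = arcosh \<bar>P\<bar>")
    case True
    show ?thesis by (rule that[of G0 G1]) (use G0h G0i G0g G0m G1h G1i G1g G1m True in \<open>auto simp: P_def\<close>)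
  next
    case False
    hence D: "D = - arcosh \<bar>P\<bar>" using dich by blast
    \<comment> \<open>If the second geodesic lies to the left of the first, the strip is turned by a
      half revolution about i pi / 2.\<close>
    show ?thesis
    proof (rule that[of "\<lambda>\<tau>. \<i> * of_real pi - G0 \<tau>" "\<lambda>\<zeta>. G1 (\<i> * of_real pi - \<zeta>)"])
      show "(\<lambda>\<tau>. \<i> * of_real pi - G0 \<tau>) holomorphic_on UH" by (intro holomorphic_intros G0h)
      show "(\<lambda>\<zeta>. G1 (\<i> * of_real pi - \<zeta>)) holomorphic_on {\<zeta>. 0 < Im \<zeta> \<and> Im \<zeta> < pi}"
        by (intro holomorphic_on_compose_gen[OF _ G1h, unfolded o_def] holomorphic_intros) auto
    qed (use G0i G0g G0m G1i G1g G1m D in \<open>auto simp: P_def\<close>)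
  qed
qed

section \<open>Optimal rectangles between two geodesics\<close>

lemma mob_holo: "a * d - b * c = 1 \<Longrightarrow> mob a b c d holomorphic_on UH"
  unfolding mob_def[abs_def] using mob_denom_neq_0 by (intro holomorphic_intros) auto

definition arc_rect :: "complex set \<Rightarrow> complex set \<Rightarrow> real \<Rightarrow> real \<Rightarrow> real \<Rightarrow> real \<Rightarrow> (complex \<Rightarrow> complex) \<Rightarrow> bool" where
  "arc_rect C C' x0 x1 y0 y1 F \<longleftrightarrow> x0 < x1 \<and> y0 < y1 \<and> continuous_on (cbox (Complex x0 y0) (Complex x1 y1)) F \<and>
     F holomorphic_on box (Complex x0 y0) (Complex x1 y1) \<and> F ` cbox (Complex x0 y0) (Complex x1 y1) \<subseteq> UH \<and>
     (\<forall>x\<in>{x0<..<x1}. F (Complex x y0) \<in> C \<and> F (Complex x y1) \<in> C')"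

lemma arc_rect_mob:
  assumes F: "arc_rect C C' x0 x1 y0 y1 F" and det: "p * s - q * r = 1"
  shows "arc_rect (mob p q r s ` C) (mob p q r s ` C') x0 x1 y0 y1 (mob p q r s \<circ> F)"
proof -
  note F = F[unfolded arc_rect_def]
  have im: "F ` cbox (Complex x0 y0) (Complex x1 y1) \<subseteq> UH" using F by blast
  have "continuous_on (cbox (Complex x0 y0) (Complex x1 y1)) (mob p q r s \<circ> F)"
    using F continuous_on_subset[OF mob_cont[OF det] im] by (intro continuous_on_compose) auto
  moreover have "mob p q r s \<circ> F holomorphic_on box (Complex x0 y0) (Complex x1 y1)"
    using F im box_subset_cbox by (intro holomorphic_on_compose_gen[OF _ mob_holo[OF det]]) blast+
  moreover have "(mob p q r s \<circ> F) ` cbox (Complex x0 y0) (Complex x1 y1) \<subseteq> UH"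
    using im mob_Im(2)[OF _ det] by (auto simp: image_subset_iff)
  ultimately show ?thesis using F by (auto simp: arc_rect_def)
qed

lemma arc_rect_lower_tr:
  assumes det: "a * d - b * c = 1" and P: "\<bar>a * d + b * c\<bar> \<ge> 1"
    and F: "arc_rect gtr (mob a b c d ` gtr) x0 x1 y0 y1 F"
  shows "arcosh \<bar>a * d + b * c\<bar> * (x1 - x0) \<le> pi * (y1 - y0)"
proof (cases "\<bar>a * d + b * c\<bar> = 1")
  case True
  have "y1 - y0 \<ge> 0" using F by (simp add: arc_rect_def)
  thus ?thesis by (simp add: True)
next
  case False
  hence P1: "\<bar>a * d + b * c\<bar> > 1" using P by simp
  obtain G where G: "G holomorphic_on UH" "\<And>\<tau>. Im \<tau> > 0 \<Longrightarrow> 0 < Im (G \<tau>) \<and> Im (G \<tau>) < pi"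
    "\<And>\<tau>. \<tau> \<in> gtr \<Longrightarrow> Re (G \<tau>) = 0" "\<And>\<tau>. \<tau> \<in> mob a b c d ` gtr \<Longrightarrow> Re (G \<tau>) = arcosh \<bar>a * d + b * c\<bar>"
    by (rule geodesic_strip[OF det P1]) (rule that; assumption)
  note F = F[unfolded arc_rect_def]
  have im: "F ` cbox (Complex x0 y0) (Complex x1 y1) \<subseteq> UH" using F by blast
  show ?thesis
  proof (rule rectangle_to_strip[of x0 x1 y0 y1 "G \<circ> F"])
    show "continuous_on (cbox (Complex x0 y0) (Complex x1 y1)) (G \<circ> F)"
      using F continuous_on_subset[OF holomorphic_on_imp_continuous_on[OF G(1)] im] by (intro continuous_on_compose) auto
    show "G \<circ> F holomorphic_on box (Complex x0 y0) (Complex x1 y1)"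
      using F im box_subset_cbox by (intro holomorphic_on_compose_gen[OF _ G(1)]) blast+
    fix z assume z: "z \<in> cbox (Complex x0 y0) (Complex x1 y1)"
    hence "Im (F z) > 0" using im by (auto simp: image_subset_iff)
    thus "0 \<le> Im ((G \<circ> F) z) \<and> Im ((G \<circ> F) z) \<le> pi" using G(2)[of "F z"] by simp
  qed (use F G in auto)
qed

text \<open>If |P| > 1, a rectangle fills the strip up to a margin \<delta> that keeps it inside the
  open strip. If |P| = 1, then a b c d = 0 and the two geodesics share the endpoint infinity or 0,
  or coincide; then rectangles of height 1 may be arbitrarily wide.\<close>

lemma arc_rect_upper_tr:
  assumes det: "a * d - b * c = 1" and P: "\<bar>a * d + b * c\<bar> \<ge> 1" and e: "\<epsilon> > 0"
  shows "\<exists>x0 x1 y1 F. arc_rect gtr (mob a b c d ` gtr) x0 x1 0 y1 F \<and> y1 / (x1 - x0) \<le> arcosh \<bar>a * d + b * c\<bar> / pi + \<epsilon>"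
proof (cases "\<bar>a * d + b * c\<bar> = 1")
  case True
  define P where "P = a * d + b * c"
  have P2: "P * P = 1" using True by (metis P_def abs_mult_self_eq mult_1)
  have "4 * ((a * b) * (c * d)) = P * P - (a * d - b * c) * (a * d - b * c)" by (simp add: P_def algebra_simps)
  hence z: "a * b = 0 \<or> c * d = 0" by (simp add: P2 det)
  \<comment> \<open>The constant real part of the second geodesic when the common endpoint is
    infinity; when it is 0, that of its image under -1 / \<tau>. Division by P is multiplication by
    P since P^2 = 1.\<close>
  define K where "K = (if c * d = 0 then P * (a * b) else - P * (c * d))"
  \<comment> \<open>On the chosen side of 0 one has - K x \<ge> 0, which keeps the image at height
    at least 1.\<close>
  define x0 x1 where "x0 = (if K \<ge> 0 then - (1 / \<epsilon>) else 0)" and "x1 = (if K \<ge> 0 then 0 else 1 / \<epsilon>)"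
  define F where "F = (\<lambda>z::complex. \<i> - \<i> * of_real K * z)"
  have x: "x0 < x1" "1 / (x1 - x0) = \<epsilon>" using e by (auto simp: x0_def x1_def)
  have Re: "Re (F z) = K * Im z" and Im: "Im (F z) = 1 - K * Re z" for z by (simp_all add: F_def)
  have Im1: "Im (F z) \<ge> 1" if "z \<in> cbox (Complex x0 0) (Complex x1 1)" for z
    using that unfolding Im by (auto simp: in_cbox_complex_iff x0_def x1_def mult_le_0_iff split: if_splits)
  have mem: "Complex x y \<in> cbox (Complex x0 0) (Complex x1 1)" if "x \<in> {x0<..<x1}" "y \<in> {0..1}" for x y
    using that by (simp add: in_cbox_complex_iff)
  have hol: "F holomorphic_on A" for A unfolding F_def by (intro holomorphic_intros)
  show ?thesis
  proof (cases "c * d = 0")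
    case True
    have "arc_rect gtr (mob a b c d ` gtr) x0 x1 0 1 F"
      unfolding arc_rect_def
    proof (intro conjI ballI)
      show "F ` cbox (Complex x0 0) (Complex x1 1) \<subseteq> UH" using Im1 by fastforce
      fix x assume "x \<in> {x0<..<x1}"
      hence i: "Im (F (Complex x 0)) \<ge> 1" "Im (F (Complex x 1)) \<ge> 1" using Im1 mem by auto
      show "F (Complex x 0) \<in> gtr" using i by (simp add: gtr_def Re)
      have "P * K = a * b" using P2 True by (simp add: K_def flip: mult.assoc)
      hence "c * d * (norm (F (Complex x 1)))\<^sup>2 - P * Re (F (Complex x 1)) + a * b = 0" using True by (simp add: Re)
      thus "F (Complex x 1) \<in> mob a b c d ` gtr" using geodesic_mem[OF det, of "F (Complex x 1)"] i by (simp add: P_def)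
    qed (use x hol holomorphic_on_imp_continuous_on in auto)
    thus ?thesis using x e unfolding \<open>\<bar>a * d + b * c\<bar> = 1\<close> by (intro exI[of _ x0] exI[of _ x1] exI[of _ 1] exI[of _ F]) auto
  next
    case False
    hence ab: "a * b = 0" using z by blast
    define H where "H = (\<lambda>z. - 1 / F z)"
    have n0: "F z \<noteq> 0" if "z \<in> cbox (Complex x0 0) (Complex x1 1)" for z using Im1[OF that] by auto
    have HRe: "Re (H z) = - Re (F z) / (norm (F z))\<^sup>2" and HIm: "Im (H z) = Im (F z) / (norm (F z))\<^sup>2" for z
      by (simp_all add: H_def Re_divide Im_divide cmod_power2)
    have Hn: "(norm (H z))\<^sup>2 = 1 / (norm (F z))\<^sup>2" for z by (simp add: H_def norm_divide power_divide)
    have HI: "Im (H z) > 0" if "z \<in> cbox (Complex x0 0) (Complex x1 1)" for z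
      using Im1[OF that] n0[OF that] by (simp add: HIm)
    have Hh: "H holomorphic_on cbox (Complex x0 0) (Complex x1 1)" unfolding H_def by (intro holomorphic_intros hol n0)
    have "arc_rect gtr (mob a b c d ` gtr) x0 x1 0 1 H"
      unfolding arc_rect_def
    proof (intro conjI ballI)
      show "H ` cbox (Complex x0 0) (Complex x1 1) \<subseteq> UH" using HI by auto
      show "H holomorphic_on box (Complex x0 0) (Complex x1 1)" using Hh box_subset_cbox holomorphic_on_subset by blast
      fix x assume "x \<in> {x0<..<x1}"
      hence m: "Complex x 0 \<in> cbox (Complex x0 0) (Complex x1 1)" "Complex x 1 \<in> cbox (Complex x0 0) (Complex x1 1)" using mem by auto
      show "H (Complex x 0) \<in> gtr" using HI[OF m(1)] by (simp add: gtr_def HRe Re)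
      have "P * K = - ((P * P) * (c * d))" using False by (simp add: K_def)
      hence PK: "P * K = - (c * d)" unfolding P2 by simp
      have "c * d * (norm (H (Complex x 1)))\<^sup>2 - P * Re (H (Complex x 1)) + a * b = (c * d + P * K) / (norm (F (Complex x 1)))\<^sup>2"
        by (simp add: HRe Hn Re ab add_divide_distrib)
      also have "\<dots> = 0" by (simp add: PK)
      finally show "H (Complex x 1) \<in> mob a b c d ` gtr" using geodesic_mem[OF det HI[OF m(2)]] by (simp add: P_def)
    qed (use x Hh holomorphic_on_imp_continuous_on in auto)
    thus ?thesis using x e unfolding \<open>\<bar>a * d + b * c\<bar> = 1\<close> by (intro exI[of _ x0] exI[of _ x1] exI[of _ 1] exI[of _ H]) auto
  qed
next
  case False
  define A where "A = arcosh \<bar>a * d + b * c\<bar>"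
  have P1: "\<bar>a * d + b * c\<bar> > 1" using P False by simp
  hence A0: "A > 0" by (simp add: A_def)
  obtain Gi where Gi: "Gi holomorphic_on {\<zeta>. 0 < Im \<zeta> \<and> Im \<zeta> < pi}" "\<And>\<zeta>. 0 < Im \<zeta> \<Longrightarrow> Im \<zeta> < pi \<Longrightarrow> Im (Gi \<zeta>) > 0"
    "\<And>\<zeta>. 0 < Im \<zeta> \<Longrightarrow> Im \<zeta> < pi \<Longrightarrow> Re \<zeta> = 0 \<Longrightarrow> Gi \<zeta> \<in> gtr"
    "\<And>\<zeta>. 0 < Im \<zeta> \<Longrightarrow> Im \<zeta> < pi \<Longrightarrow> Re \<zeta> = A \<Longrightarrow> Gi \<zeta> \<in> mob a b c d ` gtr"
    by (rule geodesic_strip[OF det P1, folded A_def]) (rule that; assumption)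
  have "((\<lambda>\<delta>::real. A / (pi - 2 * \<delta>)) \<longlongrightarrow> A / (pi - 2 * 0)) (at_right 0)" by (intro tendsto_intros) auto
  hence "eventually (\<lambda>\<delta>. A / (pi - 2 * \<delta>) < A / pi + \<epsilon>) (at_right 0)" using e by (intro order_tendstoD(2)) auto
  moreover have "eventually (\<lambda>\<delta>::real. 0 < \<delta>) (at_right 0)" by (rule eventually_at_right_less)
  moreover have "eventually (\<lambda>\<delta>::real. \<delta> < 1) (at_right 0)" by (rule order_tendstoD(2)[OF tendsto_ident_at]) simp
  ultimately have "eventually (\<lambda>\<delta>. A / (pi - 2 * \<delta>) < A / pi + \<epsilon> \<and> 0 < \<delta> \<and> \<delta> < 1) (at_right 0)" by eventually_elim simp
  then obtain \<delta> where d: "A / (pi - 2 * \<delta>) < A / pi + \<epsilon>" "0 < \<delta>" "\<delta> < 1"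
    using eventually_happens'[OF trivial_limit_at_right_real] by blast
  have pi: "pi - 2 * \<delta> > 0" using d pi_gt3 by linarith
  \<comment> \<open>The factor -\<i> turns the upright rectangle into the horizontal strip, with Im
    \<zeta> = - Re z; hence the negative abscissae.\<close>
  define F where "F = (\<lambda>z. Gi (- \<i> * z))"
  let ?R = "cbox (Complex (- (pi - \<delta>)) 0) (Complex (- \<delta>) A)"
  have sub: "(\<lambda>z. - \<i> * z) ` ?R \<subseteq> {\<zeta>. 0 < Im \<zeta> \<and> Im \<zeta> < pi}" using d by (auto simp: in_cbox_complex_iff)
  have Fh: "F holomorphic_on ?R" unfolding F_def
    using holomorphic_on_compose_gen[OF _ Gi(1) sub] by (auto simp: o_def intro!: holomorphic_intros)
  have "arc_rect gtr (mob a b c d ` gtr) (- (pi - \<delta>)) (- \<delta>) 0 A F"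
    unfolding arc_rect_def
  proof (intro conjI ballI)
    show "F ` ?R \<subseteq> UH" using sub Gi(2) by (auto simp: F_def image_subset_iff)
    show "F holomorphic_on box (Complex (- (pi - \<delta>)) 0) (Complex (- \<delta>) A)" using Fh box_subset_cbox holomorphic_on_subset by blast
  qed (use pi A0 Fh holomorphic_on_imp_continuous_on Gi(3,4) d in \<open>auto simp: F_def\<close>)
  moreover have "A / (- \<delta> - (- (pi - \<delta>))) \<le> A / pi + \<epsilon>" using d(1) by (simp add: algebra_simps)
  ultimately show ?thesis unfolding A_def by blast
qed

text \<open>The quarter turn about \<open>\<i>\<close> carries \<open>gtr\<close> to \<open>gpb\<close>, so the second case is conjugate to the first.\<close>

lemma gpb_quarter_turn: "gpb = mob (1 / sqrt 2) (- 1 / sqrt 2) (1 / sqrt 2) (1 / sqrt 2) ` gtr"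
proof -
  have "mob (1 / sqrt 2) (- 1 / sqrt 2) (1 / sqrt 2) (1 / sqrt 2) (\<i> * of_real y) = cay y" for y
  proof -
    have gen: "mob k (- k) k k z = (of_real k * (z - 1)) / (of_real k * (z + 1))" for k z
      by (simp add: mob_def algebra_simps)
    have "mob (1 / sqrt 2) (- 1 / sqrt 2) (1 / sqrt 2) (1 / sqrt 2) (\<i> * of_real y)
        = (of_real (1 / sqrt 2) * (\<i> * of_real y - 1)) / (of_real (1 / sqrt 2) * (\<i> * of_real y + 1))"
      using gen[of "1 / sqrt 2" "\<i> * of_real y"] by (simp only: minus_divide_left)
    also have "\<dots> = cay y" unfolding cay_def by (rule mult_divide_mult_cancel_left) simp
    finally show ?thesis .
  qed
  thus ?thesis unfolding gpb_eq gtr_eq image_image by simp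
qed

context
  fixes a b c d :: real
  assumes det: "a * d - b * c = 1" and P: "\<bar>a\<^sup>2 + d\<^sup>2 - b\<^sup>2 - c\<^sup>2\<bar> / 2 \<ge> 1"
begin

text \<open>The entries of the matrix conjugated by the quarter turn. Their a' d' + b' c' is (a^2 +
  d^2 - b^2 - c^2) / 2, which explains the quantity q for conjugate pairs.\<close>

private definition "a' = (a + b + c + d) / 2"
private definition "b' = (b + d - a - c) / 2"
private definition "c' = (c + d - a - b) / 2"
private definition "d' = (a + d - b - c) / 2"
private definition "k = 1 / sqrt (2::real)"

private lemma kk: "k * k = 1 / 2" by (simp add: k_def)
private lemma kdet: "k * k - k * (- k) = 1" "k * k - (- k) * k = 1" using kk by simp_all
private lemma det': "a' * d' - b' * c' = 1"
  using det by (simp add: a'_def b'_def c'_def d'_def field_simps)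
private lemma P': "\<bar>a' * d' + b' * c'\<bar> = \<bar>a\<^sup>2 + d\<^sup>2 - b\<^sup>2 - c\<^sup>2\<bar> / 2"
proof -
  have "a' * d' + b' * c' = (a\<^sup>2 + d\<^sup>2 - b\<^sup>2 - c\<^sup>2) / 2"
    by (simp add: a'_def b'_def c'_def d'_def field_simps power2_eq_square)
  thus ?thesis by (simp only: abs_divide abs_numeral)
qed

private lemma gpb_k: "gpb = mob k (- k) k k ` gtr" using gpb_quarter_turn by (simp add: k_def)
private lemma gtr_k: "mob k k (- k) k ` gpb = gtr"
  unfolding gpb_k image_image using mob_inv(1)[OF _ kdet(2)] by (force simp: gtr_def)
private lemma turn_mob: "mob k k (- k) k ` mob a b c d ` gpb = mob a' b' c' d' ` gtr"
proof -
  have "mob k k (- k) k (mob a b c d (mob k (- k) k k \<tau>)) = mob a' b' c' d' \<tau>" if "\<tau> \<in> gtr" for \<tau>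
  proof -
    have t: "Im \<tau> > 0" using that by (simp add: gtr_def)
    have det2: "(a * k + b * k) * (c * - k + d * k) - (a * - k + b * k) * (c * k + d * k) = 1"
    proof -
      have "(a * k + b * k) * (c * - k + d * k) - (a * - k + b * k) * (c * k + d * k) = 2 * (k * k) * (a * d - b * c)"
        by (simp add: algebra_simps)
      thus ?thesis by (simp add: kk det)
    qed
    have "k * (a * k + b * k) + k * (c * k + d * k) = (k * k) * (a + b + c + d)"
      "k * (a * - k + b * k) + k * (c * - k + d * k) = (k * k) * (b + d - a - c)"
      "- k * (a * k + b * k) + k * (c * k + d * k) = (k * k) * (c + d - a - b)"
      "- k * (a * - k + b * k) + k * (c * - k + d * k) = (k * k) * (a + d - b - c)"
      by (simp_all add: algebra_simps)
    hence e: "k * (a * k + b * k) + k * (c * k + d * k) = a'"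
      "k * (a * - k + b * k) + k * (c * - k + d * k) = b'"
      "- k * (a * k + b * k) + k * (c * k + d * k) = c'"
      "- k * (a * - k + b * k) + k * (c * - k + d * k) = d'"
      unfolding kk a'_def b'_def c'_def d'_def by simp_all
    show ?thesis unfolding mob_mob[OF t kdet(2)] mob_mob[OF t det2] e ..
  qed
  thus ?thesis unfolding gpb_k image_image by auto
qed

lemma arc_rect_lower_pb:
  assumes F: "arc_rect gpb (mob a b c d ` gpb) x0 x1 y0 y1 F"
  shows "arcosh (\<bar>a\<^sup>2 + d\<^sup>2 - b\<^sup>2 - c\<^sup>2\<bar> / 2) * (x1 - x0) \<le> pi * (y1 - y0)"
  using arc_rect_lower_tr[OF det' _ arc_rect_mob[OF F kdet(1), unfolded gtr_k turn_mob]] P unfolding P' by blast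

lemma arc_rect_upper_pb:
  assumes e: "\<epsilon> > 0"
  shows "\<exists>x0 x1 y1 F. arc_rect gpb (mob a b c d ` gpb) x0 x1 0 y1 F \<and> y1 / (x1 - x0) \<le> arcosh (\<bar>a\<^sup>2 + d\<^sup>2 - b\<^sup>2 - c\<^sup>2\<bar> / 2) / pi + \<epsilon>"
proof -
  obtain x0 x1 y1 F where F: "arc_rect gtr (mob a' b' c' d' ` gtr) x0 x1 0 y1 F"
    "y1 / (x1 - x0) \<le> arcosh (\<bar>a\<^sup>2 + d\<^sup>2 - b\<^sup>2 - c\<^sup>2\<bar> / 2) / pi + \<epsilon>"
    using arc_rect_upper_tr[OF det' _ e] P unfolding P' by blast
  have "mob k (- k) k k ` mob k k (- k) k ` mob a b c d ` gpb = mob a b c d ` gpb"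
  proof -
    have "mob k (- k) k k (mob k k (- k) k \<tau>) = \<tau>" if "\<tau> \<in> mob a b c d ` gpb" for \<tau>
      using mob_inv(2)[OF _ kdet(2), of \<tau>] that mob_Im(2)[OF _ det] by (auto simp: gpb_def)
    thus ?thesis by (force simp: image_image)
  qed
  hence "mob k (- k) k k ` mob a' b' c' d' ` gtr = mob a b c d ` gpb" unfolding turn_mob .
  thus ?thesis using arc_rect_mob[OF F(1) kdet(2)] F(2) unfolding gpb_k[symmetric] by metis
qed

end

section \<open>Lifting configurations\<close>

definition perms3 :: "(cplx3 \<Rightarrow> cplx3) set" where
  "perms3 = {\<lambda>(x, y, z). (x, y, z), \<lambda>(x, y, z). (x, z, y), \<lambda>(x, y, z). (y, x, z),
     \<lambda>(x, y, z). (y, z, x), \<lambda>(x, y, z). (z, x, y), \<lambda>(x, y, z). (z, y, x)}"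

lemma vieta_perm: "\<pi> \<in> perms3 \<Longrightarrow> vieta (\<pi> u) = vieta u"
  by (cases u) (auto simp: perms3_def vieta_def algebra_simps)

lemma Conf3_perm: "\<pi> \<in> perms3 \<Longrightarrow> u \<in> Conf3 \<Longrightarrow> \<pi> u \<in> Conf3"
  by (cases u) (auto simp: perms3_def Conf3_def)

text \<open>Equal coefficients mean equal cubics, so x is a zero of (t - p) (t - q) (t - r).\<close>

lemma vieta_root:
  assumes "vieta (x, y, z) = vieta (p, q, r)"
  shows "x \<in> {p, q, r}"
proof -
  have s: "x + y + z = p + q + r" and t: "x*y + x*z + y*z = p*q + p*r + q*r" and u: "x*y*z = p*q*r"
    using assms by (simp_all only: vieta_def prod.case prod.inject neg_equal_iff_equal)
  have "(x - p) * (x - q) * (x - r) = x^3 - (p + q + r) * x^2 + (p*q + p*r + q*r) * x - p*q*r"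
    by (simp add: algebra_simps power2_eq_square power3_eq_cube)
  also have "\<dots> = 0" unfolding s[symmetric] t[symmetric] u[symmetric]
    by (simp add: algebra_simps power2_eq_square power3_eq_cube)
  finally show ?thesis by auto
qed

lemma vieta_eqD:
  assumes eq: "vieta u = vieta w" and u: "u \<in> Conf3"
  obtains \<pi> where "\<pi> \<in> perms3" "u = \<pi> w"
proof -
  obtain x y z p q r where d: "u = (x, y, z)" "w = (p, q, r)" by (cases u; cases w)
  have e: "vieta (x, y, z) = vieta (p, q, r)" using eq by (simp add: d)
  have e2: "vieta (y, x, z) = vieta (p, q, r)" "vieta (z, y, x) = vieta (p, q, r)"
    unfolding e[symmetric] by (simp_all add: vieta_def algebra_simps)
  have "x \<in> {p, q, r}" "y \<in> {p, q, r}" "z \<in> {p, q, r}" using vieta_root[OF e] vieta_root[OF e2(1)] vieta_root[OF e2(2)] by auto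
  moreover have "x \<noteq> y" "x \<noteq> z" "y \<noteq> z" using u by (auto simp: d Conf3_def)
  ultimately have "(x, y, z) \<in> (\<lambda>\<pi>. \<pi> (p, q, r)) ` perms3" unfolding perms3_def by auto
  thus thesis using that unfolding d by blast
qed

definition polydisc :: "real \<Rightarrow> cplx3 \<Rightarrow> cplx3 set" where
  "polydisc e u = (case u of (x, y, z) \<Rightarrow> ball x e \<times> (ball y e \<times> ball z e))"

lemma polydisc_perm: "\<pi> \<in> perms3 \<Longrightarrow> w \<in> polydisc e u \<Longrightarrow> \<pi> w \<in> polydisc e (\<pi> u)"
  by (cases w; cases u) (auto simp: perms3_def polydisc_def)

lemma polydisc_open: "open (polydisc e u)"
  by (cases u) (auto simp: polydisc_def intro!: open_Times)

lemma vieta_cont: "continuous_on A vieta"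
  unfolding vieta_def[abs_def] case_prod_beta by (intro continuous_intros)

text \<open>Polydiscs whose radius is half the minimal distance of the three points are disjoint for
  different orderings, and distinct points of one polydisc are never reorderings of each other;
  openness of the image is invariance of domain.\<close>

lemma vieta_covering: "covering_space Conf3 vieta SymConf3"
proof (rule covering_spaceI)
  fix v assume "v \<in> SymConf3"
  then obtain p q r where z0: "(p, q, r) \<in> Conf3" "v = vieta (p, q, r)" by (auto simp: SymConf3_def)
  have ne: "p \<noteq> q" "p \<noteq> r" "q \<noteq> r" using z0 by (auto simp: Conf3_def)
  define e where "e = min (dist p q) (min (dist p r) (dist q r)) / 2"
  have e0: "e > 0" using ne by (simp add: e_def)
  have far: "2 * e \<le> dist x y" if "x \<in> {p, q, r}" "y \<in> {p, q, r}" "x \<noteq> y" for x y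
    using that by (auto simp: e_def dist_commute)
  have disj: "x = y" if "x \<in> {p, q, r}" "y \<in> {p, q, r}" "w \<in> ball x e" "w \<in> ball y e" for x y w
  proof (rule ccontr)
    assume "x \<noteq> y"
    hence "2 * e \<le> dist x y" using far that by blast
    moreover have "dist x y \<le> dist x w + dist y w" by (rule dist_triangle2)
    ultimately show False using that(3,4) by simp
  qed
  define F where "F = {u \<in> Conf3. vieta u = v}"
  have Fc: "x \<in> {p, q, r} \<and> y \<in> {p, q, r} \<and> z \<in> {p, q, r} \<and> x \<noteq> y \<and> x \<noteq> z \<and> y \<noteq> z" if "(x, y, z) \<in> F" for x y z
  proof -
    have e: "vieta (x, y, z) = vieta (p, q, r)" using that by (simp add: F_def z0)
    have e2: "vieta (y, x, z) = vieta (p, q, r)" "vieta (z, y, x) = vieta (p, q, r)"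
      unfolding e[symmetric] by (simp_all add: vieta_def algebra_simps)
    have "x \<noteq> y \<and> x \<noteq> z \<and> y \<noteq> z" using that by (auto simp: F_def Conf3_def)
    thus ?thesis using vieta_root[OF e] vieta_root[OF e2(1)] vieta_root[OF e2(2)] by blast
  qed
  have F0: "(p, q, r) \<in> F" using z0 by (simp add: F_def)
  have Fperm: "\<pi> u \<in> F" if "\<pi> \<in> perms3" "u \<in> F" for \<pi> u
    using that vieta_perm Conf3_perm by (simp add: F_def)
  have sub: "polydisc e u \<subseteq> Conf3" if u: "u \<in> F" for u
  proof
    fix w assume w: "w \<in> polydisc e u"
    obtain x y z x' y' z' where d: "u = (x, y, z)" "w = (x', y', z')" by (cases u; cases w)
    have c: "x \<in> {p, q, r}" "y \<in> {p, q, r}" "z \<in> {p, q, r}" "x \<noteq> y" "x \<noteq> z" "y \<noteq> z" using Fc u unfolding d by blast+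
    have b: "x' \<in> ball x e" "y' \<in> ball y e" "z' \<in> ball z e" using w by (auto simp: polydisc_def d)
    have "x' \<noteq> y'" "x' \<noteq> z'" "y' \<noteq> z'" using c b disj by metis+
    thus "w \<in> Conf3" by (simp add: Conf3_def d)
  qed
  have inj: "inj_on vieta (polydisc e u)" if u: "u \<in> F" for u
  proof (rule inj_onI)
    fix w w' assume w: "w \<in> polydisc e u" "w' \<in> polydisc e u" "vieta w = vieta w'"
    obtain x y z x' y' z' a b c where d: "u = (x, y, z)" "w = (x', y', z')" "w' = (a, b, c)" by (cases u; cases w; cases w')
    have f: "x \<in> {p, q, r}" "y \<in> {p, q, r}" "z \<in> {p, q, r}" "x \<noteq> y" "x \<noteq> z" "y \<noteq> z" using Fc u unfolding d by blast+
    have B: "x' \<in> ball x e" "y' \<in> ball y e" "z' \<in> ball z e" "a \<in> ball x e" "b \<in> ball y e" "c \<in> ball z e"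
      using w by (auto simp: polydisc_def d)
    have "w \<in> Conf3" using sub u w by blast
    then obtain \<pi> where p: "\<pi> \<in> perms3" "w = \<pi> w'" using vieta_eqD[OF w(3)] by metis
    hence m: "x' \<in> {a, b, c} \<and> y' \<in> {a, b, c} \<and> z' \<in> {a, b, c}" unfolding perms3_def d by auto
    have "x' \<noteq> b" "x' \<noteq> c" "y' \<noteq> a" "y' \<noteq> c" "z' \<noteq> a" "z' \<noteq> b" using f B disj by metis+
    thus "w = w'" using m unfolding d by blast
  qed
  define T where "T = vieta ` polydisc e (p, q, r)"
  have Fim: "vieta ` polydisc e u = T" if u: "u \<in> F" for u
  proof -
    have ex: "\<exists>\<pi>\<in>perms3. u' = \<pi> u''" if "u' \<in> F" "u'' \<in> F" for u' u''
      using vieta_eqD[of u' u''] that unfolding F_def by (metis (mono_tags, lifting) mem_Collect_eq)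
    hence le: "vieta ` polydisc e u' \<subseteq> vieta ` polydisc e u''" if uu: "u' \<in> F" "u'' \<in> F" for u' u''
    proof (intro image_subsetI)
      fix w assume w: "w \<in> polydisc e u'"
      obtain \<pi> where p: "\<pi> \<in> perms3" "u'' = \<pi> u'" using ex[OF uu(2,1)] by blast
      have "\<pi> w \<in> polydisc e u''" unfolding p(2) by (rule polydisc_perm[OF p(1) w])
      thus "vieta w \<in> vieta ` polydisc e u''" using vieta_perm[OF p(1), of w] by (metis imageI)
    qed
    show ?thesis unfolding T_def using le[OF u F0] le[OF F0 u] by blast
  qed
  have To: "open T" unfolding T_def by (rule invariance_of_domain[OF vieta_cont polydisc_open inj[OF F0]])
  have TS: "T \<subseteq> SymConf3" unfolding T_def SymConf3_def using sub[OF F0] by blast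
  show "\<exists>T. v \<in> T \<and> openin (top_of_set SymConf3) T \<and> (\<exists>V. \<Union>V = Conf3 \<inter> vieta -` T \<and>
      (\<forall>u\<in>V. openin (top_of_set Conf3) u) \<and> pairwise disjnt V \<and> (\<forall>u\<in>V. \<exists>q. homeomorphism u T vieta q))"
  proof (intro exI[of _ T] conjI exI[of _ "polydisc e ` F"] ballI)
    have "(p, q, r) \<in> polydisc e (p, q, r)" using e0 by (simp add: polydisc_def)
    thus "v \<in> T" unfolding T_def z0(2) by blast
    show "openin (top_of_set SymConf3) T" by (rule open_subset[OF TS To])
    show "\<Union> (polydisc e ` F) = Conf3 \<inter> vieta -` T"
    proof (intro equalityI subsetI)
      fix w assume "w \<in> \<Union> (polydisc e ` F)"
      then obtain u where "u \<in> F" "w \<in> polydisc e u" by blast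
      thus "w \<in> Conf3 \<inter> vieta -` T" using sub Fim by blast
    next
      fix w assume w: "w \<in> Conf3 \<inter> vieta -` T"
      then obtain w' where w': "w' \<in> polydisc e (p, q, r)" "vieta w = vieta w'" by (auto simp: T_def)
      obtain \<pi> where p: "\<pi> \<in> perms3" "w = \<pi> w'" using vieta_eqD[OF w'(2)] w by blast
      have "w \<in> polydisc e (\<pi> (p, q, r))" unfolding p(2) by (rule polydisc_perm[OF p(1) w'(1)])
      thus "w \<in> \<Union> (polydisc e ` F)" using Fperm[OF p(1) F0] by blast
    qed
    show "pairwise disjnt (polydisc e ` F)"
    proof (rule pairwiseI)
      fix A B assume "A \<in> polydisc e ` F" "B \<in> polydisc e ` F" and AB: "A \<noteq> B"
      then obtain u u' where u: "u \<in> F" "u' \<in> F" "A = polydisc e u" "B = polydisc e u'" by blast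
      show "disjnt A B"
      proof (rule ccontr)
        assume "\<not> disjnt A B"
        then obtain w where w: "w \<in> polydisc e u" "w \<in> polydisc e u'" unfolding disjnt_def u by blast
        obtain x y z x' y' z' a b c where d: "u = (x, y, z)" "u' = (x', y', z')" "w = (a, b, c)" by (cases u; cases u'; cases w)
        have "x = x'" by (rule disj[of _ _ a]) (use w Fc u in \<open>auto simp: polydisc_def d\<close>)
        moreover have "y = y'" by (rule disj[of _ _ b]) (use w Fc u in \<open>auto simp: polydisc_def d\<close>)
        moreover have "z = z'" by (rule disj[of _ _ c]) (use w Fc u in \<open>auto simp: polydisc_def d\<close>)
        ultimately show False using AB u d by simp
      qed
    qed
  next
    fix A assume "A \<in> polydisc e ` F"
    then obtain u where u: "u \<in> F" "A = polydisc e u" by blast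
    show "openin (top_of_set Conf3) A" unfolding u(2) by (rule open_subset[OF sub[OF u(1)] polydisc_open])
    obtain g where "homeomorphism A (vieta ` A) vieta g"
      using invariance_of_domain_homeomorphism[OF polydisc_open vieta_cont _ inj[OF u(1)]] unfolding u(2) by blast
    thus "\<exists>q. homeomorphism A T vieta q" unfolding u(2) Fim[OF u(1)] by blast
  qed
qed (simp_all add: vieta_cont SymConf3_def)

section \<open>Lifts to ordered triples and to the half plane\<close>

definition ratio :: "cplx3 \<Rightarrow> complex" where
  "ratio u = (case u of (x, y, z) \<Rightarrow> (y - x) / (z - x))"

lemma ratio_range: "u \<in> Conf3 \<Longrightarrow> ratio u \<in> - {0, 1}"
  by (cases u) (auto simp: ratio_def Conf3_def field_simps)

lemma ratio_cont: "continuous_on Conf3 ratio"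
  unfolding ratio_def[abs_def] case_prod_beta by (intro continuous_intros) (auto simp: Conf3_def)

text \<open>Two lifts in succession: through \<open>vieta\<close> to ordered triples, then of their
  \<open>ratio\<close> through \<open>lam\<close>. Both exist because a convex domain is simply
  connected.\<close>

lemma config_lift:
  fixes f :: "'a::euclidean_space \<Rightarrow> cplx3"
  assumes K: "convex K" "k0 \<in> K" and f: "continuous_on K f" "f ` K \<subseteq> SymConf3"
    and Z0: "Z0 \<in> Conf3" "vieta Z0 = f k0" and t0: "Im \<tau>0 > 0" "lam \<tau>0 = ratio Z0"
  obtains Z \<tau> where "continuous_on K Z" "Z ` K \<subseteq> Conf3" "\<And>k. k \<in> K \<Longrightarrow> vieta (Z k) = f k" "Z k0 = Z0"
    "continuous_on K \<tau>" "\<tau> ` K \<subseteq> UH" "\<And>k. k \<in> K \<Longrightarrow> lam (\<tau> k) = ratio (Z k)" "\<tau> k0 = \<tau>0"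
proof -
  note sc = convex_imp_simply_connected[OF K(1)] convex_imp_locally_path_connected[OF K(1)]
  obtain Z where Z: "continuous_on K Z" "Z \<in> K \<rightarrow> Conf3" "Z k0 = Z0" "\<And>k. k \<in> K \<Longrightarrow> vieta (Z k) = f k"
    by (rule covering_space_lift_strong[OF vieta_covering Z0(1) K(2) sc f(1)]) (use f Z0 that in auto)
  have rZ: "continuous_on K (ratio \<circ> Z)"
    using Z(2) by (intro continuous_on_compose Z(1) continuous_on_subset[OF ratio_cont]) auto
  obtain \<tau> where "continuous_on K \<tau>" "\<tau> \<in> K \<rightarrow> UH" "\<tau> k0 = \<tau>0" "\<And>k. k \<in> K \<Longrightarrow> lam (\<tau> k) = (ratio \<circ> Z) k"
    by (rule covering_space_lift_strong[OF lam_covering _ K(2) sc rZ, of \<tau>0]) (use Z ratio_range t0 that in \<open>auto simp: Pi_iff\<close>)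
  thus thesis using Z that[of Z \<tau>] by (auto simp: image_subset_iff_funcset)
qed

lemma config_lift_unique:
  fixes Z Z' :: "'a::topological_space \<Rightarrow> cplx3"
  assumes K: "connected K" "k0 \<in> K" "k \<in> K"
    and Z: "continuous_on K Z" "Z ` K \<subseteq> Conf3" "continuous_on K \<tau>" "\<tau> ` K \<subseteq> UH" "\<And>k. k \<in> K \<Longrightarrow> lam (\<tau> k) = ratio (Z k)"
    and Z': "continuous_on K Z'" "Z' ` K \<subseteq> Conf3" "continuous_on K \<tau>'" "\<tau>' ` K \<subseteq> UH" "\<And>k. k \<in> K \<Longrightarrow> lam (\<tau>' k) = ratio (Z' k)"
    and eq: "\<And>k. k \<in> K \<Longrightarrow> vieta (Z k) = vieta (Z' k)" and k0: "Z k0 = Z' k0" "\<tau> k0 = \<tau>' k0"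
  shows "Z k = Z' k \<and> \<tau> k = \<tau>' k"
proof -
  have fc: "continuous_on K (\<lambda>k. vieta (Z k))" by (rule continuous_on_compose2[OF vieta_cont Z(1)]) (use Z in auto)
  have ZZ: "Z k = Z' k" if "k \<in> K" for k
    by (rule covering_space_lift_unique[where ?g1.0 = Z and ?g2.0 = Z' and a = k0, OF vieta_covering k0(1) fc])
       (use Z Z' eq K that in \<open>auto simp: SymConf3_def image_subset_iff_funcset\<close>)
  have rc: "continuous_on K (\<lambda>k. ratio (Z k))" by (rule continuous_on_compose2[OF ratio_cont Z(1)]) (use Z in auto)
  have rr: "(\<lambda>k. ratio (Z k)) \<in> K \<rightarrow> - {0, 1}" using Z(2) ratio_range by blast
  have "\<tau> k = \<tau>' k"
    by (rule covering_space_lift_unique[where ?g1.0 = \<tau> and ?g2.0 = \<tau>' and a = k0, OF lam_covering k0(2) rc rr Z(3) _ _ Z'(3)]) (use Z Z' ZZ K in \<open>auto simp: image_subset_iff_funcset\<close>)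
  thus ?thesis using ZZ K by blast
qed

section \<open>Holomorphy of the lifts\<close>

text \<open>The difference quotient of g is that of h divided by Q, so it converges. This serves
  both for roots of cubics and for inverting \<open>lam\<close>.\<close>

lemma differentiable_by_slope:
  fixes g h Q :: "complex \<Rightarrow> complex"
  assumes S: "open S" "z0 \<in> S" and eq: "\<And>z. z \<in> S \<Longrightarrow> Q z * (g z - g z0) = h z - h z0"
    and Q: "(Q \<longlongrightarrow> q) (at z0)" "q \<noteq> 0" and h: "h field_differentiable (at z0)"
  shows "g field_differentiable (at z0)"
proof -
  obtain h' where h': "((\<lambda>z. (h z - h z0) / (z - z0)) \<longlongrightarrow> h') (at z0)"
    using h unfolding field_differentiable_def has_field_derivative_iff by blast
  have "((\<lambda>z. ((h z - h z0) / (z - z0)) / Q z) \<longlongrightarrow> h' / q) (at z0)" by (rule tendsto_divide[OF h' Q])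
  moreover have "eventually (\<lambda>z. ((h z - h z0) / (z - z0)) / Q z = (g z - g z0) / (z - z0)) (at z0)"
    using tendsto_imp_eventually_ne[OF Q] eventually_at_in_open'[OF S]
  proof eventually_elim
    case (elim z) thus ?case by (simp flip: eq)
  qed
  ultimately have "((\<lambda>z. (g z - g z0) / (z - z0)) \<longlongrightarrow> h' / q) (at z0)" by (rule Lim_transform_eventually)
  thus ?thesis unfolding field_differentiable_def has_field_derivative_iff by blast
qed

text \<open>Q is the divided difference of the cubic between x(z) and x(z0); at z0 it is the
  derivative of the cubic, which does not vanish at a simple root.\<close>

lemma root_holomorphic:
  assumes S: "open S" and x: "continuous_on S x" and coef: "A holomorphic_on S" "B holomorphic_on S" "C holomorphic_on S"
    and root: "\<And>z. z \<in> S \<Longrightarrow> x z ^ 3 + A z * (x z)\<^sup>2 + B z * x z + C z = 0"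
    and simple: "\<And>z. z \<in> S \<Longrightarrow> 3 * (x z)\<^sup>2 + 2 * A z * x z + B z \<noteq> 0"
  shows "x holomorphic_on S"
  unfolding holomorphic_on_def
proof
  fix z0 assume z0: "z0 \<in> S"
  define Q where "Q = (\<lambda>z. (x z)\<^sup>2 + x z * x z0 + (x z0)\<^sup>2 + A z * (x z + x z0) + B z)"
  define h where "h = (\<lambda>z. - (A z * (x z0)\<^sup>2 + B z * x z0 + C z))"
  have "x field_differentiable (at z0)"
  proof (rule differentiable_by_slope[OF S z0, of Q _ h "Q z0"])
    fix z assume z: "z \<in> S"
    have "Q z * (x z - x z0) = (x z ^ 3 + A z * (x z)\<^sup>2 + B z * x z + C z) - (x z0 ^ 3 + A z0 * (x z0)\<^sup>2 + B z0 * x z0 + C z0) + (h z - h z0)"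
      by (simp add: Q_def h_def algebra_simps power2_eq_square power3_eq_cube)
    thus "Q z * (x z - x z0) = h z - h z0" using root[OF z] root[OF z0] by simp
  next
    have "continuous_on S Q" unfolding Q_def
      by (intro continuous_intros x holomorphic_on_imp_continuous_on coef)
    thus "(Q \<longlongrightarrow> Q z0) (at z0)" using S z0 by (simp add: continuous_on_eq_continuous_at isContD)
    show "Q z0 \<noteq> 0" using simple[OF z0] by (simp add: Q_def algebra_simps power2_eq_square)
    have "h holomorphic_on S" unfolding h_def by (intro holomorphic_intros coef)
    thus "h field_differentiable (at z0)" using S z0 holomorphic_on_imp_differentiable_at by blast
  qed
  thus "x field_differentiable (at z0 within S)" by (rule field_differentiable_at_within)
qed

lemma holomorphic_through_locally_injective:
  assumes S: "open S" and g: "continuous_on S g" "g ` S \<subseteq> U" and U: "open U" "\<phi> holomorphic_on U"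
    and d: "\<And>u. u \<in> U \<Longrightarrow> deriv \<phi> u \<noteq> 0" and h: "(\<lambda>z. \<phi> (g z)) holomorphic_on S"
  shows "g holomorphic_on S"
  unfolding holomorphic_on_def
proof
  fix z0 assume z0: "z0 \<in> S"
  define u0 where "u0 = g z0"
  have u0: "u0 \<in> U" using g z0 by (auto simp: u0_def)
  define q where "q = (\<lambda>u. if u = u0 then deriv \<phi> u0 else (\<phi> u - \<phi> u0) / (u - u0))"
  have "(\<phi> has_field_derivative deriv \<phi> u0) (at u0)" using U u0 by (simp add: holomorphic_derivI)
  hence "((\<lambda>u. (\<phi> u - \<phi> u0) / (u - u0)) \<longlongrightarrow> deriv \<phi> u0) (at u0)" by (simp add: has_field_derivative_iff)
  hence "(q \<longlongrightarrow> deriv \<phi> u0) (at u0)"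
    by (rule Lim_transform_eventually) (auto simp: q_def eventually_at_filter)
  hence "isCont q u0" by (simp add: isCont_def q_def)
  moreover have "isCont g z0" using g(1) S z0 by (simp add: continuous_on_eq_continuous_at)
  ultimately have "isCont (\<lambda>z. q (g z)) z0" unfolding u0_def by (rule isCont_o2[rotated])
  hence lim: "((\<lambda>z. q (g z)) \<longlongrightarrow> q (g z0)) (at z0)" by (simp add: isCont_def)
  have "g field_differentiable (at z0)"
  proof (rule differentiable_by_slope[OF S z0 _ lim, of _ "\<lambda>z. \<phi> (g z)"])
    show "q (g z) * (g z - g z0) = \<phi> (g z) - \<phi> (g z0)" if "z \<in> S" for z by (simp add: q_def u0_def)
    show "q (g z0) \<noteq> 0" using d[OF u0] by (simp add: q_def u0_def)
    show "(\<lambda>z. \<phi> (g z)) field_differentiable (at z0)" using h S z0 holomorphic_on_imp_differentiable_at by blast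
  qed
  thus "g field_differentiable (at z0 within S)" by (rule field_differentiable_at_within)
qed

text \<open>On a small disc \<open>lam\<close> is injective, and an injective holomorphic function
  has no critical points.\<close>

lemma lam_deriv: assumes t: "Im \<tau> > 0" shows "deriv lam \<tau> \<noteq> 0"
proof -
  obtain e where e: "e > 0" "ball \<tau> e \<subseteq> UH"
    "\<And>(a::int) b c d \<tau>'. even b \<Longrightarrow> even c \<Longrightarrow> a * d - b * c = 1 \<Longrightarrow> \<tau>' \<in> ball \<tau> e \<Longrightarrow> mob a b c d \<tau>' \<in> ball \<tau> e
       \<Longrightarrow> b = 0 \<and> c = 0 \<and> (a = 1 \<and> d = 1 \<or> a = -1 \<and> d = -1)"
    using Gamma2_separation[OF t] by metis
  have "inj_on lam (ball \<tau> e)"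
  proof (rule inj_onI)
    fix x y assume xy: "x \<in> ball \<tau> e" "y \<in> ball \<tau> e" "lam x = lam y"
    have i: "Im x > 0" "Im y > 0" using xy e(2) by auto
    obtain a b c d :: int where m: "even b" "even c" "a * d - b * c = 1" "y = mob a b c d x"
      by (rule lam_eqD[OF i xy(3)])
    have "b = 0 \<and> c = 0 \<and> (a = 1 \<and> d = 1 \<or> a = -1 \<and> d = -1)"
      using e(3)[OF m(1-3) xy(1)] xy(2) m(4) by simp
    thus "x = y" using m(4) by auto
  qed
  thus ?thesis using holomorphic_injective_imp_regular[of lam "ball \<tau> e" \<tau>] lam_holo e(1,2) holomorphic_on_subset by auto
qed

text \<open>The coordinates of Z are simple roots of a cubic with holomorphic coefficients, so their
  ratio is holomorphic, and it can be pulled back through \<open>lam\<close> because the derivative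
  of \<open>lam\<close> has no zeros.\<close>

lemma config_lift_holomorphic:
  assumes S: "open S" and Z: "continuous_on S Z" "Z ` S \<subseteq> Conf3" and f: "holo3 (\<lambda>z. vieta (Z z)) S"
    and \<tau>: "continuous_on S \<tau>" "\<tau> ` S \<subseteq> UH" "\<And>z. z \<in> S \<Longrightarrow> lam (\<tau> z) = ratio (Z z)"
  shows "\<tau> holomorphic_on S"
proof -
  define x y w where "x = (\<lambda>z. fst (Z z))" and "y = (\<lambda>z. fst (snd (Z z)))" and "w = (\<lambda>z. snd (snd (Z z)))"
  have Zz: "Z z = (x z, y z, w z)" for z by (simp add: x_def y_def w_def)
  have ne: "x z \<noteq> y z" "x z \<noteq> w z" "y z \<noteq> w z" if "z \<in> S" for z
  proof -
    have "Z z \<in> Conf3" using Z(2) that by blast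
    thus "x z \<noteq> y z" "x z \<noteq> w z" "y z \<noteq> w z" by (auto simp: Zz Conf3_def)
  qed
  define A B C where "A = (\<lambda>z. - (x z + y z + w z))" and "B = (\<lambda>z. x z * y z + x z * w z + y z * w z)" and "C = (\<lambda>z. - (x z * y z * w z))"
  have coef: "A holomorphic_on S" "B holomorphic_on S" "C holomorphic_on S"
    using f unfolding holo3_def Zz vieta_def A_def B_def C_def by simp_all
  have c: "continuous_on S x" "continuous_on S y" "continuous_on S w"
    unfolding x_def y_def w_def by (intro continuous_intros Z(1))+
  have dx: "3 * (x z)\<^sup>2 + 2 * A z * x z + B z = (x z - y z) * (x z - w z)"
    and dy: "3 * (y z)\<^sup>2 + 2 * A z * y z + B z = (y z - x z) * (y z - w z)"
    and dw: "3 * (w z)\<^sup>2 + 2 * A z * w z + B z = (w z - x z) * (w z - y z)" for z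
    by (simp_all add: A_def B_def algebra_simps power2_eq_square)
  have hx: "x holomorphic_on S"
    by (rule root_holomorphic[OF S c(1) coef])
       (use ne ne[THEN not_sym] in \<open>auto simp: dx, auto simp: A_def B_def C_def algebra_simps power2_eq_square power3_eq_cube\<close>)
  have hy: "y holomorphic_on S"
    by (rule root_holomorphic[OF S c(2) coef])
       (use ne ne[THEN not_sym] in \<open>auto simp: dy, auto simp: A_def B_def C_def algebra_simps power2_eq_square power3_eq_cube\<close>)
  have hw: "w holomorphic_on S"
    by (rule root_holomorphic[OF S c(3) coef])
       (use ne ne[THEN not_sym] in \<open>auto simp: dw, auto simp: A_def B_def C_def algebra_simps power2_eq_square power3_eq_cube\<close>)
  have "(\<lambda>z. (y z - x z) / (w z - x z)) holomorphic_on S" using ne by (intro holomorphic_intros hx hy hw) force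
  hence "(\<lambda>z. lam (\<tau> z)) holomorphic_on S"
    by (rule holomorphic_transform) (simp add: \<tau>(3) ratio_def Zz)
  thus ?thesis
    by (intro holomorphic_through_locally_injective[OF S \<tau>(1,2) UH_open lam_holo]) (use lam_deriv in auto)
qed

section \<open>Lifts of braids\<close>

text \<open>Coordinates on the universal covering of the ordered configuration space: m is the
  midpoint of z1 and z3, exp \<sigma> is z3 - z1, and lam \<tau> is the ratio.\<close>

definition Psi :: "complex \<times> complex \<times> complex \<Rightarrow> cplx3" where
  "Psi u = (case u of (\<tau>, \<sigma>, m) \<Rightarrow> (m - exp \<sigma> / 2, m + exp \<sigma> * (lam \<tau> - 1/2), m + exp \<sigma> / 2))"

text \<open>Gamma(2) acts on the first coordinate; k counts full turns of z3 - z1.\<close>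

definition deck :: "int \<Rightarrow> int \<Rightarrow> int \<Rightarrow> int \<Rightarrow> int \<Rightarrow> complex \<times> complex \<times> complex \<Rightarrow> complex \<times> complex \<times> complex" where
  "deck a b c d k u = (case u of (\<tau>, \<sigma>, m) \<Rightarrow> (mob a b c d \<tau>, \<sigma> + 2 * of_real pi * \<i> * of_int k, m))"

definition G2 :: "int \<Rightarrow> int \<Rightarrow> int \<Rightarrow> int \<Rightarrow> bool" where
  "G2 a b c d \<longleftrightarrow> even b \<and> even c \<and> a * d - b * c = 1"

lemma Psi_Conf3: "Im (fst u) > 0 \<Longrightarrow> Psi u \<in> Conf3"
  using lam_neq[of "fst u"] by (cases u) (auto simp: Psi_def Conf3_def algebra_simps)

lemma ratio_Psi: "ratio (Psi u) = lam (fst u)"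
proof -
  obtain \<tau> \<sigma> m where u: "u = (\<tau>, \<sigma>, m)" by (cases u)
  have "ratio (Psi u) = (exp \<sigma> * lam \<tau>) / exp \<sigma>" unfolding ratio_def Psi_def u by (simp add: algebra_simps)
  thus ?thesis by (simp add: u)
qed

lemma Psi_cont: "continuous_on (UH \<times> UNIV) Psi"
proof -
  have "continuous_on (UH \<times> UNIV) (\<lambda>u. lam (fst u))"
    by (rule continuous_on_compose2[OF holomorphic_on_imp_continuous_on[OF lam_holo]]) (auto intro: continuous_intros)
  thus ?thesis unfolding Psi_def[abs_def] case_prod_beta by (intro continuous_intros) auto
qed

lemma exp_2pi_int: "exp (2 * of_real pi * \<i> * of_int k) = 1"
  by (subst exp_eq_1) auto

lemma Psi_deck: "Im (fst u) > 0 \<Longrightarrow> G2 a b c d \<Longrightarrow> Psi (deck a b c d k u) = Psi u"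
  using lam_mob_six(1)[of "fst u" a d b c] by (cases u) (auto simp: Psi_def deck_def G2_def exp_add exp_2pi_int)

lemma deck_dom: "u \<in> UH \<times> UNIV \<Longrightarrow> G2 a b c d \<Longrightarrow> deck a b c d k u \<in> UH \<times> UNIV"
  using mob_Im(2)[OF _ det_real, of "fst u" a d b c] by (cases u) (auto simp: deck_def G2_def)

lemma deck_cont: "G2 a b c d \<Longrightarrow> continuous_on (UH \<times> UNIV) (deck a b c d k)"
proof -
  assume "G2 a b c d"
  hence "continuous_on (UH \<times> UNIV) (\<lambda>u::complex \<times> complex \<times> complex. mob a b c d (fst u))"
    by (intro continuous_on_compose2[OF mob_cont[OF det_real]] continuous_intros) (auto simp: G2_def)
  thus ?thesis unfolding deck_def[abs_def] case_prod_beta by (intro continuous_intros)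
qed

lemma deck_deck:
  "u \<in> UH \<times> UNIV \<Longrightarrow> G2 a' b' c' d' \<Longrightarrow>
     deck a b c d k (deck a' b' c' d' l u) = deck (a*a'+b*c') (a*b'+b*d') (c*a'+d*c') (c*b'+d*d') (k + l) u"
  using mob_mob[OF _ det_real, of "fst u" a' d' b' c' a b c d]
  by (cases u) (auto simp: deck_def G2_def algebra_simps)

lemma G2_mult: "G2 a b c d \<Longrightarrow> G2 a' b' c' d' \<Longrightarrow> G2 (a*a'+b*c') (a*b'+b*d') (c*a'+d*c') (c*b'+d*d')"
proof -
  assume g: "G2 a b c d" "G2 a' b' c' d'"
  have "(a*a'+b*c') * (c*b'+d*d') - (a*b'+b*d') * (c*a'+d*c') = (a*d - b*c) * (a'*d' - b'*c')" by (simp add: algebra_simps)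
  thus ?thesis using g by (simp add: G2_def)
qed

lemma path_deck:
  assumes P: "path P" "path_image P \<subseteq> UH \<times> UNIV" and g: "G2 a b c d"
  shows "path (deck a b c d k \<circ> P)" "path_image (deck a b c d k \<circ> P) \<subseteq> UH \<times> UNIV"
  using path_continuous_image[OF P(1) continuous_on_subset[OF deck_cont[OF g] P(2)]] P(2) deck_dom[OF _ g]
  by (auto simp: path_image_compose image_subset_iff)

section \<open>Monodromy of the generators\<close>

definition u0 :: "complex \<times> complex \<times> complex" where "u0 = (\<i>, of_real (ln 2), 0)"

lemma u0_dom: "u0 \<in> UH \<times> UNIV" by (simp add: u0_def)

lemma exp_ln2: "exp (complex_of_real (ln 2)) = 2" unfolding exp_of_real by simp

lemma Psi_u0: "Psi u0 = base3"
  by (simp add: u0_def Psi_def exp_ln2 lam_i base3_def)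

definition braid_lift :: "(real \<Rightarrow> cplx3) \<Rightarrow> int \<Rightarrow> int \<Rightarrow> int \<Rightarrow> int \<Rightarrow> int \<Rightarrow> bool" where
  "braid_lift p a b c d k \<longleftrightarrow> G2 a b c d \<and> (\<exists>P. path P \<and> path_image P \<subseteq> UH \<times> UNIV \<and> (\<forall>t\<in>{0..1}. Psi (P t) = p t) \<and>
     pathstart P = u0 \<and> pathfinish P = deck a b c d k u0)"

lemma braid_lift_const: "braid_lift (\<lambda>t. base3) 1 0 0 1 0"
  unfolding braid_lift_def
  by (intro conjI exI[of _ "\<lambda>t. u0"])
     (auto simp: G2_def Psi_u0 path_def path_image_def u0_dom pathstart_def pathfinish_def, auto simp: deck_def u0_def)

text \<open>The second lift is moved by the deck transformation of the first, so concatenation of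
  loops becomes matrix multiplication in the same order.\<close>

lemma braid_lift_join:
  assumes p: "braid_lift p a b c d k" and q: "braid_lift q a' b' c' d' l"
  shows "braid_lift (p +++ q) (a*a'+b*c') (a*b'+b*d') (c*a'+d*c') (c*b'+d*d') (k + l)"
proof -
  obtain P where P: "path P" "path_image P \<subseteq> UH \<times> UNIV" "\<And>t. t \<in> {0..1} \<Longrightarrow> Psi (P t) = p t" "pathstart P = u0" "pathfinish P = deck a b c d k u0"
    and g: "G2 a b c d" using p unfolding braid_lift_def by blast
  obtain Q where Q: "path Q" "path_image Q \<subseteq> UH \<times> UNIV" "\<And>t. t \<in> {0..1} \<Longrightarrow> Psi (Q t) = q t" "pathstart Q = u0" "pathfinish Q = deck a' b' c' d' l u0"
    and g': "G2 a' b' c' d'" using q unfolding braid_lift_def by blast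
  let ?Q = "deck a b c d k \<circ> Q"
  note dQ = path_deck[OF Q(1,2) g, of k]
  have st: "pathstart ?Q = pathfinish P" using P(5) Q(4) by (simp add: pathstart_compose)
  have "Psi ((P +++ ?Q) t) = (p +++ q) t" if "t \<in> {0..1}" for t
  proof (cases "t \<le> 1/2")
    case True thus ?thesis using that P(3)[of "2 * t"] by (simp add: joinpaths_def)
  next
    case False
    hence t: "2 * t - 1 \<in> {0..1}" using that by auto
    hence "Q (2 * t - 1) \<in> UH \<times> UNIV" using Q(2) by (auto simp: path_image_def)
    hence "Im (fst (Q (2 * t - 1))) > 0" by auto
    thus ?thesis using False Q(3)[OF t] Psi_deck[OF _ g] by (simp add: joinpaths_def)
  qed
  moreover have "pathfinish (P +++ ?Q) = deck (a*a'+b*c') (a*b'+b*d') (c*a'+d*c') (c*b'+d*d') (k + l) u0"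
    using deck_deck[OF u0_dom g'] Q(5) by (simp add: pathfinish_compose)
  moreover have "path_image (P +++ ?Q) \<subseteq> UH \<times> UNIV" using P(2) dQ(2) path_image_join_subset by blast
  ultimately show ?thesis unfolding braid_lift_def using G2_mult[OF g g'] P dQ st
    by (intro conjI exI[of _ "P +++ ?Q"]) auto
qed

lemma braid_lift_reverse:
  assumes p: "braid_lift p a b c d k"
  shows "braid_lift (reversepath p) d (-b) (-c) a (-k)"
proof -
  obtain P where P: "path P" "path_image P \<subseteq> UH \<times> UNIV" "\<And>t. t \<in> {0..1} \<Longrightarrow> Psi (P t) = p t" "pathstart P = u0" "pathfinish P = deck a b c d k u0"
    and g: "G2 a b c d" using p unfolding braid_lift_def by blast
  have g': "G2 d (-b) (-c) a" using g by (simp add: G2_def algebra_simps)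
  let ?P = "deck d (-b) (-c) a (-k) \<circ> reversepath P"
  have "path ?P" "path_image ?P \<subseteq> UH \<times> UNIV" using path_deck[OF _ _ g', of "reversepath P"] P by auto
  moreover have "Psi (?P t) = reversepath p t" if "t \<in> {0..1}" for t
  proof -
    have t: "1 - t \<in> {0..1}" using that by auto
    hence "P (1 - t) \<in> UH \<times> UNIV" using P(2) by (auto simp: path_image_def)
    hence "Im (fst (P (1 - t))) > 0" by auto
    thus ?thesis using P(3)[OF t] Psi_deck[OF _ g'] by (simp add: reversepath_def)
  qed
  moreover have "pathstart ?P = u0"
    using mob_inv(1)[OF _ det_real, of "\<i>" a d b c] g P(5) by (simp add: pathstart_compose deck_def u0_def G2_def)
  moreover have "pathfinish ?P = deck d (-b) (-c) a (-k) u0" using P(4) by (simp add: pathfinish_compose)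
  ultimately show ?thesis using g' unfolding braid_lift_def by (intro conjI exI[of _ ?P]) auto
qed

lemma braid_lift_start: "braid_lift p a b c d k \<Longrightarrow> p 0 = base3"
  unfolding braid_lift_def by (metis Psi_u0 atLeastAtMost_iff order_refl pathstart_def zero_le_one)

text \<open>Upper and lower triangular matrices are treated separately because their powers are
  explicit; the generators are of these two kinds.\<close>

lemma braid_lift_npow:
  "braid_lift p 1 x 0 1 k \<Longrightarrow> braid_lift (npow p n) 1 (int n * x) 0 1 (int n * k)"
  "braid_lift p 1 0 y 1 k \<Longrightarrow> braid_lift (npow p n) 1 0 (int n * y) 1 (int n * k)"
proof -
  show "braid_lift (npow p n) 1 (int n * x) 0 1 (int n * k)" if "braid_lift p 1 x 0 1 k"
  proof (induction n)
    case 0 thus ?case using braid_lift_const braid_lift_start[OF that] by simp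
  next
    case (Suc n) thus ?case using braid_lift_join[OF that Suc] by (simp add: algebra_simps)
  qed
  show "braid_lift (npow p n) 1 0 (int n * y) 1 (int n * k)" if "braid_lift p 1 0 y 1 k"
  proof (induction n)
    case 0 thus ?case using braid_lift_const braid_lift_start[OF that] by simp
  next
    case (Suc n) thus ?case using braid_lift_join[OF that Suc] by (simp add: algebra_simps)
  qed
qed

lemma braid_lift_ipow:
  "braid_lift p 1 x 0 1 k \<Longrightarrow> braid_lift (ipow p n) 1 (n * x) 0 1 (n * k)"
  "braid_lift p 1 0 y 1 k \<Longrightarrow> braid_lift (ipow p n) 1 0 (n * y) 1 (n * k)"
proof -
  show "braid_lift (ipow p n) 1 (n * x) 0 1 (n * k)" if p: "braid_lift p 1 x 0 1 k"
  proof (cases "n \<ge> 0")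
    case True thus ?thesis using braid_lift_npow(1)[OF p, of "nat n"] by (simp add: ipow_def)
  next
    case False thus ?thesis using braid_lift_npow(1)[of _ "-x" "-k" "nat (-n)"] braid_lift_reverse[OF p] by (simp add: ipow_def)
  qed
  show "braid_lift (ipow p n) 1 0 (n * y) 1 (n * k)" if p: "braid_lift p 1 0 y 1 k"
  proof (cases "n \<ge> 0")
    case True thus ?thesis using braid_lift_npow(2)[OF p, of "nat n"] by (simp add: ipow_def)
  next
    case False thus ?thesis using braid_lift_npow(2)[of _ "-y" "-k" "nat (-n)"] braid_lift_reverse[OF p] by (simp add: ipow_def)
  qed
qed

text \<open>For the first generator \<tau> follows \<open>loop0_lift\<close>, while \<sigma> and m
  are read off from z1 and z3. The second generator is the first one under z \<mapsto> -z with the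
  order reversed; this replaces the ratio by 1 minus the ratio, hence \<tau> by -1 / \<tau>.\<close>

lemma braid_lift_gens:
  "braid_lift (gen_loop 1) 1 2 0 1 0" "g \<noteq> 1 \<Longrightarrow> braid_lift (gen_loop g) 1 0 (-2) 1 0"
proof -
  obtain P where P: "path P" "path_image P \<subseteq> UH" "pathstart P = \<i>" "pathfinish P = \<i> + 2"
    "\<And>t. t \<in> {0..1} \<Longrightarrow> lam (P t) = loop0 t" using loop0_lift by blast
  define e where "e = (\<lambda>t::real. exp (2 * of_real pi * \<i> * of_real t))"
  have n: "norm (e t) = 1" for t by (simp add: e_def)
  have Re_e: "Re (3 / 2 + e t / 2) > 0" for t
    using abs_Re_le_cmod[of "e t"] by (simp add: n)
  hence w0: "3 / 2 + e t / 2 \<noteq> 0" for t by (metis less_irrefl zero_complex.sel(1))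
  have e3: "3 + e t \<noteq> 0" for t using w0[of t] by (auto simp: field_simps)
  have l0: "loop0 t = 2 * e t / (3 + e t)" for t by (simp add: loop0_def e_def)
  define s where "s = (\<lambda>t. Ln (3 / 2 + e t / 2))"
  have es: "exp (s t) = 3 / 2 + e t / 2" for t using w0 by (simp add: s_def)
  have ec: "continuous_on A e" for A unfolding e_def by (intro continuous_intros)
  have sc: "continuous_on A s" for A unfolding s_def
    by (intro continuous_intros ec) (use Re_e in \<open>auto simp: complex_nonpos_Reals_iff not_le\<close>)
  have PU: "Im (P t) > 0" if "t \<in> {0..1}" for t using P(2) that by (auto simp: path_image_def image_subset_iff)
  have e01: "e 0 = 1" "e 1 = 1" using exp_2pi_int[of 1] by (simp_all add: e_def)
  have s01: "s 0 = of_real (ln 2)" "s 1 = of_real (ln 2)" using Ln_of_real[of 2] by (simp_all add: s_def e01)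
  have Pc: "continuous_on {0..1} P" using P(1) by (simp add: path_def)
  have ab: "exp (s t) * (loop0 t - 1/2) = e t - (3 / 2 + e t / 2) / 2" for t
  proof -
    have "(3 / 2 + e t / 2) * loop0 t = ((3 + e t) * (e t / (3 + e t)))" unfolding l0 by (simp add: add_divide_distrib algebra_simps)
    also have "\<dots> = e t" using e3[of t] by simp
    finally show ?thesis unfolding es right_diff_distrib by simp
  qed
  note ab' = ab[unfolded es]
  have ee: "exp (2 * pi * \<i> * t) = e t" for t by (simp add: e_def)
  define P1 where "P1 = (\<lambda>t. (P t, s t, 1 / 4 - e t / 4))"
  have "path P1" unfolding P1_def path_def by (intro continuous_intros Pc sc ec) auto
  moreover have "path_image P1 \<subseteq> UH \<times> UNIV" using PU by (auto simp: P1_def path_image_def)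
  moreover have "Psi (P1 t) = gen_loop 1 t" if "t \<in> {0..1}" for t
    unfolding Psi_def P1_def gen_loop_def prod.case P(5)[OF that] es ab' ee by (simp add: field_simps)
  moreover have "pathstart P1 = u0" "pathfinish P1 = deck 1 2 0 1 0 u0"
    using P(3,4) by (simp_all add: P1_def pathstart_def pathfinish_def u0_def deck_def mob_def e01 s01)
  ultimately show "braid_lift (gen_loop 1) 1 2 0 1 0"
    unfolding braid_lift_def by (intro conjI exI[of _ P1]) (auto simp: G2_def)
  assume g: "g \<noteq> 1"
  define P2 where "P2 = (\<lambda>t. (- 1 / P t, s t, - 1 / 4 + e t / 4))"
  have P0: "P t \<noteq> 0" if "t \<in> {0..1}" for t using PU[OF that] by auto
  have "path P2" unfolding P2_def path_def by (intro continuous_intros Pc sc ec) (use P0 in auto)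
  moreover have "Im (- 1 / P t) > 0" if "t \<in> {0..1}" for t
    using PU[OF that] mob_Im(2)[of "P t" 0 0 "-1" 1] by (simp add: mob_def)
  hence "path_image P2 \<subseteq> UH \<times> UNIV" by (auto simp: P2_def path_image_def)
  moreover have "Psi (P2 t) = gen_loop g t" if "t \<in> {0..1}" for t
  proof -
    have "lam (- 1 / P t) - 1/2 = - (loop0 t - 1/2)" using lam_S[OF PU[OF that]] P(5)[OF that] by simp
    hence x: "exp (s t) * (lam (- 1 / P t) - 1/2) = - (e t - (3 / 2 + e t / 2) / 2)"
      using ab[of t] by (simp only: mult_minus_right)
    show ?thesis unfolding Psi_def P2_def gen_loop_def prod.case es x[unfolded es] ee using g by (simp add: field_simps)
  qed
  moreover have "- 1 / (\<i> + 2) = mob 1 0 (- 2) 1 \<i>"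
    by (simp add: mob_def complex_eq_iff Re_divide Im_divide)
  hence "pathstart P2 = u0" "pathfinish P2 = deck 1 0 (-2) 1 0 u0"
    using P(3,4) by (simp_all add: P2_def pathstart_def pathfinish_def u0_def deck_def e01 s01)
  ultimately show "braid_lift (gen_loop g) 1 0 (-2) 1 0"
    unfolding braid_lift_def by (intro conjI exI[of _ P2]) (auto simp: G2_def)
qed

text \<open>A rotation of the whole triple keeps the ratio, so \<tau> rests at i and only \<sigma>
  moves, by 2 pi i.\<close>

lemma braid_lift_delta2: "braid_lift delta2 1 0 0 1 1"
proof -
  define P where "P = (\<lambda>t::real. (\<i>, complex_of_real (ln 2) + 2 * of_real pi * \<i> * of_real t, 0::complex))"
  have "path P" unfolding P_def path_def by (intro continuous_intros)
  moreover have "Psi (P t) = delta2 t" for t by (simp add: Psi_def P_def exp_add exp_ln2 lam_i delta2_def)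
  ultimately show ?thesis unfolding braid_lift_def
    by (intro conjI exI[of _ P]) (auto simp: G2_def path_image_def P_def pathstart_def pathfinish_def u0_def deck_def)
qed

lemma braid_lift_word: "mat w = (a, b, c, d) \<Longrightarrow> braid_lift (word_loop w) a b c d 0"
proof (induction w arbitrary: a b c d)
  case Nil thus ?case using braid_lift_const by simp
next
  case (Cons x w)
  obtain g n where x: "x = (g, n)" by (cases x)
  obtain a' b' c' d' where m: "mat w = (a', b', c', d')" by (cases "mat w")
  show ?case
  proof (cases "g = 1")
    case True
    show ?thesis using Cons.prems braid_lift_join[OF braid_lift_ipow(1)[OF braid_lift_gens(1), of n] Cons.IH[OF m]]
      by (auto simp: x m True algebra_simps)
  next
    case False
    show ?thesis using False Cons.prems braid_lift_join[OF braid_lift_ipow(2)[OF braid_lift_gens(2)[OF False], of n] Cons.IH[OF m]]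
      by (auto simp: x m algebra_simps split: if_splits)
  qed
qed

section \<open>Arcs in the symmetrized space\<close>

text \<open>The start has \<tau> = i, where \<open>gtr\<close> and \<open>gpb\<close> cross; the two
  end sets differ in s, the logarithm of z3 - z1 at the start.\<close>

definition arc_lift :: "(real \<Rightarrow> cplx3) \<Rightarrow> complex \<Rightarrow> int \<Rightarrow> int \<Rightarrow> int \<Rightarrow> int \<Rightarrow> int \<Rightarrow> bool" where
  "arc_lift \<beta> s a b c d k \<longleftrightarrow> G2 a b c d \<and> (\<exists>P. path P \<and> path_image P \<subseteq> UH \<times> UNIV \<and> (\<forall>t\<in>{0..1}. vieta (Psi (P t)) = \<beta> t) \<and>
     pathstart P = (\<i>, s, 0) \<and> pathfinish P = deck a b c d k (\<i>, s, 0))"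

lemma braid_lift_total:
  assumes "mat w = (a, b, c, d)" shows "braid_lift (word_loop w +++ ipow delta2 k) a b c d k"
  using braid_lift_join[OF braid_lift_word[OF assms] braid_lift_ipow(1)[OF braid_lift_delta2, of k]] by simp

lemma arc_lift_tr:
  assumes "mat w = (a, b, c, d)" shows "arc_lift (braid_arc_tr w k) (of_real (ln 2)) a b c d k"
  using braid_lift_total[OF assms, of k] unfolding arc_lift_def braid_lift_def braid_arc_tr_def u0_def by auto

text \<open>The quarter rotation moves only \<sigma>, from log 2 to log 2 + i pi / 2. It commutes
  with the deck transformations, so transport along it changes neither the matrix nor k.\<close>

lemma arc_lift_pb:
  assumes "mat w = (a, b, c, d)" shows "arc_lift (braid_arc_pb w k) (of_real (ln 2) + \<i> * of_real (pi / 2)) a b c d k"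
proof -
  obtain P where P: "path P" "path_image P \<subseteq> UH \<times> UNIV" "\<And>t. t \<in> {0..1} \<Longrightarrow> vieta (Psi (P t)) = braid_arc_tr w k t"
    "pathstart P = u0" "pathfinish P = deck a b c d k u0" and g: "G2 a b c d"
    using arc_lift_tr[OF assms, of k] unfolding arc_lift_def u0_def by blast
  define R where "R = (\<lambda>t::real. (\<i>, complex_of_real (ln 2) + \<i> * of_real (pi * t / 2), 0::complex))"
  have R: "path R" "path_image R \<subseteq> UH \<times> UNIV" "pathstart R = u0" "pathfinish R = (\<i>, of_real (ln 2) + \<i> * of_real (pi / 2), 0)"
    unfolding R_def path_def by (intro continuous_intros) (auto simp: path_image_def pathstart_def pathfinish_def u0_def)
  have PR: "Psi (R t) = (- exp (pi * \<i> * t / 2), 0, exp (pi * \<i> * t / 2))" for t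
    by (simp add: Psi_def R_def exp_add exp_ln2 lam_i mult_ac)
  hence rho: "vieta (Psi (R t)) = rho t" for t by (simp add: rho_def)
  let ?D = "deck a b c d k \<circ> R"
  note D = path_deck[OF R(1,2) g, of k]
  have rhoD: "vieta (Psi (?D t)) = rho t" for t
    using Psi_deck[OF _ g, of "R t" k] rho[of t] by (simp add: R_def)
  define S where "S = reversepath R +++ (P +++ ?D)"
  have st: "pathstart ?D = pathfinish P" by (simp add: pathstart_compose R P)
  have "path S" unfolding S_def using R P D st by simp
  moreover have "path_image S \<subseteq> UH \<times> UNIV" unfolding S_def using R(2) P(2) D(2)
    by (intro subset_path_image_join) (simp_all add: subset_path_image_join)
  moreover have "vieta (Psi (S t)) = braid_arc_pb w k t" if "t \<in> {0..1}" for t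
    unfolding S_def braid_arc_pb_def joinpaths_def reversepath_def using that rho rhoD P(3) by auto
  moreover have "pathstart S = (\<i>, of_real (ln 2) + \<i> * of_real (pi / 2), 0)" "pathfinish S = deck a b c d k (\<i>, of_real (ln 2) + \<i> * of_real (pi / 2), 0)"
    unfolding S_def using R by (simp_all add: pathfinish_compose)
  ultimately show ?thesis unfolding arc_lift_def using g by (intro conjI exI[of _ S]) auto
qed

section \<open>End sets and admissible maps\<close>

text \<open>\<open>R\<close> is one sheet of the preimage of the end set \<open>E\<close> in the ordered configuration space: configurations
  cannot leave it while staying over \<open>E\<close>, and \<open>C\<close> is the corresponding geodesic in the half plane.\<close>

definition end_sheet :: "cplx3 set \<Rightarrow> cplx3 set \<Rightarrow> complex set \<Rightarrow> complex set \<Rightarrow> complex \<Rightarrow> bool" where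
  "end_sheet E R C J s \<longleftrightarrow> lam_sheet C J \<and> path_connected C \<and> \<i> \<in> C \<and> (\<forall>Z\<in>R. ratio Z \<in> J \<and> vieta Z \<in> E) \<and>
     (\<forall>\<tau>\<in>C. \<forall>\<sigma> m. Im \<sigma> = Im s \<longrightarrow> Im m = 0 \<longrightarrow> Psi (\<tau>, \<sigma>, m) \<in> R) \<and>
     (\<forall>K (g :: real \<Rightarrow> cplx3) k0 k. connected K \<longrightarrow> continuous_on K g \<longrightarrow> (\<forall>k\<in>K. g k \<in> Conf3 \<and> vieta (g k) \<in> E) \<longrightarrow>
        k0 \<in> K \<longrightarrow> k \<in> K \<longrightarrow> g k0 \<in> R \<longrightarrow> g k \<in> R)"

lemma connected_between:
  fixes \<phi> :: "real \<Rightarrow> real"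
  assumes K: "connected K" "k0 \<in> K" "k \<in> K" and c: "continuous_on K \<phi>" and av: "\<And>k. k \<in> K \<Longrightarrow> \<phi> k \<noteq> l" "\<And>k. k \<in> K \<Longrightarrow> \<phi> k \<noteq> u"
    and 0: "l < \<phi> k0" "\<phi> k0 < u"
  shows "l < \<phi> k \<and> \<phi> k < u"
proof -
  have iv: "is_interval (\<phi> ` K)" using connected_continuous_image[OF c K(1)] by (simp add: is_interval_connected_1)
  have m: "\<phi> k \<in> \<phi> ` K" "\<phi> k0 \<in> \<phi> ` K" "l \<notin> \<phi> ` K" "u \<notin> \<phi> ` K" using K av by auto
  have "\<not> \<phi> k \<le> l" using mem_is_interval_1_I[OF iv m(1,2), of l] m(3) 0 by auto
  moreover have "\<not> u \<le> \<phi> k" using mem_is_interval_1_I[OF iv m(2,1), of u] m(4) 0 by auto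
  ultimately show ?thesis by simp
qed

lemma E_tr_real:
  assumes Z: "Z \<in> Conf3" "vieta Z \<in> E_tr" and d: "Z = (x, y, z)"
  shows "Im x = 0 \<and> Im y = 0 \<and> Im z = 0"
proof -
  obtain p q r where w: "vieta Z = vieta (p, q, r)" "Im p = 0" "Im q = 0" "Im r = 0" using Z(2) by (auto simp: E_tr_def)
  obtain \<pi> where "\<pi> \<in> perms3" "Z = \<pi> (p, q, r)" using vieta_eqD[OF w(1) Z(1)] by blast
  thus ?thesis using w(2-4) d by (auto simp: perms3_def)
qed

text \<open>Exactly one of the three points is real. The second part expresses by closed conditions
  both that it is y and that it is one of x, z, as needed for a connectedness argument.\<close>

lemma E_pb_shape:
  assumes Z: "Z \<in> Conf3" "vieta Z \<in> E_pb" and d: "Z = (x, y, z)"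
  shows "(Im y = 0 \<longrightarrow> z = cnj x) \<and> (Im y = 0 \<longleftrightarrow> Im x \<noteq> 0 \<and> Im z \<noteq> 0)"
proof -
  obtain p q where w: "vieta Z = vieta (p, q, cnj q)" "Im p = 0" "Im q \<noteq> 0" using Z(2) by (auto simp: E_pb_def)
  obtain \<pi> where "\<pi> \<in> perms3" "Z = \<pi> (p, q, cnj q)" using vieta_eqD[OF w(1) Z(1)] by blast
  thus ?thesis using w(2-3) d by (auto simp: perms3_def)
qed

text \<open>Over \<open>E_tr\<close> the ratio is real and avoids 0 and 1, so along a connected set
  it cannot leave (0, 1): the middle point stays in the middle.\<close>

lemma end_sheet_tr:
  "end_sheet E_tr {(x, y, z) |x y z. (x, y, z) \<in> Conf3 \<and> Im x = 0 \<and> Im y = 0 \<and> Im z = 0 \<and> 0 < Re (ratio (x, y, z)) \<and> Re (ratio (x, y, z)) < 1}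
     gtr {x. Im x = 0 \<and> 0 < Re x \<and> Re x < 1} (of_real (ln 2))"
  (is "end_sheet _ ?R _ ?J _")
  unfolding end_sheet_def
proof (intro conjI allI impI ballI)
  have real: "Im (ratio (x, y, z)) = 0" if "Im x = 0" "Im y = 0" "Im z = 0" for x y z
    using that by (simp add: ratio_def Im_divide)
  show "lam_sheet gtr ?J" by (rule lam_sheet_gtr)
  show "path_connected gtr" by (rule convex_imp_path_connected[OF gtr_convex])
  show "\<i> \<in> gtr" by (simp add: gtr_def)
  show "ratio Z \<in> ?J" if "Z \<in> ?R" for Z using that real by auto
  show "vieta Z \<in> E_tr" if "Z \<in> ?R" for Z using that unfolding E_tr_def by blast
  show "Psi (\<tau>, \<sigma>, m) \<in> ?R" if "\<tau> \<in> gtr" "Im \<sigma> = Im (of_real (ln 2))" "Im m = 0" for \<tau> \<sigma> m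
  proof -
    have c: "Psi (\<tau>, \<sigma>, m) \<in> Conf3" by (rule Psi_Conf3) (use that in \<open>simp add: gtr_def\<close>)
    have r: "ratio (Psi (\<tau>, \<sigma>, m)) = lam \<tau>" by (simp add: ratio_Psi)
    have "Im (exp \<sigma>) = 0" using that(2) by (simp add: Im_exp)
    thus ?thesis using c r lam_gtr[OF that(1)] that(3) by (simp add: Psi_def)
  qed
  fix K k0 k and g :: "real \<Rightarrow> cplx3"
  assume K: "connected K" "continuous_on K g" "\<forall>k\<in>K. g k \<in> Conf3 \<and> vieta (g k) \<in> E_tr" "k0 \<in> K" "k \<in> K" "g k0 \<in> ?R"
  have rl: "Im (ratio (g k)) = 0" if "k \<in> K" for k
  proof -
    obtain x y z where d: "g k = (x, y, z)" by (cases "g k")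
    show ?thesis using E_tr_real[OF _ _ d] K(3) that real d by auto
  qed
  have "continuous_on K (\<lambda>k. Re (ratio (g k)))"
    by (intro continuous_intros continuous_on_compose2[OF ratio_cont K(2)]) (use K(3) in auto)
  moreover have "Re (ratio (g k)) \<noteq> 0" "Re (ratio (g k)) \<noteq> 1" if "k \<in> K" for k
    using ratio_range[of "g k"] rl[OF that] K(3) that by (auto simp: complex_eq_iff)
  ultimately have "0 < Re (ratio (g k)) \<and> Re (ratio (g k)) < 1"
    using connected_between[of K k0 k "\<lambda>k. Re (ratio (g k))" 0 1] K by auto
  moreover obtain x y z where d: "g k = (x, y, z)" by (cases "g k")
  moreover have "g k \<in> Conf3" "vieta (g k) \<in> E_tr" using K by auto
  ultimately show "g k \<in> ?R" using E_tr_real[OF _ _ d] by simp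
qed

text \<open>The sheet records that the second coordinate is the real one; by
  \<open>E_pb_shape\<close> this condition is both closed and open along a connected set.\<close>

lemma end_sheet_pb:
  "end_sheet E_pb {(x, y, cnj x) |x y. (x, y, cnj x) \<in> Conf3 \<and> Im y = 0}
     gpb {x. Re x = 1/2} (of_real (ln 2) + \<i> * of_real (pi / 2))"
  (is "end_sheet _ ?R _ ?J _")
  unfolding end_sheet_def
proof (intro conjI allI impI ballI)
  have im: "Im x \<noteq> 0" if "(x, y, cnj x) \<in> Conf3" for x y using that by (auto simp: Conf3_def complex_eq_iff)
  show "lam_sheet gpb ?J" by (rule lam_sheet_gpb)
  show "path_connected gpb" by (rule gpb_path_connected)
  show "\<i> \<in> gpb" by (simp add: gpb_def)
  show "ratio Z \<in> ?J" if ZR: "Z \<in> ?R" for Z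
  proof -
    obtain x y where Z: "Z = (x, y, cnj x)" "Im x \<noteq> 0" "Im y = 0" using ZR im by blast
    thus ?thesis by (simp add: ratio_def Re_divide field_simps power2_eq_square)
  qed
  show "vieta Z \<in> E_pb" if ZR: "Z \<in> ?R" for Z
  proof -
    obtain x y where Z: "Z = (x, y, cnj x)" "Im x \<noteq> 0" "Im y = 0" using ZR im by blast
    have "vieta Z = vieta (y, x, cnj x)" by (simp add: vieta_def Z algebra_simps)
    thus ?thesis using Z unfolding E_pb_def by blast
  qed
  show "Psi (\<tau>, \<sigma>, m) \<in> ?R" if "\<tau> \<in> gpb" "Im \<sigma> = Im (of_real (ln 2) + \<i> * of_real (pi / 2))" "Im m = 0" for \<tau> \<sigma> m
  proof -
    have c: "Psi (\<tau>, \<sigma>, m) \<in> Conf3" by (rule Psi_Conf3) (use that in \<open>simp add: gpb_def\<close>)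
    have s: "Im \<sigma> = pi / 2" using that(2) by simp
    have e: "exp \<sigma> = \<i> * of_real (exp (Re \<sigma>))" by (simp add: complex_eq_iff Re_exp Im_exp s)
    have "m + exp \<sigma> / 2 = cnj (m - exp \<sigma> / 2)" unfolding e using that(3) by (simp add: complex_eq_iff)
    moreover have "Im (m + exp \<sigma> * (lam \<tau> - 1/2)) = 0" unfolding e using that(3) lam_gpb[OF that(1)] by simp
    ultimately show ?thesis using c unfolding Psi_def by auto
  qed
  fix K k0 k and g :: "real \<Rightarrow> cplx3"
  assume K: "connected K" "continuous_on K g" "\<forall>k\<in>K. g k \<in> Conf3 \<and> vieta (g k) \<in> E_pb" "k0 \<in> K" "k \<in> K" "g k0 \<in> ?R"
  define x y z where "x = (\<lambda>k. fst (g k))" and "y = (\<lambda>k. fst (snd (g k)))" and "z = (\<lambda>k. snd (snd (g k)))"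
  have gk: "g k = (x k, y k, z k)" for k by (simp add: x_def y_def z_def)
  have shape: "(Im (y k) = 0 \<longrightarrow> z k = cnj (x k)) \<and> (Im (y k) = 0 \<longleftrightarrow> Im (x k) \<noteq> 0 \<and> Im (z k) \<noteq> 0)" if "k \<in> K" for k
    using E_pb_shape[OF _ _ gk[of k]] K(3) that by blast
  have c: "continuous_on K (\<lambda>k. Im (y k))" "continuous_on K (\<lambda>k. Im (x k) * Im (z k))"
    unfolding x_def y_def z_def by (intro continuous_intros K(2))+
  have A: "closedin (top_of_set K) (K \<inter> (\<lambda>k. Im (y k)) -` {0})" and B: "closedin (top_of_set K) (K \<inter> (\<lambda>k. Im (x k) * Im (z k)) -` {0})"
    by (intro continuous_closedin_preimage c closed_singleton)+
  have Eq: "K \<inter> (\<lambda>k. Im (x k) * Im (z k)) -` {0} = K - (K \<inter> (\<lambda>k. Im (y k)) -` {0})"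
  proof (rule set_eqI)
    fix q show "q \<in> K \<inter> (\<lambda>k. Im (x k) * Im (z k)) -` {0} \<longleftrightarrow> q \<in> K - (K \<inter> (\<lambda>k. Im (y k)) -` {0})"
      using shape[of q, THEN conjunct2] by auto
  qed
  have "openin (top_of_set K) (K \<inter> (\<lambda>k. Im (y k)) -` {0})"
    unfolding openin_closedin_eq topspace_euclidean_subtopology using B[unfolded Eq] by (intro conjI Int_lower1)
  hence "K \<inter> (\<lambda>k. Im (y k)) -` {0} = {} \<or> K \<inter> (\<lambda>k. Im (y k)) -` {0} = K"
    using A K(1) unfolding connected_clopen by blast
  moreover have "k0 \<in> K \<inter> (\<lambda>k. Im (y k)) -` {0}" using K(4,6) unfolding gk by auto
  ultimately have y0: "Im (y k) = 0" using K(5) by blast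
  thus "g k \<in> ?R" using shape[OF K(5)] K(3,5) unfolding gk by auto
qed

lemma end_sheet_stay:
  fixes Z :: "real \<Rightarrow> cplx3"
  assumes R: "end_sheet E R C J s" and g: "G2 a b c d" and K: "connected K" "k0 \<in> K" "k \<in> K"
    and Z: "continuous_on K Z" "Z ` K \<subseteq> Conf3" "\<And>k. k \<in> K \<Longrightarrow> vieta (Z k) \<in> E"
    and \<tau>: "continuous_on K \<tau>" "\<tau> ` K \<subseteq> UH" "\<And>k. k \<in> K \<Longrightarrow> lam (\<tau> k) = ratio (Z k)"
    and k0: "Z k0 \<in> R" "\<tau> k0 \<in> mob a b c d ` C"
  shows "Z k \<in> R \<and> \<tau> k \<in> mob a b c d ` C"
proof -
  have ZC: "\<forall>k\<in>K. Z k \<in> Conf3 \<and> vieta (Z k) \<in> E" using Z by auto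
  have ZR: "Z k \<in> R" if "k \<in> K" for k
    using R[unfolded end_sheet_def, THEN conjunct2, THEN conjunct2, THEN conjunct2, THEN conjunct2, THEN conjunct2, rule_format, of K Z k0 k]
      K(1,2) Z(1) ZC k0(1) that by simp
  have "\<tau> k \<in> mob a b c d ` C"
    by (rule lam_sheet_stay[of C J b c a d K k0 k \<tau>]) (use R g K \<tau> k0 ZR in \<open>auto simp: end_sheet_def G2_def\<close>)
  thus ?thesis using ZR K by blast
qed

section \<open>Between admissible maps and rectangles in the half plane\<close>

lemma segment_bounds:
  fixes t :: real
  assumes "y0 \<le> y1" "0 \<le> t" "t \<le> 1"
  shows "y0 \<le> y0 + t * (y1 - y0)" "y0 + t * (y1 - y0) \<le> y1"
proof -
  have "y1 - (y0 + t * (y1 - y0)) = (1 - t) * (y1 - y0)" by (simp add: algebra_simps)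
  also have "\<dots> \<ge> 0" using assms by (intro mult_nonneg_nonneg) auto
  finally show "y0 + t * (y1 - y0) \<le> y1" by simp
  show "y0 \<le> y0 + t * (y1 - y0)" using assms by simp
qed

lemma continuous_on_vertical:
  assumes "continuous_on (cbox (Complex x0 y0) (Complex x1 y1)) f"
  shows "x0 \<le> x \<Longrightarrow> x \<le> x1 \<Longrightarrow> y0 \<le> y1 \<Longrightarrow> continuous_on {0..1} (\<lambda>t. f (Complex x (y0 + t * (y1 - y0))))"
    "y0 \<le> y \<Longrightarrow> y \<le> y1 \<Longrightarrow> continuous_on {x0<..<x1} (\<lambda>x. f (Complex x y))"
proof -
  show "continuous_on {0..1} (\<lambda>t. f (Complex x (y0 + t * (y1 - y0))))" if x: "x0 \<le> x" "x \<le> x1" "y0 \<le> y1"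
  proof (rule continuous_on_compose2[OF assms])
    show "continuous_on {0..1} (\<lambda>t. Complex x (y0 + t * (y1 - y0)))" unfolding Complex_eq by (intro continuous_intros)
    show "(\<lambda>t. Complex x (y0 + t * (y1 - y0))) ` {0..1} \<subseteq> cbox (Complex x0 y0) (Complex x1 y1)"
      using x segment_bounds[of y0 y1] by (auto simp: in_cbox_complex_iff)
  qed
  show "continuous_on {x0<..<x1} (\<lambda>x. f (Complex x y))" if "y0 \<le> y" "y \<le> y1"
  proof (rule continuous_on_compose2[OF assms])
    show "continuous_on {x0<..<x1} (\<lambda>x. Complex x y)" unfolding Complex_eq by (intro continuous_intros)
    show "(\<lambda>x. Complex x y) ` {x0<..<x1} \<subseteq> cbox (Complex x0 y0) (Complex x1 y1)"
      using that by (auto simp: in_cbox_complex_iff)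
  qed
qed

text \<open>The homotopy is lifted from its edge over \<beta>, where a lift is known, and followed
  to the edge over the middle vertical segment of the rectangle; f itself is then lifted from the
  foot of that segment. Wherever an endpoint moves inside E, \<open>end_sheet_stay\<close> holds its
  lift on the geodesic or its translate.\<close>

lemma arc_rect_of_admissible:
  assumes R: "end_sheet E R C J s" and \<beta>: "arc_lift \<beta> s a b c d k" and f: "admissible E \<beta> x0 x1 y0 y1 f"
  shows "\<exists>F. arc_rect C (mob a b c d ` C) x0 x1 y0 y1 F"
proof -
  obtain P where P: "path P" "path_image P \<subseteq> UH \<times> UNIV" "\<And>t. t \<in> {0..1} \<Longrightarrow> vieta (Psi (P t)) = \<beta> t"
    "P 0 = (\<i>, s, 0)" "P 1 = deck a b c d k (\<i>, s, 0)" and g: "G2 a b c d"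
    using \<beta> unfolding arc_lift_def pathstart_def pathfinish_def by blast
  have g1: "G2 1 0 0 1" by (simp add: G2_def)
  let ?B = "cbox (Complex x0 y0) (Complex x1 y1)"
  note f = f[unfolded admissible_def]
  have xy: "x0 < x1" "y0 < y1" using f by auto
  define x where "x = (x0 + x1) / 2"
  have x: "x0 < x" "x < x1" using xy by (auto simp: x_def)
  define v where "v = (\<lambda>t. Complex x (y0 + t * (y1 - y0)))"
  have v01: "v 0 = Complex x y0" "v 1 = Complex x y1" by (simp_all add: v_def)
  have vB: "v t \<in> ?B" if "t \<in> {0..1}" for t
    using that x xy segment_bounds[of y0 y1 t] by (simp add: v_def in_cbox_complex_iff)
  let ?I = "{0..1::real}"
  obtain H where H: "continuous_on (?I \<times> ?I) H" "H ` (?I \<times> ?I) \<subseteq> SymConf3"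
    "\<And>t. t \<in> ?I \<Longrightarrow> H (0, t) = f (v t)" "\<And>t. t \<in> ?I \<Longrightarrow> H (1, t) = \<beta> t"
    "\<And>s. s \<in> ?I \<Longrightarrow> H (s, 0) \<in> E \<and> H (s, 1) \<in> E"
    using f x unfolding relhomotopic_def v_def by (metis greaterThanLessThan_iff)
  have R0: "Psi (\<i>, s, 0) \<in> R" and iC: "\<i> \<in> C" using R by (auto simp: end_sheet_def)
  have c0: "Psi (\<i>, s, 0) \<in> Conf3" by (rule Psi_Conf3) simp
  have "vieta (Psi (\<i>, s, 0)) = H (1, 0)" using P(3)[of 0] H(4)[of 0] by (simp add: P(4))
  then obtain Z \<tau> where Z: "continuous_on (?I \<times> ?I) Z" "Z ` (?I \<times> ?I) \<subseteq> Conf3" "\<And>k. k \<in> ?I \<times> ?I \<Longrightarrow> vieta (Z k) = H k"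
    "Z (1, 0) = Psi (\<i>, s, 0)" "continuous_on (?I \<times> ?I) \<tau>" "\<tau> ` (?I \<times> ?I) \<subseteq> UH"
    "\<And>k. k \<in> ?I \<times> ?I \<Longrightarrow> lam (\<tau> k) = ratio (Z k)" "\<tau> (1, 0) = \<i>"
    using config_lift[of "?I \<times> ?I" "(1, 0)" H "Psi (\<i>, s, 0)" \<i>] H(1,2) c0
    by (simp add: convex_Times ratio_Psi) blast
  have sec: "continuous_on ?I (\<lambda>t. Z (u, t))" "continuous_on ?I (\<lambda>t. \<tau> (u, t))"
    "continuous_on ?I (\<lambda>t. Z (t, u))" "continuous_on ?I (\<lambda>t. \<tau> (t, u))" if "u \<in> ?I" for u
    using that by (auto intro!: continuous_on_compose2[OF Z(1)] continuous_on_compose2[OF Z(5)] continuous_intros)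
  have Psi_sec: "continuous_on ?I (\<lambda>t. Psi (P t))" "continuous_on ?I (\<lambda>t. fst (P t))"
    using P(1,2) by (auto intro!: continuous_on_compose2[OF Psi_cont] continuous_intros simp: path_def path_image_def)
  have PU: "Im (fst (P t)) > 0" if "t \<in> ?I" for t using P(2) that by (auto simp: path_image_def image_subset_iff mem_Times_iff)
  \<comment> \<open>By uniqueness of lifts the edge over \<beta> carries the given lift, so its
    upper corner is the deck transform of the start.\<close>
  have e1: "Z (1, 1) = Psi (P 1) \<and> \<tau> (1, 1) = fst (P 1)"
  proof (rule config_lift_unique[of ?I 0 1 "\<lambda>t. Z (1, t)" "\<lambda>t. \<tau> (1, t)" "\<lambda>t. Psi (P t)" "\<lambda>t. fst (P t)"])
    show "vieta (Z (1, t)) = vieta (Psi (P t))" if "t \<in> ?I" for t using that Z(3) H(4) P(3) by simp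
  qed (use sec[of 1] Psi_sec Z PU P(4) in \<open>auto simp: ratio_Psi Psi_Conf3 image_subset_iff\<close>)
  have Z11: "Z (1, 1) \<in> R" using e1 R0 Psi_deck[OF _ g, of "(\<i>, s, 0)" k] by (simp add: P(5))
  have t11: "\<tau> (1, 1) \<in> mob a b c d ` C" using e1 iC by (simp add: P(5) deck_def)
  \<comment> \<open>The identity matrix stands for the untranslated geodesic, so that
    \<open>end_sheet_stay\<close> serves bottom and top alike.\<close>
  have bot: "Z (0, 0) \<in> R \<and> \<tau> (0, 0) \<in> mob (of_int 1) (of_int 0) (of_int 0) (of_int 1) ` C"
    by (rule end_sheet_stay[OF R g1, of ?I 1 0 "\<lambda>u. Z (u, 0)" "\<lambda>u. \<tau> (u, 0)"])
       (use sec[of 0] Z H(5) R0 iC in \<open>auto simp: image_subset_iff\<close>)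
  have top: "Z (0, 1) \<in> R \<and> \<tau> (0, 1) \<in> mob a b c d ` C"
    by (rule end_sheet_stay[OF R g, of ?I 1 0 "\<lambda>u. Z (u, 1)" "\<lambda>u. \<tau> (u, 1)"])
       (use sec[of 1] Z H(5) Z11 t11 in \<open>auto simp: image_subset_iff\<close>)
  have fB: "f ` ?B \<subseteq> SymConf3" "continuous_on ?B f" using f by auto
  have i0: "Im (\<tau> (0, 0)) > 0" "Z (0, 0) \<in> Conf3" using Z(2,6) by (auto simp: image_subset_iff)
  have f0: "vieta (Z (0, 0)) = f (v 0)" using Z(3)[of "(0, 0)"] H(3)[of 0] by simp
  have l0: "lam (\<tau> (0, 0)) = ratio (Z (0, 0))" using Z(7) by simp
  obtain Y \<mu> where Y: "continuous_on ?B Y" "Y ` ?B \<subseteq> Conf3" "\<And>k. k \<in> ?B \<Longrightarrow> vieta (Y k) = f k"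
    "Y (v 0) = Z (0, 0)" "continuous_on ?B \<mu>" "\<mu> ` ?B \<subseteq> UH"
    "\<And>k. k \<in> ?B \<Longrightarrow> lam (\<mu> k) = ratio (Y k)" "\<mu> (v 0) = \<tau> (0, 0)"
    by (rule config_lift[OF convex_box(1) vB fB(2,1) i0(2) f0 i0(1) l0]) auto
  have vc: "continuous_on ?I (\<lambda>t. Y (v t))" "continuous_on ?I (\<lambda>t. \<mu> (v t))"
    unfolding v_def by (rule continuous_on_vertical(1)[OF Y(1)] continuous_on_vertical(1)[OF Y(5)]; use x xy in simp)+
  have e2: "Y (v 1) = Z (0, 1) \<and> \<mu> (v 1) = \<tau> (0, 1)"
  proof (rule config_lift_unique[of ?I 0 1 "\<lambda>t. Y (v t)" "\<lambda>t. \<mu> (v t)" "\<lambda>t. Z (0, t)" "\<lambda>t. \<tau> (0, t)"])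
    show "vieta (Y (v t)) = vieta (Z (0, t))" if "t \<in> ?I" for t using that Z(3) H(3) Y(3)[OF vB[OF that]] by simp
  qed (use sec[of 0] vc Z Y vB in \<open>auto simp: image_subset_iff\<close>)
  have side: "Complex u y \<in> ?B" if "u \<in> {x0<..<x1}" "y = y0 \<or> y = y1" for u y
    using that xy by (auto simp: in_cbox_complex_iff)
  have bot2: "\<mu> (Complex u y0) \<in> C" if u: "u \<in> {x0<..<x1}" for u
  proof -
    have "Y (Complex u y0) \<in> R \<and> \<mu> (Complex u y0) \<in> mob (of_int 1) (of_int 0) (of_int 0) (of_int 1) ` C"
      by (rule end_sheet_stay[OF R g1 connected_Ioo, of x x0 x1 u "\<lambda>u. Y (Complex u y0)" "\<lambda>u. \<mu> (Complex u y0)"])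
         (use continuous_on_vertical(2)[OF Y(1), of y0] continuous_on_vertical(2)[OF Y(5), of y0] x xy u Y side f bot in
           \<open>auto simp: image_subset_iff v01\<close>)
    thus ?thesis by auto
  qed
  have top2: "\<mu> (Complex u y1) \<in> mob a b c d ` C" if u: "u \<in> {x0<..<x1}" for u
  proof -
    have "Y (Complex u y1) \<in> R \<and> \<mu> (Complex u y1) \<in> mob a b c d ` C"
      by (rule end_sheet_stay[OF R g connected_Ioo, of x x0 x1 u "\<lambda>u. Y (Complex u y1)" "\<lambda>u. \<mu> (Complex u y1)"])
         (use continuous_on_vertical(2)[OF Y(1), of y1] continuous_on_vertical(2)[OF Y(5), of y1] x xy u Y side f top e2 in
           \<open>auto simp: image_subset_iff v01\<close>)
    thus ?thesis by auto
  qed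
  have sub: "box (Complex x0 y0) (Complex x1 y1) \<subseteq> ?B" by (rule box_subset_cbox)
  have "\<mu> holomorphic_on box (Complex x0 y0) (Complex x1 y1)"
  proof (rule config_lift_holomorphic[OF open_box])
    show "continuous_on (box (Complex x0 y0) (Complex x1 y1)) Y" "continuous_on (box (Complex x0 y0) (Complex x1 y1)) \<mu>"
      using Y(1,5) sub continuous_on_subset by blast+
    have e: "f z = vieta (Y z)" if "z \<in> box (Complex x0 y0) (Complex x1 y1)" for z using Y(3) sub that by auto
    have t: "(\<lambda>z. h (vieta (Y z))) holomorphic_on box (Complex x0 y0) (Complex x1 y1)"
      if "(\<lambda>z. h (f z)) holomorphic_on box (Complex x0 y0) (Complex x1 y1)" for h :: "cplx3 \<Rightarrow> complex"
      by (rule holomorphic_transform[OF that]) (simp add: e)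
    have "holo3 f (box (Complex x0 y0) (Complex x1 y1))" using f by blast
    thus "holo3 (\<lambda>z. vieta (Y z)) (box (Complex x0 y0) (Complex x1 y1))"
      unfolding holo3_def using t[of fst] t[of "\<lambda>v. fst (snd v)"] t[of "\<lambda>v. snd (snd v)"] by simp
  qed (use Y sub in \<open>auto simp: image_subset_iff\<close>)
  thus ?thesis using xy Y(5,6) bot2 top2 unfolding arc_rect_def by blast
qed

text \<open>The total space of \<open>Psi\<close> is convex, so by Dugundji a map on the boundary of
  the square extends to the square. All that remains is to join the endpoints inside the
  path-connected sets over E.\<close>

lemma relhomotopic_of_lifts:
  assumes P: "path P" "path_image P \<subseteq> UH \<times> UNIV" and Q: "path Q" "path_image Q \<subseteq> UH \<times> UNIV"
    and S: "path_connected S0" "path_connected S1" "S0 \<subseteq> UH \<times> UNIV" "S1 \<subseteq> UH \<times> UNIV"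
    and ends: "P 0 \<in> S0" "Q 0 \<in> S0" "P 1 \<in> S1" "Q 1 \<in> S1" and E: "\<And>u. u \<in> S0 \<union> S1 \<Longrightarrow> vieta (Psi u) \<in> E"
    and p: "\<And>t. t \<in> {0..1} \<Longrightarrow> p t = vieta (Psi (P t))" and q: "\<And>t. t \<in> {0..1} \<Longrightarrow> q t = vieta (Psi (Q t))"
  shows "relhomotopic SymConf3 E p q"
proof -
  let ?I = "{0..1::real}"
  obtain \<alpha> where \<alpha>: "path \<alpha>" "path_image \<alpha> \<subseteq> S0" "\<alpha> 0 = P 0" "\<alpha> 1 = Q 0"
    using S(1) ends unfolding path_connected_def pathstart_def pathfinish_def by metis
  obtain \<omega> where \<omega>: "path \<omega>" "path_image \<omega> \<subseteq> S1" "\<omega> 0 = P 1" "\<omega> 1 = Q 1"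
    using S(2) ends unfolding path_connected_def pathstart_def pathfinish_def by metis
  \<comment> \<open>The clauses agree at the corners, because \<alpha> runs from P 0 to Q 0 and
    \<omega> from P 1 to Q 1.\<close>
  define h where "h = (\<lambda>u::real \<times> real. if fst u = 0 then P (snd u) else if fst u = 1 then Q (snd u)
    else if snd u = 0 then \<alpha> (fst u) else \<omega> (fst u))"
  have bot: "h (u, 0) = \<alpha> u" and top: "h (u, 1) = \<omega> u" for u by (simp_all add: h_def \<alpha> \<omega>)
  have left: "h (0, t) = P t" and right: "h (1, t) = Q t" for t by (simp_all add: h_def)
  have c: "continuous_on ?I P" "continuous_on ?I Q" "continuous_on ?I \<alpha>" "continuous_on ?I \<omega>" using P Q \<alpha> \<omega> by (auto simp: path_def)
  let ?B = "({0} \<times> ?I \<union> {1} \<times> ?I) \<union> (?I \<times> {0} \<union> ?I \<times> {1})"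
  have 1: "continuous_on ({0} \<times> ?I) h"
    by (rule continuous_on_eq[of _ "\<lambda>u. P (snd u)"]) (auto simp: left intro!: continuous_on_compose2[OF c(1)] continuous_intros)
  have 2: "continuous_on ({1} \<times> ?I) h"
    by (rule continuous_on_eq[of _ "\<lambda>u. Q (snd u)"]) (auto simp: right intro!: continuous_on_compose2[OF c(2)] continuous_intros)
  have 3: "continuous_on (?I \<times> {0}) h"
    by (rule continuous_on_eq[of _ "\<lambda>u. \<alpha> (fst u)"]) (auto simp: bot intro!: continuous_on_compose2[OF c(3)] continuous_intros)
  have 4: "continuous_on (?I \<times> {1}) h"
    by (rule continuous_on_eq[of _ "\<lambda>u. \<omega> (fst u)"]) (auto simp: top intro!: continuous_on_compose2[OF c(4)] continuous_intros)
  have cl: "closed ({0::real} \<times> ?I)" "closed ({1::real} \<times> ?I)" "closed (?I \<times> {0::real})" "closed (?I \<times> {1::real})" by (auto intro!: closed_Times)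
  have hc: "continuous_on ?B h" by (intro continuous_on_closed_Un closed_Un cl 1 2 3 4)
  have hi: "h ` ?B \<subseteq> UH \<times> UNIV"
  proof (rule image_subsetI)
    fix v assume "v \<in> ?B"
    then consider t where "t \<in> ?I" "v = (0, t)" | t where "t \<in> ?I" "v = (1, t)" | t where "t \<in> ?I" "v = (t, 0)" | t where "t \<in> ?I" "v = (t, 1)"
      by blast
    thus "h v \<in> UH \<times> UNIV"
    proof cases
      case (1 t) thus ?thesis using P(2) unfolding path_image_def 1(2) left by blast
    next
      case (2 t) thus ?thesis using Q(2) unfolding path_image_def 2(2) right by blast
    next
      case (3 t) thus ?thesis using \<alpha>(2) S(3) unfolding path_image_def 3(2) bot by blast
    next
      case (4 t) thus ?thesis using \<omega>(2) S(4) unfolding path_image_def 4(2) top by blast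
    qed
  qed
  have clB: "closedin (top_of_set (?I \<times> ?I)) ?B" by (rule closed_subset) (auto intro!: closed_Un cl)
  have cv: "convex (UH \<times> (UNIV :: (complex \<times> complex) set))" using UH_convex by (intro convex_Times) auto
  have ne: "UH \<times> (UNIV :: (complex \<times> complex) set) \<noteq> {}" using u0_dom by blast
  obtain G where G: "continuous_on (?I \<times> ?I) G" "G ` (?I \<times> ?I) \<subseteq> UH \<times> UNIV" "\<And>u. u \<in> ?B \<Longrightarrow> G u = h u"
    by (rule Dugundji[OF cv ne clB hc hi]) (rule that; assumption)
  have "continuous_on (?I \<times> ?I) (\<lambda>u. vieta (Psi (G u)))"
    by (intro continuous_on_compose2[OF vieta_cont] continuous_on_compose2[OF Psi_cont] G) auto
  moreover have "(\<lambda>u. vieta (Psi (G u))) ` (?I \<times> ?I) \<subseteq> SymConf3"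
    using G(2) Psi_Conf3 unfolding SymConf3_def by (auto simp: image_subset_iff mem_Times_iff)
  moreover have "vieta (Psi (G (0, t))) = p t" "vieta (Psi (G (1, t))) = q t" if "t \<in> ?I" for t
    using G(3)[of "(0, t)"] G(3)[of "(1, t)"] that by (simp_all add: left right p q)
  moreover have "vieta (Psi (G (u, 0))) \<in> E" "vieta (Psi (G (u, 1))) \<in> E" if "u \<in> ?I" for u
    using G(3)[of "(u, 0)"] G(3)[of "(u, 1)"] that \<alpha>(2) \<omega>(2) by (auto simp: bot top path_image_def image_subset_iff intro!: E)
  ultimately show ?thesis unfolding relhomotopic_def
    by (intro exI[of _ "\<lambda>u. vieta (Psi (G u))"]) blast
qed

text \<open>A rectangle between the geodesics only prescribes \<tau>. The other two coordinates of
  \<open>Psi\<close> are free: m is set to 0, and \<sigma> realizes the central factor.\<close>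

lemma admissible_of_arc_rect:
  assumes R: "end_sheet E R C J s" and \<beta>: "arc_lift \<beta> s a b c d k" and F: "arc_rect C (mob a b c d ` C) x0 x1 0 y1 F"
  shows "\<exists>f. admissible E \<beta> x0 x1 0 y1 f"
proof -
  obtain P where P: "path P" "path_image P \<subseteq> UH \<times> UNIV" "\<And>t. t \<in> {0..1} \<Longrightarrow> vieta (Psi (P t)) = \<beta> t"
    "P 0 = (\<i>, s, 0)" "P 1 = deck a b c d k (\<i>, s, 0)" and g: "G2 a b c d"
    using \<beta> unfolding arc_lift_def pathstart_def pathfinish_def by blast
  let ?B = "cbox (Complex x0 0) (Complex x1 y1)"
  let ?O = "box (Complex x0 0) (Complex x1 y1)"
  note F = F[unfolded arc_rect_def]
  have y1: "y1 > 0" "x0 < x1" using F by auto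
  have FU: "Im (F z) > 0" if "z \<in> ?B" for z using F that by auto
  \<comment> \<open>Linear in z: over the height y1 it grows by 2 pi i k, and on each horizontal
    side its imaginary part is constant, as the end sheets demand.\<close>
  define \<sigma> where "\<sigma> = (\<lambda>z. s + 2 * of_real pi * of_int k * z / of_real y1)"
  define u where "u = (\<lambda>z. (F z, \<sigma> z, 0::complex))"
  define f where "f = (\<lambda>z. vieta (Psi (u z)))"
  have ui: "u ` ?B \<subseteq> UH \<times> UNIV" using FU by (auto simp: u_def)
  have \<sigma>c: "continuous_on A \<sigma>" for A unfolding \<sigma>_def by (intro continuous_intros) (use y1 in auto)
  have uc: "continuous_on ?B u" unfolding u_def using F by (intro continuous_intros \<sigma>c) auto
  define S0 where "S0 = C \<times> ({z. Im z = Im s} \<times> {z. Im z = 0})"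
  define S1 where "S1 = deck a b c d k ` S0"
  have CU: "C \<subseteq> UH" using R by (simp add: end_sheet_def lam_sheet_def)
  have S0U: "S0 \<subseteq> UH \<times> UNIV" using CU by (auto simp: S0_def)
  have S1U: "S1 \<subseteq> UH \<times> UNIV" using S0U deck_dom[OF _ g] unfolding S1_def by blast
  have cvx: "convex {z. Im z = r}" for r by (rule convexI) (simp flip: distrib_right)
  have pc0: "path_connected S0" unfolding S0_def using R
    by (intro path_connected_Times convex_imp_path_connected[OF cvx]) (simp add: end_sheet_def)
  have pc1: "path_connected S1" unfolding S1_def
    by (rule path_connected_continuous_image[OF continuous_on_subset[OF deck_cont[OF g] S0U] pc0])
  have E0: "vieta (Psi v) \<in> E" if "v \<in> S0" for v
    using R that unfolding end_sheet_def S0_def by (cases v) auto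
  have E1: "vieta (Psi v) \<in> E" if "v \<in> S1" for v
  proof -
    obtain v' where v': "v' \<in> S0" "v = deck a b c d k v'" using \<open>v \<in> S1\<close> by (auto simp: S1_def)
    have "Im (fst v') > 0" using v'(1) S0U by auto
    thus ?thesis using Psi_deck[OF _ g] E0[OF v'(1)] by (simp add: v'(2))
  qed
  have u0S: "u (Complex x 0) \<in> S0" if "x \<in> {x0<..<x1}" for x
    using F that by (auto simp: u_def S0_def \<sigma>_def Im_divide_of_real)
  have u1S: "u (Complex x y1) \<in> S1" if x: "x \<in> {x0<..<x1}" for x
  proof -
    obtain \<tau> where t: "\<tau> \<in> C" "F (Complex x y1) = mob a b c d \<tau>" using F x by blast
    have "\<sigma> (Complex x y1) = \<sigma> (of_real x) + 2 * of_real pi * \<i> * of_int k"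
      using y1 unfolding \<sigma>_def Complex_eq by (simp add: field_simps)
    hence "u (Complex x y1) = deck a b c d k (\<tau>, \<sigma> (of_real x), 0)" by (simp add: u_def deck_def t(2))
    moreover have "(\<tau>, \<sigma> (of_real x), 0) \<in> S0" using t by (simp add: S0_def \<sigma>_def Im_divide_of_real)
    ultimately show ?thesis unfolding S1_def by blast
  qed
  have "holo3 f ?O"
  proof -
    have sub: "F ` ?O \<subseteq> UH" using FU box_subset_cbox by blast
    have "lam \<circ> F holomorphic_on ?O" using F by (intro holomorphic_on_compose_gen[OF _ lam_holo sub]) blast
    hence l: "(\<lambda>z. lam (F z)) holomorphic_on ?O" by (simp add: o_def)
    have s: "\<sigma> holomorphic_on ?O" unfolding \<sigma>_def by (intro holomorphic_intros) (use y1 in auto)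
    show ?thesis unfolding holo3_def f_def u_def Psi_def vieta_def prod.case fst_conv snd_conv
      by (intro conjI holomorphic_intros l s) auto
  qed
  moreover have "continuous_on ?B f" unfolding f_def
    by (intro continuous_on_compose2[OF vieta_cont] continuous_on_compose2[OF Psi_cont] uc ui) auto
  moreover have "f ` ?B \<subseteq> SymConf3" using ui Psi_Conf3 unfolding f_def SymConf3_def by (auto simp: image_subset_iff mem_Times_iff)
  moreover have "f (Complex x 0) \<in> E \<and> f (Complex x y1) \<in> E" if "x \<in> {x0<..<x1}" for x
    using E0[OF u0S[OF that]] E1[OF u1S[OF that]] by (simp add: f_def)
  moreover have "relhomotopic SymConf3 E (\<lambda>t. f (Complex x (0 + t * (y1 - 0)))) \<beta>" if x: "x \<in> {x0<..<x1}" for x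
  proof (rule relhomotopic_of_lifts[of "\<lambda>t. u (Complex x (0 + t * (y1 - 0)))" P S0 S1])
    show "path (\<lambda>t. u (Complex x (0 + t * (y1 - 0))))" unfolding path_def
      by (rule continuous_on_vertical(1)[OF uc]) (use x y1 in auto)
    have "Complex x (t * y1) \<in> ?B" if "t \<in> {0..1}" for t
    proof -
      have "t * y1 \<le> 1 * y1" using that y1 by (intro mult_right_mono) auto
      thus ?thesis using that y1 x by (simp add: in_cbox_complex_iff)
    qed
    thus "path_image (\<lambda>t. u (Complex x (0 + t * (y1 - 0)))) \<subseteq> UH \<times> UNIV"
      using ui by (auto simp: path_image_def image_subset_iff)
    show "P 0 \<in> S0" using R by (simp add: P(4) S0_def end_sheet_def)
    thus "P 1 \<in> S1" unfolding P(4,5) S1_def by blast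
    show "u (Complex x (0 + 0 * (y1 - 0))) \<in> S0" "u (Complex x (0 + 1 * (y1 - 0))) \<in> S1" using u0S u1S x by simp_all
    show "vieta (Psi v) \<in> E" if "v \<in> S0 \<union> S1" for v using that E0 E1 by blast
  qed (use P pc0 pc1 S0U S1U in \<open>auto simp: f_def\<close>)
  ultimately show ?thesis unfolding admissible_def using y1 by (intro exI[of _ f]) auto
qed

section \<open>The extremal length of a braid\<close>

text \<open>The optimum need not be attained, so rectangles are supplied only up to \<epsilon>. The
  module is computed as a supremum of its own, which makes sense of the reciprocal also for L =
  0.\<close>

lemma extremal_length_eq:
  assumes R: "end_sheet E R C J s" and \<beta>: "arc_lift \<beta> s a b c d k" and L0: "L \<ge> 0"
    and low: "\<And>x0 x1 y0 y1 F. arc_rect C (mob a b c d ` C) x0 x1 y0 y1 F \<Longrightarrow> L * (x1 - x0) \<le> y1 - y0"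
    and upp: "\<And>\<epsilon>. \<epsilon> > 0 \<Longrightarrow> \<exists>x0 x1 y1 F. arc_rect C (mob a b c d ` C) x0 x1 0 y1 F \<and> y1 / (x1 - x0) \<le> L + \<epsilon>"
  shows "ExtLen E \<beta> = ereal L" "ConfMod E \<beta> = (if L = 0 then \<infinity> else ereal (1 / L))"
proof -
  have lower: "L * (x1 - x0) \<le> y1 - y0 \<and> x0 < x1 \<and> y0 < y1" if "admissible E \<beta> x0 x1 y0 y1 f" for x0 x1 y0 y1 f
    using arc_rect_of_admissible[OF R \<beta> that] low that by (auto simp: admissible_def)
  have upper: "\<exists>x0 x1 y1 f. admissible E \<beta> x0 x1 0 y1 f \<and> x0 < x1 \<and> 0 < y1 \<and> y1 / (x1 - x0) \<le> L + \<epsilon>" if e: "\<epsilon> > 0" for \<epsilon>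
  proof -
    obtain x0 x1 y1 F where F: "arc_rect C (mob a b c d ` C) x0 x1 0 y1 F" "y1 / (x1 - x0) \<le> L + \<epsilon>" using upp[OF e] by blast
    obtain f where "admissible E \<beta> x0 x1 0 y1 f" using admissible_of_arc_rect[OF R \<beta> F(1)] by blast
    moreover have "x0 < x1 \<and> 0 < y1" using F(1) by (simp add: arc_rect_def)
    ultimately show ?thesis using F(2) by blast
  qed
  let ?A = "{ereal ((d - c) / (b - a)) | a b c d f. admissible E \<beta> a b c d f}"
  let ?B = "{ereal ((b - a) / (d - c)) | a b c d f. admissible E \<beta> a b c d f}"
  show "ExtLen E \<beta> = ereal L"
  proof (rule antisym)
    show "ExtLen E \<beta> \<le> ereal L"
    proof (rule ereal_le_epsilon2)
      fix \<epsilon> :: real assume "0 < \<epsilon>"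
      then obtain x0 x1 y1 f where f: "admissible E \<beta> x0 x1 0 y1 f" "y1 / (x1 - x0) \<le> L + \<epsilon>" using upper by blast
      have "ExtLen E \<beta> \<le> ereal ((y1 - 0) / (x1 - x0))" unfolding ExtLen_def by (rule Inf_lower) (use f(1) in blast)
      also have "\<dots> \<le> ereal L + ereal \<epsilon>" using f(2) by simp
      finally show "ExtLen E \<beta> \<le> ereal L + ereal \<epsilon>" .
    qed
    show "ereal L \<le> ExtLen E \<beta>" unfolding ExtLen_def
    proof (rule Inf_greatest)
      fix q assume "q \<in> ?A"
      then obtain x0 x1 y0 y1 f where q: "q = ereal ((y1 - y0) / (x1 - x0))" "admissible E \<beta> x0 x1 y0 y1 f" by blast
      show "ereal L \<le> q" using lower[OF q(2)] by (simp add: q(1) pos_le_divide_eq)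
    qed
  qed
  have big: "ereal (1 / (L + \<epsilon>)) \<le> ConfMod E \<beta>" if e: "\<epsilon> > 0" for \<epsilon>
  proof -
    obtain x0 x1 y1 f where f: "admissible E \<beta> x0 x1 0 y1 f" "y1 / (x1 - x0) \<le> L + \<epsilon>" "x0 < x1" "0 < y1" using upper[OF e] by blast
    have "1 / (L + \<epsilon>) \<le> 1 / (y1 / (x1 - x0))" using f e L0 by (intro divide_left_mono mult_pos_pos) auto
    hence "ereal (1 / (L + \<epsilon>)) \<le> ereal ((x1 - x0) / (y1 - 0))" by simp
    also have "\<dots> \<le> ConfMod E \<beta>" unfolding ConfMod_def by (rule Sup_upper) (use f(1) in blast)
    finally show ?thesis .
  qed
  show "ConfMod E \<beta> = (if L = 0 then \<infinity> else ereal (1 / L))"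
  proof (cases "L = 0")
    case True
    have "ereal B \<le> ConfMod E \<beta>" for B
    proof -
      have "ereal B \<le> ereal (1 / (0 + 1 / max B 1))" by simp
      also have "\<dots> \<le> ConfMod E \<beta>" using big[of "1 / max B 1"] True by simp
      finally show ?thesis .
    qed
    thus ?thesis using True ereal_top by simp
  next
    case False
    hence Lp: "L > 0" using L0 by simp
    have "((\<lambda>\<epsilon>. ereal (1 / (L + \<epsilon>))) \<longlongrightarrow> ereal (1 / (L + 0))) (at_right 0)" by (intro tendsto_intros) (use Lp in auto)
    moreover have "eventually (\<lambda>\<epsilon>. ereal (1 / (L + \<epsilon>)) \<le> ConfMod E \<beta>) (at_right 0)"
      using eventually_at_right_less[of "0::real"] by eventually_elim (rule big)
    ultimately have "ereal (1 / L) \<le> ConfMod E \<beta>" by (intro tendsto_upperbound[of _ "ereal (1 / L)" "at_right (0::real)"]) auto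
    moreover have "ConfMod E \<beta> \<le> ereal (1 / L)" unfolding ConfMod_def
    proof (rule Sup_least)
      fix q assume "q \<in> ?B"
      then obtain x0 x1 y0 y1 f where q: "q = ereal ((x1 - x0) / (y1 - y0))" "admissible E \<beta> x0 x1 y0 y1 f" by blast
      show "q \<le> ereal (1 / L)" using lower[OF q(2)] Lp by (simp add: q(1) field_simps)
    qed
    ultimately show ?thesis using False by (simp add: antisym)
  qed
qed

text \<open>The chain arcosh p \<le> log (2 p) \<le> log 4 + 2 L gives the upper bound; L \<ge> 1
  absorbs the additive constant, and 300 pi leaves ample room.\<close>

lemma arcosh_cosh_bounds:
  assumes L: "L \<ge> 1" and p: "cosh (L / 2) \<le> p" "p \<le> 2 * exp (2 * L)"
  shows "L / (2 * pi) \<le> arcosh p / pi" "arcosh p / pi \<le> 300 * L" "arcosh p > 0"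
proof -
  have c1: "cosh (L / 2) > 1" using L cosh_real_strict_mono[of 0 "L / 2"] by simp
  have p1: "p > 1" using c1 p by linarith
  have "L / 2 = arcosh (cosh (L / 2))" using L by (simp add: arcosh_cosh_real)
  also have "\<dots> \<le> arcosh p"
    using arcosh_less_iff_real[of p "cosh (L / 2)"] c1 p(1) p1 by linarith
  finally have 1: "L / 2 \<le> arcosh p" .
  thus "L / (2 * pi) \<le> arcosh p / pi" by (simp add: field_simps)
  show "arcosh p > 0" using 1 L by linarith
  have "sqrt (p\<^sup>2 - 1) \<le> p" using p1 by (intro real_le_lsqrt) auto
  moreover have "sqrt (p\<^sup>2 - 1) \<ge> 0" using p1 by simp
  ultimately have "ln (p + sqrt (p\<^sup>2 - 1)) \<le> ln (2 * p)" using p1 by (intro ln_mono) linarith+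
  hence "arcosh p \<le> ln (2 * p)" using p1 by (simp add: arcosh_real_def)
  also have "\<dots> \<le> ln (4 * exp (2 * L))" using p p1 by simp
  also have "\<dots> = ln 4 + 2 * L" by (simp add: ln_mult)
  also have "\<dots> \<le> 4 + 2 * L" using ln_le_minus_one[of "4::real"] by simp
  also have "\<dots> \<le> 300 * L * 1" using L by simp
  also have "\<dots> \<le> 300 * L * pi" using L pi_gt3 by (intro mult_left_mono) auto
  finally show "arcosh p / pi \<le> 300 * L" by (simp add: field_simps)
qed

theorem theorem1:
  fixes w :: "(nat \<times> int) list" and k :: int
  assumes "reduced_word w"
  shows "(length w \<le> 1 \<longrightarrow> Lambda_tr w k = 0 \<and> M_tr w k = \<infinity>)
       \<and> (length w > 1 \<longrightarrow>
           ereal (Lw w / (2 * pi)) \<le> Lambda_tr w k \<and> Lambda_tr w k = 1 / M_tr w k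
           \<and> Lambda_tr w k \<le> ereal (300 * Lw w))
       \<and> ((\<forall>(g, n) \<in> set w. n = 1) \<or> (\<forall>(g, n) \<in> set w. n = -1) \<longrightarrow>
           Lambda_pb w k = 0 \<and> M_pb w k = \<infinity>)
       \<and> (\<not> ((\<forall>(g, n) \<in> set w. n = 1) \<or> (\<forall>(g, n) \<in> set w. n = -1)) \<longrightarrow>
           ereal (Lw w / (2 * pi)) \<le> Lambda_pb w k \<and> Lambda_pb w k = 1 / M_pb w k
           \<and> Lambda_pb w k \<le> ereal (300 * Lw w))"
proof -
  obtain a b c d where m: "mat w = (a, b, c, d)" by (cases "mat w")
  note W = word_matrix_bounds[OF assms m]
  define p where "p = real_of_int \<bar>a * d + b * c\<bar>"
  define q where "q = real_of_int \<bar>a\<^sup>2 + d\<^sup>2 - b\<^sup>2 - c\<^sup>2\<bar> / 2"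
  have pr: "p = \<bar>real_of_int a * real_of_int d + real_of_int b * real_of_int c\<bar>" by (simp add: p_def)
  have qr: "q = \<bar>(real_of_int a)\<^sup>2 + (real_of_int d)\<^sup>2 - (real_of_int b)\<^sup>2 - (real_of_int c)\<^sup>2\<bar> / 2" by (simp add: q_def)
  let ?slow = "(\<forall>(g, n) \<in> set w. n = 1) \<or> (\<forall>(g, n) \<in> set w. n = -1)"
  have ptriv: "p = 1" if "length w \<le> 1" using W(2)[OF that] by (simp add: p_def)
  have qtriv: "q = 1" if ?slow using W(4)[OF that] by (simp add: q_def)
  have pb: "L / (2 * pi) \<le> arcosh p / pi" "arcosh p / pi \<le> 300 * L" "arcosh p > 0" if "length w > 1" "L = Lw w" for L
  proof -
    have "w \<noteq> []" using that(1) by auto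
    hence "Lw w \<ge> 1" by (rule W(1))
    moreover have "cosh (Lw w / 2) \<le> p \<and> p \<le> 2 * exp (2 * Lw w)" using W(3)[OF that(1)] by (simp add: p_def)
    ultimately show "L / (2 * pi) \<le> arcosh p / pi" "arcosh p / pi \<le> 300 * L" "arcosh p > 0" using arcosh_cosh_bounds[of L p] that(2) by auto
  qed
  have qb: "L / (2 * pi) \<le> arcosh q / pi" "arcosh q / pi \<le> 300 * L" "arcosh q > 0" if ns: "\<not> ?slow" "L = Lw w" for L
  proof -
    have "w \<noteq> []" using ns(1) by auto
    hence "Lw w \<ge> 1" by (rule W(1))
    moreover have "cosh (Lw w / 2) \<le> q \<and> q \<le> 2 * exp (2 * Lw w)" using W(5)[OF ns(1)] by (simp add: q_def)
    ultimately show "L / (2 * pi) \<le> arcosh q / pi" "arcosh q / pi \<le> 300 * L" "arcosh q > 0" using arcosh_cosh_bounds[of L q] ns(2) by auto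
  qed
  have p1: "p \<ge> 1"
  proof (cases "length w \<le> 1")
    case False
    hence "cosh (Lw w / 2) \<le> p" using W(3) by (simp add: p_def)
    thus ?thesis using cosh_real_ge_1[of "Lw w / 2"] by linarith
  qed (simp add: ptriv)
  have q1: "q \<ge> 1"
  proof (cases ?slow)
    case False
    hence "cosh (Lw w / 2) \<le> q" using W(5) by (simp add: q_def)
    thus ?thesis using cosh_real_ge_1[of "Lw w / 2"] by linarith
  qed (simp add: qtriv)
  have det: "real_of_int a * real_of_int d - real_of_int b * real_of_int c = 1" using mat_Gamma2[OF m] det_real by blast
  have "arcosh p \<ge> 0" "arcosh q \<ge> 0" using p1 q1 by simp_all
  hence a0: "arcosh p / pi \<ge> 0" "arcosh q / pi \<ge> 0" by simp_all
  \<comment> \<open>This exact value holds for every word; the exceptional ones differ only in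
    having p = 1, hence length 0.\<close>
  have tr: "Lambda_tr w k = ereal (arcosh p / pi)" "M_tr w k = (if arcosh p / pi = 0 then \<infinity> else ereal (1 / (arcosh p / pi)))"
    unfolding Lambda_tr_def M_tr_def
    by (rule extremal_length_eq[OF end_sheet_tr arc_lift_tr[OF m] a0(1)];
        use arc_rect_lower_tr[OF det] arc_rect_upper_tr[OF det] p1 in \<open>simp add: pr field_simps\<close>)+
  have pbv: "Lambda_pb w k = ereal (arcosh q / pi)" "M_pb w k = (if arcosh q / pi = 0 then \<infinity> else ereal (1 / (arcosh q / pi)))"
    unfolding Lambda_pb_def M_pb_def
    by (rule extremal_length_eq[OF end_sheet_pb arc_lift_pb[OF m] a0(2)];
        use arc_rect_lower_pb[OF det] arc_rect_upper_pb[OF det] q1 in \<open>simp add: qr field_simps\<close>)+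
  have inv: "ereal x = 1 / ereal (1 / x)" if "x > 0" for x :: real using that by (simp add: one_ereal_def)
  show ?thesis unfolding tr pbv
  proof (intro conjI impI)
    assume "length w \<le> 1"
    from ptriv[OF this] show "ereal (arcosh p / pi) = 0" "(if arcosh p / pi = 0 then \<infinity> else ereal (1 / (arcosh p / pi))) = \<infinity>" by simp_all
  next
    assume l: "length w > 1"
    show "ereal (Lw w / (2 * pi)) \<le> ereal (arcosh p / pi)" "ereal (arcosh p / pi) \<le> ereal (300 * Lw w)" using pb(1,2)[OF l refl] by simp_all
    show "ereal (arcosh p / pi) = 1 / (if arcosh p / pi = 0 then \<infinity> else ereal (1 / (arcosh p / pi)))"
      using pb(3)[OF l refl] inv[of "arcosh p / pi"] by simp
  next
    assume ?slow
    from qtriv[OF this] show "ereal (arcosh q / pi) = 0" "(if arcosh q / pi = 0 then \<infinity> else ereal (1 / (arcosh q / pi))) = \<infinity>" by simp_all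
  next
    assume s: "\<not> ?slow"
    show "ereal (Lw w / (2 * pi)) \<le> ereal (arcosh q / pi)" "ereal (arcosh q / pi) \<le> ereal (300 * Lw w)" using qb(1,2)[OF s refl] by simp_all
    show "ereal (arcosh q / pi) = 1 / (if arcosh q / pi = 0 then \<infinity> else ereal (1 / (arcosh q / pi)))"
      using qb(3)[OF s refl] inv[of "arcosh q / pi"] by simp
  qed
qed

end
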